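(* Let $X$ be a scheme and let $\mathscr{O}_Y$ be a quadratic $\mathscr{O}_X$-algebra, corresponding to $Y\to X$. Forgetting the rigidification fits into a short exact sequence of groups $$1\to \mathscr{O}_X(X)^\times/\operatorname{Nm}\mathscr{O}_Y(Y)^\times\to\operatorname{RigPic}_{\mathscr{O}_X}Y\to\operatorname{Pic}_{\mathscr{O}_X}Y\to 1,$$ where $\operatorname{Pic}_{\mathscr{O}_X}Y=\ker(\mathscr{N}\colon\operatorname{Pic}Y\to\operatorname{Pic}X)$.
   Context: A quadratic $\mathscr{O}_X$-algebra is an $\mathscr{O}_X$-algebra locally free of rank $2$ as an $\mathscr{O}_X$-module; $\operatorname{Nm}\colon\mathscr{O}_Y\to\mathscr{O}_X$ is its norm (determinant of multiplication), and $\operatorname{Pic}Y$ is identified with isomorphism classes of invertible $\mathscr{O}_Y$-modules. For an invertible $\mathscr{O}_Y$-module $\mathscr{I}$, put $\mathscr{N}(\mathscr{I})=\bigwedge^2_{\mathscr{O}_X}\mathscr{I}\otimes(\mathscr{O}_Y/\mathscr{O}_X)^\vee$, an invertible $\mathscr{O}_X$-module. There is a canonical isomorphism $\mathscr{N}(\mathscr{I})\otimes_{\mathscr{O}_X}\mathscr{N}(\mathscr{I}')\cong\mathscr{N}(\mathscr{I}\otimes_{\mathscr{O}_Y}\mathscr{I}')$, obtained (using the canonical isomorphism $\bigwedge^2\mathscr{O}_Y\cong\mathscr{O}_Y/\mathscr{O}_X$, $1\wedge\gamma\mapsto\overline\gamma$) from the unique $\mathscr{O}_X$-module isomorphism $\bigwedge^2\mathscr{I}\otimes\bigwedge^2\mathscr{I}'\to\bigwedge^2(\mathscr{I}\otimes_{\mathscr{O}_Y}\mathscr{I}')\otimes\bigwedge^2\mathscr{O}_Y$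 sending $(\gamma x\wedge x)\otimes(\gamma x'\wedge x')\mapsto(\gamma(x\otimes x')\wedge(x\otimes x'))\otimes(1\wedge\gamma)$ for all local sections $x,x',\gamma$. Hence $\mathscr{N}\colon\operatorname{Pic}Y\to\operatorname{Pic}X$ is a group homomorphism. An $\mathscr{O}_X$-rigidification of $\mathscr{I}$ is an $\mathscr{O}_X$-module isomorphism $r\colon\mathscr{N}(\mathscr{I})\xrightarrow{\sim}\mathscr{O}_X$. An $\mathscr{O}_Y$-module isomorphism $\varphi\colon\mathscr{I}\to\mathscr{I}'$ between $(\mathscr{I},r)$ and $(\mathscr{I}',r')$ is rigidified if $r'\circ(\wedge^2\varphi\otimes\mathrm{id})=r$. $\operatorname{RigPic}_{\mathscr{O}_X}Y$ is the set of classes of invertible $\mathscr{O}_X$-rigidified $\mathscr{O}_Y$-modules under rigidified isomorphisms; its group law is $[(\mathscr{I},r)]\cdot[(\mathscr{I}',r')]=[(\mathscr{I}\otimes_{\mathscr{O}_Y}\mathscr{I}',r\cdot r')]$, where $r\cdot r'$ is the composite $\mathscr{N}(\mathscr{I}\otimes\mathscr{I}')\cong\mathscr{N}(\mathscr{I})\otimes\mathscr{N}(\mathscr{I}')\xrightarrow{r\otimes r'}\mathscr{O}_X\otimes\mathscr{O}_X\cong\mathscr{O}_X$. The identity is $(\mathscr{O}_Y,r_0)$ with $r_0\colon\mathscr{N}(\mathscr{O}_Y)=\bigwedge^2\mathscr{O}_Y\otimes(\mathscr{O}_Y/\mathscr{O}_X)^\vee\cong\mathscr{O}_X$ the canonical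 isomorphism. The first map in the sequence is by rescaling the rigidification of $\mathscr{O}_Y$; the second is $[(\mathscr{I},r)]\mapsto[\mathscr{I}]$.
   Formalization: The rigidification r_0 of O_Y is taken as (γ∧1)⊗δ ↦ δ(γ̄), the negative of the one induced by 1∧γ ↦ γ̄; with the latter, r_0·r_0 = −r_0, so (O_Y, r_0) would not be the identity (e.g. for Z[i] over Z). *)

theory Defs
  imports "HOL-Analysis.Abstract_Topology" "HOL-Algebra.Free_Abelian_Groups"
    "HOL-Algebra.QuotRing" "HOL-Algebra.Module" "HOL-Algebra.Exact_Sequence"
begin

section \<open>Sheaves of rings and schemes\<close>

text \<open>Sections over an open set \<open>U\<close> form a structure \<open>sec F U\<close> (a ring or a module), and
  \<open>res F U V\<close> is the restriction map from \<open>U\<close> to an open \<open>V \<subseteq> U\<close>.  Nothing is required of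
  \<open>sec\<close> and \<open>res\<close> outside the open sets, and nothing of \<open>res\<close> outside the carriers.\<close>

record ('p, 'm, 's) presheaf =
  sec :: "'p set \<Rightarrow> 's"
  res :: "'p set \<Rightarrow> 'p set \<Rightarrow> 'm \<Rightarrow> 'm"

type_synonym ('p, 'r) ring_presheaf = "('p, 'r, 'r ring) presheaf"
type_synonym ('p, 'r, 'm) module_presheaf = "('p, 'm, ('r, 'm) module) presheaf"

definition is_presheaf ::
  "'p topology \<Rightarrow> ('p, 'm, ('m, 'z) partial_object_scheme) presheaf \<Rightarrow> bool" where
  "is_presheaf T F \<longleftrightarrow>
    (\<forall>U V. openin T U \<and> openin T V \<and> V \<subseteq> U \<longrightarrow> res F U V \<in> carrier (sec F U) \<rightarrow> carrier (sec F V)) \<and>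
    (\<forall>U. openin T U \<longrightarrow> (\<forall>s\<in>carrier (sec F U). res F U U s = s)) \<and>
    (\<forall>U V W. openin T U \<and> openin T V \<and> openin T W \<and> W \<subseteq> V \<and> V \<subseteq> U \<longrightarrow>
      (\<forall>s\<in>carrier (sec F U). res F V W (res F U V s) = res F U W s))"

text \<open>Gluing is required for covers \<open>C\<close> that are sets of open sets; the empty cover is included.\<close>

definition is_sheaf ::
  "'p topology \<Rightarrow> ('p, 'm, ('m, 'z) partial_object_scheme) presheaf \<Rightarrow> bool" where
  "is_sheaf T F \<longleftrightarrow> is_presheaf T F \<and>
    (\<forall>C s. (\<forall>V\<in>C. openin T V \<and> s V \<in> carrier (sec F V)) \<and>
       (\<forall>V\<in>C. \<forall>W\<in>C. res F V (V \<inter> W) (s V) = res F W (V \<inter> W) (s W)) \<longrightarrow>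
       (\<exists>!t. t \<in> carrier (sec F (\<Union>C)) \<and> (\<forall>V\<in>C. res F (\<Union>C) V t = s V)))"

definition is_ring_sheaf :: "'p topology \<Rightarrow> ('p, 'r) ring_presheaf \<Rightarrow> bool" where
  "is_ring_sheaf T F \<longleftrightarrow> is_sheaf T F \<and>
    (\<forall>U. openin T U \<longrightarrow> cring (sec F U)) \<and>
    (\<forall>U V. openin T U \<and> openin T V \<and> V \<subseteq> U \<longrightarrow> res F U V \<in> ring_hom (sec F U) (sec F V))"

record ('p, 'r) ringed_space =
  underlying :: "'p topology"
  structure_sheaf :: "('p, 'r) ring_presheaf"

abbreviation is_open :: "('p, 'r) ringed_space \<Rightarrow> 'p set \<Rightarrow> bool" where
  "is_open X U \<equiv> openin (underlying X) U"

abbreviation whole :: "('p, 'r) ringed_space \<Rightarrow> 'p set" where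
  "whole X \<equiv> topspace (underlying X)"

abbreviation ring_of :: "('p, 'r) ringed_space \<Rightarrow> 'p set \<Rightarrow> 'r ring" where
  "ring_of X U \<equiv> sec (structure_sheaf X) U"

definition is_ringed_space :: "('p, 'r) ringed_space \<Rightarrow> bool" where
  "is_ringed_space X \<longleftrightarrow> is_ring_sheaf (underlying X) (structure_sheaf X)"

definition open_subspace :: "('p, 'r) ringed_space \<Rightarrow> 'p set \<Rightarrow> ('p, 'r) ringed_space" where
  "open_subspace X U = X\<lparr>underlying := subtopology (underlying X) U\<rparr>"

definition ringed_isomorphic :: "('p, 'r) ringed_space \<Rightarrow> ('q, 's) ringed_space \<Rightarrow> bool" where
  "ringed_isomorphic X Z \<longleftrightarrow> (\<exists>h \<psi>. homeomorphic_map (underlying X) (underlying Z) h \<and>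
    (\<forall>V. is_open Z V \<longrightarrow> \<psi> V \<in> ring_iso (ring_of Z V) (ring_of X {p \<in> whole X. h p \<in> V})) \<and>
    (\<forall>V W. is_open Z V \<and> is_open Z W \<and> W \<subseteq> V \<longrightarrow> (\<forall>s\<in>carrier (ring_of Z V).
       \<psi> W (res (structure_sheaf Z) V W s) =
         res (structure_sheaf X) {p \<in> whole X. h p \<in> V} {p \<in> whole X. h p \<in> W} (\<psi> V s))))"

text \<open>\<open>fraction A P a f\<close> is the class of \<open>a/f\<close> in the localization of \<open>A\<close> at the prime \<open>P\<close>.\<close>

definition fraction :: "('a, 'z) ring_scheme \<Rightarrow> 'a set \<Rightarrow> 'a \<Rightarrow> 'a \<Rightarrow> ('a \<times> 'a) set" where
  "fraction A P a f = {(b, g). b \<in> carrier A \<and> g \<in> carrier A - P \<and>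
     (\<exists>h\<in>carrier A - P. h \<otimes>\<^bsub>A\<^esub> (a \<otimes>\<^bsub>A\<^esub> g) = h \<otimes>\<^bsub>A\<^esub> (b \<otimes>\<^bsub>A\<^esub> f))}"

definition spec_topology :: "('a, 'z) ring_scheme \<Rightarrow> 'a set topology" where
  "spec_topology A =
     topology_generated_by {{P. primeideal P A \<and> f \<notin> P} | f. f \<in> carrier A}"

text \<open>In the operations below the unions are over equal sets, one for each choice of
  representatives; the same device is used throughout for operations on classes.\<close>

definition spec_ring ::
  "('a, 'z) ring_scheme \<Rightarrow> 'a set set \<Rightarrow> ('a set \<Rightarrow> ('a \<times> 'a) set) ring" where
  "spec_ring A U =
    \<lparr>carrier = {s \<in> extensional U. \<forall>P\<in>U. \<exists>V a f. openin (spec_topology A) V \<and> P \<in> V \<and> V \<subseteq> U \<and>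
        a \<in> carrier A \<and> f \<in> carrier A \<and> (\<forall>Q\<in>V. f \<notin> Q \<and> s Q = fraction A Q a f)},
     mult = (\<lambda>s t. \<lambda>P\<in>U. \<Union>(a, f)\<in>s P. \<Union>(b, g)\<in>t P.
       fraction A P (a \<otimes>\<^bsub>A\<^esub> b) (f \<otimes>\<^bsub>A\<^esub> g)),
     one = (\<lambda>P\<in>U. fraction A P \<one>\<^bsub>A\<^esub> \<one>\<^bsub>A\<^esub>),
     zero = (\<lambda>P\<in>U. fraction A P \<zero>\<^bsub>A\<^esub> \<one>\<^bsub>A\<^esub>),
     add = (\<lambda>s t. \<lambda>P\<in>U. \<Union>(a, f)\<in>s P. \<Union>(b, g)\<in>t P.
       fraction A P ((a \<otimes>\<^bsub>A\<^esub> g) \<oplus>\<^bsub>A\<^esub> (b \<otimes>\<^bsub>A\<^esub> f)) (f \<otimes>\<^bsub>A\<^esub> g))\<rparr>"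

definition Spec :: "('a, 'z) ring_scheme \<Rightarrow> ('a set, 'a set \<Rightarrow> ('a \<times> 'a) set) ringed_space" where
  "Spec A = \<lparr>underlying = spec_topology A,
     structure_sheaf = \<lparr>sec = spec_ring A, res = (\<lambda>U V s. restrict s V)\<rparr>\<rparr>"

text \<open>Local rings and local homomorphisms need no mention: the stalks of an affine scheme are local
  and an isomorphism of ringed spaces is automatically local.  The ring \<open>A\<close> may be taken over the
  section type \<open>'r\<close>, because it is isomorphic to the ring of sections of \<open>X\<close> over \<open>U\<close>.\<close>

definition is_scheme :: "('p, 'r) ringed_space \<Rightarrow> bool" where
  "is_scheme X \<longleftrightarrow> is_ringed_space X \<and>
    (\<forall>p\<in>whole X. \<exists>U (A :: 'r ring). is_open X U \<and> p \<in> U \<and> cring A \<and>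
       ringed_isomorphic (open_subspace X U) (Spec A))"


section \<open>Sheaves of modules\<close>

definition is_module_presheaf ::
  "('p, 'r) ringed_space \<Rightarrow> ('p, 'r, 'm) module_presheaf \<Rightarrow> bool" where
  "is_module_presheaf X M \<longleftrightarrow> is_presheaf (underlying X) M \<and>
    (\<forall>U. is_open X U \<longrightarrow> Module.module (ring_of X U) (sec M U)) \<and>
    (\<forall>U V. is_open X U \<and> is_open X V \<and> V \<subseteq> U \<longrightarrow>
      (\<forall>m\<in>carrier (sec M U). \<forall>n\<in>carrier (sec M U).
         res M U V (m \<oplus>\<^bsub>sec M U\<^esub> n) = res M U V m \<oplus>\<^bsub>sec M V\<^esub> res M U V n) \<and>
      (\<forall>a\<in>carrier (ring_of X U). \<forall>m\<in>carrier (sec M U).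
         res M U V (a \<odot>\<^bsub>sec M U\<^esub> m) = res (structure_sheaf X) U V a \<odot>\<^bsub>sec M V\<^esub> res M U V m))"

definition is_module_sheaf ::
  "('p, 'r) ringed_space \<Rightarrow> ('p, 'r, 'm) module_presheaf \<Rightarrow> bool" where
  "is_module_sheaf X M \<longleftrightarrow> is_module_presheaf X M \<and> is_sheaf (underlying X) M"

definition is_linear ::
  "'r ring \<Rightarrow> ('r, 'm) module \<Rightarrow> ('r, 'n) module \<Rightarrow> ('m \<Rightarrow> 'n) \<Rightarrow> bool" where
  "is_linear R M N f \<longleftrightarrow> f \<in> carrier M \<rightarrow> carrier N \<and>
    (\<forall>m\<in>carrier M. \<forall>n\<in>carrier M. f (m \<oplus>\<^bsub>M\<^esub> n) = f m \<oplus>\<^bsub>N\<^esub> f n) \<and>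
    (\<forall>a\<in>carrier R. \<forall>m\<in>carrier M. f (a \<odot>\<^bsub>M\<^esub> m) = a \<odot>\<^bsub>N\<^esub> f m)"

definition module_morphism ::
  "('p, 'r) ringed_space \<Rightarrow> ('p, 'r, 'm) module_presheaf \<Rightarrow> ('p, 'r, 'n) module_presheaf \<Rightarrow>
   ('p set \<Rightarrow> 'm \<Rightarrow> 'n) \<Rightarrow> bool" where
  "module_morphism X M N \<phi> \<longleftrightarrow>
    (\<forall>U. is_open X U \<longrightarrow> is_linear (ring_of X U) (sec M U) (sec N U) (\<phi> U)) \<and>
    (\<forall>U V. is_open X U \<and> is_open X V \<and> V \<subseteq> U \<longrightarrow>
      (\<forall>m\<in>carrier (sec M U). \<phi> V (res M U V m) = res N U V (\<phi> U m)))"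

definition module_isomorphism ::
  "('p, 'r) ringed_space \<Rightarrow> ('p, 'r, 'm) module_presheaf \<Rightarrow> ('p, 'r, 'n) module_presheaf \<Rightarrow>
   ('p set \<Rightarrow> 'm \<Rightarrow> 'n) \<Rightarrow> bool" where
  "module_isomorphism X M N \<phi> \<longleftrightarrow> module_morphism X M N \<phi> \<and>
    (\<forall>U. is_open X U \<longrightarrow> bij_betw (\<phi> U) (carrier (sec M U)) (carrier (sec N U)))"

definition module_basis :: "'r ring \<Rightarrow> ('r, 'm) module \<Rightarrow> nat \<Rightarrow> (nat \<Rightarrow> 'm) \<Rightarrow> bool" where
  "module_basis R M n e \<longleftrightarrow> (\<forall>i<n. e i \<in> carrier M) \<and>
    (\<forall>m\<in>carrier M. \<exists>!c. c \<in> {..<n} \<rightarrow>\<^sub>E carrier R \<and> m = (\<Oplus>\<^bsub>M\<^esub>i\<in>{..<n}. c i \<odot>\<^bsub>M\<^esub> e i))"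

text \<open>Such an \<open>e\<close> is the same thing as an isomorphism from the \<open>n\<close>-th power of the structure
  sheaf to \<open>M\<close> over \<open>U\<close>.\<close>

definition sheaf_basis ::
  "('p, 'r) ringed_space \<Rightarrow> ('p, 'r, 'm) module_presheaf \<Rightarrow> nat \<Rightarrow> 'p set \<Rightarrow> (nat \<Rightarrow> 'm) \<Rightarrow> bool" where
  "sheaf_basis X M n U e \<longleftrightarrow> is_open X U \<and> (\<forall>i<n. e i \<in> carrier (sec M U)) \<and>
    (\<forall>V. is_open X V \<and> V \<subseteq> U \<longrightarrow>
       module_basis (ring_of X V) (sec M V) n (\<lambda>i. res M U V (e i)))"

definition locally_free ::
  "('p, 'r) ringed_space \<Rightarrow> nat \<Rightarrow> ('p, 'r, 'm) module_presheaf \<Rightarrow> bool" where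
  "locally_free X n M \<longleftrightarrow> is_module_sheaf X M \<and>
    (\<forall>p\<in>whole X. \<exists>U e. p \<in> U \<and> sheaf_basis X M n U e)"

definition invertible :: "('p, 'r) ringed_space \<Rightarrow> ('p, 'r, 'm) module_presheaf \<Rightarrow> bool" where
  "invertible X M \<longleftrightarrow> locally_free X 1 M"

text \<open>The multiplication and unit fields of the library's module record carry no meaning for a
  module.\<close>

definition mk_module ::
  "'m set \<Rightarrow> 'm \<Rightarrow> ('m \<Rightarrow> 'm \<Rightarrow> 'm) \<Rightarrow> ('r \<Rightarrow> 'm \<Rightarrow> 'm) \<Rightarrow> ('r, 'm) module" where
  "mk_module C z p s =
    \<lparr>carrier = C, mult = undefined, one = undefined, zero = z, add = p, smult = s\<rparr>"

definition self_module :: "('p, 'r) ring_presheaf \<Rightarrow> ('p, 'r, 'r) module_presheaf" where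
  "self_module F = \<lparr>sec = (\<lambda>U. mk_module (carrier (sec F U)) (zero (sec F U)) (add (sec F U))
     (mult (sec F U))), res = res F\<rparr>"


subsection \<open>Sheafification\<close>

definition germ ::
  "('p, 'r) ringed_space \<Rightarrow> ('p, 'r, 'm) module_presheaf \<Rightarrow> 'p \<Rightarrow> 'p set \<Rightarrow> 'm \<Rightarrow> ('p set \<times> 'm) set" where
  "germ X M p U s = {(V, t). is_open X V \<and> p \<in> V \<and> t \<in> carrier (sec M V) \<and>
     (\<exists>W. is_open X W \<and> p \<in> W \<and> W \<subseteq> U \<inter> V \<and> res M U W s = res M V W t)}"

type_synonym ('p, 'm) sheafified = "'p \<Rightarrow> ('p set \<times> 'm) set"

definition sheafify ::
  "('p, 'r) ringed_space \<Rightarrow> ('p, 'r, 'm) module_presheaf \<Rightarrow> ('p, 'r, ('p, 'm) sheafified) module_presheaf"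
  where
  "sheafify X M = \<lparr>sec = (\<lambda>U. mk_module
      {f \<in> extensional U. \<forall>p\<in>U. \<exists>V s. is_open X V \<and> p \<in> V \<and> V \<subseteq> U \<and> s \<in> carrier (sec M V) \<and>
         (\<forall>q\<in>V. f q = germ X M q V s)}
      (\<lambda>p\<in>U. germ X M p U (zero (sec M U)))
      (\<lambda>f g. \<lambda>p\<in>U. \<Union>(V, s)\<in>f p. \<Union>(W, t)\<in>g p.
         germ X M p (V \<inter> W) (res M V (V \<inter> W) s \<oplus>\<^bsub>sec M (V \<inter> W)\<^esub> res M W (V \<inter> W) t))
      (\<lambda>a f. \<lambda>p\<in>U. \<Union>(V, s)\<in>f p.
         germ X M p (U \<inter> V) (res (structure_sheaf X) U (U \<inter> V) a
           \<odot>\<^bsub>sec M (U \<inter> V)\<^esub> res M V (U \<inter> V) s))),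
     res = (\<lambda>U V f. restrict f V)\<rparr>"

definition to_sheafification ::
  "('p, 'r) ringed_space \<Rightarrow> ('p, 'r, 'm) module_presheaf \<Rightarrow> 'p set \<Rightarrow> 'm \<Rightarrow> ('p, 'm) sheafified" where
  "to_sheafification X M U s = (\<lambda>p\<in>U. germ X M p U s)"


subsection \<open>Tensor products and exterior squares\<close>

text \<open>\<open>bilin_quot R M N E\<close> is the quotient of the free abelian group on \<open>M \<times> N\<close> by the relations
  that make the pairing \<open>R\<close>-bilinear and by further relations \<open>E\<close>.  Without further relations it
  is the tensor product.  It is the exterior square if \<open>N = M\<close> and \<open>E\<close> is \<open>alt_rel R M\<close>: only an
  additive subgroup is generated, so the multiples \<open>(r x) \<otimes> x = r (x \<otimes> x)\<close> are listed as well.\<close>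

definition bilin_rel ::
  "'r ring \<Rightarrow> ('r, 'm) module \<Rightarrow> ('r, 'n) module \<Rightarrow> ('m \<times> 'n \<Rightarrow>\<^sub>0 int) set" where
  "bilin_rel R M N =
    {frag_of (m \<oplus>\<^bsub>M\<^esub> m', n) - frag_of (m, n) - frag_of (m', n) | m m' n.
       m \<in> carrier M \<and> m' \<in> carrier M \<and> n \<in> carrier N} \<union>
    {frag_of (m, n \<oplus>\<^bsub>N\<^esub> n') - frag_of (m, n) - frag_of (m, n') | m n n'.
       m \<in> carrier M \<and> n \<in> carrier N \<and> n' \<in> carrier N} \<union>
    {frag_of (r \<odot>\<^bsub>M\<^esub> m, n) - frag_of (m, r \<odot>\<^bsub>N\<^esub> n) | r m n.
       r \<in> carrier R \<and> m \<in> carrier M \<and> n \<in> carrier N}"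

definition alt_rel :: "'r ring \<Rightarrow> ('r, 'm) module \<Rightarrow> ('m \<times> 'm \<Rightarrow>\<^sub>0 int) set" where
  "alt_rel R M = {frag_of (r \<odot>\<^bsub>M\<^esub> x, x) | r x. r \<in> carrier R \<and> x \<in> carrier M}"

definition bilin_coset ::
  "'r ring \<Rightarrow> ('r, 'm) module \<Rightarrow> ('r, 'n) module \<Rightarrow> ('m \<times> 'n \<Rightarrow>\<^sub>0 int) set \<Rightarrow>
   ('m \<times> 'n \<Rightarrow>\<^sub>0 int) \<Rightarrow> ('m \<times> 'n \<Rightarrow>\<^sub>0 int) set" where
  "bilin_coset R M N E c =
    (let G = free_Abelian_group (carrier M \<times> carrier N)
     in generate G (bilin_rel R M N \<union> E) #>\<^bsub>G\<^esub> c)"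

definition bilin_quot ::
  "'r ring \<Rightarrow> ('r, 'm) module \<Rightarrow> ('r, 'n) module \<Rightarrow> ('m \<times> 'n \<Rightarrow>\<^sub>0 int) set \<Rightarrow>
   ('r, ('m \<times> 'n \<Rightarrow>\<^sub>0 int) set) module" where
  "bilin_quot R M N E =
    (let G = free_Abelian_group (carrier M \<times> carrier N);
         Q = G Mod generate G (bilin_rel R M N \<union> E)
     in mk_module (carrier Q) (one Q) (mult Q)
          (\<lambda>r t. \<Union>c\<in>t. bilin_coset R M N E (frag_extend (\<lambda>(m, n). frag_of (r \<odot>\<^bsub>M\<^esub> m, n)) c)))"

definition bilin_presheaf ::
  "('p, 'r) ringed_space \<Rightarrow> ('p, 'r, 'm) module_presheaf \<Rightarrow> ('p, 'r, 'n) module_presheaf \<Rightarrow>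
   ('p set \<Rightarrow> ('m \<times> 'n \<Rightarrow>\<^sub>0 int) set) \<Rightarrow> ('p, 'r, ('m \<times> 'n \<Rightarrow>\<^sub>0 int) set) module_presheaf" where
  "bilin_presheaf X M N E =
    \<lparr>sec = (\<lambda>U. bilin_quot (ring_of X U) (sec M U) (sec N U) (E U)),
     res = (\<lambda>U V t. \<Union>c\<in>t. bilin_coset (ring_of X V) (sec M V) (sec N V) (E V)
       (frag_extend (\<lambda>(m, n). frag_of (res M U V m, res N U V n)) c))\<rparr>"

type_synonym ('p, 'm, 'n) tensored = "('p, ('m \<times> 'n \<Rightarrow>\<^sub>0 int) set) sheafified"

definition tensor ::
  "('p, 'r) ringed_space \<Rightarrow> ('p, 'r, 'm) module_presheaf \<Rightarrow> ('p, 'r, 'n) module_presheaf \<Rightarrow>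
   ('p, 'r, ('p, 'm, 'n) tensored) module_presheaf" where
  "tensor X M N = sheafify X (bilin_presheaf X M N (\<lambda>U. {}))"

definition tens ::
  "('p, 'r) ringed_space \<Rightarrow> ('p, 'r, 'm) module_presheaf \<Rightarrow> ('p, 'r, 'n) module_presheaf \<Rightarrow>
   'p set \<Rightarrow> 'm \<Rightarrow> 'n \<Rightarrow> ('p, 'm, 'n) tensored" where
  "tens X M N U m n = to_sheafification X (bilin_presheaf X M N (\<lambda>U. {})) U
     (bilin_coset (ring_of X U) (sec M U) (sec N U) {} (frag_of (m, n)))"

definition wedge2 ::
  "('p, 'r) ringed_space \<Rightarrow> ('p, 'r, 'm) module_presheaf \<Rightarrow>
   ('p, 'r, ('p, 'm, 'm) tensored) module_presheaf" where
  "wedge2 X M = sheafify X (bilin_presheaf X M M (\<lambda>U. alt_rel (ring_of X U) (sec M U)))"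

definition wedge ::
  "('p, 'r) ringed_space \<Rightarrow> ('p, 'r, 'm) module_presheaf \<Rightarrow> 'p set \<Rightarrow> 'm \<Rightarrow> 'm \<Rightarrow>
   ('p, 'm, 'm) tensored" where
  "wedge X M U x y = to_sheafification X
     (bilin_presheaf X M M (\<lambda>U. alt_rel (ring_of X U) (sec M U))) U
     (bilin_coset (ring_of X U) (sec M U) (sec M U) (alt_rel (ring_of X U) (sec M U))
       (frag_of (x, y)))"

text \<open>Here and below, \<open>SOME\<close> picks a morphism whose values on sections over open sets are determined
  uniquely by the stated conditions.\<close>

definition tensor_map ::
  "('p, 'r) ringed_space \<Rightarrow>
   ('p, 'r, 'm) module_presheaf \<Rightarrow> ('p, 'r, 'm') module_presheaf \<Rightarrow>
   ('p, 'r, 'n) module_presheaf \<Rightarrow> ('p, 'r, 'n') module_presheaf \<Rightarrow>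
   ('p set \<Rightarrow> 'm \<Rightarrow> 'm') \<Rightarrow> ('p set \<Rightarrow> 'n \<Rightarrow> 'n') \<Rightarrow>
   'p set \<Rightarrow> ('p, 'm, 'n) tensored \<Rightarrow> ('p, 'm', 'n') tensored" where
  "tensor_map X M M' N N' \<phi> \<psi> = (SOME h. module_morphism X (tensor X M N) (tensor X M' N') h \<and>
    (\<forall>U. is_open X U \<longrightarrow> (\<forall>m\<in>carrier (sec M U). \<forall>n\<in>carrier (sec N U).
       h U (tens X M N U m n) = tens X M' N' U (\<phi> U m) (\<psi> U n))))"

definition wedge2_map ::
  "('p, 'r) ringed_space \<Rightarrow> ('p, 'r, 'm) module_presheaf \<Rightarrow> ('p, 'r, 'n) module_presheaf \<Rightarrow>
   ('p set \<Rightarrow> 'm \<Rightarrow> 'n) \<Rightarrow> 'p set \<Rightarrow> ('p, 'm, 'm) tensored \<Rightarrow> ('p, 'n, 'n) tensored" where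
  "wedge2_map X M N \<phi> = (SOME h. module_morphism X (wedge2 X M) (wedge2 X N) h \<and>
    (\<forall>U. is_open X U \<longrightarrow> (\<forall>x\<in>carrier (sec M U). \<forall>y\<in>carrier (sec M U).
       h U (wedge X M U x y) = wedge X N U (\<phi> U x) (\<phi> U y))))"

text \<open>The isomorphism that multiplies the two factors of the structure sheaf tensored with itself.\<close>

definition multiply_map ::
  "('p, 'r) ringed_space \<Rightarrow> 'p set \<Rightarrow> ('p, 'r, 'r) tensored \<Rightarrow> 'r" where
  "multiply_map X = (let S = self_module (structure_sheaf X) in
    SOME h. module_isomorphism X (tensor X S S) S h \<and>
    (\<forall>U. is_open X U \<longrightarrow> (\<forall>a\<in>carrier (ring_of X U). \<forall>b\<in>carrier (ring_of X U).
       h U (tens X S S U a b) = a \<otimes>\<^bsub>ring_of X U\<^esub> b)))"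


subsection \<open>Duals\<close>

text \<open>A section of the dual over \<open>U\<close> is a morphism, over the open subspace \<open>U\<close>, to the structure
  sheaf.  \<open>cut\<close> makes such a family of functions undefined wherever it has no meaning, so that
  equal morphisms are equal as functions.\<close>

definition cut ::
  "('p, 'r) ringed_space \<Rightarrow> ('p, 'r, 'm) module_presheaf \<Rightarrow> 'p set \<Rightarrow> ('p set \<Rightarrow> 'm \<Rightarrow> 'r) \<Rightarrow>
   'p set \<Rightarrow> 'm \<Rightarrow> 'r" where
  "cut X M U \<phi> = (\<lambda>V m. if is_open X V \<and> V \<subseteq> U \<and> m \<in> carrier (sec M V) then \<phi> V m else undefined)"

definition dual ::
  "('p, 'r) ringed_space \<Rightarrow> ('p, 'r, 'm) module_presheaf \<Rightarrow>
   ('p, 'r, 'p set \<Rightarrow> 'm \<Rightarrow> 'r) module_presheaf" where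
  "dual X M = \<lparr>sec = (\<lambda>U. mk_module
      {\<phi>. module_morphism (open_subspace X U) M (self_module (structure_sheaf X)) \<phi> \<and> cut X M U \<phi> = \<phi>}
      (cut X M U (\<lambda>V m. zero (ring_of X V)))
      (\<lambda>\<phi> \<psi>. cut X M U (\<lambda>V m. \<phi> V m \<oplus>\<^bsub>ring_of X V\<^esub> \<psi> V m))
      (\<lambda>a \<phi>. cut X M U (\<lambda>V m. res (structure_sheaf X) U V a \<otimes>\<^bsub>ring_of X V\<^esub> \<phi> V m))),
     res = (\<lambda>U V \<phi>. cut X M V \<phi>)\<rparr>"


subsection \<open>The Picard group\<close>

text \<open>Classes have to be formed over one fixed type of sections.  The type \<open>'p \<Rightarrow> 'r\<close> is large enough:
  if \<open>I\<close> is invertible, over any type of sections, choose around each point \<open>p\<close> an open \<open>U p\<close> with an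
  isomorphism \<open>\<tau> p\<close> from \<open>I\<close> to the structure sheaf over \<open>U p\<close>; then a section \<open>s\<close> of \<open>I\<close> is
  determined by the function that sends \<open>p\<close> to the image under \<open>\<tau> p\<close> of the restriction of \<open>s\<close> to
  \<open>U p\<close> (intersected with the domain of \<open>s\<close>).  So every invertible sheaf is isomorphic to one over
  this type, and \<open>pic_class\<close> is defined for invertible sheaves over any type.\<close>

definition pic_class ::
  "('p, 'r) ringed_space \<Rightarrow> ('p, 'r, 'm) module_presheaf \<Rightarrow> ('p, 'r, 'p \<Rightarrow> 'r) module_presheaf set" where
  "pic_class X I = {J. invertible X J \<and> (\<exists>\<phi>. module_isomorphism X J I \<phi>)}"

definition Pic :: "('p, 'r) ringed_space \<Rightarrow> ('p, 'r, 'p \<Rightarrow> 'r) module_presheaf set monoid" where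
  "Pic X = \<lparr>carrier = pic_class X ` {I :: ('p, 'r, 'p \<Rightarrow> 'r) module_presheaf. invertible X I},
     mult = (\<lambda>a b. \<Union>I\<in>a. \<Union>J\<in>b. pic_class X (tensor X I J)),
     one = pic_class X (self_module (structure_sheaf X))\<rparr>"


section \<open>Quadratic algebras, the norm, and rigidifications\<close>

record ('p, 'r, 's) sheaf_algebra =
  algebra_sheaf :: "('p, 's) ring_presheaf"
  algebra_map :: "'p set \<Rightarrow> 'r \<Rightarrow> 's"

definition is_algebra :: "('p, 'r) ringed_space \<Rightarrow> ('p, 'r, 's) sheaf_algebra \<Rightarrow> bool" where
  "is_algebra X Y \<longleftrightarrow> is_ring_sheaf (underlying X) (algebra_sheaf Y) \<and>
    (\<forall>U. is_open X U \<longrightarrow> algebra_map Y U \<in> ring_hom (ring_of X U) (sec (algebra_sheaf Y) U)) \<and>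
    (\<forall>U V. is_open X U \<and> is_open X V \<and> V \<subseteq> U \<longrightarrow> (\<forall>a\<in>carrier (ring_of X U).
       algebra_map Y V (res (structure_sheaf X) U V a) =
         res (algebra_sheaf Y) U V (algebra_map Y U a)))"

text \<open>Modules over the algebra are modules over the ringed space \<open>over X Y\<close>, which has the points of
  \<open>X\<close> and the algebra as structure sheaf.  Invertible ones are free of rank 1 locally on \<open>X\<close>; they are
  the invertible sheaves on the spectrum of the algebra, because this is finite over \<open>X\<close> and
  semilocal rings have trivial Picard group.\<close>

definition over :: "('p, 'r) ringed_space \<Rightarrow> ('p, 'r, 's) sheaf_algebra \<Rightarrow> ('p, 's) ringed_space" where
  "over X Y = \<lparr>underlying = underlying X, structure_sheaf = algebra_sheaf Y\<rparr>"

abbreviation alg_of :: "('p, 'r, 's) sheaf_algebra \<Rightarrow> 'p set \<Rightarrow> 's ring" where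
  "alg_of Y U \<equiv> sec (algebra_sheaf Y) U"

abbreviation alg_self :: "('p, 'r, 's) sheaf_algebra \<Rightarrow> ('p, 's, 's) module_presheaf" where
  "alg_self Y \<equiv> self_module (algebra_sheaf Y)"

definition restrict_scalars ::
  "('p, 'r, 's) sheaf_algebra \<Rightarrow> ('p, 's, 'm) module_presheaf \<Rightarrow> ('p, 'r, 'm) module_presheaf" where
  "restrict_scalars Y M = \<lparr>sec = (\<lambda>U. mk_module (carrier (sec M U)) (zero (sec M U)) (add (sec M U))
      (\<lambda>a m. algebra_map Y U a \<odot>\<^bsub>sec M U\<^esub> m)),
     res = res M\<rparr>"

abbreviation alg_module :: "('p, 'r, 's) sheaf_algebra \<Rightarrow> ('p, 'r, 's) module_presheaf" where
  "alg_module Y \<equiv> restrict_scalars Y (alg_self Y)"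

definition is_quadratic_algebra ::
  "('p, 'r) ringed_space \<Rightarrow> ('p, 'r, 's) sheaf_algebra \<Rightarrow> bool" where
  "is_quadratic_algebra X Y \<longleftrightarrow> is_algebra X Y \<and> locally_free X 2 (alg_module Y)"

text \<open>The determinant of multiplication by the global section \<open>b\<close>, computed in local bases.\<close>

definition Nm :: "('p, 'r) ringed_space \<Rightarrow> ('p, 'r, 's) sheaf_algebra \<Rightarrow> 's \<Rightarrow> 'r" where
  "Nm X Y b = (THE a. a \<in> carrier (ring_of X (whole X)) \<and>
    (\<forall>U e c. sheaf_basis X (alg_module Y) 2 U e \<and>
       (\<forall>i<2. \<forall>j<2. c i j \<in> carrier (ring_of X U)) \<and>
       (\<forall>j<2. res (algebra_sheaf Y) (whole X) U b \<otimes>\<^bsub>alg_of Y U\<^esub> e j =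
          (\<Oplus>\<^bsub>alg_of Y U\<^esub>i\<in>{..<2::nat}. algebra_map Y U (c i j) \<otimes>\<^bsub>alg_of Y U\<^esub> e i)) \<longrightarrow>
       res (structure_sheaf X) (whole X) U a =
         (c 0 0 \<otimes>\<^bsub>ring_of X U\<^esub> c 1 1) \<ominus>\<^bsub>ring_of X U\<^esub> (c 0 1 \<otimes>\<^bsub>ring_of X U\<^esub> c 1 0)))"

text \<open>The quotient of the algebra by the image of the structure sheaf of \<open>X\<close>.\<close>

abbreviation scalars :: "('p, 'r) ringed_space \<Rightarrow> ('p, 'r, 's) sheaf_algebra \<Rightarrow> 'p set \<Rightarrow> 's set" where
  "scalars X Y U \<equiv> algebra_map Y U ` carrier (ring_of X U)"

definition quotient_presheaf ::
  "('p, 'r) ringed_space \<Rightarrow> ('p, 'r, 's) sheaf_algebra \<Rightarrow> ('p, 'r, 's set) module_presheaf" where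
  "quotient_presheaf X Y = \<lparr>sec = (\<lambda>U. mk_module
      (a_rcosets\<^bsub>alg_of Y U\<^esub> scalars X Y U) (scalars X Y U) (set_add (alg_of Y U))
      (\<lambda>a t. \<Union>b\<in>t. scalars X Y U +>\<^bsub>alg_of Y U\<^esub> (algebra_map Y U a \<otimes>\<^bsub>alg_of Y U\<^esub> b))),
     res = (\<lambda>U V t. \<Union>b\<in>t. scalars X Y V +>\<^bsub>alg_of Y V\<^esub> res (algebra_sheaf Y) U V b)\<rparr>"

definition quotient_module ::
  "('p, 'r) ringed_space \<Rightarrow> ('p, 'r, 's) sheaf_algebra \<Rightarrow>
   ('p, 'r, ('p, 's set) sheafified) module_presheaf" where
  "quotient_module X Y = sheafify X (quotient_presheaf X Y)"

definition quotient_class ::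
  "('p, 'r) ringed_space \<Rightarrow> ('p, 'r, 's) sheaf_algebra \<Rightarrow> 'p set \<Rightarrow> 's \<Rightarrow> ('p, 's set) sheafified" where
  "quotient_class X Y U b = to_sheafification X (quotient_presheaf X Y) U
     (scalars X Y U +>\<^bsub>alg_of Y U\<^esub> b)"

type_synonym ('p, 'r, 's) quotient_dual = "'p set \<Rightarrow> ('p, 's set) sheafified \<Rightarrow> 'r"

abbreviation qdual ::
  "('p, 'r) ringed_space \<Rightarrow> ('p, 'r, 's) sheaf_algebra \<Rightarrow>
   ('p, 'r, ('p, 'r, 's) quotient_dual) module_presheaf" where
  "qdual X Y \<equiv> dual X (quotient_module X Y)"

abbreviation alg_wedge2 ::
  "('p, 'r) ringed_space \<Rightarrow> ('p, 'r, 's) sheaf_algebra \<Rightarrow> ('p, 's, 'm) module_presheaf \<Rightarrow>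
   ('p, 'r, ('p, 'm, 'm) tensored) module_presheaf" where
  "alg_wedge2 X Y I \<equiv> wedge2 X (restrict_scalars Y I)"

abbreviation alg_wedge ::
  "('p, 'r) ringed_space \<Rightarrow> ('p, 'r, 's) sheaf_algebra \<Rightarrow> ('p, 's, 'm) module_presheaf \<Rightarrow>
   'p set \<Rightarrow> 'm \<Rightarrow> 'm \<Rightarrow> ('p, 'm, 'm) tensored" where
  "alg_wedge X Y I U x y \<equiv> wedge X (restrict_scalars Y I) U x y"

abbreviation alg_tensor ::
  "('p, 'r) ringed_space \<Rightarrow> ('p, 'r, 's) sheaf_algebra \<Rightarrow>
   ('p, 's, 'm) module_presheaf \<Rightarrow> ('p, 's, 'n) module_presheaf \<Rightarrow>
   ('p, 's, ('p, 'm, 'n) tensored) module_presheaf" where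
  "alg_tensor X Y I J \<equiv> tensor (over X Y) I J"

abbreviation alg_tens ::
  "('p, 'r) ringed_space \<Rightarrow> ('p, 'r, 's) sheaf_algebra \<Rightarrow>
   ('p, 's, 'm) module_presheaf \<Rightarrow> ('p, 's, 'n) module_presheaf \<Rightarrow>
   'p set \<Rightarrow> 'm \<Rightarrow> 'n \<Rightarrow> ('p, 'm, 'n) tensored" where
  "alg_tens X Y I J U x y \<equiv> tens (over X Y) I J U x y"

type_synonym ('p, 'r, 's, 'm) normed =
  "('p, ('p, 'm, 'm) tensored, ('p, 'r, 's) quotient_dual) tensored"

definition norm_module ::
  "('p, 'r) ringed_space \<Rightarrow> ('p, 'r, 's) sheaf_algebra \<Rightarrow> ('p, 's, 'm) module_presheaf \<Rightarrow>
   ('p, 'r, ('p, 'r, 's, 'm) normed) module_presheaf" where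
  "norm_module X Y I = tensor X (alg_wedge2 X Y I) (qdual X Y)"

abbreviation norm_tens ::
  "('p, 'r) ringed_space \<Rightarrow> ('p, 'r, 's) sheaf_algebra \<Rightarrow> ('p, 's, 'm) module_presheaf \<Rightarrow>
   'p set \<Rightarrow> ('p, 'm, 'm) tensored \<Rightarrow> ('p, 'r, 's) quotient_dual \<Rightarrow> ('p, 'r, 's, 'm) normed" where
  "norm_tens X Y I U w \<delta> \<equiv> tens X (alg_wedge2 X Y I) (qdual X Y) U w \<delta>"

definition norm_map ::
  "('p, 'r) ringed_space \<Rightarrow> ('p, 'r, 's) sheaf_algebra \<Rightarrow>
   ('p, 's, 'm) module_presheaf \<Rightarrow> ('p, 's, 'n) module_presheaf \<Rightarrow> ('p set \<Rightarrow> 'm \<Rightarrow> 'n) \<Rightarrow>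
   'p set \<Rightarrow> ('p, 'r, 's, 'm) normed \<Rightarrow> ('p, 'r, 's, 'n) normed" where
  "norm_map X Y I J \<phi> = tensor_map X (alg_wedge2 X Y I) (alg_wedge2 X Y J) (qdual X Y) (qdual X Y)
     (wedge2_map X (restrict_scalars Y I) (restrict_scalars Y J) \<phi>) (\<lambda>U \<delta>. \<delta>)"

definition wedge2_alg_iso ::
  "('p, 'r) ringed_space \<Rightarrow> ('p, 'r, 's) sheaf_algebra \<Rightarrow>
   'p set \<Rightarrow> ('p, 's, 's) tensored \<Rightarrow> ('p, 's set) sheafified" where
  "wedge2_alg_iso X Y = (SOME \<kappa>.
    module_isomorphism X (alg_wedge2 X Y (alg_self Y)) (quotient_module X Y) \<kappa> \<and>
    (\<forall>U. is_open X U \<longrightarrow> (\<forall>\<gamma>\<in>carrier (alg_of Y U).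
       \<kappa> U (alg_wedge X Y (alg_self Y) U \<one>\<^bsub>alg_of Y U\<^esub> \<gamma>) = quotient_class X Y U \<gamma>)))"

definition wedge2_tensor_iso ::
  "('p, 'r) ringed_space \<Rightarrow> ('p, 'r, 's) sheaf_algebra \<Rightarrow>
   ('p, 's, 'm) module_presheaf \<Rightarrow> ('p, 's, 'n) module_presheaf \<Rightarrow>
   'p set \<Rightarrow> ('p, ('p, 'm, 'm) tensored, ('p, 'n, 'n) tensored) tensored \<Rightarrow>
   ('p, ('p, ('p, 'm, 'n) tensored, ('p, 'm, 'n) tensored) tensored, ('p, 's, 's) tensored) tensored"
  where
  "wedge2_tensor_iso X Y I J = (SOME \<Psi>.
    module_isomorphism X
      (tensor X (alg_wedge2 X Y I) (alg_wedge2 X Y J))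
      (tensor X (alg_wedge2 X Y (alg_tensor X Y I J)) (alg_wedge2 X Y (alg_self Y))) \<Psi> \<and>
    (\<forall>U. is_open X U \<longrightarrow>
      (\<forall>x\<in>carrier (sec I U). \<forall>y\<in>carrier (sec J U). \<forall>\<gamma>\<in>carrier (alg_of Y U).
       \<Psi> U (tens X (alg_wedge2 X Y I) (alg_wedge2 X Y J) U
              (alg_wedge X Y I U (\<gamma> \<odot>\<^bsub>sec I U\<^esub> x) x) (alg_wedge X Y J U (\<gamma> \<odot>\<^bsub>sec J U\<^esub> y) y)) =
       tens X (alg_wedge2 X Y (alg_tensor X Y I J)) (alg_wedge2 X Y (alg_self Y)) U
         (alg_wedge X Y (alg_tensor X Y I J) U
            (\<gamma> \<odot>\<^bsub>sec (alg_tensor X Y I J) U\<^esub> alg_tens X Y I J U x y) (alg_tens X Y I J U x y))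
         (alg_wedge X Y (alg_self Y) U \<one>\<^bsub>alg_of Y U\<^esub> \<gamma>))))"

text \<open>The isomorphism from \<open>N(I) \<otimes> N(J)\<close> to \<open>N(I \<otimes> J)\<close>: apply \<open>\<Psi> = wedge2_tensor_iso\<close> to the
  exterior squares, carry the factor \<open>\<nu>\<close> from the exterior square of the algebra to the quotient
  by \<open>wedge2_alg_iso\<close>, and evaluate one of the two linear forms on it.  As locally every section
  \<open>\<Psi> (w \<otimes> w')\<close> has the form \<open>\<mu> \<otimes> \<nu>\<close>, this determines the isomorphism; which linear form is
  evaluated does not matter, since the quotient has rank 1.\<close>

definition norm_tensor_iso ::
  "('p, 'r) ringed_space \<Rightarrow> ('p, 'r, 's) sheaf_algebra \<Rightarrow>
   ('p, 's, 'm) module_presheaf \<Rightarrow> ('p, 's, 'n) module_presheaf \<Rightarrow>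
   'p set \<Rightarrow> ('p, ('p, 'r, 's, 'm) normed, ('p, 'r, 's, 'n) normed) tensored \<Rightarrow>
   ('p, 'r, 's, ('p, 'm, 'n) tensored) normed" where
  "norm_tensor_iso X Y I J = (SOME h.
    module_isomorphism X
      (tensor X (norm_module X Y I) (norm_module X Y J)) (norm_module X Y (alg_tensor X Y I J)) h \<and>
    (\<forall>U. is_open X U \<longrightarrow>
      (\<forall>w\<in>carrier (sec (alg_wedge2 X Y I) U). \<forall>w'\<in>carrier (sec (alg_wedge2 X Y J) U).
       \<forall>\<mu>\<in>carrier (sec (alg_wedge2 X Y (alg_tensor X Y I J)) U).
       \<forall>\<nu>\<in>carrier (sec (alg_wedge2 X Y (alg_self Y)) U).
       \<forall>\<delta>\<in>carrier (sec (qdual X Y) U). \<forall>\<delta>'\<in>carrier (sec (qdual X Y) U).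
       wedge2_tensor_iso X Y I J U (tens X (alg_wedge2 X Y I) (alg_wedge2 X Y J) U w w') =
         tens X (alg_wedge2 X Y (alg_tensor X Y I J)) (alg_wedge2 X Y (alg_self Y)) U \<mu> \<nu> \<longrightarrow>
       h U (tens X (norm_module X Y I) (norm_module X Y J) U
              (norm_tens X Y I U w \<delta>) (norm_tens X Y J U w' \<delta>')) =
       norm_tens X Y (alg_tensor X Y I J) U \<mu>
         (\<delta>' U (wedge2_alg_iso X Y U \<nu>) \<odot>\<^bsub>sec (qdual X Y) U\<^esub> \<delta>))))"

definition rigidification ::
  "('p, 'r) ringed_space \<Rightarrow> ('p, 'r, 's) sheaf_algebra \<Rightarrow> ('p, 's, 'm) module_presheaf \<Rightarrow>
   ('p set \<Rightarrow> ('p, 'r, 's, 'm) normed \<Rightarrow> 'r) \<Rightarrow> bool" where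
  "rigidification X Y I r \<longleftrightarrow>
     module_isomorphism X (norm_module X Y I) (self_module (structure_sheaf X)) r"

definition rigidified_isomorphism ::
  "('p, 'r) ringed_space \<Rightarrow> ('p, 'r, 's) sheaf_algebra \<Rightarrow>
   ('p, 's, 'm) module_presheaf \<Rightarrow> ('p set \<Rightarrow> ('p, 'r, 's, 'm) normed \<Rightarrow> 'r) \<Rightarrow>
   ('p, 's, 'n) module_presheaf \<Rightarrow> ('p set \<Rightarrow> ('p, 'r, 's, 'n) normed \<Rightarrow> 'r) \<Rightarrow>
   ('p set \<Rightarrow> 'm \<Rightarrow> 'n) \<Rightarrow> bool" where
  "rigidified_isomorphism X Y I r J r' \<phi> \<longleftrightarrow> module_isomorphism (over X Y) I J \<phi> \<and>
    (\<forall>U. is_open X U \<longrightarrow> (\<forall>n\<in>carrier (sec (norm_module X Y I) U).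
       r' U (norm_map X Y I J \<phi> U n) = r U n))"

definition rig_product ::
  "('p, 'r) ringed_space \<Rightarrow> ('p, 'r, 's) sheaf_algebra \<Rightarrow>
   ('p, 's, 'm) module_presheaf \<Rightarrow> ('p set \<Rightarrow> ('p, 'r, 's, 'm) normed \<Rightarrow> 'r) \<Rightarrow>
   ('p, 's, 'n) module_presheaf \<Rightarrow> ('p set \<Rightarrow> ('p, 'r, 's, 'n) normed \<Rightarrow> 'r) \<Rightarrow>
   'p set \<Rightarrow> ('p, 'r, 's, ('p, 'm, 'n) tensored) normed \<Rightarrow> 'r" where
  "rig_product X Y I r J r' = (\<lambda>U n. multiply_map X U
     (tensor_map X (norm_module X Y I) (self_module (structure_sheaf X))
        (norm_module X Y J) (self_module (structure_sheaf X)) r r' U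
        (inv_into (carrier (sec (tensor X (norm_module X Y I) (norm_module X Y J)) U))
           (norm_tensor_iso X Y I J U) n)))"

text \<open>The canonical rigidification of the algebra, \<open>(\<gamma> \<and> 1) \<otimes> \<delta> \<mapsto> \<delta> \<gamma>\<close>.  The order of \<open>\<gamma>\<close> and \<open>1\<close>
  is forced by the formula for \<open>wedge2_tensor_iso\<close>: with \<open>x = y = 1\<close>, \<open>norm_tensor_iso\<close> sends
  \<open>((\<gamma> \<and> 1) \<otimes> \<delta>) \<otimes> ((\<gamma> \<and> 1) \<otimes> \<delta>')\<close> to \<open>(\<gamma> (1 \<otimes> 1) \<and> (1 \<otimes> 1)) \<otimes> (\<delta>' \<gamma>) \<delta>\<close>, so this \<open>r\<close> is
  the one with \<open>r \<cdot> r = r\<close>, which makes it neutral.  Its negative, \<open>(1 \<and> \<gamma>) \<otimes> \<delta> \<mapsto> \<delta> \<gamma>\<close>, is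
  neutral only if \<open>-1\<close> is the norm of a unit.\<close>

definition canonical_rig ::
  "('p, 'r) ringed_space \<Rightarrow> ('p, 'r, 's) sheaf_algebra \<Rightarrow>
   'p set \<Rightarrow> ('p, 'r, 's, 's) normed \<Rightarrow> 'r" where
  "canonical_rig X Y = (SOME r. rigidification X Y (alg_self Y) r \<and>
    (\<forall>U. is_open X U \<longrightarrow> (\<forall>\<gamma>\<in>carrier (alg_of Y U). \<forall>\<delta>\<in>carrier (sec (qdual X Y) U).
       r U (norm_tens X Y (alg_self Y) U (alg_wedge X Y (alg_self Y) U \<gamma> \<one>\<^bsub>alg_of Y U\<^esub>) \<delta>) =
         \<delta> U (quotient_class X Y U \<gamma>))))"

definition rescaled_rig ::
  "('p, 'r) ringed_space \<Rightarrow> ('p, 'r, 's) sheaf_algebra \<Rightarrow> 'r \<Rightarrow>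
   'p set \<Rightarrow> ('p, 'r, 's, 's) normed \<Rightarrow> 'r" where
  "rescaled_rig X Y u =
    (\<lambda>U n. res (structure_sheaf X) (whole X) U u \<otimes>\<^bsub>ring_of X U\<^esub> canonical_rig X Y U n)"


section \<open>The groups and maps of the sequence\<close>

text \<open>The section type of the representatives is fixed as in \<^const>\<open>pic_class\<close>.\<close>

type_synonym ('p, 'r, 's) rigidified =
  "('p, 's, 'p \<Rightarrow> 's) module_presheaf \<times> ('p set \<Rightarrow> ('p, 'r, 's, 'p \<Rightarrow> 's) normed \<Rightarrow> 'r)"

definition rig_class ::
  "('p, 'r) ringed_space \<Rightarrow> ('p, 'r, 's) sheaf_algebra \<Rightarrow> ('p, 's, 'm) module_presheaf \<Rightarrow>
   ('p set \<Rightarrow> ('p, 'r, 's, 'm) normed \<Rightarrow> 'r) \<Rightarrow> ('p, 'r, 's) rigidified set" where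
  "rig_class X Y I r = {(J, r'). invertible (over X Y) J \<and> rigidification X Y J r' \<and>
     (\<exists>\<phi>. rigidified_isomorphism X Y J r' I r \<phi>)}"

definition RigPic ::
  "('p, 'r) ringed_space \<Rightarrow> ('p, 'r, 's) sheaf_algebra \<Rightarrow> ('p, 'r, 's) rigidified set monoid" where
  "RigPic X Y =
    \<lparr>carrier = {rig_class X Y I r | (I :: ('p, 's, 'p \<Rightarrow> 's) module_presheaf) r.
        invertible (over X Y) I \<and> rigidification X Y I r},
     mult = (\<lambda>a b. \<Union>(I, r)\<in>a. \<Union>(J, r')\<in>b.
        rig_class X Y (alg_tensor X Y I J) (rig_product X Y I r J r')),
     one = rig_class X Y (alg_self Y) (canonical_rig X Y)\<rparr>"

definition norm_hom ::
  "('p, 'r) ringed_space \<Rightarrow> ('p, 'r, 's) sheaf_algebra \<Rightarrow>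
   ('p, 's, 'p \<Rightarrow> 's) module_presheaf set \<Rightarrow> ('p, 'r, 'p \<Rightarrow> 'r) module_presheaf set" where
  "norm_hom X Y a = (\<Union>I\<in>a. pic_class X (norm_module X Y I))"

definition Pic_kernel ::
  "('p, 'r) ringed_space \<Rightarrow> ('p, 'r, 's) sheaf_algebra \<Rightarrow>
   ('p, 's, 'p \<Rightarrow> 's) module_presheaf set monoid" where
  "Pic_kernel X Y =
    (Pic (over X Y))\<lparr>carrier := kernel (Pic (over X Y)) (Pic X) (norm_hom X Y)\<rparr>"

definition units_mod_norms ::
  "('p, 'r) ringed_space \<Rightarrow> ('p, 'r, 's) sheaf_algebra \<Rightarrow> 'r set monoid" where
  "units_mod_norms X Y =
    units_of (ring_of X (whole X)) Mod (Nm X Y ` Units (alg_of Y (whole X)))"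

definition rescale_map ::
  "('p, 'r) ringed_space \<Rightarrow> ('p, 'r, 's) sheaf_algebra \<Rightarrow> 'r set \<Rightarrow> ('p, 'r, 's) rigidified set" where
  "rescale_map X Y c = (\<Union>u\<in>c. rig_class X Y (alg_self Y) (rescaled_rig X Y u))"

definition forget_map ::
  "('p, 'r) ringed_space \<Rightarrow> ('p, 'r, 's) sheaf_algebra \<Rightarrow> ('p, 'r, 's) rigidified set \<Rightarrow>
   ('p, 's, 'p \<Rightarrow> 's) module_presheaf set" where
  "forget_map X Y a = (\<Union>(I, r)\<in>a. pic_class (over X Y) I)"

text \<open>The library's \<^const>\<open>short_exact_sequence\<close> requires its three groups to have elements of
  the same type.\<close>

definition short_exact ::
  "('a, 'x) monoid_scheme \<Rightarrow> ('b, 'y) monoid_scheme \<Rightarrow> ('c, 'z) monoid_scheme \<Rightarrow>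
   ('a \<Rightarrow> 'b) \<Rightarrow> ('b \<Rightarrow> 'c) \<Rightarrow> bool" where
  "short_exact A B C f g \<longleftrightarrow> group_hom A B f \<and> group_hom B C g \<and>
     inj_on f (carrier A) \<and> f ` carrier A = kernel B C g \<and> g ` carrier B = carrier C"

end

theory Submission
  imports Defs
begin

text \<open>Let \<open>x\<close> generate an invertible \<open>O\<^sub>Y\<close>-module \<open>I\<close> over an open set on which \<open>1, \<gamma>\<close> is a basis of the
  algebra.  Then \<open>n(x) = (\<gamma> x \<and> x) \<otimes> \<gamma>*\<close>, where \<open>\<gamma>*\<close> is the linear form on the quotient that sends
  \<open>\<gamma>\<close> to 1, generates \<open>N(I)\<close>, does not depend on \<open>\<gamma>\<close>, and satisfies \<open>n(b x) = Nm(b) n(x)\<close>.  So a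
  rigidification \<open>r\<close> is the same thing as a family of units \<open>r(n(x))\<close> that is compatible with norms.
  In these terms the product of \<open>r\<close> and \<open>r'\<close> has the value \<open>r(n(x)) r'(n(y))\<close> at \<open>n(x \<otimes> y)\<close>, the neutral
  rigidification of \<open>O\<^sub>Y\<close> has the value 1 at \<open>n(1)\<close>, and the inverse of \<open>(I, r)\<close> is the dual of \<open>I\<close>, with the
  value \<open>1 / r(n(x))\<close> at \<open>n(x*)\<close> for the generator \<open>x*\<close> dual to \<open>x\<close>; all group laws are checked on generators.
  Every rigidification of \<open>O\<^sub>Y\<close> is given by a global unit \<open>u\<close>, its value at \<open>n(1)\<close>, and the
  automorphism of \<open>O\<^sub>Y\<close> that multiplies by a global unit \<open>b\<close> changes \<open>u\<close> by the factor \<open>Nm(b)\<close>; this is exactness in the middle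
  and on the left.  A class in the kernel of \<open>N\<close> has a rigidification by definition.\<close>

section \<open>Sheaves of modules\<close>

text \<open>The definitions select their morphisms with \<open>SOME\<close> from conditions on all
  sections, so every use needs an existence proof, although sections of sheafified tensor products,
  exterior squares and quotients admit no direct formula. Rank one is the way out: a morphism is
  prescribed on generators over small open sets, provided that its values change by the same factors
  as the generators, and the conditions on arbitrary sections are then verified in coordinates. Few
  factors occur. Replacing \<gamma> by p + t \<gamma> multiplies \<gamma> x \<and> x by t and
  divides \<gamma>* by t, which is why n(x) does not see \<gamma>. Replacing x by b x applies the
  determinant of multiplication by b, because the coordinates of b x and b \<gamma> x in x, \<gamma>
  x are those of b and b \<gamma> in 1, \<gamma>. Such a \<gamma> exists only locally, so the global
  norm is obtained by gluing, and the unit of a rigidification of the algebra through an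
  automorphism of the structure sheaf.\<close>

abbreviation (input) ring_add ("(_ \<oplus>[_] _)" [65, 0, 66] 65) where "x \<oplus>[G] y \<equiv> x \<oplus>\<^bsub>G\<^esub> y"
abbreviation (input) ring_diff ("(_ \<ominus>[_] _)" [65, 0, 66] 65) where "x \<ominus>[G] y \<equiv> x \<ominus>\<^bsub>G\<^esub> y"
abbreviation (input) ring_neg ("\<ominus>[_] _" [0, 81] 80) where "\<ominus>[G] x \<equiv> \<ominus>\<^bsub>G\<^esub> x"
abbreviation (input) ring_mult ("(_ \<otimes>[_] _)" [70, 0, 71] 70) where "x \<otimes>[G] y \<equiv> x \<otimes>\<^bsub>G\<^esub> y"
abbreviation (input) mod_smult ("(_ \<odot>[_] _)" [70, 0, 71] 70) where "a \<odot>[G] x \<equiv> a \<odot>\<^bsub>G\<^esub> x"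
abbreviation (input) ring_one ("\<one>[_]") where "\<one>[G] \<equiv> \<one>\<^bsub>G\<^esub>"
abbreviation (input) ring_zero ("\<zero>[_]") where "\<zero>[G] \<equiv> \<zero>\<^bsub>G\<^esub>"
abbreviation (input) sec_add ("(_ \<oplus>[_,_] _)" [65, 0, 0, 66] 65) where "x \<oplus>[M,U] y \<equiv> x \<oplus>[sec M U] y"
abbreviation (input) sec_smult ("(_ \<odot>[_,_] _)" [70, 0, 0, 71] 70) where "a \<odot>[M,U] x \<equiv> a \<odot>[sec M U] x"
abbreviation (input) in_carrier (infix "\<in>:" 50) where "x \<in>: G \<equiv> x \<in> carrier G"

text \<open>The uniqueness of gluing is applied to the cover by all open subsets of \<open>U\<close>
  on which the restrictions of \<open>s\<close> and \<open>t\<close> agree, so that no member has to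
  be chosen for each point.\<close>

lemma sheaf_eqI:
  assumes "is_sheaf T F" "openin T U" "s \<in>: sec F U" "t \<in>: sec F U"
    and loc: "\<And>p. p \<in> U ==> \<exists>W. openin T W \<and> p \<in> W \<and> W \<subseteq> U \<and> res F U W s = res F U W t"
  shows "s = t"
proof -
  have pre: "is_presheaf T F" using assms(1) by (simp add: is_sheaf_def)
  define C where "C = {W. openin T W \<and> W \<subseteq> U \<and> res F U W s = res F U W t}"
  have U: "\<Union>C = U" using loc by (fastforce simp: C_def)
  have clos: "res F U W s \<in>: sec F W" if "W \<in> C" for W
  proof -
    have "res F U W \<in> carrier (sec F U) \<rightarrow> carrier (sec F W)"
      using pre assms(2) that by (simp add: is_presheaf_def C_def)
    then show ?thesis using assms(3) by blast
  qed
  have "\<forall>V\<in>C. \<forall>W\<in>C. res F V (V \<inter> W) (res F U V s) = res F W (V \<inter> W) (res F U W s)"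
  proof (intro ballI)
    fix V W assume "V \<in> C" "W \<in> C"
    then have V: "openin T V" "V \<subseteq> U" and W: "openin T W" "W \<subseteq> U" by (auto simp: C_def)
    have "openin T (V \<inter> W)" using V W by auto
    then show "res F V (V \<inter> W) (res F U V s) = res F W (V \<inter> W) (res F U W s)"
      using pre V W assms(2,3) unfolding is_presheaf_def
      by (metis inf_le1 inf_le2)
  qed
  then have ex1: "\<exists>!t. t \<in>: sec F (\<Union>C) \<and> (\<forall>V\<in>C. res F (\<Union>C) V t = res F U V s)"
    using assms(1)[unfolded is_sheaf_def, THEN conjunct2, THEN spec[of _ C],
        THEN spec[of _ "\<lambda>V. res F U V s"]] clos by (simp add: C_def)
  have "t \<in>: sec F (\<Union>C) \<and> (\<forall>V\<in>C. res F (\<Union>C) V t = res F U V s)"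
    "s \<in>: sec F (\<Union>C) \<and> (\<forall>V\<in>C. res F (\<Union>C) V s = res F U V s)"
    using assms unfolding U by (auto simp: C_def)
  then show ?thesis using ex1 by blast
qed

text \<open>Local data enter as a relation \<open>P\<close>, because in the applications several
  descriptions may produce a section over the same set and none is preferred. Compatibility of
  \<open>P W s\<close> with \<open>P W s'\<close> already forces \<open>s = s'\<close> (this is
  \<open>uniq\<close>), so selecting one section for each member of the cover loses nothing.\<close>

lemma sheaf_glue:
  assumes "is_sheaf T F" "openin T U"
    and P: "\<And>W s. P W s ==> openin T W \<and> W \<subseteq> U \<and> s \<in>: sec F W"
    and cov: "\<And>p. p \<in> U ==> \<exists>W s. p \<in> W \<and> P W s"
    and compat: "\<And>W s W' s'. P W s ==> P W' s' ==> res F W (W \<inter> W') s = res F W' (W \<inter> W') s'"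
  shows "\<exists>t\<in>carrier (sec F U). \<forall>W s. P W s --> res F U W t = s"
proof -
  have pre: "is_presheaf T F" using assms(1) by (simp add: is_sheaf_def)
  define C where "C = {W. \<exists>s. P W s}"
  have U: "\<Union>C = U" using P cov by (fastforce simp: C_def)
  have uniq: "s = s'" if "P W s" "P W s'" for W s s'
  proof -
    have "res F W W s = res F W W s'" using compat[OF that] by simp
    then show ?thesis using pre P[OF that(1)] P[OF that(2)] by (auto simp: is_presheaf_def)
  qed
  define f where "f = (\<lambda>W. SOME s. P W s)"
  have f: "P W (f W)" if "W \<in> C" for W
    using that someI_ex[of "P W"] by (auto simp: C_def f_def)
  have "\<forall>V\<in>C. openin T V \<and> f V \<in>: sec F V" using f P by blast
  moreover have "\<forall>V\<in>C. \<forall>W\<in>C. res F V (V \<inter> W) (f V) = res F W (V \<inter> W) (f W)"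
    using f compat by blast
  ultimately have "\<exists>t. t \<in>: sec F (\<Union>C) \<and> (\<forall>V\<in>C. res F (\<Union>C) V t = f V)"
    using assms(1) unfolding is_sheaf_def by blast
  then obtain t where t: "t \<in>: sec F U" "\<forall>V\<in>C. res F U V t = f V" unfolding U by blast
  have "res F U W t = s" if "P W s" for W s
  proof -
    have "W \<in> C" using that by (auto simp: C_def)
    then show ?thesis using t(2) uniq[OF f that] by simp
  qed
  then show ?thesis using t by blast
qed

section \<open>Rings and modules of sections with their restriction maps\<close>

locale ringed =
  fixes X :: "('p, 'r) ringed_space"
  assumes ringed_space: "is_ringed_space X"
begin

abbreviation "mpre M \<equiv> is_module_presheaf X M"
abbreviation "msh M \<equiv> is_module_sheaf X M"
abbreviation "mmor M N \<phi> \<equiv> module_morphism X M N \<phi>"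
abbreviation "miso M N \<phi> \<equiv> module_isomorphism X M N \<phi>"
abbreviation "line M \<equiv> invertible X M"
abbreviation "opn U \<equiv> is_open X U"
abbreviation "R U \<equiv> ring_of X U"
abbreviation "rr U V a \<equiv> res (structure_sheaf X) U V a"

lemma R_sheaf: "is_sheaf (underlying X) (structure_sheaf X)"
  using ringed_space by (simp add: is_ringed_space_def is_ring_sheaf_def)

lemma R_presheaf: "is_presheaf (underlying X) (structure_sheaf X)"
  using R_sheaf by (simp add: is_sheaf_def)

lemma R_cring: "opn U ==> cring (R U)"
  using ringed_space by (simp add: is_ringed_space_def is_ring_sheaf_def)

lemma rr_hom: "opn U ==> opn V ==> V \<subseteq> U ==> res (structure_sheaf X) U V \<in> ring_hom (R U) (R V)"
  using ringed_space by (simp add: is_ringed_space_def is_ring_sheaf_def)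

lemma rr_ring_hom: "opn U ==> opn V ==> V \<subseteq> U ==> ring_hom_cring (R U) (R V) (res (structure_sheaf X) U V)"
  using rr_hom R_cring by (simp add: ring_hom_cring_def ring_hom_cring_axioms_def)

context
  fixes U V assumes UV: "opn U" "opn V" "V \<subseteq> U"
begin
interpretation h: ring_hom_cring "R U" "R V" "res (structure_sheaf X) U V" by (rule rr_ring_hom[OF UV])
lemma rr_closed [simp]: "a \<in>: R U ==> rr U V a \<in>: R V" by simp
lemma rr_add: "a \<in>: R U ==> b \<in>: R U ==> rr U V (a \<oplus>[R U] b) = rr U V a \<oplus>[R V] rr U V b"
  by simp
lemma rr_mult: "a \<in>: R U ==> b \<in>: R U ==> rr U V (a \<otimes>[R U] b) = rr U V a \<otimes>[R V] rr U V b"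
  by simp
lemma rr_uminus: "a \<in>: R U ==> rr U V (\<ominus>[R U] a) = \<ominus>[R V] rr U V a"
  by simp
lemma rr_minus: "a \<in>: R U ==> b \<in>: R U ==> rr U V (a \<ominus>[R U] b) = rr U V a \<ominus>[R V] rr U V b"
  by (simp add: a_minus_def)
lemma rr_zero [simp]: "rr U V \<zero>[R U] = \<zero>[R V]" by simp
lemma rr_one [simp]: "rr U V \<one>[R U] = \<one>[R V]" by simp
lemma rr_Units: "a \<in> Units (R U) ==> rr U V a \<in> Units (R V)"
  unfolding Units_def by clarsimp (metis h.hom_closed h.hom_mult h.hom_one)
end

lemma rr_id [simp]: "opn U ==> a \<in>: R U ==> rr U U a = a"
  using R_presheaf by (simp add: is_presheaf_def)

lemma rr_trans [simp]: "opn U ==> opn V ==> opn W ==> W \<subseteq> V ==> V \<subseteq> U ==> a \<in>: R U ==>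
  rr V W (rr U V a) = rr U W a"
  using R_presheaf by (simp add: is_presheaf_def)

lemma mp_presheaf: "mpre M ==> is_presheaf (underlying X) M"
  by (simp add: is_module_presheaf_def)

lemma mp_module: "mpre M ==> opn U ==> Module.module (R U) (sec M U)"
  by (simp add: is_module_presheaf_def)

lemma mres_closed [simp]: "mpre M ==> opn U ==> opn V ==> V \<subseteq> U ==>
  m \<in>: sec M U ==> res M U V m \<in>: sec M V"
  using mp_presheaf[of M] by (auto simp: is_presheaf_def)

lemma mres_id [simp]: "mpre M ==> opn U ==>
  m \<in>: sec M U ==> res M U U m = m"
  using mp_presheaf[of M] by (auto simp: is_presheaf_def)

lemma mres_trans [simp]: "mpre M ==> opn U ==> opn V ==> opn W ==> W \<subseteq> V ==> V \<subseteq> U ==>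
  m \<in>: sec M U ==> res M V W (res M U V m) = res M U W m"
  using mp_presheaf[of M] by (simp add: is_presheaf_def)

lemma mres_add: "mpre M ==> opn U ==> opn V ==> V \<subseteq> U ==>
  m \<in>: sec M U ==> n \<in>: sec M U ==>
  res M U V (m \<oplus>[M,U] n) = res M U V m \<oplus>[M,V] res M U V n"
  by (simp add: is_module_presheaf_def)

lemma mres_smult: "mpre M ==> opn U ==> opn V ==> V \<subseteq> U ==>
  a \<in>: R U ==> m \<in>: sec M U ==>
  res M U V (a \<odot>[M,U] m) = rr U V a \<odot>[M,V] res M U V m"
  by (simp add: is_module_presheaf_def)

context
  fixes M :: "('p, 'r, 'm) module_presheaf" and U
  assumes M: "mpre M" "opn U"
begin
interpretation m: Module.module "R U" "sec M U" by (rule mp_module[OF M])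
lemma msmult_closed [simp]: "a \<in>: R U ==> m \<in>: sec M U ==> a \<odot>[M,U] m \<in>: sec M U"
  by simp
lemma madd_closed [simp]: "n \<in>: sec M U ==> m \<in>: sec M U ==> n \<oplus>[M,U] m \<in>: sec M U"
  by simp
lemma mzero_closed [simp]: "\<zero>[sec M U] \<in>: sec M U"
  by simp
lemma msmult_one [simp]: "m \<in>: sec M U ==> \<one>[R U] \<odot>[M,U] m = m"
  by simp
lemma msmult_assoc: "a \<in>: R U ==> b \<in>: R U ==> m \<in>: sec M U ==>
   (a \<otimes>[R U] b) \<odot>[M,U] m = a \<odot>[M,U] (b \<odot>[M,U] m)"
  by (rule m.smult_assoc1)
lemma msmult_l_distr: "a \<in>: R U ==> b \<in>: R U ==> m \<in>: sec M U ==>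
   (a \<oplus>[R U] b) \<odot>[M,U] m = a \<odot>[M,U] m \<oplus>[M,U] b \<odot>[M,U] m"
  by (rule m.smult_l_distr)
end

text \<open>Obtained from compatibility with scalars: zero is the multiple of itself by the zero of
  the ring.\<close>

lemma mres_zero [simp]:
  assumes "mpre M" "opn U" "opn V" "V \<subseteq> U"
  shows "res M U V \<zero>[sec M U] = \<zero>[sec M V]"
proof -
  interpret u: Module.module "R U" "sec M U" by (rule mp_module) fact+
  interpret v: Module.module "R V" "sec M V" by (rule mp_module) fact+
  have "res M U V (\<zero>[R U] \<odot>[M,U] \<zero>[sec M U]) = rr U V \<zero>[R U] \<odot>[M,V] res M U V \<zero>[sec M U]"
    using assms by (intro mres_smult) auto
  then show ?thesis using assms by simp
qed

lemma ms_mp [simp]: "msh M ==> mpre M"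
  by (simp add: is_module_sheaf_def)

lemma ms_sheaf: "msh M ==> is_sheaf (underlying X) M"
  by (simp add: is_module_sheaf_def)

lemma mm_closed [simp]: "mmor M N \<phi> ==> opn U ==> m \<in>: sec M U ==> \<phi> U m \<in>: sec N U"
  by (auto simp: module_morphism_def is_linear_def)

lemma mm_add: "mmor M N \<phi> ==> opn U ==> m \<in>: sec M U ==> n \<in>: sec M U ==>
   \<phi> U (m \<oplus>[M,U] n) = \<phi> U m \<oplus>[N,U] \<phi> U n"
  by (auto simp: module_morphism_def is_linear_def)

lemma mm_smult: "mmor M N \<phi> ==> opn U ==> a \<in>: R U ==> m \<in>: sec M U ==>
   \<phi> U (a \<odot>[M,U] m) = a \<odot>[N,U] \<phi> U m"
  by (auto simp: module_morphism_def is_linear_def)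

lemma mm_res: "mmor M N \<phi> ==> opn U ==> opn V ==> V \<subseteq> U ==> m \<in>: sec M U ==>
   \<phi> V (res M U V m) = res N U V (\<phi> U m)"
  by (auto simp: module_morphism_def)

lemma mi_mm [simp]: "miso M N \<phi> ==> mmor M N \<phi>"
  by (simp add: module_isomorphism_def)

lemma mi_inj: "miso M N \<phi> ==> opn U ==> m \<in>: sec M U ==> n \<in>: sec M U ==>
   \<phi> U m = \<phi> U n ==> m = n"
  unfolding module_isomorphism_def bij_betw_def by (meson inj_onD)

lemma mi_surj: "miso M N \<phi> ==> opn U ==> n \<in>: sec N U ==>
   \<exists>m\<in>carrier (sec M U). \<phi> U m = n"
  unfolding module_isomorphism_def bij_betw_def by (metis imageE)

lemma mm_comp: "mmor M N \<phi> ==> mmor N K \<psi> ==> mmor M K (\<lambda>U m. \<psi> U (\<phi> U m))"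
  by (auto simp: module_morphism_def is_linear_def Pi_iff)

lemma mi_comp: "miso M N \<phi> ==> miso N K \<psi> ==>
   miso M K (\<lambda>U m. \<psi> U (\<phi> U m))"
  unfolding module_isomorphism_def
proof (intro conjI allI impI; (elim conjE)?)
  assume "mmor M N \<phi>" "mmor N K \<psi>"
  then show "mmor M K (\<lambda>U m. \<psi> U (\<phi> U m))" by (rule mm_comp)
next
  fix U assume U: "opn U" "\<forall>U. opn U --> bij_betw (\<phi> U) (carrier (sec M U)) (carrier (sec N U))"
    "\<forall>U. opn U --> bij_betw (\<psi> U) (carrier (sec N U)) (carrier (sec K U))"
  then have "bij_betw (\<psi> U \<circ> \<phi> U) (carrier (sec M U)) (carrier (sec K U))"
    by (intro bij_betw_trans) auto
  then show "bij_betw (\<lambda>m. \<psi> U (\<phi> U m)) (carrier (sec M U)) (carrier (sec K U))"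
    by (simp add: comp_def)
qed

lemma mi_id: "mpre M ==> miso M M (\<lambda>U m. m)"
  using bij_betw_id[unfolded id_def]
  by (auto simp: module_isomorphism_def module_morphism_def is_linear_def)

lemma mi_inv:
  assumes "miso M N \<phi>" "mpre M"
  shows "miso N M (\<lambda>U. inv_into (carrier (sec M U)) (\<phi> U))"
proof -
  let ?i = "\<lambda>U. inv_into (carrier (sec M U)) (\<phi> U)"
  have b: "bij_betw (\<phi> U) (carrier (sec M U)) (carrier (sec N U))" if "opn U" for U
    using assms that by (simp add: module_isomorphism_def)
  have bi: "bij_betw (?i U) (carrier (sec N U)) (carrier (sec M U))" if "opn U" for U
    using b[OF that] by (rule bij_betw_inv_into)
  have fi: "\<phi> U (?i U n) = n" if "opn U" "n \<in>: sec N U" for U n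
    using b[OF that(1)] that(2) by (simp add: bij_betw_inv_into_right)
  have ic: "?i U n \<in>: sec M U" if "opn U" "n \<in>: sec N U" for U n
    using bi[OF that(1)] that(2) by (auto simp: bij_betw_def)
  \<comment> \<open>An identity for the inverse then only has to be verified after applying
    \<open>\<phi>\<close>, where it is linearity or naturality of \<open>\<phi>\<close>.\<close>
  have eqi: "?i U n = m" if "opn U" "m \<in>: sec M U" "\<phi> U m = n" for U n m
    using b[OF that(1)] that by (metis bij_betw_inv_into_left)
  have mm: "mmor M N \<phi>" using assms by simp
  have "mmor N M ?i"
    unfolding module_morphism_def is_linear_def
    by (auto intro!: eqi simp: ic fi mm_add[OF mm] mm_smult[OF mm] mm_res[OF mm] assms)
  then show ?thesis using bi by (simp add: module_isomorphism_def)
qed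

end

section \<open>Generators of sheaves of rank one\<close>

lemma ex1_iff_bij_betw:
  assumes "f \<in> A \<rightarrow> B"
  shows "(\<forall>y\<in>B. \<exists>!x. x \<in> A \<and> y = f x) \<longleftrightarrow> bij_betw f A B"
proof
  assume *: "\<forall>y\<in>B. \<exists>!x. x \<in> A \<and> y = f x"
  have "inj_on f A"
  proof (rule inj_onI)
    fix x y assume xy: "x \<in> A" "y \<in> A" "f x = f y"
    then have "f x \<in> B" using assms by auto
    then have "\<exists>!z. z \<in> A \<and> f x = f z" using * by (rule bspec[rotated])
    then show "x = y" using xy by blast
  qed
  moreover have "f ` A = B"
  proof
    show "B \<subseteq> f ` A"
    proof
      fix y assume "y \<in> B"
      with * have "\<exists>!x. x \<in> A \<and> y = f x" by (rule bspec)
      then show "y \<in> f ` A" by auto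
    qed
  qed (use assms in auto)
  ultimately show "bij_betw f A B" by (simp add: bij_betw_def)
next
  assume f: "bij_betw f A B"
  show "\<forall>y\<in>B. \<exists>!x. x \<in> A \<and> y = f x"
  proof
    fix y assume "y \<in> B"
    then obtain x where x: "x \<in> A" "y = f x" using f by (auto simp: bij_betw_def)
    show "\<exists>!x. x \<in> A \<and> y = f x"
    proof (rule ex1I[of _ x])
      fix z assume z: "z \<in> A \<and> y = f z"
      show "z = x" by (rule inj_onD[of f A]) (use f x z in \<open>auto simp: bij_betw_def\<close>)
    qed (use x in simp)
  qed
qed

text \<open>Bijectivity of the coordinate map can be composed with other bijections; for ranks 1 and
  2 this replaces extensional coordinate families by a scalar and by a pair of scalars.\<close>

lemma module_basis_iff_bij_betw:
  assumes "Module.module R M" "\<forall>i<n. e i \<in>: M"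
  shows "module_basis R M n e \<longleftrightarrow>
    bij_betw (\<lambda>c. \<Oplus>\<^bsub>M\<^esub>i\<in>{..<n}. c i \<odot>[M] e i) ({..<n} \<rightarrow>\<^sub>E carrier R) (carrier M)"
proof -
  interpret Module.module R M by fact
  have "(\<lambda>c. \<Oplus>\<^bsub>M\<^esub>i\<in>{..<n}. c i \<odot>[M] e i) \<in> ({..<n} \<rightarrow>\<^sub>E carrier R) \<rightarrow> carrier M"
  proof
    fix c assume c: "c \<in> {..<n} \<rightarrow>\<^sub>E carrier R"
    have "c i \<odot>[M] e i \<in>: M" if "i \<in> {..<n}" for i
      using PiE_mem[OF c that] assms(2) that by simp
    then show "(\<Oplus>\<^bsub>M\<^esub>i\<in>{..<n}. c i \<odot>[M] e i) \<in>: M" by (intro M.finsum_closed) auto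
  qed
  from ex1_iff_bij_betw[OF this] show ?thesis using assms(2) unfolding module_basis_def by simp
qed

lemma module_basis_1:
  assumes "Module.module R M" "e 0 \<in>: M"
  shows "module_basis R M 1 e \<longleftrightarrow> bij_betw (\<lambda>a. a \<odot>[M] e 0) (carrier R) (carrier M)"
proof -
  interpret Module.module R M by fact
  define k where "k = (\<lambda>a::'a. \<lambda>i\<in>{..<1::nat}. a)"
  define F where "F = (\<lambda>c. \<Oplus>\<^bsub>M\<^esub>i\<in>{..<1::nat}. c i \<odot>[M] e i)"
  have k: "bij_betw k (carrier R) ({..<1::nat} \<rightarrow>\<^sub>E carrier R)"
  proof (rule bij_betw_byWitness[where f' = "\<lambda>c. c 0"])
    show "\<forall>c\<in>{..<1::nat} \<rightarrow>\<^sub>E carrier R. k (c 0) = c"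
      by (auto simp: k_def fun_eq_iff PiE_iff extensional_def restrict_def)
    show "(\<lambda>c. c 0) ` ({..<1::nat} \<rightarrow>\<^sub>E carrier R) \<subseteq> carrier R"
      by (rule image_subsetI, erule PiE_mem) simp
    show "k ` carrier R \<subseteq> {..<1::nat} \<rightarrow>\<^sub>E carrier R" by (auto simp: k_def split: if_splits)
  qed (simp add: k_def)
  have "F (k a) = a \<odot>[M] e 0" if "a \<in>: R" for a
    unfolding F_def k_def using that assms(2) by (simp add: lessThan_Suc)
  then have "bij_betw (\<lambda>a. a \<odot>[M] e 0) (carrier R) (carrier M) \<longleftrightarrow> bij_betw (F \<circ> k) (carrier R) (carrier M)"
    by (intro bij_betw_cong) simp
  also have "\<dots> \<longleftrightarrow> bij_betw F ({..<1::nat} \<rightarrow>\<^sub>E carrier R) (carrier M)"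
    using bij_betw_comp_iff[OF k] by blast
  finally show ?thesis using module_basis_iff_bij_betw[OF assms(1), of 1 e] assms(2) by (simp add: F_def)
qed

lemma module_basis_2:
  assumes "Module.module R M" "e 0 \<in>: M" "e (Suc 0) \<in>: M"
  shows "module_basis R M 2 e \<longleftrightarrow>
    bij_betw (\<lambda>(a, b). a \<odot>[M] e 0 \<oplus>[M] b \<odot>[M] e (Suc 0)) (carrier R \<times> carrier R) (carrier M)"
proof -
  interpret Module.module R M by fact
  define k where "k = (\<lambda>(a::'a, b). \<lambda>i\<in>{..<2::nat}. if i = 0 then a else b)"
  define F where "F = (\<lambda>c. \<Oplus>\<^bsub>M\<^esub>i\<in>{..<2::nat}. c i \<odot>[M] e i)"
  have set2: "{..<2} = {0, Suc 0}" by auto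
  have k: "bij_betw k (carrier R \<times> carrier R) ({..<2::nat} \<rightarrow>\<^sub>E carrier R)"
  proof (rule bij_betw_byWitness[where f' = "\<lambda>c. (c 0, c (Suc 0))"])
    show "\<forall>c\<in>{..<2::nat} \<rightarrow>\<^sub>E carrier R. k (c 0, c (Suc 0)) = c"
    proof
      fix c assume c: "c \<in> {..<2::nat} \<rightarrow>\<^sub>E carrier R"
      show "k (c 0, c (Suc 0)) = c"
      proof
        fix i :: nat
        consider "i = 0" | "i = Suc 0" | "i \<notin> {..<2}" by fastforce
        then show "k (c 0, c (Suc 0)) i = c i" by cases (simp_all add: k_def PiE_arb[OF c])
      qed
    qed
    show "(\<lambda>c. (c 0, c (Suc 0))) ` ({..<2::nat} \<rightarrow>\<^sub>E carrier R) \<subseteq> carrier R \<times> carrier R"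
      by (rule image_subsetI, rule SigmaI; erule PiE_mem) simp_all
    show "k ` (carrier R \<times> carrier R) \<subseteq> {..<2::nat} \<rightarrow>\<^sub>E carrier R"
      by (auto simp: k_def less_2_cases_iff split: if_splits)
  qed (simp add: k_def)
  have "F (k (a, b)) = a \<odot>[M] e 0 \<oplus>[M] b \<odot>[M] e (Suc 0)" if "a \<in>: R" "b \<in>: R" for a b
    unfolding F_def k_def using that assms(2,3) by (simp add: set2)
  then have "bij_betw (\<lambda>(a, b). a \<odot>[M] e 0 \<oplus>[M] b \<odot>[M] e (Suc 0)) (carrier R \<times> carrier R) (carrier M)
     \<longleftrightarrow> bij_betw (F \<circ> k) (carrier R \<times> carrier R) (carrier M)"
    by (intro bij_betw_cong) auto
  also have "\<dots> \<longleftrightarrow> bij_betw F ({..<2::nat} \<rightarrow>\<^sub>E carrier R) (carrier M)"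
    using bij_betw_comp_iff[OF k] by blast
  finally show ?thesis using module_basis_iff_bij_betw[OF assms(1), of 2 e] assms(2,3)
    by (simp add: F_def less_2_cases_iff)
qed

context ringed
begin

text \<open>Such a \<open>g\<close> is an isomorphism from the structure sheaf to \<open>M\<close>
  over \<open>U\<close>, hence a free generator. Bijectivity over all smaller open sets is built in,
  so that the notion restricts well for presheaves too.\<close>

definition gen :: "('p, 'r, 'm) module_presheaf => 'p set => 'm => bool" where
  "gen M U g \<longleftrightarrow> opn U \<and> g \<in>: sec M U \<and> (\<forall>W. opn W \<and> W \<subseteq> U -->
     bij_betw (\<lambda>a. a \<odot>[M,W] res M U W g) (carrier (R W)) (carrier (sec M W)))"

lemma gen_open [simp]: "gen M U g ==> opn U" unfolding gen_def by (elim conjE)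
lemma gen_closed [simp]: "gen M U g ==> g \<in>: sec M U" unfolding gen_def by (elim conjE)

lemma gen_res: "mpre M ==> gen M U g ==> opn W ==> W \<subseteq> U ==> gen M W (res M U W g)"
  unfolding gen_def by auto

lemma gen_coeff:
  assumes "mpre M" "gen M U g" "m \<in>: sec M U"
  shows "\<exists>a\<in>carrier (R U). m = a \<odot>[M,U] g"
proof -
  have "bij_betw (\<lambda>a. a \<odot>[M,U] res M U U g) (carrier (R U)) (carrier (sec M U))"
    using assms unfolding gen_def by blast
  then show ?thesis using assms by (auto simp: bij_betw_def)
qed

lemma gen_cancel:
  assumes "mpre M" "gen M U g" "a \<in>: R U" "b \<in>: R U"
    "a \<odot>[M,U] g = b \<odot>[M,U] g"
  shows "a = b"
proof -
  have "bij_betw (\<lambda>a. a \<odot>[M,U] res M U U g) (carrier (R U)) (carrier (sec M U))"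
    using assms unfolding gen_def by blast
  then have "inj_on (\<lambda>a. a \<odot>[M,U] g) (carrier (R U))" using assms by (simp add: bij_betw_def)
  then show ?thesis using assms by (meson inj_onD)
qed

lemma genI:
  assumes M: "mpre M" "opn U" "g \<in>: sec M U"
    and ex: "\<And>W m. opn W ==> W \<subseteq> U ==> m \<in>: sec M W ==> \<exists>a\<in>carrier (R W). m = a \<odot>[M,W] res M U W g"
    and inj: "\<And>W a b. opn W ==> W \<subseteq> U ==> a \<in>: R W ==> b \<in>: R W ==>
       a \<odot>[M,W] res M U W g = b \<odot>[M,W] res M U W g ==> a = b"
  shows "gen M U g"
  unfolding gen_def
proof (intro conjI allI impI)
  fix W assume W: "opn W \<and> W \<subseteq> U"
  show "bij_betw (\<lambda>a. a \<odot>[M,W] res M U W g) (carrier (R W)) (carrier (sec M W))"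
  proof (rule bij_betw_imageI)
    show "inj_on (\<lambda>a. a \<odot>[M,W] res M U W g) (carrier (R W))" using W inj by (intro inj_onI) auto
    show "(\<lambda>a. a \<odot>[M,W] res M U W g) ` carrier (R W) = carrier (sec M W)"
    proof
      show "carrier (sec M W) \<subseteq> (\<lambda>a. a \<odot>[M,W] res M U W g) ` carrier (R W)" using ex[of W] W by blast
    qed (use M W in auto)
  qed
qed (use M in auto)

text \<open>Writing h = b g gives (b a) h = h, and cancelling the generator h makes b inverse to
  a.\<close>

lemma gen_ratio_Units:
  assumes "mpre M" "gen M U g" "gen M U h" "a \<in>: R U" "g = a \<odot>[M,U] h"
  shows "a \<in> Units (R U)"
proof -
  interpret cring "R U" using assms(2) by (simp add: R_cring)
  obtain b where b: "b \<in>: R U" "h = b \<odot>[M,U] g" using gen_coeff assms by (metis gen_closed)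
  have U: "opn U" and h: "h \<in>: sec M U" using assms by auto
  have "(b \<otimes>[R U] a) \<odot>[M,U] h = b \<odot>[M,U] g"
    unfolding assms(5) by (rule msmult_assoc[OF assms(1) U b(1) assms(4) h])
  also have "\<dots> = \<one>[R U] \<odot>[M,U] h" using b(2) msmult_one[OF assms(1) U h] by simp
  finally have "(b \<otimes>[R U] a) \<odot>[M,U] h = \<one>[R U] \<odot>[M,U] h" .
  then have "b \<otimes>[R U] a = \<one>[R U]" using gen_cancel[OF assms(1,3)] b assms(4) by simp
  then show ?thesis using b(1) assms(4) m_comm[of a b] unfolding Units_def by auto
qed

lemma gen_ratio:
  assumes "mpre M" "gen M U g" "gen M U h"
  shows "\<exists>a\<in>Units (R U). g = a \<odot>[M,U] h"
  using gen_ratio_Units[OF assms] gen_coeff[OF assms(1,3) gen_closed[OF assms(2)]] by blast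

lemma gen_smult:
  assumes M: "mpre M" and g: "gen M U g" and u: "u \<in> Units (R U)"
  shows "gen M U (u \<odot>[M,U] g)"
proof (rule genI[OF M])
  interpret RU: cring "R U" using g by (simp add: R_cring)
  note [simp] = RU.Units_closed[OF u] M gen_closed[OF g] gen_open[OF g]
  show "opn U" "u \<odot>[M,U] g \<in>: sec M U" by auto
  fix W assume W: "opn W" "W \<subseteq> U"
  interpret RW: cring "R W" using W by (simp add: R_cring)
  let ?u = "rr U W u" and ?g = "res M U W g"
  have gW: "gen M W ?g" using gen_res[OF M g W] .
  have uW: "?u \<in> Units (R W)" using rr_Units[OF _ W u] by simp
  note [simp] = RW.Units_closed[OF uW] RW.Units_inv_closed[OF uW] W gen_closed[OF gW]
  have r: "res M U W (u \<odot>[M,U] g) = ?u \<odot>[M,W] ?g" by (simp add: mres_smult)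
  { fix m assume "m \<in>: sec M W"
    then obtain a where a: "a \<in>: R W" "m = a \<odot>[M,W] ?g" using gen_coeff[OF M gW] by blast
    have "m = (a \<otimes>[R W] inv\<^bsub>R W\<^esub> ?u) \<odot>[M,W] (?u \<odot>[M,W] ?g)"
      using a uW by (simp add: msmult_assoc[symmetric] RW.m_assoc)
    then show "\<exists>a\<in>carrier (R W). m = a \<odot>[M,W] res M U W (u \<odot>[M,U] g)"
      unfolding r using a by (intro bexI[of _ "a \<otimes>[R W] inv\<^bsub>R W\<^esub> ?u"]) auto }
  { fix a b assume ab: "a \<in>: R W" "b \<in>: R W"
      "a \<odot>[M,W] res M U W (u \<odot>[M,U] g) = b \<odot>[M,W] res M U W (u \<odot>[M,U] g)"
    then have "(a \<otimes>[R W] ?u) \<odot>[M,W] ?g = (b \<otimes>[R W] ?u) \<odot>[M,W] ?g"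
      unfolding r by (simp add: msmult_assoc)
    then have "a \<otimes>[R W] ?u = b \<otimes>[R W] ?u" using gen_cancel[OF M gW] ab by simp
    then have "a \<otimes>[R W] ?u \<otimes>[R W] inv\<^bsub>R W\<^esub> ?u = b \<otimes>[R W] ?u \<otimes>[R W] inv\<^bsub>R W\<^esub> ?u" by simp
    then show "a = b" using uW ab by (simp add: RW.m_assoc) }
qed

lemma gen_iso:
  assumes M: "mpre M" "mpre N" and i: "miso M N \<phi>" and g: "gen M U g"
  shows "gen N U (\<phi> U g)"
proof (rule genI[OF M(2)])
  have mm: "mmor M N \<phi>" using i by simp
  show "opn U" "\<phi> U g \<in>: sec N U" using g mm by auto
  fix W assume W: "opn W" "W \<subseteq> U"
  have gW: "gen M W (res M U W g)" using gen_res[OF M(1) g W] .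
  have r: "res N U W (\<phi> U g) = \<phi> W (res M U W g)" using g W by (simp add: mm_res[OF mm])
  { fix m assume "m \<in>: sec N W"
    then obtain m' where m': "m' \<in>: sec M W" "m = \<phi> W m'" using mi_surj[OF i W(1)] by blast
    then obtain a where a: "a \<in>: R W" "m' = a \<odot>[M,W] res M U W g" using gen_coeff[OF M(1) gW] by blast
    then have "m = a \<odot>[N,W] res N U W (\<phi> U g)" using gW W m' r by (simp add: mm_smult[OF mm])
    then show "\<exists>a\<in>carrier (R W). m = a \<odot>[N,W] res N U W (\<phi> U g)" using a by blast }
  { fix a b assume ab: "a \<in>: R W" "b \<in>: R W"
      "a \<odot>[N,W] res N U W (\<phi> U g) = b \<odot>[N,W] res N U W (\<phi> U g)"
    then have "\<phi> W (a \<odot>[M,W] res M U W g) = \<phi> W (b \<odot>[M,W] res M U W g)"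
      unfolding r using gW W by (simp add: mm_smult[OF mm])
    then have "a \<odot>[M,W] res M U W g = b \<odot>[M,W] res M U W g"
      using ab gW W M by (intro mi_inj[OF i]) auto
    then show "a = b" using gen_cancel[OF M(1) gW] ab by simp }
qed

lemma sheaf_basis_1:
  assumes M: "mpre M"
  shows "sheaf_basis X M 1 U e \<longleftrightarrow> gen M U (e 0)"
proof -
  have "module_basis (R V) (sec M V) 1 (\<lambda>i. res M U V (e i)) \<longleftrightarrow>
      bij_betw (\<lambda>a. a \<odot>[M,V] res M U V (e 0)) (carrier (R V)) (carrier (sec M V))"
    if "opn U" "e 0 \<in>: sec M U" "opn V" "V \<subseteq> U" for V
    using that M by (intro module_basis_1 mp_module) auto
  then show ?thesis unfolding sheaf_basis_def gen_def by auto
qed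

lemma invertible_iff: "line M \<longleftrightarrow> msh M \<and> (\<forall>p\<in>whole X. \<exists>U g. p \<in> U \<and> gen M U g)"
proof (cases "msh M")
  case True
  have "(\<exists>e. sheaf_basis X M 1 U e) \<longleftrightarrow> (\<exists>g. gen M U g)" for U
    using True by (auto simp only: sheaf_basis_1 ms_mp) 
  then show ?thesis unfolding invertible_def locally_free_def by (metis True)
qed (simp add: invertible_def locally_free_def)

lemma inv_ms [simp]: "line M ==> msh M"
  by (simp add: invertible_iff)

lemma inv_gen_within:
  assumes "line M" "opn U" "p \<in> U"
  shows "\<exists>V g. opn V \<and> p \<in> V \<and> V \<subseteq> U \<and> gen M V g"
proof -
  have "p \<in> whole X" using assms openin_subset by blast
  then obtain V g where V: "p \<in> V" "gen M V g" using assms by (auto simp: invertible_iff)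
  have "gen M (V \<inter> U) (res M V (V \<inter> U) g)" using V assms by (intro gen_res) auto
  then show ?thesis using V assms by (intro exI[of _ "V \<inter> U"]) auto
qed

lemma self_sec [simp]: "carrier (sec (self_module F) U) = carrier (sec F U)"
  "\<zero>[sec (self_module F) U] = \<zero>[sec F U]"
  "(\<oplus>\<^bsub>sec (self_module F) U\<^esub>) = (\<oplus>\<^bsub>sec F U\<^esub>)"
  "(\<odot>\<^bsub>sec (self_module F) U\<^esub>) = (\<otimes>\<^bsub>sec F U\<^esub>)"
  "res (self_module F) = res F"
  by (simp_all add: self_module_def mk_module_def)

lemma self_sheaf: "msh (self_module (structure_sheaf X))"
proof -
  have "Module.module (R U) (sec (self_module (structure_sheaf X)) U)" if "opn U" for U
  proof -
    interpret cring "R U" using that by (rule R_cring)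
    show ?thesis
    proof (rule moduleI, rule is_cring, rule abelian_groupI)
      fix x assume "x \<in>: sec (self_module (structure_sheaf X)) U"
      then show "\<exists>y\<in>carrier (sec (self_module (structure_sheaf X)) U). y \<oplus>[sec (self_module (structure_sheaf X)) U] x = \<zero>[sec (self_module (structure_sheaf X)) U]"
        by (intro bexI[of _ "\<ominus>[R U] x"]) (auto simp: l_neg)
    qed (simp_all add: a_ac l_distr r_distr m_assoc)
  qed
  then show ?thesis
    using R_sheaf unfolding is_module_sheaf_def is_module_presheaf_def is_sheaf_def is_presheaf_def
    by (simp add: rr_add rr_mult)
qed

lemma gen_self: "opn U ==> u \<in> Units (R U) ==> gen (self_module (structure_sheaf X)) U u"
proof -
  assume U: "opn U" and u: "u \<in> Units (R U)"
  interpret RU: cring "R U" using U by (simp add: R_cring)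
  have "gen (self_module (structure_sheaf X)) U \<one>[R U]"
  proof (rule genI)
    fix W a b assume W: "opn W" "W \<subseteq> U"
    interpret RW: cring "R W" using W by (simp add: R_cring)
    { fix m assume "m \<in>: sec (self_module (structure_sheaf X)) W"
      then show "\<exists>a\<in>carrier (R W). m = a \<odot>[sec (self_module (structure_sheaf X)) W] res (self_module (structure_sheaf X)) U W \<one>[R U]"
        using U W by auto }
    assume "a \<in>: R W" "b \<in>: R W"
     "a \<odot>[sec (self_module (structure_sheaf X)) W] res (self_module (structure_sheaf X)) U W \<one>[R U] =
      b \<odot>[sec (self_module (structure_sheaf X)) W] res (self_module (structure_sheaf X)) U W \<one>[R U]"
    then show "a = b" using U W by simp
  qed (use U self_sheaf in auto)
  from gen_smult[OF _ this u] show ?thesis using u RU.Units_closed self_sheaf by simp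
qed

lemma self_invertible: "line (self_module (structure_sheaf X))"
proof -
  have "opn (whole X)" by simp
  then have "gen (self_module (structure_sheaf X)) (whole X) \<one>[R (whole X)]"
    by (rule gen_self) (use R_cring[of "whole X"] in \<open>simp add: cring_def ring.is_monoid monoid.Units_one_closed\<close>)
  then show ?thesis using self_sheaf by (auto simp: invertible_iff)
qed

text \<open>Both 1 and \<open>u\<close> are generators, so their ratio is a unit. In this way the
  values of isomorphisms at generators are recognised as units.\<close>

lemma gen_self_Units: "gen (self_module (structure_sheaf X)) U u ==> u \<in> Units (R U)"
proof -
  assume g: "gen (self_module (structure_sheaf X)) U u"
  interpret RU: cring "R U" using g by (simp add: R_cring gen_open)
  show ?thesis using gen_ratio_Units[OF _ g gen_self[of U "\<one>[R U]"], of u] g self_sheaf gen_closed[OF g] by simp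
qed

end

section \<open>Morphisms between sheaves of rank one, prescribed on generators\<close>

context ringed
begin

text \<open>The uniqueness half of the method: locally every section is a multiple of a generator,
  and the two morphisms agree there by linearity. Separatedness of \<open>N\<close> does the
  rest.\<close>

lemma morphism_eq_on_gens:
  assumes N: "msh N" and M: "mpre M"
    and \<phi>: "mmor M N \<phi>" and \<psi>: "mmor M N \<psi>"
    and cov: "\<And>p. p \<in> U ==> \<exists>V g. p \<in> V \<and> V \<subseteq> U \<and> gen M V g \<and> \<phi> V g = \<psi> V g"
    and U: "opn U" and s: "s \<in>: sec M U"
  shows "\<phi> U s = \<psi> U s"
proof (rule sheaf_eqI[OF ms_sheaf[OF N] U])
  fix p assume "p \<in> U"
  then obtain V g where V: "p \<in> V" "V \<subseteq> U" "gen M V g" "\<phi> V g = \<psi> V g" using cov by blast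
  obtain a where a: "a \<in>: R V" "res M U V s = a \<odot>[M,V] g"
    using gen_coeff[OF M V(3)] s U V M by (metis gen_open mres_closed)
  have "res N U V (\<phi> U s) = \<phi> V (res M U V s)"
    by (rule mm_res[OF \<phi>, symmetric]) (use U V s in auto)
  also have "\<dots> = a \<odot>[N,V] \<phi> V g" unfolding a(2) by (rule mm_smult[OF \<phi>]) (use V a in auto)
  also have "\<dots> = \<psi> V (res M U V s)" unfolding a(2) V(4) by (rule mm_smult[OF \<psi>, symmetric]) (use V a in auto)
  also have "\<dots> = res N U V (\<psi> U s)" by (rule mm_res[OF \<psi>]) (use U V s in auto)
  finally show "\<exists>W. opn W \<and> p \<in> W \<and> W \<subseteq> U \<and> res N U W (\<phi> U s) = res N U W (\<psi> U s)"
    using V by (metis gen_open)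
qed (use \<phi> \<psi> U s in auto)

text \<open>A frame \<open>Fr V g g'\<close> prescribes the value \<open>g'\<close> of a morphism on the generator \<open>g\<close> over \<open>V\<close>.\<close>

definition frames ::
  "('p, 'r, 'm) module_presheaf => ('p, 'r, 'n) module_presheaf => ('p set => 'm => 'n => bool) => bool" where
  "frames L N Fr \<longleftrightarrow>
    (\<forall>V g g'. Fr V g g' --> gen L V g \<and> g' \<in>: sec N V) \<and>
    (\<forall>V W g g'. Fr V g g' \<and> opn W \<and> W \<subseteq> V --> Fr W (res L V W g) (res N V W g')) \<and>
    (\<forall>p\<in>whole X. \<exists>V g g'. p \<in> V \<and> Fr V g g') \<and>
    (\<forall>V g g' h h' a. Fr V g g' \<and> Fr V h h' \<and> a \<in>: R V \<and> g = a \<odot>[L,V] h -->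
       g' = a \<odot>[N,V] h')"

lemma framesI:
  assumes "\<And>V g g'. Fr V g g' ==> gen L V g \<and> g' \<in>: sec N V"
    and "\<And>V W g g'. Fr V g g' ==> opn W ==> W \<subseteq> V ==> Fr W (res L V W g) (res N V W g')"
    and "\<And>p. p \<in> whole X ==> \<exists>V g g'. p \<in> V \<and> Fr V g g'"
    and "\<And>V g g' h h' a. Fr V g g' ==> Fr V h h' ==> a \<in>: R V ==> g = a \<odot>[L,V] h ==>
       g' = a \<odot>[N,V] h'"
  shows "frames L N Fr"
  unfolding frames_def
proof (intro conjI allI impI ballI; (elim conjE)?)
  fix V g g' assume "Fr V g g'"
  then show "gen L V g" "g' \<in>: sec N V" using assms(1) by simp_all
qed (rule assms(2-4); assumption)+

context
  fixes L :: "('p, 'r, 'm) module_presheaf" and N :: "('p, 'r, 'n) module_presheaf" and Fr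
  assumes L: "mpre L" and N: "msh N" and fr: "frames L N Fr"
begin

lemma Fr_gen: "Fr V g g' ==> gen L V g"
  using fr unfolding frames_def by (elim conjE) simp

lemma Fr_closed: "Fr V g g' ==> g' \<in>: sec N V"
  using fr unfolding frames_def by (elim conjE) simp

lemma Fr_res: "Fr V g g' ==> opn W ==> W \<subseteq> V ==> Fr W (res L V W g) (res N V W g')"
  using fr unfolding frames_def by (elim conjE) simp

lemma Fr_compat: "Fr V g g' ==> Fr V h h' ==> a \<in>: R V ==> g = a \<odot>[L,V] h ==> g' = a \<odot>[N,V] h'"
  using fr unfolding frames_def by (elim conjE) simp

lemma Fr_open: "Fr V g g' ==> opn V"
  by (rule gen_open[OF Fr_gen])

text \<open>Since frames restrict, one frame around each point of the whole space yields frames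
  inside every open neighbourhood.\<close>

lemma Fr_cover: "opn U ==> p \<in> U ==> \<exists>V g g'. p \<in> V \<and> V \<subseteq> U \<and> Fr V g g'"
proof -
  assume U: "opn U" "p \<in> U"
  then have "p \<in> whole X" using openin_subset by blast
  then obtain V g g' where V: "p \<in> V" "Fr V g g'" using fr unfolding frames_def by (elim conjE) (drule bspec, assumption, elim exE conjE, rule that)
  have "opn V" using V Fr_open by blast
  then have "Fr (V \<inter> U) (res L V (V \<inter> U) g) (res N V (V \<inter> U) g')" using V U by (intro Fr_res) auto
  then show ?thesis using U V by blast
qed

text \<open>The value over \<open>W\<close> that a frame assigns to \<open>s\<close>. It is a
  relation because several frames may live over \<open>W\<close>; this is the form in which
  \<open>sheaf_glue\<close> takes its input.\<close>

definition line_local where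
  "line_local U s W t \<longleftrightarrow> (\<exists>g g' a. Fr W g g' \<and> W \<subseteq> U \<and> a \<in>: R W \<and>
     res L U W s = a \<odot>[L,W] g \<and> t = a \<odot>[N,W] g')"

lemma line_local_res:
  assumes "line_local U s W t" "opn U" "s \<in>: sec L U" "opn W'" "W' \<subseteq> W"
  shows "line_local U s W' (res N W W' t)"
proof -
  from assms(1) obtain g g' a where g: "Fr W g g'" "W \<subseteq> U" "a \<in>: R W"
    "res L U W s = a \<odot>[L,W] g" "t = a \<odot>[N,W] g'" unfolding line_local_def by blast
  note W = Fr_open[OF g(1)] and gg = gen_closed[OF Fr_gen[OF g(1)]] and g' = Fr_closed[OF g(1)]
  have "res L U W' s = res L W W' (res L U W s)" by (rule mres_trans[OF L assms(2) W assms(4,5) g(2) assms(3), symmetric])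
  also have "\<dots> = rr W W' a \<odot>[L,W'] res L W W' g" unfolding g(4)
    by (rule mres_smult[OF L W assms(4,5) g(3) gg])
  finally have 1: "res L U W' s = rr W W' a \<odot>[L,W'] res L W W' g" .
  have 2: "res N W W' t = rr W W' a \<odot>[N,W'] res N W W' g'" unfolding g(5)
    by (rule mres_smult[OF ms_mp[OF N] W assms(4,5) g(3) g'])
  have "W' \<subseteq> U" "rr W W' a \<in>: R W'" using g(2,3) assms(4,5) W by auto
  then show ?thesis unfolding line_local_def using 1 2 Fr_res[OF g(1) assms(4,5)] by (intro exI conjI)
qed

text \<open>If g = c h, then a g = (a c) h = b h gives a c = b, and the frames provide g' = c h'
  with the same c, so a g' = b h'. Only frames over the same set are compared; those over different
  sets are first restricted to the intersection.\<close>

lemma line_local_unique: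
  assumes "line_local U s W t" "line_local U s W t'"
  shows "t = t'"
proof -
  from assms obtain g g' a h h' b where g: "Fr W g g'" "a \<in>: R W"
    "res L U W s = a \<odot>[L,W] g" "t = a \<odot>[N,W] g'" and h: "Fr W h h'" "b \<in>: R W"
    "res L U W s = b \<odot>[L,W] h" "t' = b \<odot>[N,W] h'" unfolding line_local_def by metis
  note W = Fr_open[OF g(1)] and gg = gen_closed[OF Fr_gen[OF g(1)]] and hg = Fr_gen[OF h(1)]
  interpret cring "R W" using W by (rule R_cring)
  obtain c where c: "c \<in>: R W" "g = c \<odot>[L,W] h" using gen_coeff[OF L hg gg] by blast
  have g': "g' = c \<odot>[N,W] h'" by (rule Fr_compat[OF g(1) h(1) c])
  have "(a \<otimes>[R W] c) \<odot>[L,W] h = a \<odot>[L,W] g"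
    unfolding c(2) using msmult_assoc[OF L W g(2) c(1)] hg by simp
  also have "\<dots> = b \<odot>[L,W] h" using g(3) h(3) by simp
  finally have "a \<otimes>[R W] c = b" using gen_cancel[OF L hg] g(2) c(1) h(2) by simp
  moreover have "(a \<otimes>[R W] c) \<odot>[N,W] h' = a \<odot>[N,W] g'"
    unfolding g' by (rule msmult_assoc[OF ms_mp[OF N] W g(2) c(1) Fr_closed[OF h(1)]])
  ultimately show ?thesis using g(4) h(4) by simp
qed

lemma line_local_cover:
  assumes "opn U" "s \<in>: sec L U" "p \<in> U"
  shows "\<exists>W t. p \<in> W \<and> line_local U s W t"
proof -
  obtain W g g' where W: "p \<in> W" "W \<subseteq> U" "Fr W g g'" using Fr_cover[OF assms(1,3)] by blast
  have "res L U W s \<in>: sec L W" by (rule mres_closed[OF L assms(1) Fr_open[OF W(3)] W(2) assms(2)])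
  then obtain a where "a \<in>: R W" "res L U W s = a \<odot>[L,W] g"
    using gen_coeff[OF L Fr_gen[OF W(3)]] by blast
  then have "line_local U s W (a \<odot>[N,W] g')" using W unfolding line_local_def by blast
  then show ?thesis using W by blast
qed

lemma line_local_closed:
  assumes "line_local U s W t" shows "opn W" "W \<subseteq> U" "t \<in>: sec N W"
  using assms Fr_open Fr_closed N unfolding line_local_def by (auto intro!: msmult_closed)

definition line_map where
  "line_map U s = (THE t. t \<in>: sec N U \<and> (\<forall>W t'. line_local U s W t' --> res N U W t = t'))"

text \<open>Two local values agree on an overlap because both restrict to local values there, and
  these are unique over a given set. The sets carrying local values cover \<open>U\<close>, which
  gives uniqueness of the glued section.\<close>

lemma line_map_ex1:
  assumes U: "opn U" and s: "s \<in>: sec L U"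
  shows "\<exists>!t. t \<in>: sec N U \<and> (\<forall>W t'. line_local U s W t' --> res N U W t = t')"
proof -
  have "\<exists>t\<in>carrier (sec N U). \<forall>W t'. line_local U s W t' --> res N U W t = t'"
  proof (rule sheaf_glue[OF ms_sheaf[OF N] U])
    show "\<And>W s'. line_local U s W s' ==> opn W \<and> W \<subseteq> U \<and> s' \<in>: sec N W"
      using line_local_closed by blast
    show "\<And>p. p \<in> U ==> \<exists>W s'. p \<in> W \<and> line_local U s W s'" using line_local_cover U s by blast
    fix W1 t1 W2 t2 assume l: "line_local U s W1 t1" "line_local U s W2 t2"
    have o: "opn (W1 \<inter> W2)" by (rule openin_Int[OF line_local_closed(1)[OF l(1)] line_local_closed(1)[OF l(2)]])
    show "res N W1 (W1 \<inter> W2) t1 = res N W2 (W1 \<inter> W2) t2"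
      by (rule line_local_unique) (rule line_local_res[OF _ U s o], use l in auto)+
  qed
  then obtain t where t: "t \<in>: sec N U" "\<And>W t'. line_local U s W t' ==> res N U W t = t'" by blast
  show ?thesis
  proof (rule ex1I[of _ t])
    fix t2 assume t2: "t2 \<in>: sec N U \<and> (\<forall>W t'. line_local U s W t' --> res N U W t2 = t')"
    show "t2 = t"
    proof (rule sheaf_eqI[OF ms_sheaf[OF N] U])
      fix p assume "p \<in> U"
      then obtain W t' where W: "p \<in> W" "line_local U s W t'" using line_local_cover U s by blast
      then show "\<exists>W. opn W \<and> p \<in> W \<and> W \<subseteq> U \<and> res N U W t2 = res N U W t"
        using t t2 line_local_closed[OF W(2)] by (intro exI[of _ W]) auto
    qed (use t t2 in auto)
  qed (use t in auto)
qed

lemma line_map_closed: "opn U ==> s \<in>: sec L U ==> line_map U s \<in>: sec N U"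
  using theI'[OF line_map_ex1] unfolding line_map_def by blast

lemma line_map_local: "opn U ==> s \<in>: sec L U ==> line_local U s W t ==> res N U W (line_map U s) = t"
  using theI'[OF line_map_ex1] unfolding line_map_def by blast

lemma line_map_frame:
  assumes "opn U" "s \<in>: sec L U" "Fr W g g'" "W \<subseteq> U" "a \<in>: R W" "res L U W s = a \<odot>[L,W] g"
  shows "res N U W (line_map U s) = a \<odot>[N,W] g'"
  using assms by (intro line_map_local) (auto simp: line_local_def)

lemma line_map_gen: "Fr V g g' ==> line_map V g = g'"
proof -
  assume f: "Fr V g g'"
  note V = Fr_open[OF f] and g = gen_closed[OF Fr_gen[OF f]] and g' = Fr_closed[OF f]
  have one: "\<one>[R V] \<in>: R V" using R_cring[OF V] by (simp add: cring_def ring.is_monoid monoid.one_closed)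
  have "res N V V (line_map V g) = \<one>[R V] \<odot>[N,V] g'"
    by (rule line_map_frame[OF V g f]) (use one V g L in auto)
  then show ?thesis using line_map_closed[OF V g] N V g' by simp
qed

text \<open>In a frame around a point the map sends a g to a g', so each identity becomes one
  between coordinates with respect to the same frame.\<close>

lemma line_map_morphism: "mmor L N line_map"
proof -
  have Np: "mpre N" using N by simp
  have add: "line_map U (m \<oplus>[L,U] n) = line_map U m \<oplus>[N,U] line_map U n"
    if U: "opn U" and m: "m \<in>: sec L U" and n: "n \<in>: sec L U" for U m n
  proof (rule sheaf_eqI[OF ms_sheaf[OF N] U])
    fix p assume p: "p \<in> U"
    obtain W g g' where W: "p \<in> W" "W \<subseteq> U" "Fr W g g'" using Fr_cover[OF U p] by auto
    note Wo = Fr_open[OF W(3)] and gg = Fr_gen[OF W(3)] and g' = Fr_closed[OF W(3)]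
    interpret cring "R W" using Wo by (rule R_cring)
    obtain a b where a: "a \<in>: R W" "res L U W m = a \<odot>[L,W] g"
      and b: "b \<in>: R W" "res L U W n = b \<odot>[L,W] g"
      using gen_coeff[OF L gg] mres_closed[OF L U Wo W(2)] m n by metis
    have "res L U W (m \<oplus>[L,U] n) = (a \<oplus>[R W] b) \<odot>[L,W] g"
      using mres_add[OF L U Wo W(2) m n] a b msmult_l_distr[OF L Wo a(1) b(1)] gg by simp
    then have "res N U W (line_map U (m \<oplus>[L,U] n)) = (a \<oplus>[R W] b) \<odot>[N,W] g'"
      by (intro line_map_frame[OF U _ W(3,2)]) (use L U m n a b in auto)
    also have "\<dots> = res N U W (line_map U m) \<oplus>[N,W] res N U W (line_map U n)"
      using line_map_frame[OF U m W(3,2) a] line_map_frame[OF U n W(3,2) b]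
        msmult_l_distr[OF Np Wo a(1) b(1) g'] by simp
    also have "\<dots> = res N U W (line_map U m \<oplus>[N,U] line_map U n)"
      by (rule mres_add[OF Np U Wo W(2), symmetric]) (use line_map_closed U m n in auto)
    finally show "\<exists>W. opn W \<and> p \<in> W \<and> W \<subseteq> U \<and> res N U W (line_map U (m \<oplus>[L,U] n)) =
        res N U W (line_map U m \<oplus>[N,U] line_map U n)" using W Wo by blast
  qed (use line_map_closed U m n L Np in auto)
  have smult: "line_map U (c \<odot>[L,U] m) = c \<odot>[N,U] line_map U m"
    if U: "opn U" and m: "m \<in>: sec L U" and c: "c \<in>: R U" for U m c
  proof (rule sheaf_eqI[OF ms_sheaf[OF N] U])
    fix p assume p: "p \<in> U"
    obtain W g g' where W: "p \<in> W" "W \<subseteq> U" "Fr W g g'" using Fr_cover[OF U p] by auto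
    note Wo = Fr_open[OF W(3)] and gg = Fr_gen[OF W(3)] and g' = Fr_closed[OF W(3)]
    interpret cring "R W" using Wo by (rule R_cring)
    obtain a where a: "a \<in>: R W" "res L U W m = a \<odot>[L,W] g"
      using gen_coeff[OF L gg] mres_closed[OF L U Wo W(2)] m by metis
    have cW: "rr U W c \<in>: R W" using U Wo W c by simp
    have "res L U W (c \<odot>[L,U] m) = (rr U W c \<otimes>[R W] a) \<odot>[L,W] g"
      using mres_smult[OF L U Wo W(2) c m] a msmult_assoc[OF L Wo cW a(1)] gg by simp
    then have "res N U W (line_map U (c \<odot>[L,U] m)) = (rr U W c \<otimes>[R W] a) \<odot>[N,W] g'"
      by (intro line_map_frame[OF U _ W(3,2)]) (use L U m a c cW in auto)
    also have "\<dots> = rr U W c \<odot>[N,W] res N U W (line_map U m)"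
      using line_map_frame[OF U m W(3,2) a] msmult_assoc[OF Np Wo cW a(1) g'] by simp
    also have "\<dots> = res N U W (c \<odot>[N,U] line_map U m)"
      by (rule mres_smult[OF Np U Wo W(2), symmetric]) (use line_map_closed U m c in auto)
    finally show "\<exists>W. opn W \<and> p \<in> W \<and> W \<subseteq> U \<and> res N U W (line_map U (c \<odot>[L,U] m)) =
        res N U W (c \<odot>[N,U] line_map U m)" using W Wo by blast
  qed (use line_map_closed U m c L Np in auto)
  have nat: "line_map V (res L U V m) = res N U V (line_map U m)"
    if U: "opn U" and V: "opn V" "V \<subseteq> U" and m: "m \<in>: sec L U" for U V m
  proof (rule sheaf_eqI[OF ms_sheaf[OF N] V(1)])
    have mV: "res L U V m \<in>: sec L V" using L U V m by simp
    fix p assume p: "p \<in> V"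
    obtain W g g' where W: "p \<in> W" "W \<subseteq> V" "Fr W g g'" using Fr_cover[OF V(1) p] by auto
    note Wo = Fr_open[OF W(3)] and gg = Fr_gen[OF W(3)]
    have WU: "W \<subseteq> U" using W V by blast
    obtain a where a: "a \<in>: R W" "res L U W m = a \<odot>[L,W] g"
      using gen_coeff[OF L gg] mres_closed[OF L U Wo WU] m by metis
    have a2: "res L V W (res L U V m) = a \<odot>[L,W] g" using a(2) L U V W Wo m by simp
    have "res N V W (res N U V (line_map U m)) = res N U W (line_map U m)"
      using Np U V W Wo line_map_closed[OF U m] by simp
    then have "res N V W (line_map V (res L U V m)) = res N V W (res N U V (line_map U m))"
      using line_map_frame[OF U m W(3) WU a] line_map_frame[OF V(1) mV W(3,2) a(1) a2] by simp
    then show "\<exists>W. opn W \<and> p \<in> W \<and> W \<subseteq> V \<and> res N V W (line_map V (res L U V m)) =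
        res N V W (res N U V (line_map U m))" using W Wo by blast
  qed (use line_map_closed U V m L Np in auto)
  show ?thesis unfolding module_morphism_def is_linear_def
    using line_map_closed add smult nat by simp
qed

end

lemma line_morphism:
  assumes "mpre L" "msh N" "frames L N Fr"
  shows "\<exists>\<phi>. mmor L N \<phi> \<and> (\<forall>V g g'. Fr V g g' --> \<phi> V g = g')"
  using line_map_morphism[OF assms] line_map_gen[OF assms] by blast

text \<open>The frames read backwards define a morphism in the opposite direction, and both
  composites fix the generators. As \<open>\<phi>\<close> is any morphism with the prescribed
  values, the result also applies to maps selected by \<open>SOME\<close>.\<close>

lemma line_isomorphism:
  assumes L: "msh L" and N: "msh N" and fr: "frames L N Fr"
    and gen': "\<And>V g g'. Fr V g g' ==> gen N V g'"
    and \<phi>: "mmor L N \<phi>" "\<And>V g g'. Fr V g g' ==> \<phi> V g = g'"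
  shows "miso L N \<phi>"
proof -
  have Lp: "mpre L" and Np: "mpre N" using L N by simp_all
  define Fr' where "Fr' = (\<lambda>V g' g. Fr V g g')"
  have "frames N L Fr'"
  proof (rule framesI)
    fix V g' g h' h a assume *: "Fr' V g' g" "Fr' V h' h" "a \<in>: R V" "g' = a \<odot>[N,V] h'"
    note f = *(1,2)[unfolded Fr'_def]
    have gg: "gen L V g" "gen L V h" "gen N V h'" using f Fr_gen[OF Lp N fr] gen' by auto
    \<comment> \<open>Compatibility of the reversed frames: the factor c between g and h reappears
      between g' and h', and cancelling the generator h' identifies it with a.\<close>
    obtain c where c: "c \<in>: R V" "g = c \<odot>[L,V] h" using gen_coeff[OF Lp gg(2) gen_closed[OF gg(1)]] by auto
    have "g' = c \<odot>[N,V] h'" by (rule Fr_compat[OF Lp N fr f c])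
    then have "c = a" using gen_cancel[OF Np gg(3)] * c by simp
    then show "g = a \<odot>[L,V] h" using c by simp
  next
    fix V g g' assume "Fr' V g g'"
    then show "gen N V g \<and> g' \<in>: sec L V" unfolding Fr'_def using Fr_gen[OF Lp N fr] gen' by auto
  next
    fix V W g g' assume "Fr' V g g'" "opn W" "W \<subseteq> V"
    then show "Fr' W (res N V W g) (res L V W g')" unfolding Fr'_def using Fr_res[OF Lp N fr] by auto
  next
    fix p assume "p \<in> whole X"
    then show "\<exists>V g g'. p \<in> V \<and> Fr' V g g'" using Fr_cover[OF Lp N fr, of "whole X" p] unfolding Fr'_def by auto
  qed
  then obtain \<psi> where \<psi>: "mmor N L \<psi>" "\<And>V g g'. Fr V g g' ==> \<psi> V g' = g"
    using line_morphism[OF Np L] unfolding Fr'_def by blast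
  have 1: "\<psi> U (\<phi> U s) = s" if U: "opn U" "s \<in>: sec L U" for U s
  proof (rule morphism_eq_on_gens[OF L Lp mm_comp[OF \<phi>(1) \<psi>(1)] mi_mm[OF mi_id[OF Lp]] _ U])
    fix p assume "p \<in> U"
    then show "\<exists>V g. p \<in> V \<and> V \<subseteq> U \<and> gen L V g \<and> \<psi> V (\<phi> V g) = g"
      using Fr_cover[OF Lp N fr U(1)] Fr_gen[OF Lp N fr] \<phi>(2) \<psi>(2) by metis
  qed
  have 2: "\<phi> U (\<psi> U s) = s" if U: "opn U" "s \<in>: sec N U" for U s
  proof (rule morphism_eq_on_gens[OF N Np mm_comp[OF \<psi>(1) \<phi>(1)] mi_mm[OF mi_id[OF Np]] _ U])
    fix p assume "p \<in> U"
    then show "\<exists>V g. p \<in> V \<and> V \<subseteq> U \<and> gen N V g \<and> \<phi> V (\<psi> V g) = g"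
      using Fr_cover[OF Lp N fr U(1)] gen' \<phi>(2) \<psi>(2) by metis
  qed
  have "bij_betw (\<phi> U) (carrier (sec L U)) (carrier (sec N U))" if "opn U" for U
    by (rule bij_betw_byWitness[where f' = "\<psi> U"])
      (use that 1 2 mm_closed[OF \<phi>(1)] mm_closed[OF \<psi>(1)] in auto)
  then show ?thesis using \<phi>(1) by (simp add: module_isomorphism_def)
qed

lemma ex_line_isomorphism:
  assumes L: "msh L" and N: "msh N" and fr: "frames L N Fr"
    and gen': "\<And>V g g'. Fr V g g' ==> gen N V g'"
  shows "\<exists>\<phi>. miso L N \<phi> \<and> (\<forall>V g g'. Fr V g g' --> \<phi> V g = g')"
proof -
  obtain \<phi> where \<phi>: "mmor L N \<phi>" "\<And>V g g'. Fr V g g' ==> \<phi> V g = g'"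
    using line_morphism[OF ms_mp[OF L] N fr] by auto
  have "miso L N \<phi>" by (rule line_isomorphism[OF L N fr gen' \<phi>])
  then show ?thesis using \<phi>(2) by auto
qed

end

section \<open>Sheafification\<close>

lemma mk_module_simps [simp]:
  "carrier (mk_module C z p s) = C" "zero (mk_module C z p s) = z"
  "add (mk_module C z p s) = p" "smult (mk_module C z p s) = s"
  by (simp_all add: mk_module_def)

declare openin_Int [simp]

text \<open>Operations on classes are unions over representatives. These rules evaluate such a union
  once there is a representative and all representatives give the same set.\<close>

lemma UN_const: "c \<in> A ==> (\<And>x. x \<in> A ==> F x = k) ==> (\<Union>x\<in>A. F x) = k"
  by blast

lemma UN_pair_const:
  "c \<in> A ==> (\<And>a b. (a, b) \<in> A ==> F a b = k) ==> (\<Union>(a, b)\<in>A. F a b) = k"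
  by (erule UN_const) auto

lemma UN_pair_pair_const:
  "c \<in> A ==> d \<in> B ==> (\<And>a b a' b'. (a, b) \<in> A ==> (a', b') \<in> B ==> F a b a' b' = k) ==>
    (\<Union>(a, b)\<in>A. \<Union>(a', b')\<in>B. F a b a' b') = k"
  by (intro UN_pair_const[of c A] UN_pair_const[of d B])

context ringed
begin

context
  fixes M :: "('p, 'r, 'm) module_presheaf"
  assumes M: "mpre M"
begin

lemma germ_self: "opn U ==> p \<in> U ==> s \<in>: sec M U ==> (U, s) \<in> germ X M p U s"
  unfolding germ_def by auto

lemma mem_germI:
  "opn V ==> p \<in> V ==> t \<in>: sec M V ==> opn W ==> p \<in> W ==> W \<subseteq> U ==> W \<subseteq> V ==>
    res M U W s = res M V W t ==> (V, t) \<in> germ X M p U s"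
  unfolding germ_def by auto

lemma mem_germE:
  assumes "(V, t) \<in> germ X M p U s"
  obtains W where "opn V" "p \<in> V" "t \<in>: sec M V" "opn W" "p \<in> W" "W \<subseteq> U" "W \<subseteq> V"
    "res M U W s = res M V W t"
  using assms unfolding germ_def by auto

lemma germ_subset:
  assumes UV: "opn U" "opn V" "p \<in> U" "p \<in> V" and s: "s \<in>: sec M U" and t: "t \<in>: sec M V"
    and W: "opn W" "p \<in> W" "W \<subseteq> U" "W \<subseteq> V" "res M U W s = res M V W t"
  shows "germ X M p U s \<subseteq> germ X M p V t"
proof (rule subrelI)
  fix V' t' assume "(V', t') \<in> germ X M p U s"
  then obtain W' where W': "opn V'" "p \<in> V'" "t' \<in>: sec M V'" "opn W'" "p \<in> W'" "W' \<subseteq> U" "W' \<subseteq> V'"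
    "res M U W' s = res M V' W' t'" by (rule mem_germE)
  have o: "opn (W \<inter> W')" using W W' by simp
  have "res M V (W \<inter> W') t = res M W (W \<inter> W') (res M V W t)" using mres_trans[OF M UV(2) W(1) o _ W(4) t] by simp
  also have "\<dots> = res M U (W \<inter> W') s" unfolding W(5)[symmetric] using mres_trans[OF M UV(1) W(1) o _ W(3) s] by simp
  also have "\<dots> = res M W' (W \<inter> W') (res M U W' s)" using mres_trans[OF M UV(1) W'(4) o _ W'(6) s] by simp
  also have "\<dots> = res M V' (W \<inter> W') t'" unfolding W'(8) using mres_trans[OF M W'(1) W'(4) o _ W'(7) W'(3)] by simp
  finally show "(V', t') \<in> germ X M p V t"
    by (intro mem_germI[where W = "W \<inter> W'"]) (use W W' o in auto)
qed

lemma germ_eqI: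
  assumes "opn U" "opn V" "s \<in>: sec M U" "t \<in>: sec M V"
    and "opn W" "p \<in> W" "W \<subseteq> U" "W \<subseteq> V" "res M U W s = res M V W t"
  shows "germ X M p U s = germ X M p V t"
  using germ_subset[of U V p s t W] germ_subset[of V U p t s W] assms by auto

lemma germ_res: "opn U ==> opn V ==> V \<subseteq> U ==> p \<in> V ==> s \<in>: sec M U ==>
    germ X M p V (res M U V s) = germ X M p U s"
  by (rule germ_eqI[of V U _ _ V]) (use M in auto)

lemma germ_eqD:
  assumes "germ X M p U s = germ X M p V t" "opn V" "p \<in> V" "t \<in>: sec M V"
  shows "\<exists>W. opn W \<and> p \<in> W \<and> W \<subseteq> U \<and> W \<subseteq> V \<and> res M U W s = res M V W t"
proof -
  have "(V, t) \<in> germ X M p U s" unfolding assms(1) by (rule germ_self[OF assms(2-4)])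
  then show ?thesis by (rule mem_germE) auto
qed

abbreviation "S U \<equiv> sec (sheafify X M) U"

lemma S_carrier: "f \<in>: S U \<longleftrightarrow> f \<in> extensional U \<and> (\<forall>p\<in>U. \<exists>V s. opn V \<and> p \<in> V \<and> V \<subseteq> U \<and>
    s \<in>: sec M V \<and> (\<forall>q\<in>V. f q = germ X M q V s))"
  unfolding sheafify_def by simp

lemma S_local:
  assumes "f \<in>: S U" "p \<in> U"
  obtains V s where "opn V" "p \<in> V" "V \<subseteq> U" "s \<in>: sec M V" "\<forall>q\<in>V. f q = germ X M q V s"
  using assms unfolding S_carrier by metis

text \<open>Around each point two sections of the sheafification are represented by sections of
  \<open>M\<close> over one common neighbourhood. With \<open>S_local3\<close> for three sections,
  this carries the module axioms over from \<open>M\<close>.\<close>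

lemma S_local2:
  assumes "f \<in>: S U" "g \<in>: S U" "p \<in> U"
  obtains V s t where "opn V" "p \<in> V" "V \<subseteq> U" "s \<in>: sec M V" "t \<in>: sec M V"
    "\<forall>q\<in>V. f q = germ X M q V s" "\<forall>q\<in>V. g q = germ X M q V t"
proof -
  obtain V1 s where V1: "opn V1" "p \<in> V1" "V1 \<subseteq> U" "s \<in>: sec M V1" "\<forall>q\<in>V1. f q = germ X M q V1 s"
    using S_local[OF assms(1,3)] by auto
  obtain V2 t where V2: "opn V2" "p \<in> V2" "V2 \<subseteq> U" "t \<in>: sec M V2" "\<forall>q\<in>V2. g q = germ X M q V2 t"
    using S_local[OF assms(2,3)] by auto
  have o: "opn (V1 \<inter> V2)" using V1 V2 by simp
  show thesis
  proof (rule that[of "V1 \<inter> V2" "res M V1 (V1 \<inter> V2) s" "res M V2 (V1 \<inter> V2) t"])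
    show "\<forall>q\<in>V1 \<inter> V2. f q = germ X M q (V1 \<inter> V2) (res M V1 (V1 \<inter> V2) s)" using V1 o germ_res[of V1 "V1 \<inter> V2" _ s] by simp
    show "\<forall>q\<in>V1 \<inter> V2. g q = germ X M q (V1 \<inter> V2) (res M V2 (V1 \<inter> V2) t)" using V2 o germ_res[of V2 "V1 \<inter> V2" _ t] by simp
  qed (use V1 V2 o M in auto)
qed

lemma S_local3:
  assumes "f \<in>: S U" "g \<in>: S U" "h \<in>: S U" "p \<in> U"
  obtains V s t u where "opn V" "p \<in> V" "V \<subseteq> U" "s \<in>: sec M V" "t \<in>: sec M V" "u \<in>: sec M V"
    "\<forall>q\<in>V. f q = germ X M q V s" "\<forall>q\<in>V. g q = germ X M q V t" "\<forall>q\<in>V. h q = germ X M q V u"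
proof -
  obtain V1 s t where V1: "opn V1" "p \<in> V1" "V1 \<subseteq> U" "s \<in>: sec M V1" "t \<in>: sec M V1"
     "\<forall>q\<in>V1. f q = germ X M q V1 s" "\<forall>q\<in>V1. g q = germ X M q V1 t"
    by (rule S_local2[OF assms(1,2,4)])
  obtain V2 u where V2: "opn V2" "p \<in> V2" "V2 \<subseteq> U" "u \<in>: sec M V2" "\<forall>q\<in>V2. h q = germ X M q V2 u"
    using S_local[OF assms(3,4)] by auto
  have o: "opn (V1 \<inter> V2)" using V1 V2 by simp
  show thesis
  proof (rule that[of "V1 \<inter> V2" "res M V1 (V1 \<inter> V2) s" "res M V1 (V1 \<inter> V2) t" "res M V2 (V1 \<inter> V2) u"])
    show "\<forall>q\<in>V1 \<inter> V2. f q = germ X M q (V1 \<inter> V2) (res M V1 (V1 \<inter> V2) s)" using V1 o germ_res[of V1 "V1 \<inter> V2" _ s] by simp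
    show "\<forall>q\<in>V1 \<inter> V2. g q = germ X M q (V1 \<inter> V2) (res M V1 (V1 \<inter> V2) t)" using V1 o germ_res[of V1 "V1 \<inter> V2" _ t] by simp
    show "\<forall>q\<in>V1 \<inter> V2. h q = germ X M q (V1 \<inter> V2) (res M V2 (V1 \<inter> V2) u)" using V2 o germ_res[of V2 "V1 \<inter> V2" _ u] by simp
  qed (use V1 V2 o M in auto)
qed

text \<open>The sum is a union over all pairs of representatives of the two germs. Any such pair
  agrees with \<open>s\<close> and \<open>t\<close> on a small neighbourhood, so every member of the
  union is the same germ.\<close>

lemma S_add:
  assumes q: "q \<in> U" "q \<in> V" and V: "opn V" and st: "s \<in>: sec M V" "t \<in>: sec M V"
    and f: "f q = germ X M q V s" and g: "g q = germ X M q V t"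
  shows "(f \<oplus>[S U] g) q = germ X M q V (s \<oplus>[M,V] t)"
proof -
  have "(\<Union>(V', s')\<in>germ X M q V s. \<Union>(W', t')\<in>germ X M q V t.
         germ X M q (V' \<inter> W') (res M V' (V' \<inter> W') s' \<oplus>[sec M (V' \<inter> W')] res M W' (V' \<inter> W') t')) =
       germ X M q V (s \<oplus>[M,V] t)"
  proof (rule UN_pair_pair_const[OF germ_self[OF V q(2) st(1)] germ_self[OF V q(2) st(2)]])
    fix V' s' W' t' assume "(V', s') \<in> germ X M q V s" "(W', t') \<in> germ X M q V t"
    then obtain A B where A: "opn V'" "q \<in> V'" "s' \<in>: sec M V'" "opn A" "q \<in> A" "A \<subseteq> V" "A \<subseteq> V'"
        "res M V A s = res M V' A s'"
      and B: "opn W'" "q \<in> W'" "t' \<in>: sec M W'" "opn B" "q \<in> B" "B \<subseteq> V" "B \<subseteq> W'"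
        "res M V B t = res M W' B t'" by (elim mem_germE)
    let ?I = "V' \<inter> W'" and ?J = "A \<inter> B"
    have o: "opn ?I" "opn ?J" using A B by auto
    have i: "?J \<subseteq> ?I" "?I \<subseteq> V'" "?I \<subseteq> W'" "?J \<subseteq> V" "?J \<subseteq> A" "?J \<subseteq> B" using A B by auto
    have c: "res M V' ?I s' \<in>: sec M ?I" "res M W' ?I t' \<in>: sec M ?I" using A B o M i by auto
    have 1: "res M V ?J s = res M ?I ?J (res M V' ?I s')"
      using mres_trans[OF M V A(4) o(2) i(5) A(6) st(1)] mres_trans[OF M A(1) A(4) o(2) i(5) A(7) A(3)]
        mres_trans[OF M A(1) o i(1,2) A(3)] A(8) by simp
    have 2: "res M V ?J t = res M ?I ?J (res M W' ?I t')"
      using mres_trans[OF M V B(4) o(2) i(6) B(6) st(2)] mres_trans[OF M B(1) B(4) o(2) i(6) B(7) B(3)]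
        mres_trans[OF M B(1) o i(1,3) B(3)] B(8) by simp
    show "germ X M q ?I (res M V' ?I s' \<oplus>[sec M ?I] res M W' ?I t') = germ X M q V (s \<oplus>[M,V] t)"
      by (rule germ_eqI[OF o(1) V madd_closed[OF M o(1) c] madd_closed[OF M V st] o(2) _ i(1,4)])
        (use A B 1 2 mres_add[OF M V o(2) i(4) st] mres_add[OF M o i(1) c] in auto)
  qed
  then show ?thesis using f g q unfolding sheafify_def by simp
qed

lemma S_smult:
  assumes q: "q \<in> V" and V: "opn V" "V \<subseteq> U" "opn U" and s: "s \<in>: sec M V" and a: "a \<in>: R U"
    and f: "f q = germ X M q V s"
  shows "(a \<odot>[S U] f) q = germ X M q V (rr U V a \<odot>[M,V] s)"
proof -
  have "(\<Union>(V', s')\<in>germ X M q V s.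
         germ X M q (U \<inter> V') (rr U (U \<inter> V') a \<odot>[sec M (U \<inter> V')] res M V' (U \<inter> V') s')) =
       germ X M q V (rr U V a \<odot>[M,V] s)"
  proof (rule UN_pair_const[OF germ_self[OF V(1) q s]])
    fix V' s' assume "(V', s') \<in> germ X M q V s"
    then obtain A where A: "opn V'" "q \<in> V'" "s' \<in>: sec M V'" "opn A" "q \<in> A" "A \<subseteq> V" "A \<subseteq> V'"
        "res M V A s = res M V' A s'" by (elim mem_germE)
    let ?I = "U \<inter> V'"
    have o: "opn ?I" using A V by auto
    have i: "A \<subseteq> ?I" "?I \<subseteq> V'" "?I \<subseteq> U" "A \<subseteq> U" using A V by auto
    have c: "res M V' ?I s' \<in>: sec M ?I" using A o M i by auto
    have aI: "rr U ?I a \<in>: R ?I" and aV: "rr U V a \<in>: R V" using a o V by auto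
    have 1: "res M V A s = res M ?I A (res M V' ?I s')"
      using mres_trans[OF M A(1) o A(4) i(1,2) A(3)] A(8) by simp
    have 2: "rr ?I A (rr U ?I a) = rr V A (rr U V a)"
      using rr_trans[OF V(3) o A(4) i(1,3) a] rr_trans[OF V(3,1) A(4) A(6) V(2) a] by simp
    show "germ X M q ?I (rr U ?I a \<odot>[sec M ?I] res M V' ?I s') = germ X M q V (rr U V a \<odot>[M,V] s)"
      by (rule germ_eqI[OF o V(1) msmult_closed[OF M o aI c] msmult_closed[OF M V(1) aV s] A(4,5) i(1) A(6)])
        (use 1 2 mres_smult[OF M o A(4) i(1) aI c] mres_smult[OF M V(1) A(4) A(6) aV s] in simp)
  qed
  then show ?thesis using f q V unfolding sheafify_def by auto
qed

lemma S_zero: "q \<in> V ==> opn V ==> V \<subseteq> U ==> opn U ==> \<zero>[S U] q = germ X M q V \<zero>[sec M V]"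
  using germ_res[of U V q "\<zero>[sec M U]"] M unfolding sheafify_def by auto

lemma S_ext: "f \<in> extensional U ==> g \<in> extensional U ==> (\<And>p. p \<in> U ==> f p = g p) ==> f = g"
  by (rule extensionalityI)

lemma S_add_ext: "f \<oplus>[S U] g \<in> extensional U" unfolding sheafify_def by simp
lemma S_smult_ext: "a \<odot>[S U] g \<in> extensional U" unfolding sheafify_def by simp
lemma S_zero_ext: "\<zero>[S U] \<in> extensional U" unfolding sheafify_def by simp
lemma S_carrier_ext: "f \<in>: S U ==> f \<in> extensional U" unfolding S_carrier by simp

lemma S_add_closed: 
  assumes "f \<in>: S U" "g \<in>: S U" shows "f \<oplus>[S U] g \<in>: S U"
  unfolding S_carrier
proof (intro conjI ballI S_add_ext)
  fix p assume "p \<in> U"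
  then obtain V s t where V: "opn V" "p \<in> V" "V \<subseteq> U" "s \<in>: sec M V" "t \<in>: sec M V"
     "\<forall>q\<in>V. f q = germ X M q V s" "\<forall>q\<in>V. g q = germ X M q V t"
    using S_local2[OF assms] by metis
  have "\<forall>q\<in>V. (f \<oplus>[S U] g) q = germ X M q V (s \<oplus>[M,V] t)"
    using S_add[of _ U V s t f g] V by auto
  then show "\<exists>V s. opn V \<and> p \<in> V \<and> V \<subseteq> U \<and> s \<in>: sec M V \<and> (\<forall>q\<in>V. (f \<oplus>[S U] g) q = germ X M q V s)"
    using V M by (intro exI[of _ V] exI[of _ "s \<oplus>[M,V] t"]) simp
qed

lemma S_smult_closed:
  assumes "opn U" "a \<in>: R U" "f \<in>: S U" shows "a \<odot>[S U] f \<in>: S U"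
  unfolding S_carrier
proof (intro conjI ballI S_smult_ext)
  fix p assume "p \<in> U"
  then obtain V s where V: "opn V" "p \<in> V" "V \<subseteq> U" "s \<in>: sec M V"
     "\<forall>q\<in>V. f q = germ X M q V s"
    using S_local[OF assms(3)] by metis
  have "\<forall>q\<in>V. (a \<odot>[S U] f) q = germ X M q V (rr U V a \<odot>[M,V] s)"
    using S_smult[of _ V U s a f] V assms by auto
  then show "\<exists>V s. opn V \<and> p \<in> V \<and> V \<subseteq> U \<and> s \<in>: sec M V \<and> (\<forall>q\<in>V. (a \<odot>[S U] f) q = germ X M q V s)"
    using V M assms by (intro exI[of _ V] exI[of _ "rr U V a \<odot>[M,V] s"]) simp
qed

lemma to_sh_closed:
  assumes "opn U" "s \<in>: sec M U" shows "to_sheafification X M U s \<in>: S U"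
  unfolding S_carrier to_sheafification_def using assms by (auto intro!: exI[of _ U])

lemma S_zero_eq: "\<zero>[S U] = to_sheafification X M U \<zero>[sec M U]"
  unfolding to_sheafification_def sheafify_def by simp

text \<open>Each axiom is an equality of functions on \<open>U\<close>; at a point it is the
  corresponding axiom for sections of \<open>M\<close> over a neighbourhood that represents all
  sections involved.\<close>

lemma S_module:
  assumes U: "opn U" shows "Module.module (R U) (S U)"
proof -
  interpret RU: cring "R U" using U by (rule R_cring)
  \<comment> \<open>The negative is taken as the multiple by -1, so that it lies in the carrier by
    \<open>S_smult_closed\<close>.\<close>
  have minus: "\<exists>g\<in>carrier (S U). g \<oplus>[S U] f = \<zero>[S U]" if f: "f \<in>: S U" for f
  proof (intro bexI[of _ "(\<ominus>[R U] \<one>[R U]) \<odot>[S U] f"] S_ext)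
    fix p assume "p \<in> U"
    then obtain V s where V: "opn V" "p \<in> V" "V \<subseteq> U" "s \<in>: sec M V"
     "\<forall>q\<in>V. f q = germ X M q V s" using S_local[OF f] by metis
    interpret mv: Module.module "R V" "sec M V" using mp_module[OF M V(1)] .
    let ?m = "rr U V (\<ominus>[R U] \<one>[R U])"
    have m: "?m = \<ominus>[R V] \<one>[R V]" using U V rr_uminus[OF U V(1,3), of "\<one>[R U]"] by simp
    have 1: "((\<ominus>[R U] \<one>[R U]) \<odot>[S U] f) p = germ X M p V (?m \<odot>[M,V] s)"
      by (rule S_smult) (use V U in auto)
    have "((\<ominus>[R U] \<one>[R U]) \<odot>[S U] f \<oplus>[S U] f) p = germ X M p V (?m \<odot>[M,V] s \<oplus>[M,V] s)"
      by (rule S_add[where f = "(\<ominus>[R U] \<one>[R U]) \<odot>[S U] f" and g = f, OF \<open>p \<in> U\<close> V(2,1) _ V(4) 1]) (use V m in auto)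
    also have "?m \<odot>[M,V] s \<oplus>[M,V] s = \<zero>[sec M V]"
      unfolding m using V by (simp add: mv.smult_l_minus mv.l_neg)
    finally show "((\<ominus>[R U] \<one>[R U]) \<odot>[S U] f \<oplus>[S U] f) p = \<zero>[S U] p" using S_zero[OF V(2,1,3) U] by simp
  qed (use S_add_ext S_zero_ext S_smult_closed U f in auto)
  show ?thesis
  proof (rule moduleI, rule RU.is_cring, rule abelian_groupI)
    show "\<zero>[S U] \<in>: S U" using S_zero_eq to_sh_closed[OF U] M U by simp
    fix f assume f: "f \<in>: S U"
    show "\<zero>[S U] \<oplus>[S U] f = f"
    proof (rule S_ext[OF S_add_ext S_carrier_ext[OF f]])
      fix p assume p: "p \<in> U"
      then obtain V s where V: "opn V" "p \<in> V" "V \<subseteq> U" "s \<in>: sec M V"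
       "\<forall>q\<in>V. f q = germ X M q V s" using S_local[OF f] by metis
      interpret mv: Module.module "R V" "sec M V" using mp_module[OF M V(1)] .
      show "(\<zero>[S U] \<oplus>[S U] f) p = f p"
        using S_add[where f = "\<zero>[S U]" and g = f, OF p V(2,1) _ V(4) S_zero[OF V(2,1,3) U] V(5)[rule_format, OF V(2)]] V by simp
    qed
    show "\<one>[R U] \<odot>[S U] f = f"
    proof (rule S_ext[OF S_smult_ext S_carrier_ext[OF f]])
      fix p assume p: "p \<in> U"
      then obtain V s where V: "opn V" "p \<in> V" "V \<subseteq> U" "s \<in>: sec M V"
       "\<forall>q\<in>V. f q = germ X M q V s" using S_local[OF f] by metis
      show "(\<one>[R U] \<odot>[S U] f) p = f p"
        using S_smult[where f = f, OF V(2,1,3) U V(4) RU.one_closed V(5)[rule_format, OF V(2)]] V U M by simp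
    qed
    fix g assume g: "g \<in>: S U"
    show "f \<oplus>[S U] g = g \<oplus>[S U] f"
    proof (rule S_ext[OF S_add_ext S_add_ext])
      fix p assume p: "p \<in> U"
      obtain V s t where V: "opn V" "p \<in> V" "V \<subseteq> U" "s \<in>: sec M V" "t \<in>: sec M V"
       "\<forall>q\<in>V. f q = germ X M q V s" "\<forall>q\<in>V. g q = germ X M q V t"
       by (rule S_local2[OF f g p])
      interpret mv: Module.module "R V" "sec M V" using mp_module[OF M V(1)] .
      show "(f \<oplus>[S U] g) p = (g \<oplus>[S U] f) p"
        using S_add[where f = f and g = g, OF p V(2,1,4,5) V(6)[rule_format, OF V(2)] V(7)[rule_format, OF V(2)]] S_add[where f = g and g = f, OF p V(2,1,5,4) V(7)[rule_format, OF V(2)] V(6)[rule_format, OF V(2)]]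
          mv.a_comm V by simp
    qed
    { fix a assume a: "a \<in>: R U"
      show "a \<odot>[S U] (f \<oplus>[S U] g) = a \<odot>[S U] f \<oplus>[S U] a \<odot>[S U] g"
      proof (rule S_ext[OF S_smult_ext S_add_ext])
        fix p assume p: "p \<in> U"
        obtain V s t where V: "opn V" "p \<in> V" "V \<subseteq> U" "s \<in>: sec M V" "t \<in>: sec M V"
         "\<forall>q\<in>V. f q = germ X M q V s" "\<forall>q\<in>V. g q = germ X M q V t"
         by (rule S_local2[OF f g p])
        interpret mv: Module.module "R V" "sec M V" using mp_module[OF M V(1)] .
        have aV: "rr U V a \<in>: R V" using a U V by simp
        note 1 = S_smult[where f = f, OF V(2,1,3) U V(4) a V(6)[rule_format, OF V(2)]] and 2 = S_smult[where f = g, OF V(2,1,3) U V(5) a V(7)[rule_format, OF V(2)]]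
        show "(a \<odot>[S U] (f \<oplus>[S U] g)) p = (a \<odot>[S U] f \<oplus>[S U] a \<odot>[S U] g) p"
          using S_smult[where f = "f \<oplus>[S U] g", OF V(2,1,3) U _ a S_add[where f = f and g = g, OF p V(2,1,4,5) V(6)[rule_format, OF V(2)] V(7)[rule_format, OF V(2)]]]
            S_add[where f = "a \<odot>[S U] f" and g = "a \<odot>[S U] g", OF p V(2,1) _ _ 1 2] V aV mv.smult_r_distr by simp
      qed }
    { fix a b assume a: "a \<in>: R U" and b: "b \<in>: R U"
      show "(a \<oplus>[R U] b) \<odot>[S U] f = a \<odot>[S U] f \<oplus>[S U] b \<odot>[S U] f"
      proof (rule S_ext[OF S_smult_ext S_add_ext])
        fix p assume p: "p \<in> U"
        then obtain V s where V: "opn V" "p \<in> V" "V \<subseteq> U" "s \<in>: sec M V"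
         "\<forall>q\<in>V. f q = germ X M q V s" using S_local[OF f] by metis
        interpret mv: Module.module "R V" "sec M V" using mp_module[OF M V(1)] .
        have aV: "rr U V a \<in>: R V" "rr U V b \<in>: R V" using a b U V by simp_all
        note 1 = S_smult[where f = f, OF V(2,1,3) U V(4) a V(5)[rule_format, OF V(2)]] and 2 = S_smult[where f = f, OF V(2,1,3) U V(4) b V(5)[rule_format, OF V(2)]]
        show "((a \<oplus>[R U] b) \<odot>[S U] f) p = (a \<odot>[S U] f \<oplus>[S U] b \<odot>[S U] f) p"
          using S_smult[where f = f, OF V(2,1,3) U V(4) RU.a_closed[OF a b] V(5)[rule_format, OF V(2)]]
            S_add[where f = "a \<odot>[S U] f" and g = "b \<odot>[S U] f", OF p V(2,1) _ _ 1 2] V aV mv.smult_l_distr rr_add[OF U V(1,3) a b] by simp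
      qed
      show "(a \<otimes>[R U] b) \<odot>[S U] f = a \<odot>[S U] (b \<odot>[S U] f)"
      proof (rule S_ext[OF S_smult_ext S_smult_ext])
        fix p assume p: "p \<in> U"
        then obtain V s where V: "opn V" "p \<in> V" "V \<subseteq> U" "s \<in>: sec M V"
         "\<forall>q\<in>V. f q = germ X M q V s" using S_local[OF f] by metis
        interpret mv: Module.module "R V" "sec M V" using mp_module[OF M V(1)] .
        have aV: "rr U V a \<in>: R V" "rr U V b \<in>: R V" using a b U V by simp_all
        note 2 = S_smult[where f = f, OF V(2,1,3) U V(4) b V(5)[rule_format, OF V(2)]]
        show "((a \<otimes>[R U] b) \<odot>[S U] f) p = (a \<odot>[S U] (b \<odot>[S U] f)) p"
          using S_smult[where f = f, OF V(2,1,3) U V(4) RU.m_closed[OF a b] V(5)[rule_format, OF V(2)]]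
            S_smult[where f = "b \<odot>[S U] f", OF V(2,1,3) U _ a 2] V aV mv.smult_assoc1 rr_mult[OF U V(1,3) a b] by simp
      qed }
    fix h assume h: "h \<in>: S U"
    show "(f \<oplus>[S U] g) \<oplus>[S U] h = f \<oplus>[S U] (g \<oplus>[S U] h)"
    proof (rule S_ext[OF S_add_ext S_add_ext])
      fix p assume p: "p \<in> U"
      obtain V s t u where V: "opn V" "p \<in> V" "V \<subseteq> U" "s \<in>: sec M V" "t \<in>: sec M V" "u \<in>: sec M V"
       "\<forall>q\<in>V. f q = germ X M q V s" "\<forall>q\<in>V. g q = germ X M q V t" "\<forall>q\<in>V. h q = germ X M q V u"
       by (rule S_local3[OF f g h p])
      interpret mv: Module.module "R V" "sec M V" using mp_module[OF M V(1)] .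
      note 1 = S_add[where f = f and g = g, OF p V(2,1,4,5) V(7)[rule_format, OF V(2)] V(8)[rule_format, OF V(2)]] and 2 = S_add[where f = g and g = h, OF p V(2,1,5,6) V(8)[rule_format, OF V(2)] V(9)[rule_format, OF V(2)]]
      show "((f \<oplus>[S U] g) \<oplus>[S U] h) p = (f \<oplus>[S U] (g \<oplus>[S U] h)) p"
        using S_add[where f = "f \<oplus>[S U] g" and g = h, OF p V(2,1) _ V(6) 1 V(9)[rule_format, OF V(2)]] S_add[where f = f and g = "g \<oplus>[S U] h", OF p V(2,1,4) _ V(7)[rule_format, OF V(2)] 2] V mv.a_assoc by simp
    qed
  qed (use S_add_closed S_smult_closed U minus in auto)
qed

lemma S_res_closed:
  assumes "opn V" "V \<subseteq> U" "f \<in>: S U" shows "restrict f V \<in>: S V"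
  unfolding S_carrier
proof (intro conjI ballI)
  fix p assume p: "p \<in> V"
  then obtain W s where W: "opn W" "p \<in> W" "W \<subseteq> U" "s \<in>: sec M W"
     "\<forall>q\<in>W. f q = germ X M q W s" using S_local[OF assms(3)] assms(2) by (metis subsetD)
  have o: "opn (W \<inter> V)" using W assms by simp
  have "\<forall>q\<in>W \<inter> V. restrict f V q = germ X M q (W \<inter> V) (res M W (W \<inter> V) s)"
    using germ_res[of W "W \<inter> V" _ s] W o by simp
  then show "\<exists>Va s. opn Va \<and> p \<in> Va \<and> Va \<subseteq> V \<and> s \<in>: sec M Va \<and> (\<forall>q\<in>Va. restrict f V q = germ X M q Va s)"
    using o W M p by (intro exI[of _ "W \<inter> V"] exI[of _ "res M W (W \<inter> V) s"]) auto
qed auto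

lemma S_res: "res (sheafify X M) U V f = restrict f V"
  by (simp add: sheafify_def)

lemma S_presheaf: "is_presheaf (underlying X) (sheafify X M)"
  unfolding is_presheaf_def
proof (intro conjI allI impI ballI)
  fix U V assume "opn U \<and> opn V \<and> V \<subseteq> U"
  then show "res (sheafify X M) U V \<in> carrier (S U) \<rightarrow> carrier (S V)" using S_res_closed by (auto simp: S_res)
next
  fix U s assume "s \<in>: S U"
  then show "res (sheafify X M) U U s = s" using S_carrier_ext extensional_restrict unfolding S_res by metis
next
  fix U V W s assume "opn U \<and> opn V \<and> opn W \<and> W \<subseteq> V \<and> V \<subseteq> U"
  then show "res (sheafify X M) V W (res (sheafify X M) U V s) = res (sheafify X M) U W s"
    unfolding S_res by (simp add: Int_absorb1)
qed

lemma S_sheaf: "is_sheaf (underlying X) (sheafify X M)"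
  unfolding is_sheaf_def
proof (intro conjI allI impI S_presheaf; elim conjE)
  fix C s assume s: "\<forall>V\<in>C. opn V \<and> s V \<in>: S V"
    and c: "\<forall>V\<in>C. \<forall>W\<in>C. res (sheafify X M) V (V \<inter> W) (s V) = res (sheafify X M) W (V \<inter> W) (s W)"
  \<comment> \<open>\<open>k p\<close> is some member of the cover that contains \<open>p\<close>;
    agreement on intersections makes the value at \<open>p\<close> independent of this choice, which
    is the claim \<open>t\<close> below.\<close>
  define k where "k = (\<lambda>p. SOME V. V \<in> C \<and> p \<in> V)"
  have k: "k p \<in> C \<and> p \<in> k p" if "p \<in> \<Union>C" for p
    unfolding k_def by (rule someI_ex) (use that in auto)
  define t where "t = (\<lambda>p\<in>\<Union>C. s (k p) p)"
  have t: "t p = s V p" if "V \<in> C" "p \<in> V" for V p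
  proof -
    have kp: "k p \<in> C" "p \<in> k p" using k[of p] that by auto
    have "restrict (s (k p)) (k p \<inter> V) = restrict (s V) (k p \<inter> V)"
      using c[rule_format, OF kp(1) that(1)] unfolding S_res .
    from fun_cong[OF this, of p] have "s (k p) p = s V p" using kp that by simp
    then show ?thesis unfolding t_def using that by auto
  qed
  have tc: "t \<in>: S (\<Union>C)" unfolding S_carrier
  proof (intro conjI ballI)
    show "t \<in> extensional (\<Union>C)" unfolding t_def by simp
    fix p assume "p \<in> \<Union>C"
    then obtain V where V: "V \<in> C" "p \<in> V" by blast
    then obtain W u where W: "opn W" "p \<in> W" "W \<subseteq> V" "u \<in>: sec M W"
      "\<forall>q\<in>W. s V q = germ X M q W u" using S_local[of "s V" V p] s by metis
    then show "\<exists>V s. opn V \<and> p \<in> V \<and> V \<subseteq> \<Union>C \<and> s \<in>: sec M V \<and> (\<forall>q\<in>V. t q = germ X M q V s)"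
      using V t by (intro exI[of _ W] exI[of _ u]) auto
  qed
  show "\<exists>!t. t \<in>: S (\<Union>C) \<and> (\<forall>V\<in>C. res (sheafify X M) (\<Union>C) V t = s V)"
  proof (rule ex1I[of _ t])
    have "restrict t V = s V" if "V \<in> C" for V
      by (rule S_ext[of _ V]) (use that t s S_carrier_ext in auto)
    then show "t \<in>: S (\<Union>C) \<and> (\<forall>V\<in>C. res (sheafify X M) (\<Union>C) V t = s V)"
      using tc by (simp add: S_res)
    fix t' assume t': "t' \<in>: S (\<Union>C) \<and> (\<forall>V\<in>C. res (sheafify X M) (\<Union>C) V t' = s V)"
    show "t' = t"
    proof (rule S_ext[of _ "\<Union>C"])
      fix p assume "p \<in> \<Union>C"
      then obtain V where V: "V \<in> C" "p \<in> V" by blast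
      then have "restrict t' V = s V" using t' by (simp add: S_res)
      from fun_cong[OF this, of p] show "t' p = t p" using V t by simp
    qed (use t' tc S_carrier_ext in auto)
  qed
qed

lemma sheafify_sheaf: "msh (sheafify X M)"
  unfolding is_module_sheaf_def is_module_presheaf_def
proof (intro conjI allI impI ballI S_sheaf S_presheaf; (elim conjE)?)
  fix U assume "opn U" then show "Module.module (R U) (S U)" by (rule S_module)
next
  fix U V f g assume UV: "opn U" "opn V" "V \<subseteq> U" and f: "f \<in>: S U" and g: "g \<in>: S U"
  show "res (sheafify X M) U V (f \<oplus>[S U] g) = res (sheafify X M) U V f \<oplus>[S V] res (sheafify X M) U V g"
    unfolding S_res
  proof (rule S_ext[OF restrict_extensional S_add_ext])
    fix p assume p: "p \<in> V"
    then have pU: "p \<in> U" using UV by blast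
    obtain W s t where W: "opn W" "p \<in> W" "W \<subseteq> U" "s \<in>: sec M W" "t \<in>: sec M W"
       "\<forall>q\<in>W. f q = germ X M q W s" "\<forall>q\<in>W. g q = germ X M q W t"
       using S_local2[OF f g pU] .
    show "restrict (f \<oplus>[S U] g) V p = (restrict f V \<oplus>[S V] restrict g V) p"
      using S_add[OF pU W(2,1,4,5), of f g] S_add[OF p W(2,1,4,5), of "restrict f V" "restrict g V"] W p by simp
  qed
next
  fix U V a f assume UV: "opn U" "opn V" "V \<subseteq> U" and a: "a \<in>: R U" and f: "f \<in>: S U"
  show "res (sheafify X M) U V (a \<odot>[S U] f) = rr U V a \<odot>[S V] res (sheafify X M) U V f"
    unfolding S_res
  proof (rule S_ext[OF restrict_extensional S_smult_ext])
    fix p assume p: "p \<in> V"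
    then have pU: "p \<in> U" using UV by blast
    obtain W s where W: "opn W" "p \<in> W" "W \<subseteq> U" "s \<in>: sec M W"
       "\<forall>q\<in>W. f q = germ X M q W s" using S_local[OF f pU] by metis
    let ?I = "W \<inter> V" and ?s = "res M W (W \<inter> V) s"
    have o: "opn ?I" "?I \<subseteq> V" "?I \<subseteq> U" "p \<in> ?I" using W UV p by auto
    have sI: "?s \<in>: sec M ?I" using M W o by simp
    have fp: "f p = germ X M p ?I ?s" using germ_res[of W ?I p s] W o by simp
    have aV: "rr U V a \<in>: R V" using a UV by simp
    show "restrict (a \<odot>[S U] f) V p = (rr U V a \<odot>[S V] restrict f V) p"
      using S_smult[OF o(4,1,3) UV(1) sI a, of f] S_smult[OF o(4,1,2) UV(2) sI aV, of "restrict f V"]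
        fp p o UV a by simp
  qed
qed

lemma to_sh_morphism: "mmor M (sheafify X M) (to_sheafification X M)"
  unfolding module_morphism_def is_linear_def
proof (intro conjI allI impI ballI; (elim conjE)?)
  fix U assume U: "opn U"
  show "to_sheafification X M U \<in> carrier (sec M U) \<rightarrow> carrier (S U)" using to_sh_closed[OF U] by auto
  fix m assume m: "m \<in>: sec M U"
  have tm: "to_sheafification X M U k p = germ X M p U k" if "p \<in> U" for p k
    using that by (simp add: to_sheafification_def)
  { fix n assume n: "n \<in>: sec M U"
    show "to_sheafification X M U (m \<oplus>[M,U] n) = to_sheafification X M U m \<oplus>[S U] to_sheafification X M U n"
    proof (rule S_ext[OF _ S_add_ext])
      fix p assume p: "p \<in> U"
      show "to_sheafification X M U (m \<oplus>[M,U] n) p = (to_sheafification X M U m \<oplus>[S U] to_sheafification X M U n) p"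
        using S_add[where f = "to_sheafification X M U m" and g = "to_sheafification X M U n", OF p p U m n tm[OF p] tm[OF p]] p by (simp add: tm)
    qed (simp add: to_sheafification_def) }
  { fix a assume a: "a \<in>: R U"
    show "to_sheafification X M U (a \<odot>[M,U] m) = a \<odot>[S U] to_sheafification X M U m"
    proof (rule S_ext[OF _ S_smult_ext])
      fix p assume p: "p \<in> U"
      show "to_sheafification X M U (a \<odot>[M,U] m) p = (a \<odot>[S U] to_sheafification X M U m) p"
        using S_smult[where f = "to_sheafification X M U m", OF p U subset_refl U m a tm[OF p]] p U a by (simp add: tm)
    qed (simp add: to_sheafification_def) }
next
  fix U V m assume UV: "opn U" "opn V" "V \<subseteq> U" and m: "m \<in>: sec M U"
  show "to_sheafification X M V (res M U V m) = res (sheafify X M) U V (to_sheafification X M U m)"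
    unfolding S_res to_sheafification_def
    by (rule S_ext[OF restrict_extensional restrict_extensional]) (use germ_res[OF UV _ m] UV in auto)
qed

text \<open>The comparison map is locally surjective and, by \<open>to_sh_loc_inj\<close>, locally
  injective. These two facts are all that the passage of generators to the sheafification
  uses.\<close>

lemma to_sh_loc_surj:
  assumes "f \<in>: S U" "p \<in> U"
  shows "\<exists>V s. opn V \<and> p \<in> V \<and> V \<subseteq> U \<and> s \<in>: sec M V \<and> res (sheafify X M) U V f = to_sheafification X M V s"
proof -
  obtain V s where V: "opn V" "p \<in> V" "V \<subseteq> U" "s \<in>: sec M V" "\<forall>q\<in>V. f q = germ X M q V s"
    by (rule S_local[OF assms])
  have "restrict f V = to_sheafification X M V s" unfolding to_sheafification_def
    by (rule S_ext[OF restrict_extensional restrict_extensional]) (use V in auto)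
  then show ?thesis using V unfolding S_res by auto
qed

lemma to_sh_loc_inj:
  assumes "to_sheafification X M U s = to_sheafification X M U t" "opn U" "p \<in> U" "t \<in>: sec M U"
  shows "\<exists>W. opn W \<and> p \<in> W \<and> W \<subseteq> U \<and> res M U W s = res M U W t"
proof -
  have "germ X M p U s = germ X M p U t" using fun_cong[OF assms(1), of p] assms(3) by (simp add: to_sheafification_def)
  from germ_eqD[OF this assms(2-4)] show ?thesis by auto
qed

text \<open>A section of the sheafification comes from \<open>M\<close> only locally, so its
  coefficient is first found locally. Local coefficients are unique (\<open>inj\<close>), hence
  agree on overlaps and glue in the structure sheaf.\<close>

lemma gen_sheafify:
  assumes g: "gen M U g"
  shows "gen (sheafify X M) U (to_sheafification X M U g)"
proof (rule genI)
  let ?t = "to_sheafification X M"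
  note mm = to_sh_morphism
  have Sp: "mpre (sheafify X M)" using sheafify_sheaf by simp
  show "mpre (sheafify X M)" by (rule Sp)
  note U = gen_open[OF g] and gc = gen_closed[OF g]
  show "opn U" "?t U g \<in>: S U" using U mm_closed[OF mm U gc] by auto
  have res_t: "res (sheafify X M) U W (?t U g) = ?t W (res M U W g)" if "opn W" "W \<subseteq> U" for W
    using mm_res[OF mm U that gc] by simp
  { fix W a b assume W: "opn W" "W \<subseteq> U" and a: "a \<in>: R W" and b: "b \<in>: R W"
      and e: "a \<odot>[S W] res (sheafify X M) U W (?t U g) = b \<odot>[S W] res (sheafify X M) U W (?t U g)"
    have gW: "gen M W (res M U W g)" by (rule gen_res[OF M g W])
    have e2: "?t W (a \<odot>[M,W] res M U W g) = ?t W (b \<odot>[M,W] res M U W g)"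
      using e unfolding res_t[OF W] using mm_smult[OF mm W(1)] a b gen_closed[OF gW] by simp
    show "a = b"
    proof (rule sheaf_eqI[OF R_sheaf W(1) a b])
      fix p assume p: "p \<in> W"
      obtain V where V: "opn V" "p \<in> V" "V \<subseteq> W"
        and r: "res M W V (a \<odot>[M,W] res M U W g) = res M W V (b \<odot>[M,W] res M U W g)"
        using to_sh_loc_inj[OF e2 W(1) p msmult_closed[OF M W(1) b gen_closed[OF gW]]] by auto
      have gV: "gen M V (res M W V (res M U W g))" by (rule gen_res[OF M gW V(1,3)])
      have "rr W V a = rr W V b"
        using r gen_cancel[OF M gV] rr_closed[OF W(1) V(1,3)] a b
          mres_smult[OF M W(1) V(1,3) _ gen_closed[OF gW]] by simp
      then show "\<exists>V. opn V \<and> p \<in> V \<and> V \<subseteq> W \<and> rr W V a = rr W V b" using V by auto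
    qed } note inj = this
  fix W m assume W: "opn W" "W \<subseteq> U" and m: "m \<in>: S W"
  \<comment> \<open>The relation says that \<open>a\<close> is a coefficient of \<open>m\<close>
    over \<open>V\<close>; it is the local data handed to \<open>sheaf_glue\<close>.\<close>
  define P where "P = (\<lambda>V a. opn V \<and> V \<subseteq> W \<and> a \<in>: R V \<and>
     res (sheafify X M) W V m = a \<odot>[S V] res (sheafify X M) U V (?t U g))"
  have tc: "?t U g \<in>: S U" using mm_closed[OF mm U gc] .
  have Pres: "res (sheafify X M) W V' m = rr V V' a \<odot>[S V'] res (sheafify X M) U V' (?t U g)"
    if P: "P V a" and V': "opn V'" "V' \<subseteq> V" for V V' a
  proof -
    note P' = P[unfolded P_def]
    have V: "opn V" "V \<subseteq> W" "V \<subseteq> U" and a: "a \<in>: R V" using P' W by auto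
    have "res (sheafify X M) W V' m = res (sheafify X M) V V' (res (sheafify X M) W V m)"
      using mres_trans[OF Sp W(1) V(1) V' V(2) m] by simp
    also have "\<dots> = rr V V' a \<odot>[S V'] res (sheafify X M) V V' (res (sheafify X M) U V (?t U g))"
      using P' mres_smult[OF Sp V(1) V' a mres_closed[OF Sp U V(1,3) tc]] by simp
    also have "res (sheafify X M) V V' (res (sheafify X M) U V (?t U g)) = res (sheafify X M) U V' (?t U g)"
      by (rule mres_trans[OF Sp U V(1) V' V(3) tc])
    finally show ?thesis .
  qed
  have "\<exists>a\<in>carrier (R W). \<forall>V b. P V b --> rr W V a = b"
  proof (rule sheaf_glue[OF R_sheaf W(1)])
    show "\<And>V a. P V a ==> opn V \<and> V \<subseteq> W \<and> a \<in>: R V" unfolding P_def by simp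
    fix p assume p: "p \<in> W"
    obtain V s where V: "opn V" "p \<in> V" "V \<subseteq> W" "s \<in>: sec M V" "res (sheafify X M) W V m = ?t V s"
      using to_sh_loc_surj[OF m p] by (elim exE conjE) (rule that)
    have VU: "V \<subseteq> U" using V W by auto
    have gV: "gen M V (res M U V g)" by (rule gen_res[OF M g V(1) VU])
    obtain a where a: "a \<in>: R V" "s = a \<odot>[M,V] res M U V g" using gen_coeff[OF M gV V(4)] by auto
    have "P V a" unfolding P_def using V a res_t[OF V(1) VU] mm_smult[OF mm V(1) a(1) gen_closed[OF gV]] by simp
    then show "\<exists>V a. p \<in> V \<and> P V a" using V by auto
  next
    fix V1 a1 V2 a2 assume P: "P V1 a1" "P V2 a2"
    have o: "opn (V1 \<inter> V2)" "V1 \<inter> V2 \<subseteq> U" using P W unfolding P_def by auto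
    have c: "rr V1 (V1 \<inter> V2) a1 \<in>: R (V1 \<inter> V2)" "rr V2 (V1 \<inter> V2) a2 \<in>: R (V1 \<inter> V2)"
      using P o unfolding P_def by auto
    show "rr V1 (V1 \<inter> V2) a1 = rr V2 (V1 \<inter> V2) a2"
      by (rule inj[OF o c]) (use Pres[OF P(1) o(1)] Pres[OF P(2) o(1)] in simp)
  qed
  then obtain a where a: "a \<in>: R W" "\<And>V b. P V b ==> rr W V a = b" by auto
  have "m = a \<odot>[S W] res (sheafify X M) U W (?t U g)"
  proof (rule sheaf_eqI[OF S_sheaf W(1) m])
    have gW: "res (sheafify X M) U W (?t U g) \<in>: S W" by (rule mres_closed[OF Sp U W tc])
    show "a \<odot>[S W] res (sheafify X M) U W (?t U g) \<in>: S W"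
      by (rule msmult_closed[OF Sp W(1) a(1) gW])
    fix p assume p: "p \<in> W"
    obtain V s where V: "opn V" "p \<in> V" "V \<subseteq> W" "s \<in>: sec M V" "res (sheafify X M) W V m = ?t V s"
      using to_sh_loc_surj[OF m p] by (elim exE conjE) (rule that)
    have VU: "V \<subseteq> U" using V W by auto
    have gV: "gen M V (res M U V g)" by (rule gen_res[OF M g V(1) VU])
    obtain b where b: "b \<in>: R V" "s = b \<odot>[M,V] res M U V g" using gen_coeff[OF M gV V(4)] by auto
    have "P V b" unfolding P_def using V b res_t[OF V(1) VU] mm_smult[OF mm V(1) b(1) gen_closed[OF gV]] by simp
    then have "rr W V a = b" "res (sheafify X M) W V m = b \<odot>[S V] res (sheafify X M) U V (?t U g)"
      using a(2) unfolding P_def by auto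
    then have "res (sheafify X M) W V m = res (sheafify X M) W V (a \<odot>[S W] res (sheafify X M) U W (?t U g))"
      using mres_smult[OF Sp W(1) V(1,3) a(1) gW] mres_trans[OF Sp U W(1) V(1,3) W(2) tc] by simp
    then show "\<exists>V. opn V \<and> p \<in> V \<and> V \<subseteq> W \<and> res (sheafify X M) W V m =
       res (sheafify X M) W V (a \<odot>[S W] res (sheafify X M) U W (?t U g))" using V by auto
  qed
  then show "\<exists>a\<in>carrier (R W). m = a \<odot>[S W] res (sheafify X M) U W (?t U g)" using a by auto
qed

end

end

section \<open>Tensor products and exterior squares\<close>

text \<open>One treatment of tensor products and exterior squares. Scalars act on the left factor of
  a formal sum, and \<open>E_scale\<close> makes the additive subgroup generated by the relations
  stable under them, so that the quotient is a module and not only an abelian group.\<close>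

locale bilin_data =
  M: Module.module R M + N: Module.module R N
  for R :: "'r ring" and M :: "('r, 'm) module" and N :: "('r, 'n) module" +
  fixes E :: "('m \<times> 'n \<Rightarrow>\<^sub>0 int) set"
  assumes E_keys: "e \<in> E ==> Poly_Mapping.keys e \<subseteq> carrier M \<times> carrier N"
    and E_scale: "r \<in>: R ==> e \<in> E ==> frag_extend (\<lambda>(m, n). frag_of (r \<odot>[M] m, n)) e \<in> E"
begin

abbreviation "G \<equiv> free_Abelian_group (carrier M \<times> carrier N)"
abbreviation "cst \<equiv> bilin_coset R M N E"
abbreviation "Q \<equiv> bilin_quot R M N E"

definition "K = generate G (bilin_rel R M N \<union> E)"

sublocale G: comm_group G by (rule abelian_free_Abelian_group)

lemma keys_diff_subset: "Poly_Mapping.keys a \<subseteq> S ==> Poly_Mapping.keys b \<subseteq> S ==> Poly_Mapping.keys (a - b) \<subseteq> S"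
  using keys_diff[of a b] by blast

lemma keys_add_subset: "Poly_Mapping.keys a \<subseteq> S ==> Poly_Mapping.keys b \<subseteq> S ==> Poly_Mapping.keys (a + b) \<subseteq> S"
  using keys_add[of a b] by blast

lemma rel_keys: "c \<in> bilin_rel R M N \<union> E ==> Poly_Mapping.keys c \<subseteq> carrier M \<times> carrier N"
proof -
  assume "c \<in> bilin_rel R M N \<union> E"
  then consider (1) m m' n where "c = frag_of (m \<oplus>[M] m', n) - frag_of (m, n) - frag_of (m', n)" "m \<in>: M" "m' \<in>: M" "n \<in>: N"
    | (2) m n n' where "c = frag_of (m, n \<oplus>[N] n') - frag_of (m, n) - frag_of (m, n')" "m \<in>: M" "n \<in>: N" "n' \<in>: N"
    | (3) r m n where "c = frag_of (r \<odot>[M] m, n) - frag_of (m, r \<odot>[N] n)" "r \<in>: R" "m \<in>: M" "n \<in>: N"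
    | (4) "c \<in> E" unfolding bilin_rel_def by blast
  then show ?thesis
  proof cases
    case 4 then show ?thesis by (rule E_keys)
  qed (simp_all add: keys_diff_subset)
qed

lemma K_subgroup: "subgroup K G"
  unfolding K_def by (rule G.generate_is_subgroup) (use rel_keys in \<open>simp add: subset_iff\<close>)

lemma K_keys: "c \<in> K ==> Poly_Mapping.keys c \<subseteq> carrier M \<times> carrier N"
  using subgroup.mem_carrier[OF K_subgroup] by simp

lemma K_zero [simp]: "0 \<in> K" using subgroup.one_closed[OF K_subgroup] by simp

lemma K_add: "c \<in> K ==> d \<in> K ==> c + d \<in> K" using subgroup.m_closed[OF K_subgroup] by simp

lemma K_uminus: "c \<in> K ==> - c \<in> K" using subgroup.m_inv_closed[OF K_subgroup] K_keys by fastforce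

lemma K_diff: "c \<in> K ==> d \<in> K ==> c - d \<in> K" using K_add[of c "- d"] K_uminus[of d] by simp

lemma K_rel: "c \<in> bilin_rel R M N ==> c \<in> K" unfolding K_def by (rule generate.incl) simp

lemma K_E: "c \<in> E ==> c \<in> K" unfolding K_def by (rule generate.incl) simp

text \<open>Induction over the relation subgroup: the elements with property \<open>P\<close> that
  are supported on the carriers form a subgroup containing all generating relations.\<close>

lemma K_least:
  assumes "\<And>c. c \<in> bilin_rel R M N \<union> E ==> P c" "P 0" "\<And>c d. P c ==> P d ==> P (c + d)" "\<And>c. P c ==> P (- c)"
  shows "c \<in> K ==> P c"
proof -
  assume c: "c \<in> K"
  let ?H = "{c. Poly_Mapping.keys c \<subseteq> carrier M \<times> carrier N \<and> P c}"
  have "subgroup ?H G"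
  proof (rule G.subgroupI)
    show "?H \<subseteq> carrier G" by (simp add: subset_iff)
    show "?H \<noteq> {}" using assms(2) by (auto intro!: exI[of _ 0])
  qed (simp_all add: assms(3,4) keys_add_subset)
  moreover have "bilin_rel R M N \<union> E \<subseteq> ?H" using rel_keys assms(1) by auto
  ultimately have "K \<subseteq> ?H" unfolding K_def by (rule G.generate_subgroup_incl[rotated])
  then show ?thesis using c by blast
qed

lemma coset_eq: "cst c = {k + c | k. k \<in> K}"
  unfolding bilin_coset_def Let_def K_def[symmetric] r_coset_def by auto

lemma mem_cos: "d \<in> cst c \<longleftrightarrow> d - c \<in> K"
  unfolding coset_eq by (auto intro!: exI[of _ "d - c"])

lemma cos_self: "c \<in> cst c" by (simp add: mem_cos)

lemma cos_eq_iff: "cst c = cst d \<longleftrightarrow> c - d \<in> K"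
proof
  assume "cst c = cst d" then show "c - d \<in> K" using cos_self[of c] mem_cos by blast
next
  assume k: "c - d \<in> K"
  have "e - c \<in> K \<longleftrightarrow> e - d \<in> K" for e
    using K_add[OF k, of "e - c"] K_diff[OF _ k, of "e - d"] by (auto simp: algebra_simps)
  then show "cst c = cst d" using mem_cos by blast
qed

lemma Q_carrier: "carrier Q = cst ` {c. Poly_Mapping.keys c \<subseteq> carrier M \<times> carrier N}"
proof -
  have "carrier Q = (\<lambda>c. K #>\<^bsub>G\<^esub> c) ` carrier G"
    by (simp add: bilin_quot_def Let_def K_def carrier_FactGroup)
  also have "(\<lambda>c. K #>\<^bsub>G\<^esub> c) = cst" by (simp add: fun_eq_iff bilin_coset_def Let_def K_def)
  finally show ?thesis by (simp add: free_Abelian_group_def)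
qed

lemma Q_add:
  assumes "Poly_Mapping.keys c \<subseteq> carrier M \<times> carrier N" "Poly_Mapping.keys d \<subseteq> carrier M \<times> carrier N"
  shows "cst c \<oplus>[Q] cst d = cst (c + d)"
proof -
  have "normal K G" using K_subgroup by (rule G.subgroup_imp_normal)
  then interpret normal K G .
  have "(K #>\<^bsub>G\<^esub> c) <#>\<^bsub>G\<^esub> (K #>\<^bsub>G\<^esub> d) = K #>\<^bsub>G\<^esub> (c \<otimes>[G] d)"
    by (rule rcos_sum) (use assms in auto)
  then show ?thesis unfolding bilin_quot_def bilin_coset_def Let_def K_def by simp
qed

lemma Q_zero: "\<zero>[Q] = cst 0"
proof -
  have "K = cst 0" unfolding coset_eq by auto
  then show ?thesis unfolding bilin_quot_def Let_def K_def by simp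
qed

abbreviation "sc r \<equiv> frag_extend (\<lambda>(m, n). frag_of (r \<odot>[M] m, n))"

lemma keys_extend:
  assumes "Poly_Mapping.keys c \<subseteq> S" "\<And>x. x \<in> S ==> Poly_Mapping.keys (f x) \<subseteq> T"
  shows "Poly_Mapping.keys (frag_extend f c) \<subseteq> T"
  using keys_frag_extend[of f c] assms by blast

lemma sc_keys: "r \<in>: R ==> Poly_Mapping.keys c \<subseteq> carrier M \<times> carrier N ==>
   Poly_Mapping.keys (sc r c) \<subseteq> carrier M \<times> carrier N"
  by (rule keys_extend) auto

lemma rel1: "m \<in>: M ==> m' \<in>: M ==> n \<in>: N ==>
  frag_of (m \<oplus>[M] m', n) - frag_of (m, n) - frag_of (m', n) \<in> bilin_rel R M N"
  unfolding bilin_rel_def by blast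
lemma rel2: "m \<in>: M ==> n \<in>: N ==> n' \<in>: N ==>
  frag_of (m, n \<oplus>[N] n') - frag_of (m, n) - frag_of (m, n') \<in> bilin_rel R M N"
  unfolding bilin_rel_def by blast
lemma rel3: "r \<in>: R ==> m \<in>: M ==> n \<in>: N ==>
  frag_of (r \<odot>[M] m, n) - frag_of (m, r \<odot>[N] n) \<in> bilin_rel R M N"
  unfolding bilin_rel_def by blast

lemma relE:
  assumes "c \<in> bilin_rel R M N"
  obtains (1) m m' n where "c = frag_of (m \<oplus>[M] m', n) - frag_of (m, n) - frag_of (m', n)" "m \<in>: M" "m' \<in>: M" "n \<in>: N"
    | (2) m n n' where "c = frag_of (m, n \<oplus>[N] n') - frag_of (m, n) - frag_of (m, n')" "m \<in>: M" "n \<in>: N" "n' \<in>: N"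
    | (3) r m n where "c = frag_of (r \<odot>[M] m, n) - frag_of (m, r \<odot>[N] n)" "r \<in>: R" "m \<in>: M" "n \<in>: N"
  using assms unfolding bilin_rel_def by blast

lemma sc_K:
  assumes r: "r \<in>: R" shows "c \<in> K ==> sc r c \<in> K"
proof (rule K_least[where P = "\<lambda>c. sc r c \<in> K"])
  fix c assume "c \<in> bilin_rel R M N \<union> E"
  then show "sc r c \<in> K"
  proof
    assume "c \<in> bilin_rel R M N"
    then show ?thesis
    proof (cases rule: relE)
      case (1 m m' n)
      have "sc r c = frag_of (r \<odot>[M] m \<oplus>[M] r \<odot>[M] m', n) - frag_of (r \<odot>[M] m, n) - frag_of (r \<odot>[M] m', n)"
        using 1 r by (simp add: frag_extend_diff M.smult_r_distr)
      then show ?thesis using rel1[of "r \<odot>[M] m" "r \<odot>[M] m'" n] 1 r by (simp add: K_rel)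
    next
      case (2 m n n')
      then show ?thesis using rel2[of "r \<odot>[M] m" n n'] r by (simp add: frag_extend_diff K_rel)
    next
      \<comment> \<open>Because r (s m) = s (r m), scaling the relation that moves \<open>s\<close>
        across the tensor sign gives the same relation for \<open>r m\<close>.\<close>
      case (3 s m n)
      have "sc r c = frag_of (s \<odot>[M] (r \<odot>[M] m), n) - frag_of (r \<odot>[M] m, s \<odot>[N] n)"
        using 3 r by (simp add: frag_extend_diff M.smult_assoc1[symmetric] M.m_comm)
      then show ?thesis using rel3[of s "r \<odot>[M] m" n] 3 r by (simp add: K_rel)
    qed
  qed (use E_scale r K_E in blast)
qed (auto simp: frag_extend_add frag_extend_minus K_add K_uminus)

lemma Q_smult: "r \<in>: R ==> Poly_Mapping.keys c \<subseteq> carrier M \<times> carrier N ==> r \<odot>[Q] cst c = cst (sc r c)"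
proof -
  assume r: "r \<in>: R" "Poly_Mapping.keys c \<subseteq> carrier M \<times> carrier N"
  have "(\<Union>d\<in>cst c. cst (sc r d)) = cst (sc r c)"
  proof (rule UN_const[OF cos_self])
    fix d assume "d \<in> cst c"
    then have "sc r (d - c) \<in> K" using sc_K r by (simp add: mem_cos)
    then show "cst (sc r d) = cst (sc r c)" by (simp add: cos_eq_iff frag_extend_diff)
  qed
  then show ?thesis unfolding bilin_quot_def Let_def by simp
qed

lemma Q_module: "Module.module R Q"
proof (rule moduleI, rule M.is_cring, rule abelian_groupI)
  fix x assume "x \<in>: Q"
  then obtain c where c: "x = cst c" "Poly_Mapping.keys c \<subseteq> carrier M \<times> carrier N" unfolding Q_carrier by auto
  show "\<zero>[Q] \<oplus>[Q] x = x" unfolding c Q_zero using Q_add[of 0 c] c by simp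
  show "\<exists>y\<in>carrier Q. y \<oplus>[Q] x = \<zero>[Q]"
    using Q_add[of "- c" c] c Q_zero by (intro bexI[of _ "cst (- c)"]) (auto simp: Q_carrier)
  have "sc \<one>[R] c = c" using c(2)
    by (induction rule: frag_induction) (auto simp: frag_extend_diff)
  then show "\<one>[R] \<odot>[Q] x = x" using Q_smult[of "\<one>[R]" c] c by simp
  { fix r assume r: "r \<in>: R"
    show "r \<odot>[Q] x \<in>: Q" unfolding c(1) Q_smult[OF r c(2)] Q_carrier using sc_keys[OF r c(2)] by auto
    fix s assume s: "s \<in>: R"
    have rs: "r \<otimes>[R] s \<in>: R" "r \<oplus>[R] s \<in>: R" using r s by auto
    have "sc (r \<otimes>[R] s) c = sc r (sc s c)" using c(2)
      by (induction rule: frag_induction) (use r s in \<open>auto simp: frag_extend_diff M.smult_assoc1\<close>)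
    then show "(r \<otimes>[R] s) \<odot>[Q] x = r \<odot>[Q] (s \<odot>[Q] x)"
      unfolding c(1) Q_smult[OF rs(1) c(2)] Q_smult[OF s c(2)] Q_smult[OF r sc_keys[OF s c(2)]] by simp
    \<comment> \<open>The two sides differ as formal sums; on each pair their difference is a
      relation of additivity in the left factor.\<close>
    have "sc (r \<oplus>[R] s) c - (sc r c + sc s c) \<in> K" using c(2)
    proof (induction rule: frag_induction)
      case (one x)
      obtain m n where x: "x = (m, n)" "m \<in>: M" "n \<in>: N" using one by auto
      then show ?case using K_rel[OF rel1[of "r \<odot>[M] m" "s \<odot>[M] m" n]] r s
        by (simp add: M.smult_l_distr algebra_simps)
    next
      case (diff a b)
      then show ?case using K_diff[OF diff] by (simp add: frag_extend_diff algebra_simps)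
    qed simp
    then show "(r \<oplus>[R] s) \<odot>[Q] x = r \<odot>[Q] x \<oplus>[Q] s \<odot>[Q] x"
      unfolding c(1) Q_smult[OF rs(2) c(2)] Q_smult[OF s c(2)] Q_smult[OF r c(2)]
        Q_add[OF sc_keys[OF r c(2)] sc_keys[OF s c(2)]] by (simp add: cos_eq_iff) }
  fix y assume "y \<in>: Q"
  then obtain d where d: "y = cst d" "Poly_Mapping.keys d \<subseteq> carrier M \<times> carrier N" unfolding Q_carrier by auto
  show "x \<oplus>[Q] y \<in>: Q" unfolding c d Q_add[OF c(2) d(2)] Q_carrier
    using keys_add_subset[OF c(2) d(2)] by auto
  show "x \<oplus>[Q] y = y \<oplus>[Q] x" unfolding c d Q_add[OF c(2) d(2)] Q_add[OF d(2) c(2)] by (simp add: add.commute)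
  { fix r assume r: "r \<in>: R"
    show "r \<odot>[Q] (x \<oplus>[Q] y) = r \<odot>[Q] x \<oplus>[Q] r \<odot>[Q] y"
      unfolding c d Q_add[OF c(2) d(2)] Q_smult[OF r keys_add_subset[OF c(2) d(2)]] Q_smult[OF r c(2)]
        Q_smult[OF r d(2)] Q_add[OF sc_keys[OF r c(2)] sc_keys[OF r d(2)]] by (simp add: frag_extend_add) }
  fix z assume "z \<in>: Q"
  then obtain e where e: "z = cst e" "Poly_Mapping.keys e \<subseteq> carrier M \<times> carrier N" unfolding Q_carrier by auto
  show "(x \<oplus>[Q] y) \<oplus>[Q] z = x \<oplus>[Q] (y \<oplus>[Q] z)"
    unfolding c d e Q_add[OF c(2) d(2)] Q_add[OF d(2) e(2)] Q_add[OF c(2) keys_add_subset[OF d(2) e(2)]]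
      Q_add[OF keys_add_subset[OF c(2) d(2)] e(2)] by (simp add: add.assoc)
qed (simp add: Q_zero Q_carrier)

sublocale Q: Module.module R Q by (rule Q_module)

definition "pt m n = cst (frag_of (m, n))"

lemma pt_closed [simp]: "m \<in>: M ==> n \<in>: N ==> pt m n \<in>: Q"
  unfolding pt_def Q_carrier by auto

lemma pt_add_l: "m \<in>: M ==> m' \<in>: M ==> n \<in>: N ==> pt (m \<oplus>[M] m') n = pt m n \<oplus>[Q] pt m' n"
  unfolding pt_def using K_rel[OF rel1[of m m' n]] by (simp add: Q_add cos_eq_iff algebra_simps)

lemma pt_add_r: "m \<in>: M ==> n \<in>: N ==> n' \<in>: N ==> pt m (n \<oplus>[N] n') = pt m n \<oplus>[Q] pt m n'"
  unfolding pt_def using K_rel[OF rel2[of m n n']] by (simp add: Q_add cos_eq_iff algebra_simps)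

lemma pt_smult_l: "r \<in>: R ==> m \<in>: M ==> n \<in>: N ==> pt (r \<odot>[M] m) n = r \<odot>[Q] pt m n"
  unfolding pt_def by (simp add: Q_smult)

lemma pt_smult_r: "r \<in>: R ==> m \<in>: M ==> n \<in>: N ==> pt m (r \<odot>[N] n) = r \<odot>[Q] pt m n"
  using pt_smult_l[of r m n] K_rel[OF rel3[of r m n]] unfolding pt_def by (simp add: cos_eq_iff[symmetric])

text \<open>The inductive step is for differences, following the induction rule of free abelian
  groups, so that one step covers sums and negatives.\<close>

lemma Q_induct:
  assumes "x \<in>: Q" "P \<zero>[Q]" "\<And>m n. m \<in>: M ==> n \<in>: N ==> P (pt m n)"
    "\<And>x y. x \<in>: Q ==> y \<in>: Q ==> P x ==> P y ==> P (x \<ominus>[Q] y)"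
  shows "P x"
proof -
  obtain c where c: "x = cst c" "Poly_Mapping.keys c \<subseteq> carrier M \<times> carrier N" using assms(1) unfolding Q_carrier by auto
  have "P (cst c)"
  proof (rule free_Abelian_group_induct[OF c(2), where P = "\<lambda>c. P (cst c)"])
    fix a b assume 2: "Poly_Mapping.keys a \<subseteq> carrier M \<times> carrier N" "Poly_Mapping.keys b \<subseteq> carrier M \<times> carrier N"
      "P (cst a)" "P (cst b)"
    have ab: "cst a \<in>: Q" "cst b \<in>: Q" using 2 by (auto simp: Q_carrier)
    have "cst (a - b) \<oplus>[Q] cst b = cst a" using Q_add[OF keys_diff_subset[OF 2(1,2)] 2(2)] by simp
    moreover have "cst (a - b) \<in>: Q" using keys_diff_subset[OF 2(1,2)] by (simp add: Q_carrier)
    ultimately have "cst a \<ominus>[Q] cst b = cst (a - b)"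
      using ab by (metis Q.M.add.inv_solve_right' Q.M.minus_eq)
    then show "P (cst (a - b))" using assms(4)[OF ab] 2 by simp
  qed (use assms(2,3) in \<open>auto simp: Q_zero pt_def\<close>)
  then show ?thesis using c by simp
qed

text \<open>The universal property. As \<open>E\<close> consists of formal sums and not of pairs,
  its vanishing is demanded for any homomorphism on the free group that extends
  \<open>\<beta>\<close>.\<close>

lemma Q_lift:
  fixes P :: "('r, 'q) module"
  assumes P: "Module.module R P" and \<beta>: "\<And>m n. m \<in>: M ==> n \<in>: N ==> \<beta> m n \<in>: P"
    and add_l: "\<And>m m' n. m \<in>: M ==> m' \<in>: M ==> n \<in>: N ==> \<beta> (m \<oplus>[M] m') n = \<beta> m n \<oplus>[P] \<beta> m' n"
    and add_r: "\<And>m n n'. m \<in>: M ==> n \<in>: N ==> n' \<in>: N ==> \<beta> m (n \<oplus>[N] n') = \<beta> m n \<oplus>[P] \<beta> m n'"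
    and smult_l: "\<And>r m n. r \<in>: R ==> m \<in>: M ==> n \<in>: N ==> \<beta> (r \<odot>[M] m) n = r \<odot>[P] \<beta> m n"
    and smult_r: "\<And>r m n. r \<in>: R ==> m \<in>: M ==> n \<in>: N ==> \<beta> m (r \<odot>[N] n) = r \<odot>[P] \<beta> m n"
    and E: "\<And>e h. e \<in> E ==> h \<in> hom G (add_monoid P) ==>
      (\<And>m n. m \<in>: M ==> n \<in>: N ==> h (frag_of (m, n)) = \<beta> m n) ==> h e = \<zero>[P]"
  shows "\<exists>f. is_linear R Q P f \<and> (\<forall>m\<in>carrier M. \<forall>n\<in>carrier N. f (pt m n) = \<beta> m n)"
proof -
  interpret P: Module.module R P by (rule P)
  obtain h where h: "h \<in> hom G (add_monoid P)" and hf: "\<And>x. x \<in> carrier M \<times> carrier N ==> h (frag_of x) = (case x of (m, n) => \<beta> m n)"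
    by (rule comm_group.free_Abelian_group_universal[OF P.M.a_comm_group, of "\<lambda>(m, n). \<beta> m n" "carrier M \<times> carrier N"]) (use \<beta> in auto)
  have hb: "h (frag_of (m, n)) = \<beta> m n" if "m \<in>: M" "n \<in>: N" for m n using hf[of "(m, n)"] that by simp
  have hc: "h c \<in>: P" if "Poly_Mapping.keys c \<subseteq> carrier M \<times> carrier N" for c
    using hom_in_carrier[OF h, of c] that by simp
  have hadd: "h (c + d) = h c \<oplus>[P] h d" if "Poly_Mapping.keys c \<subseteq> carrier M \<times> carrier N" "Poly_Mapping.keys d \<subseteq> carrier M \<times> carrier N" for c d
    using hom_mult[OF h, of c d] that by simp
  have h0: "h 0 = \<zero>[P]" using hom_one[OF h group_free_Abelian_group P.M.a_group] by simp
  have hdiff: "h (c - d) = h c \<ominus>[P] h d" if "Poly_Mapping.keys c \<subseteq> carrier M \<times> carrier N" "Poly_Mapping.keys d \<subseteq> carrier M \<times> carrier N" for c d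
  proof -
    have "h (c - d) \<oplus>[P] h d = h c" using hadd[OF keys_diff_subset[OF that] that(2)] by simp
    then show ?thesis using hc[OF keys_diff_subset[OF that]] hc[OF that(1)] hc[OF that(2)] by (metis P.M.add.inv_solve_right' P.M.minus_eq)
  qed
  have rel: "h c = \<zero>[P]" if "c \<in> bilin_rel R M N" for c using that
  proof (cases rule: relE)
    case (1 m m' n)
    then have "h c = (\<beta> m n \<oplus>[P] \<beta> m' n) \<ominus>[P] \<beta> m n \<ominus>[P] \<beta> m' n" by (simp add: hdiff keys_diff_subset hb add_l)
    also have "\<dots> = \<zero>[P]" using \<beta>[of m n] \<beta>[of m' n] 1
      by (simp add: P.M.minus_eq P.M.a_ac P.M.r_neg P.M.r_neg1 P.M.r_neg2)
    finally show ?thesis .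
  next
    case (2 m n n')
    then have "h c = (\<beta> m n \<oplus>[P] \<beta> m n') \<ominus>[P] \<beta> m n \<ominus>[P] \<beta> m n'" by (simp add: hdiff keys_diff_subset hb add_r)
    also have "\<dots> = \<zero>[P]" using \<beta>[of m n] \<beta>[of m n'] 2
      by (simp add: P.M.minus_eq P.M.a_ac P.M.r_neg P.M.r_neg1 P.M.r_neg2)
    finally show ?thesis .
  next
    case (3 r m n)
    then show ?thesis using \<beta>[of m n] by (simp add: hdiff hb smult_l smult_r P.M.minus_eq P.M.r_neg)
  qed
  have hK: "h c = \<zero>[P]" if "c \<in> K" for c
  proof -
    have "Poly_Mapping.keys c \<subseteq> carrier M \<times> carrier N \<and> h c = \<zero>[P]" using that
    proof (rule K_least[rotated -1])
      fix c assume "c \<in> bilin_rel R M N \<union> E"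
      then show "Poly_Mapping.keys c \<subseteq> carrier M \<times> carrier N \<and> h c = \<zero>[P]" using rel E[OF _ h hb] rel_keys by auto
    next
      fix c assume "Poly_Mapping.keys c \<subseteq> carrier M \<times> carrier N \<and> h c = \<zero>[P]"
      then show "Poly_Mapping.keys (- c) \<subseteq> carrier M \<times> carrier N \<and> h (- c) = \<zero>[P]"
        using hdiff[of 0 c] h0 by (simp add: P.M.minus_eq)
    qed (auto simp: h0 hadd keys_add_subset)
    then show ?thesis by simp
  qed
  \<comment> \<open>A representative of the coset is chosen; by \<open>hK\<close> the homomorphism
    \<open>h\<close> vanishes on all relations, so its value does not depend on the choice.\<close>
  define f where "f t = (SOME x. \<exists>c. Poly_Mapping.keys c \<subseteq> carrier M \<times> carrier N \<and> t = cst c \<and> x = h c)" for t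
  have f: "f (cst c) = h c" if c: "Poly_Mapping.keys c \<subseteq> carrier M \<times> carrier N" for c
  proof -
    have "\<exists>d. Poly_Mapping.keys d \<subseteq> carrier M \<times> carrier N \<and> cst c = cst d \<and> f (cst c) = h d"
      unfolding f_def by (rule someI[of _ "h c"]) (use c in auto)
    then obtain d where d: "Poly_Mapping.keys d \<subseteq> carrier M \<times> carrier N" "cst c = cst d" "f (cst c) = h d" by auto
    have "h (c - d) = \<zero>[P]" using hK[of "c - d"] d cos_eq_iff by simp
    then show ?thesis using d(3) hc[OF d(1)] hadd[OF keys_diff_subset[OF c d(1)] d(1)] by simp
  qed
  have hsc: "h (sc r c) = r \<odot>[P] h c" if r: "r \<in>: R" and c: "Poly_Mapping.keys c \<subseteq> carrier M \<times> carrier N" for r c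
  proof (rule free_Abelian_group_induct[OF c, where P = "\<lambda>c. h (sc r c) = r \<odot>[P] h c"])
    fix a b assume "Poly_Mapping.keys a \<subseteq> carrier M \<times> carrier N" "Poly_Mapping.keys b \<subseteq> carrier M \<times> carrier N"
      "h (sc r a) = r \<odot>[P] h a" "h (sc r b) = r \<odot>[P] h b"
    then show "h (sc r (a - b)) = r \<odot>[P] h (a - b)" using r hc[of a] hc[of b]
      by (simp add: frag_extend_diff hdiff sc_keys P.M.minus_eq P.smult_r_distr P.smult_r_minus)
  qed (use r in \<open>auto simp: h0 hb smult_l\<close>)
  have "is_linear R Q P f" unfolding is_linear_def
    by (auto simp: Q_carrier f hc Q_add Q_smult hadd keys_add_subset sc_keys hsc)
  then show ?thesis using f by (auto simp: pt_def hb)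
qed

end

text \<open>Bilinearity shows that g \<otimes> k spans. For injectivity, the product of the
  coordinates of m and n is bilinear in (m, n), and the induced map sends a (g \<otimes> k) back to
  a.\<close>

lemma (in bilin_data) tensor_bij:
  assumes E0: "E = {}" and g: "g \<in>: M" "bij_betw (\<lambda>a. a \<odot>[M] g) (carrier R) (carrier M)"
    and k: "k \<in>: N" "bij_betw (\<lambda>a. a \<odot>[N] k) (carrier R) (carrier N)"
  shows "bij_betw (\<lambda>a. a \<odot>[Q] pt g k) (carrier R) (carrier Q)"
proof (rule bij_betw_imageI)
  have pc: "pt g k \<in>: Q" using g k by simp
  define cm where "cm = inv_into (carrier R) (\<lambda>a. a \<odot>[M] g)"
  define cn where "cn = inv_into (carrier R) (\<lambda>a. a \<odot>[N] k)"
  have cm: "cm m \<in>: R" "cm m \<odot>[M] g = m" if "m \<in>: M" for m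
    using that bij_betw_inv_into_right[OF g(2)] bij_betw_apply[OF bij_betw_inv_into[OF g(2)]] unfolding cm_def by auto
  have cn: "cn m \<in>: R" "cn m \<odot>[N] k = m" if "m \<in>: N" for m
    using that bij_betw_inv_into_right[OF k(2)] bij_betw_apply[OF bij_betw_inv_into[OF k(2)]] unfolding cn_def by auto
  have cme: "cm (a \<odot>[M] g) = a" "cn (a \<odot>[N] k) = a" if "a \<in>: R" for a
    using that bij_betw_inv_into_left[OF g(2)] bij_betw_inv_into_left[OF k(2)] unfolding cm_def cn_def by auto
  have cmadd: "cm (m \<oplus>[M] m') = cm m \<oplus>[R] cm m'" if "m \<in>: M" "m' \<in>: M" for m m'
    using cme(1)[of "cm m \<oplus>[R] cm m'"] cm that g(1) by (simp add: M.smult_l_distr)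
  have cnadd: "cn (m \<oplus>[N] m') = cn m \<oplus>[R] cn m'" if "m \<in>: N" "m' \<in>: N" for m m'
    using cme(2)[of "cn m \<oplus>[R] cn m'"] cn that k(1) by (simp add: N.smult_l_distr)
  have cms: "cm (r \<odot>[M] m) = r \<otimes>[R] cm m" if "m \<in>: M" "r \<in>: R" for m r
    using cme(1)[of "r \<otimes>[R] cm m"] cm that g(1) by (simp add: M.smult_assoc1)
  have cns: "cn (r \<odot>[N] m) = r \<otimes>[R] cn m" if "m \<in>: N" "r \<in>: R" for m r
    using cme(2)[of "r \<otimes>[R] cn m"] cn that k(1) by (simp add: N.smult_assoc1)
  define S where "S = mk_module (carrier R) \<zero>[R] (\<oplus>\<^bsub>R\<^esub>) (\<otimes>\<^bsub>R\<^esub>)"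
  have S: "Module.module R S"
  proof (rule moduleI, rule M.is_cring, rule abelian_groupI)
    fix x assume "x \<in>: S"
    then show "\<exists>y\<in>carrier S. y \<oplus>[S] x = \<zero>[S]"
      by (intro bexI[of _ "\<ominus>[R] x"]) (auto simp: S_def M.R.l_neg)
  qed (simp_all add: S_def M.R.a_ac M.R.l_distr M.R.r_distr M.m_assoc)
  obtain f where f: "is_linear R Q S f" "\<And>m n. m \<in>: M ==> n \<in>: N ==> f (pt m n) = cm m \<otimes>[R] cn n"
    using Q_lift[OF S, of "\<lambda>m n. cm m \<otimes>[R] cn n"] E0
    by (auto simp: S_def cm cn cmadd cnadd cms cns M.R.l_distr M.R.r_distr M.m_assoc M.R.m_lcomm)
  have f1: "f (pt g k) = \<one>[R]" using f(2)[OF g(1) k(1)] cme[of "\<one>[R]"] g k by simp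
  have fa: "f (a \<odot>[Q] pt g k) = a" if "a \<in>: R" for a
    using f(1) f1 pc that unfolding is_linear_def by (simp add: S_def)
  show "inj_on (\<lambda>a. a \<odot>[Q] pt g k) (carrier R)" by (rule inj_on_inverseI[of _ f]) (rule fa)
  show "(\<lambda>a. a \<odot>[Q] pt g k) ` carrier R = carrier Q"
  proof
    show "carrier Q \<subseteq> (\<lambda>a. a \<odot>[Q] pt g k) ` carrier R"
    proof
      fix x assume "x \<in>: Q"
      then show "x \<in> (\<lambda>a. a \<odot>[Q] pt g k) ` carrier R"
      proof (rule Q_induct)
        show "\<zero>[Q] \<in> (\<lambda>a. a \<odot>[Q] pt g k) ` carrier R" using pc by (intro image_eqI[of _ _ "\<zero>[R]"]) auto
        fix m n assume m: "m \<in>: M" and n: "n \<in>: N"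
        have "pt m n = pt (cm m \<odot>[M] g) (cn n \<odot>[N] k)" using cm cn m n by simp
        also have "\<dots> = (cm m \<otimes>[R] cn n) \<odot>[Q] pt g k"
          using cm(1)[OF m] cn(1)[OF n] g k by (simp add: pt_smult_l pt_smult_r Q.smult_assoc1[symmetric] M.m_comm)
        finally show "pt m n \<in> (\<lambda>a. a \<odot>[Q] pt g k) ` carrier R" using cm(1)[OF m] cn(1)[OF n] by auto
      next
        fix x y assume "x \<in> (\<lambda>a. a \<odot>[Q] pt g k) ` carrier R" "y \<in> (\<lambda>a. a \<odot>[Q] pt g k) ` carrier R"
        then obtain a b where ab: "x = a \<odot>[Q] pt g k" "y = b \<odot>[Q] pt g k" "a \<in>: R" "b \<in>: R" by auto
        then have "x \<ominus>[Q] y = (a \<ominus>[R] b) \<odot>[Q] pt g k"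
          using pc by (simp add: Q.M.minus_eq M.R.minus_eq Q.smult_l_distr Q.smult_l_minus)
        then show "x \<ominus>[Q] y \<in> (\<lambda>a. a \<odot>[Q] pt g k) ` carrier R" using ab by auto
      qed
    qed
  qed (use pc in auto)
qed

text \<open>An interface shared by the exterior square of a module and by the sections of the sheaf
  of exterior squares, whose sections are germs and no longer cosets.\<close>

locale alternating = M: Module.module R M + P: Module.module R P
  for R :: "'r ring" and M :: "('r, 'm) module" and P :: "('r, 'q) module" +
  fixes w :: "'m => 'm => 'q"
  assumes w_closed [simp]: "x \<in>: M ==> y \<in>: M ==> w x y \<in>: P"
    and w_add_l: "x \<in>: M ==> x' \<in>: M ==> y \<in>: M ==> w (x \<oplus>[M] x') y = w x y \<oplus>[P] w x' y"
    and w_add_r: "x \<in>: M ==> y \<in>: M ==> y' \<in>: M ==> w x (y \<oplus>[M] y') = w x y \<oplus>[P] w x y'"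
    and w_smult_l: "r \<in>: R ==> x \<in>: M ==> y \<in>: M ==> w (r \<odot>[M] x) y = r \<odot>[P] w x y"
    and w_smult_r: "r \<in>: R ==> x \<in>: M ==> y \<in>: M ==> w x (r \<odot>[M] y) = r \<odot>[P] w x y"
    and w_self: "x \<in>: M ==> w x x = \<zero>[P]"
begin

lemma w_swap: "x \<in>: M ==> y \<in>: M ==> w y x = \<ominus>[P] w x y"
proof -
  assume x: "x \<in>: M" and y: "y \<in>: M"
  have "w (x \<oplus>[M] y) (x \<oplus>[M] y) = w x y \<oplus>[P] w y x"
    using x y by (simp add: w_add_l w_add_r w_self[OF x] w_self[OF y] P.M.a_comm)
  then have "w y x \<oplus>[P] w x y = \<zero>[P]" using x y w_self[of "x \<oplus>[M] y"] by (simp add: P.M.a_comm)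
  then show ?thesis using x y by (simp add: P.M.minus_equality)
qed

text \<open>Base change of exterior squares and the computations with norms below all rest on this 2
  by 2 determinant.\<close>

lemma w_det:
  assumes e: "e \<in>: M" "f \<in>: M"
    and a: "a \<in>: R" "b \<in>: R" "c \<in>: R" "d \<in>: R"
  shows "w (a \<odot>[M] e \<oplus>[M] b \<odot>[M] f) (c \<odot>[M] e \<oplus>[M] d \<odot>[M] f) =
    (a \<otimes>[R] d \<ominus>[R] b \<otimes>[R] c) \<odot>[P] w e f"
proof -
  have ef: "w e f \<in>: P" "w f e \<in>: P" using e by auto
  have "w (a \<odot>[M] e \<oplus>[M] b \<odot>[M] f) (c \<odot>[M] e \<oplus>[M] d \<odot>[M] f) =
     (a \<otimes>[R] d) \<odot>[P] w e f \<oplus>[P] (b \<otimes>[R] c) \<odot>[P] w f e"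
    using e a ef by (simp add: w_add_l w_add_r w_smult_l w_smult_r w_self[OF e(1)] w_self[OF e(2)]
      P.smult_assoc1[symmetric] M.m_comm P.M.a_comm)
  also have "\<dots> = (a \<otimes>[R] d \<ominus>[R] b \<otimes>[R] c) \<odot>[P] w e f"
    unfolding w_swap[OF e] using a ef
    by (simp add: P.smult_assoc1[symmetric] P.smult_r_minus P.smult_l_minus M.R.minus_eq P.smult_l_distr)
  finally show ?thesis .
qed

end

lemma (in bilin_data) E_pt_zero:
  "frag_of (m, n) \<in> E ==> pt m n = \<zero>[Q]"
  unfolding pt_def Q_zero cos_eq_iff using K_E by simp

lemma wedge_alternating:
  assumes "bilin_data R M M (alt_rel R M)"
  shows "alternating R M (bilin_quot R M M (alt_rel R M)) (bilin_data.pt R M M (alt_rel R M))"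
proof -
  interpret bilin_data R M M "alt_rel R M" by fact
  have "frag_of (x, x) \<in> alt_rel R M" if "x \<in>: M" for x
    unfolding alt_rel_def using that by (auto intro!: exI[of _ "\<one>[R]"] exI[of _ x])
  then show ?thesis
    by unfold_locales (auto simp: pt_add_l pt_add_r pt_smult_l pt_smult_r E_pt_zero)
qed

text \<open>By \<open>w_det\<close> every wedge is a multiple of e \<and> f. Conversely the
  determinant of the coordinates is bilinear, kills the multiples of x \<otimes> x, and takes the
  value 1 at (e, f), so it induces a map that recovers the coefficient.\<close>

lemma wedge_bij:
  assumes "bilin_data R M M (alt_rel R M)" and g: "e \<in>: M" "f \<in>: M"
    and b: "bij_betw (\<lambda>(a, b). a \<odot>[M] e \<oplus>[M] b \<odot>[M] f) (carrier R \<times> carrier R) (carrier M)"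
  shows "bij_betw (\<lambda>a. a \<odot>[bilin_quot R M M (alt_rel R M)] bilin_data.pt R M M (alt_rel R M) e f)
    (carrier R) (carrier (bilin_quot R M M (alt_rel R M)))"
proof (rule bij_betw_imageI)
  interpret bilin_data R M M "alt_rel R M" by fact
  interpret W: alternating R M Q pt by (rule wedge_alternating) fact
  have pc: "pt e f \<in>: Q" using g by simp
  define c where "c = inv_into (carrier R \<times> carrier R) (\<lambda>(a, b). a \<odot>[M] e \<oplus>[M] b \<odot>[M] f)"
  define c1 c2 where "c1 = (\<lambda>m. fst (c m))" and "c2 = (\<lambda>m. snd (c m))"
  have cR: "c m \<in> carrier R \<times> carrier R" if "m \<in>: M" for m
    unfolding c_def using bij_betw_apply[OF bij_betw_inv_into[OF b]] that by simp
  have cm: "c1 m \<in>: R" "c2 m \<in>: R" "c1 m \<odot>[M] e \<oplus>[M] c2 m \<odot>[M] f = m" if "m \<in>: M" for m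
    using cR[OF that] bij_betw_inv_into_right[OF b that] unfolding c1_def c2_def c_def[symmetric]
    by (auto simp: case_prod_beta)
  have cme: "c1 (a \<odot>[M] e \<oplus>[M] b \<odot>[M] f) = a" "c2 (a \<odot>[M] e \<oplus>[M] b \<odot>[M] f) = b"
    if "a \<in>: R" "b \<in>: R" for a b
    using bij_betw_inv_into_left[OF b, of "(a, b)"] that unfolding c1_def c2_def c_def by auto
  have cadd: "c1 (m \<oplus>[M] m') = c1 m \<oplus>[R] c1 m'" "c2 (m \<oplus>[M] m') = c2 m \<oplus>[R] c2 m'"
    if m: "m \<in>: M" "m' \<in>: M" for m m'
  proof -
    note [simp] = cm(1,2)[OF m(1)] cm(1,2)[OF m(2)]
    have "(c1 m \<oplus>[R] c1 m') \<odot>[M] e \<oplus>[M] (c2 m \<oplus>[R] c2 m') \<odot>[M] f =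
      (c1 m \<odot>[M] e \<oplus>[M] c2 m \<odot>[M] f) \<oplus>[M] (c1 m' \<odot>[M] e \<oplus>[M] c2 m' \<odot>[M] f)"
      using g cm(1,2)[OF m(1)] cm(1,2)[OF m(2)] by (simp add: M.smult_l_distr M.M.a_ac)
    also have "\<dots> = m \<oplus>[M] m'" using cm(3)[OF m(1)] cm(3)[OF m(2)] by simp
    finally show "c1 (m \<oplus>[M] m') = c1 m \<oplus>[R] c1 m'" "c2 (m \<oplus>[M] m') = c2 m \<oplus>[R] c2 m'"
      using cme[of "c1 m \<oplus>[R] c1 m'" "c2 m \<oplus>[R] c2 m'"] by auto
  qed
  have csm: "c1 (r \<odot>[M] m) = r \<otimes>[R] c1 m" "c2 (r \<odot>[M] m) = r \<otimes>[R] c2 m"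
    if m: "m \<in>: M" and r: "r \<in>: R" for m r
  proof -
    have "(r \<otimes>[R] c1 m) \<odot>[M] e \<oplus>[M] (r \<otimes>[R] c2 m) \<odot>[M] f = r \<odot>[M] (c1 m \<odot>[M] e \<oplus>[M] c2 m \<odot>[M] f)"
      using g cm(1,2)[OF m] r by (simp add: M.smult_r_distr M.smult_assoc1)
    also have "\<dots> = r \<odot>[M] m" using cm(3)[OF m] by simp
    finally show "c1 (r \<odot>[M] m) = r \<otimes>[R] c1 m" "c2 (r \<odot>[M] m) = r \<otimes>[R] c2 m"
      using cme[of "r \<otimes>[R] c1 m" "r \<otimes>[R] c2 m"] cm(1,2)[OF m] r by auto
  qed
  define S where "S = mk_module (carrier R) \<zero>[R] (\<oplus>\<^bsub>R\<^esub>) (\<otimes>\<^bsub>R\<^esub>)"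
  have S: "Module.module R S"
  proof (rule moduleI, rule M.is_cring, rule abelian_groupI)
    fix x assume "x \<in>: S"
    then show "\<exists>y\<in>carrier S. y \<oplus>[S] x = \<zero>[S]"
      by (intro bexI[of _ "\<ominus>[R] x"]) (auto simp: S_def M.R.l_neg)
  qed (simp_all add: S_def M.R.a_ac M.R.l_distr M.R.r_distr M.m_assoc)
  let ?b = "\<lambda>m n. c1 m \<otimes>[R] c2 n \<ominus>[R] c2 m \<otimes>[R] c1 n"
  have "\<exists>h. is_linear R Q S h \<and> (\<forall>m\<in>carrier M. \<forall>n\<in>carrier M. h (pt m n) = ?b m n)"
  proof (rule Q_lift[OF S])
    fix m m' n assume m: "m \<in>: M" "m' \<in>: M" "n \<in>: M"
    note [simp] = cm(1,2)[OF m(1)] cm(1,2)[OF m(2)] cm(1,2)[OF m(3)]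
    show "?b m n \<in>: S" using m by (simp add: S_def)
    show "?b (m \<oplus>[M] m') n = ?b m n \<oplus>[S] ?b m' n"
      using m by (simp add: S_def cadd M.R.minus_eq M.R.l_distr M.R.minus_add M.R.a_ac)
    show "?b m (m' \<oplus>[M] n) = ?b m m' \<oplus>[S] ?b m n"
      using m by (simp add: S_def cadd M.R.minus_eq M.R.r_distr M.R.minus_add M.R.a_ac)
    fix r assume r: "r \<in>: R"
    show "?b (r \<odot>[M] m) n = r \<odot>[S] ?b m n"
      using m r by (simp add: S_def csm M.R.minus_eq M.R.r_distr M.R.r_minus M.m_assoc)
    show "?b m (r \<odot>[M] n) = r \<odot>[S] ?b m n"
      using m r by (simp add: S_def csm M.R.minus_eq M.R.r_distr M.R.r_minus M.R.m_lcomm)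
  next
    fix x h assume x: "x \<in> alt_rel R M" "h \<in> hom G (add_monoid S)"
      and h: "\<And>m n. m \<in>: M ==> n \<in>: M ==> h (frag_of (m, n)) = ?b m n"
    then obtain r m where r: "r \<in>: R" "m \<in>: M" "x = frag_of (r \<odot>[M] m, m)" unfolding alt_rel_def by auto
    then have "h x = ?b (r \<odot>[M] m) m" using h by simp
    also have "\<dots> = \<zero>[R]" using r cm(1,2)[OF r(2)] by (simp add: csm M.R.m_comm M.R.m_lcomm M.R.minus_eq M.R.r_neg)
    finally show "h x = \<zero>[S]" by (simp add: S_def)
  qed
  then obtain h where h: "is_linear R Q S h" "\<And>m n. m \<in>: M ==> n \<in>: M ==> h (pt m n) = ?b m n" by auto
  have "c1 e = \<one>[R]" "c2 e = \<zero>[R]" "c1 f = \<zero>[R]" "c2 f = \<one>[R]"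
    using cme[of "\<one>[R]" "\<zero>[R]"] cme[of "\<zero>[R]" "\<one>[R]"] g by auto
  then have f1: "h (pt e f) = \<one>[R]" using h(2)[OF g] by (simp add: M.R.minus_eq)
  have fa: "h (a \<odot>[Q] pt e f) = a" if "a \<in>: R" for a
    using h(1) f1 pc that unfolding is_linear_def by (simp add: S_def)
  show "inj_on (\<lambda>a. a \<odot>[Q] pt e f) (carrier R)" by (rule inj_on_inverseI[of _ h]) (rule fa)
  show "(\<lambda>a. a \<odot>[Q] pt e f) ` carrier R = carrier Q"
  proof
    show "carrier Q \<subseteq> (\<lambda>a. a \<odot>[Q] pt e f) ` carrier R"
    proof
      fix x assume "x \<in>: Q"
      then show "x \<in> (\<lambda>a. a \<odot>[Q] pt e f) ` carrier R"
      proof (rule Q_induct)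
        show "\<zero>[Q] \<in> (\<lambda>a. a \<odot>[Q] pt e f) ` carrier R" using pc by (intro image_eqI[of _ _ "\<zero>[R]"]) auto
        fix m n assume m: "m \<in>: M" and n: "n \<in>: M"
        have "pt m n = (c1 m \<otimes>[R] c2 n \<ominus>[R] c2 m \<otimes>[R] c1 n) \<odot>[Q] pt e f"
          using W.w_det[OF g cm(1,2)[OF m] cm(1,2)[OF n]] cm(3)[OF m] cm(3)[OF n] by simp
        then show "pt m n \<in> (\<lambda>a. a \<odot>[Q] pt e f) ` carrier R" using cm(1,2)[OF m] cm(1,2)[OF n] by auto
      next
        fix x y assume "x \<in> (\<lambda>a. a \<odot>[Q] pt e f) ` carrier R" "y \<in> (\<lambda>a. a \<odot>[Q] pt e f) ` carrier R"
        then obtain a b where ab: "x = a \<odot>[Q] pt e f" "y = b \<odot>[Q] pt e f" "a \<in>: R" "b \<in>: R" by auto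
        then have "x \<ominus>[Q] y = (a \<ominus>[R] b) \<odot>[Q] pt e f"
          using pc by (simp add: Q.M.minus_eq M.R.minus_eq Q.smult_l_distr Q.smult_l_minus)
        then show "x \<ominus>[Q] y \<in> (\<lambda>a. a \<odot>[Q] pt e f) ` carrier R" using ab by auto
      qed
    qed
  qed (use pc in auto)
qed

section \<open>The presheaves of tensor products and exterior squares\<close>

context ringed
begin

text \<open>Besides the conditions over each open set, the additional relations must be preserved by
  restriction; otherwise the restriction maps of the quotients would not be well defined.\<close>

definition adm :: "('p, 'r, 'm) module_presheaf => ('p, 'r, 'n) module_presheaf =>
   ('p set => ('m \<times> 'n \<Rightarrow>\<^sub>0 int) set) => bool" where
  "adm M N E \<longleftrightarrow> mpre M \<and> mpre N \<and>
    (\<forall>U. opn U --> bilin_data (R U) (sec M U) (sec N U) (E U)) \<and>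
    (\<forall>U V e. opn U \<and> opn V \<and> V \<subseteq> U \<and> e \<in> E U -->
      frag_extend (\<lambda>(m, n). frag_of (res M U V m, res N U V n)) e \<in> E V)"

lemma adm_tensor: "mpre M ==> mpre N ==> adm M N (\<lambda>U. {})"
  unfolding adm_def by (auto simp: bilin_data_def bilin_data_axioms_def mp_module)

lemma adm_wedge:
  assumes M: "mpre M" shows "adm M M (\<lambda>U. alt_rel (R U) (sec M U))"
  unfolding adm_def
proof (intro conjI allI impI M; (elim conjE)?)
  fix U assume U: "opn U"
  interpret Module.module "R U" "sec M U" by (rule mp_module[OF M U])
  show "bilin_data (R U) (sec M U) (sec M U) (alt_rel (R U) (sec M U))"
  proof (intro bilin_data.intro bilin_data_axioms.intro mp_module[OF M U])
    fix e assume "e \<in> alt_rel (R U) (sec M U)"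
    then obtain r x where r: "r \<in>: R U" "x \<in>: sec M U" "e = frag_of (r \<odot>[M,U] x, x)"
      unfolding alt_rel_def by auto
    then show "Poly_Mapping.keys e \<subseteq> carrier (sec M U) \<times> carrier (sec M U)" by simp
    fix s assume s: "s \<in>: R U"
    have "frag_extend (\<lambda>(m, n). frag_of (s \<odot>[M,U] m, n)) e = frag_of ((s \<otimes>[R U] r) \<odot>[M,U] x, x)"
      using r s by (simp add: smult_assoc1)
    then show "frag_extend (\<lambda>(m, n). frag_of (s \<odot>[M,U] m, n)) e \<in> alt_rel (R U) (sec M U)"
      unfolding alt_rel_def using r s R.m_closed[OF s r(1)] by blast
  qed
next
  fix U V e assume UV: "opn U" "opn V" "V \<subseteq> U" and "e \<in> alt_rel (R U) (sec M U)"
  then obtain r x where r: "r \<in>: R U" "x \<in>: sec M U" "e = frag_of (r \<odot>[M,U] x, x)"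
    unfolding alt_rel_def by auto
  have "frag_extend (\<lambda>(m, n). frag_of (res M U V m, res M U V n)) e =
     frag_of (rr U V r \<odot>[M,V] res M U V x, res M U V x)"
    using r UV by (simp add: mres_smult[OF M])
  then show "frag_extend (\<lambda>(m, n). frag_of (res M U V m, res M U V n)) e \<in> alt_rel (R V) (sec M V)"
    unfolding alt_rel_def using rr_closed[OF UV r(1)] mres_closed[OF M UV r(2)] by blast
qed

context
  fixes M :: "('p, 'r, 'm) module_presheaf" and N :: "('p, 'r, 'n) module_presheaf" and E
  assumes adm: "adm M N E"
begin

abbreviation "BP \<equiv> bilin_presheaf X M N E"
abbreviation "rho U V \<equiv> frag_extend (\<lambda>(m, n). frag_of (res M U V m, res N U V n))"
abbreviation "cs U \<equiv> bilin_coset (R U) (sec M U) (sec N U) (E U)"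

lemma adm_M: "mpre M" and adm_N: "mpre N"
  using adm unfolding adm_def by auto

lemma adm_bd: "opn U ==> bilin_data (R U) (sec M U) (sec N U) (E U)"
  using adm unfolding adm_def by (elim conjE) simp

lemma adm_E: "opn U ==> opn V ==> V \<subseteq> U ==> e \<in> E U ==> rho U V e \<in> E V"
  using adm unfolding adm_def by (elim conjE) simp

lemma BP_sec [simp]: "sec BP U = bilin_quot (R U) (sec M U) (sec N U) (E U)"
  by (simp add: bilin_presheaf_def)

lemma rho_keys:
  assumes "opn U" "opn V" "V \<subseteq> U" "Poly_Mapping.keys c \<subseteq> carrier (sec M U) \<times> carrier (sec N U)"
  shows "Poly_Mapping.keys (rho U V c) \<subseteq> carrier (sec M V) \<times> carrier (sec N V)"
proof -
  have "Poly_Mapping.keys (case x of (m, n) => frag_of (res M U V m, res N U V n)) \<subseteq> carrier (sec M V) \<times> carrier (sec N V)"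
    if "x \<in> carrier (sec M U) \<times> carrier (sec N U)" for x
    using that assms adm_M adm_N by auto
  then show ?thesis using keys_frag_extend[of _ c] assms(4) by fast
qed

text \<open>Restriction carries each kind of relation to a relation of the same kind, so all
  representatives of a coset restrict into one coset.\<close>

lemma BP_res:
  assumes UV: "opn U" "opn V" "V \<subseteq> U" and c: "Poly_Mapping.keys c \<subseteq> carrier (sec M U) \<times> carrier (sec N U)"
  shows "res BP U V (cs U c) = cs V (rho U V c)"
proof -
  interpret u: bilin_data "R U" "sec M U" "sec N U" "E U" by (rule adm_bd[OF UV(1)])
  interpret v: bilin_data "R V" "sec M V" "sec N V" "E V" by (rule adm_bd[OF UV(2)])
  note M = adm_M and N = adm_N
  have K: "rho U V k \<in> v.K" if "k \<in> u.K" for k using that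
  proof (rule u.K_least[rotated -1])
    fix c assume "c \<in> bilin_rel (R U) (sec M U) (sec N U) \<union> E U"
    then show "rho U V c \<in> v.K"
    proof
      assume "c \<in> bilin_rel (R U) (sec M U) (sec N U)"
      then show ?thesis
      proof (cases rule: u.relE)
        case (1 m m' n)
        then show ?thesis using v.K_rel[OF v.rel1[of "res M U V m" "res M U V m'" "res N U V n"]] UV M N
          by (simp add: frag_extend_diff mres_add)
      next
        case (2 m n n')
        then show ?thesis using v.K_rel[OF v.rel2[of "res M U V m" "res N U V n" "res N U V n'"]] UV M N
          by (simp add: frag_extend_diff mres_add)
      next
        case (3 r m n)
        then show ?thesis using v.K_rel[OF v.rel3[of "rr U V r" "res M U V m" "res N U V n"]] UV M N
          by (simp add: frag_extend_diff mres_smult)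
      qed
    next
      assume "c \<in> E U" then show ?thesis using adm_E[OF UV] v.K_E by blast
    qed
  qed (auto simp: frag_extend_add frag_extend_minus v.K_add v.K_uminus)
  have "(\<Union>d\<in>cs U c. cs V (rho U V d)) = cs V (rho U V c)"
  proof (rule UN_const[OF u.cos_self])
    fix d assume "d \<in> cs U c"
    then have "rho U V (d - c) \<in> v.K" using K by (simp add: u.mem_cos)
    then show "cs V (rho U V d) = cs V (rho U V c)" by (simp add: v.cos_eq_iff frag_extend_diff)
  qed
  then show ?thesis by (simp add: bilin_presheaf_def)
qed

lemma BP_presheaf: "mpre BP"
proof -
  note M = adm_M and N = adm_N
  have carrierE: "\<exists>c. s = cs U c \<and> Poly_Mapping.keys c \<subseteq> carrier (sec M U) \<times> carrier (sec N U)"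
    if U: "opn U" and s: "s \<in>: sec BP U" for U s
  proof -
    interpret u: bilin_data "R U" "sec M U" "sec N U" "E U" by (rule adm_bd[OF U])
    show ?thesis using s by (auto simp: u.Q_carrier)
  qed
  have 1: "is_presheaf (underlying X) BP"
    unfolding is_presheaf_def
  proof (intro conjI allI impI ballI; (elim conjE)?)
    fix U V assume UV: "opn U" "opn V" "V \<subseteq> U"
    interpret v: bilin_data "R V" "sec M V" "sec N V" "E V" by (rule adm_bd[OF UV(2)])
    show "res BP U V \<in> carrier (sec BP U) \<rightarrow> carrier (sec BP V)"
    proof
      fix s assume s: "s \<in>: sec BP U"
      obtain c where c: "s = cs U c" "Poly_Mapping.keys c \<subseteq> carrier (sec M U) \<times> carrier (sec N U)"
        using carrierE[OF UV(1) s] by auto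
      show "res BP U V s \<in>: sec BP V"
        unfolding c(1) BP_res[OF UV c(2)] using rho_keys[OF UV c(2)] by (auto simp: v.Q_carrier)
    qed
  next
    fix U s assume U: "opn U" and s: "s \<in>: sec BP U"
    obtain c where c: "s = cs U c" "Poly_Mapping.keys c \<subseteq> carrier (sec M U) \<times> carrier (sec N U)"
      using carrierE[OF U s] by auto
    have "rho U U c = c" using c(2)
      by (induction rule: frag_induction) (use M N U in \<open>auto simp: frag_extend_diff\<close>)
    then show "res BP U U s = s" unfolding c(1) BP_res[OF U U subset_refl c(2)] by simp
  next
    fix U V W s assume UV: "opn U" "opn V" and W: "opn W" "W \<subseteq> V" and VU: "V \<subseteq> U" and s: "s \<in>: sec BP U"
    have WU: "W \<subseteq> U" using W VU by auto
    obtain c where c: "s = cs U c" "Poly_Mapping.keys c \<subseteq> carrier (sec M U) \<times> carrier (sec N U)"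
      using carrierE[OF UV(1) s] by auto
    have "rho V W (rho U V c) = rho U W c" using c(2)
      by (induction rule: frag_induction) (use M N UV W VU in \<open>auto simp: frag_extend_diff\<close>)
    then show "res BP V W (res BP U V s) = res BP U W s"
      unfolding c(1) BP_res[OF UV VU c(2)] BP_res[OF UV(2) W rho_keys[OF UV VU c(2)]] BP_res[OF UV(1) W(1) WU c(2)]
      by simp
  qed
  show ?thesis unfolding is_module_presheaf_def
  proof (intro conjI allI impI ballI 1; (elim conjE)?)
    fix U assume U: "opn U"
    interpret u: bilin_data "R U" "sec M U" "sec N U" "E U" by (rule adm_bd[OF U])
    show "Module.module (R U) (sec BP U)" using u.Q_module by simp
  next
    fix U V s assume UV: "opn U" "opn V" "V \<subseteq> U" and s: "s \<in>: sec BP U"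
    interpret u: bilin_data "R U" "sec M U" "sec N U" "E U" by (rule adm_bd[OF UV(1)])
    interpret v: bilin_data "R V" "sec M V" "sec N V" "E V" by (rule adm_bd[OF UV(2)])
    obtain c where c: "s = cs U c" "Poly_Mapping.keys c \<subseteq> carrier (sec M U) \<times> carrier (sec N U)"
      using carrierE[OF UV(1) s] by auto
    { fix t assume t: "t \<in>: sec BP U"
      obtain d where d: "t = cs U d" "Poly_Mapping.keys d \<subseteq> carrier (sec M U) \<times> carrier (sec N U)"
        using carrierE[OF UV(1) t] by auto
      show "res BP U V (s \<oplus>[BP,U] t) = res BP U V s \<oplus>[BP,V] res BP U V t"
        unfolding c(1) d(1) BP_sec u.Q_add[OF c(2) d(2)] BP_res[OF UV c(2)] BP_res[OF UV d(2)]
          BP_res[OF UV u.keys_add_subset[OF c(2) d(2)]] v.Q_add[OF rho_keys[OF UV c(2)] rho_keys[OF UV d(2)]]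
        by (simp add: frag_extend_add) }
    fix a assume a: "a \<in>: R U"
    have "rho U V (u.sc a c) = v.sc (rr U V a) (rho U V c)" using c(2)
      by (induction rule: frag_induction) (use M N UV a in \<open>auto simp: frag_extend_diff mres_smult\<close>)
    then show "res BP U V (a \<odot>[BP,U] s) = rr U V a \<odot>[BP,V] res BP U V s"
      unfolding c(1) BP_sec u.Q_smult[OF a c(2)] BP_res[OF UV c(2)] BP_res[OF UV u.sc_keys[OF a c(2)]]
        v.Q_smult[OF rr_closed[OF UV a] rho_keys[OF UV c(2)]] by simp
  qed
qed

text \<open>The image of a pure tensor in the sheafification. By \<open>tens_bt\<close> and
  \<open>wedge_bt\<close> it specialises to \<open>tens\<close> and \<open>wedge\<close>, so
  bilinearity and naturality are proved once for both.\<close>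

definition "bt U m n = to_sheafification X BP U (cs U (frag_of (m, n)))"

lemma cs_frag_closed: "opn U ==> m \<in>: sec M U ==> n \<in>: sec N U ==> cs U (frag_of (m, n)) \<in>: sec BP U"
  using bilin_data.Q_carrier[OF adm_bd] by auto

lemma BS_sheaf: "msh (sheafify X BP)" by (rule sheafify_sheaf[OF BP_presheaf])

lemma bt_closed: "opn U ==> m \<in>: sec M U ==> n \<in>: sec N U ==> bt U m n \<in>: sec (sheafify X BP) U"
  unfolding bt_def by (rule mm_closed[OF to_sh_morphism[OF BP_presheaf] _ cs_frag_closed])

lemma bt_res:
  assumes "opn U" "opn V" "V \<subseteq> U" "m \<in>: sec M U" "n \<in>: sec N U"
  shows "res (sheafify X BP) U V (bt U m n) = bt V (res M U V m) (res N U V n)"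
  unfolding bt_def using mm_res[OF to_sh_morphism[OF BP_presheaf] assms(1-3) cs_frag_closed[OF assms(1,4,5)]]
    BP_res[OF assms(1-3), of "frag_of (m, n)"] assms by simp

lemma bt_add_l:
  assumes U: "opn U" and m: "m \<in>: sec M U" "m' \<in>: sec M U" "n \<in>: sec N U"
  shows "bt U (m \<oplus>[M,U] m') n = bt U m n \<oplus>[sheafify X BP,U] bt U m' n"
proof -
  interpret u: bilin_data "R U" "sec M U" "sec N U" "E U" by (rule adm_bd[OF U])
  show ?thesis unfolding bt_def using u.pt_add_l[OF m, unfolded u.pt_def]
    mm_add[OF to_sh_morphism[OF BP_presheaf] U cs_frag_closed[OF U m(1,3)] cs_frag_closed[OF U m(2,3)]] by simp
qed

lemma bt_add_r:
  assumes U: "opn U" and m: "m \<in>: sec M U" "n \<in>: sec N U" "n' \<in>: sec N U"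
  shows "bt U m (n \<oplus>[N,U] n') = bt U m n \<oplus>[sheafify X BP,U] bt U m n'"
proof -
  interpret u: bilin_data "R U" "sec M U" "sec N U" "E U" by (rule adm_bd[OF U])
  show ?thesis unfolding bt_def using u.pt_add_r[OF m, unfolded u.pt_def]
    mm_add[OF to_sh_morphism[OF BP_presheaf] U cs_frag_closed[OF U m(1,2)] cs_frag_closed[OF U m(1,3)]] by simp
qed

lemma bt_smult_l:
  assumes U: "opn U" and m: "a \<in>: R U" "m \<in>: sec M U" "n \<in>: sec N U"
  shows "bt U (a \<odot>[M,U] m) n = a \<odot>[sheafify X BP,U] bt U m n"
proof -
  interpret u: bilin_data "R U" "sec M U" "sec N U" "E U" by (rule adm_bd[OF U])
  show ?thesis unfolding bt_def using u.pt_smult_l[OF m, unfolded u.pt_def]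
    mm_smult[OF to_sh_morphism[OF BP_presheaf] U m(1) cs_frag_closed[OF U m(2,3)]] by simp
qed

lemma bt_smult_r:
  assumes U: "opn U" and m: "a \<in>: R U" "m \<in>: sec M U" "n \<in>: sec N U"
  shows "bt U m (a \<odot>[N,U] n) = a \<odot>[sheafify X BP,U] bt U m n"
proof -
  interpret u: bilin_data "R U" "sec M U" "sec N U" "E U" by (rule adm_bd[OF U])
  show ?thesis unfolding bt_def using u.pt_smult_r[OF m, unfolded u.pt_def]
    mm_smult[OF to_sh_morphism[OF BP_presheaf] U m(1) cs_frag_closed[OF U m(2,3)]] by simp
qed

end

end

section \<open>Generators and morphisms of the sheaf tensor product\<close>

context ringed
begin

lemma tensor_sheafify: "tensor X M N = sheafify X (bilin_presheaf X M N (\<lambda>U. {}))"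
  by (simp add: tensor_def)

lemma tens_bt: "mpre M ==> mpre N ==> tens X M N U m n = bt M N (\<lambda>U. {}) U m n"
  by (simp add: tens_def bt_def[OF adm_tensor])

lemma wedge2_sheafify: "wedge2 X M = sheafify X (bilin_presheaf X M M (\<lambda>U. alt_rel (R U) (sec M U)))"
  by (simp add: wedge2_def)

lemma wedge_bt: "mpre M ==> wedge X M U m n = bt M M (\<lambda>U. alt_rel (R U) (sec M U)) U m n"
  by (simp add: wedge_def bt_def[OF adm_wedge])

text \<open>Freeness of the quotient modules over every smaller open set makes the pure tensor a
  generator of the presheaf, and \<open>gen_sheafify\<close> carries this to the sheaf.\<close>

lemma gen_bt:
  assumes adm: "adm M N E" and U: "opn U" and m: "m \<in>: sec M U" and n: "n \<in>: sec N U"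
    and b: "\<And>W. opn W ==> W \<subseteq> U ==>
      bij_betw (\<lambda>a. a \<odot>[bilin_quot (R W) (sec M W) (sec N W) (E W)]
          bilin_data.pt (R W) (sec M W) (sec N W) (E W) (res M U W m) (res N U W n))
        (carrier (R W)) (carrier (bilin_quot (R W) (sec M W) (sec N W) (E W)))"
  shows "gen (sheafify X (bilin_presheaf X M N E)) U (bt M N E U m n)"
  unfolding bt_def[OF adm]
proof (rule gen_sheafify[OF BP_presheaf[OF adm]])
  let ?BP = "bilin_presheaf X M N E"
  let ?c = "bilin_coset (R U) (sec M U) (sec N U) (E U) (frag_of (m, n))"
  show "gen ?BP U ?c" unfolding gen_def
  proof (intro conjI allI impI U cs_frag_closed[OF adm U m n]; elim conjE)
    fix W assume W: "opn W" "W \<subseteq> U"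
    have "res ?BP U W ?c = bilin_data.pt (R W) (sec M W) (sec N W) (E W) (res M U W m) (res N U W n)"
      using BP_res[OF adm U W, of "frag_of (m, n)"] m n by (simp add: bilin_data.pt_def[OF adm_bd[OF adm W(1)]])
    then show "bij_betw (\<lambda>a. a \<odot>[?BP,W] res ?BP U W ?c) (carrier (R W)) (carrier (sec ?BP W))"
      using b[OF W] BP_sec[OF adm] by simp
  qed
qed

context
  fixes M :: "('p, 'r, 'm) module_presheaf" and N :: "('p, 'r, 'n) module_presheaf"
  assumes M: "mpre M" and N: "mpre N"
begin

lemma tensor_sheaf: "msh (tensor X M N)"
  unfolding tensor_sheafify by (rule BS_sheaf[OF adm_tensor[OF M N]])

lemma tens_closed: "opn U ==> m \<in>: sec M U ==> n \<in>: sec N U ==>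
    tens X M N U m n \<in>: sec (tensor X M N) U"
  unfolding tens_bt[OF M N] tensor_sheafify by (rule bt_closed[OF adm_tensor[OF M N]])

lemma tens_res: "opn U ==> opn V ==> V \<subseteq> U ==> m \<in>: sec M U ==> n \<in>: sec N U ==>
    res (tensor X M N) U V (tens X M N U m n) = tens X M N V (res M U V m) (res N U V n)"
  unfolding tens_bt[OF M N] tensor_sheafify by (rule bt_res[OF adm_tensor[OF M N]])

lemma tens_smult_l: "opn U ==> a \<in>: R U ==> m \<in>: sec M U ==> n \<in>: sec N U ==>
    tens X M N U (a \<odot>[M,U] m) n = a \<odot>[tensor X M N,U] tens X M N U m n"
  unfolding tens_bt[OF M N] tensor_sheafify by (rule bt_smult_l[OF adm_tensor[OF M N]])

lemma tens_smult_r: "opn U ==> a \<in>: R U ==> m \<in>: sec M U ==> n \<in>: sec N U ==>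
    tens X M N U m (a \<odot>[N,U] n) = a \<odot>[tensor X M N,U] tens X M N U m n"
  unfolding tens_bt[OF M N] tensor_sheafify by (rule bt_smult_r[OF adm_tensor[OF M N]])

lemma tens_smult: "opn U ==> a \<in>: R U ==> b \<in>: R U ==> m \<in>: sec M U ==> n \<in>: sec N U ==>
    tens X M N U (a \<odot>[M,U] m) (b \<odot>[N,U] n) = (a \<otimes>[R U] b) \<odot>[tensor X M N,U] tens X M N U m n"
  using M N tensor_sheaf tens_smult_l[of U a m "b \<odot>[N,U] n"] tens_smult_r[of U b m n] tens_closed[of U m n]
  by (simp add: msmult_assoc)

lemma gen_tens:
  assumes m: "gen M U m" and n: "gen N U n" shows "gen (tensor X M N) U (tens X M N U m n)"
  unfolding tens_bt[OF M N] tensor_sheafify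
proof (rule gen_bt[OF adm_tensor[OF M N] gen_open[OF m] gen_closed[OF m] gen_closed[OF n]])
  fix W assume W: "opn W" "W \<subseteq> U"
  interpret bilin_data "R W" "sec M W" "sec N W" "{}" by (rule adm_bd[OF adm_tensor[OF M N] W(1)])
  have "bij_betw (\<lambda>a. a \<odot>[M,W] res M U W m) (carrier (R W)) (carrier (sec M W))"
    "bij_betw (\<lambda>a. a \<odot>[N,W] res N U W n) (carrier (R W)) (carrier (sec N W))"
    using m n W unfolding gen_def by blast+
  then show "bij_betw (\<lambda>a. a \<odot>[Q] pt (res M U W m) (res N U W n)) (carrier (R W)) (carrier Q)"
    using gen_res[OF M m W] gen_res[OF N n W] by (intro tensor_bij) auto
qed

end

lemma gens_within:
  assumes M: "line M" and N: "line N" and U: "opn U" "p \<in> U"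
  obtains V m n where "opn V" "p \<in> V" "V \<subseteq> U" "gen M V m" "gen N V n"
proof -
  obtain V1 m where V1: "opn V1" "p \<in> V1" "V1 \<subseteq> U" "gen M V1 m" using inv_gen_within[OF M U] by auto
  obtain V n where V: "opn V" "p \<in> V" "V \<subseteq> V1" "gen N V n" using inv_gen_within[OF N V1(1,2)] by auto
  have "gen M V (res M V1 V m)" by (rule gen_res) (use M V1 V in auto)
  then show thesis using that V V1 by (meson order_trans)
qed

lemma tensor_invertible: "line M ==> line N ==> line (tensor X M N)"
proof -
  assume MN: "line M" "line N"
  have "\<exists>U g. p \<in> U \<and> gen (tensor X M N) U g" if p: "p \<in> whole X" for p
  proof -
    obtain V m n where "opn V" "p \<in> V" "V \<subseteq> whole X" "gen M V m" "gen N V n"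
      by (rule gens_within[OF MN openin_topspace p])
    then show ?thesis using gen_tens MN by (metis inv_ms ms_mp)
  qed
  then show ?thesis using tensor_sheaf[of M N] MN unfolding invertible_iff[of "tensor X M N"] by simp
qed

text \<open>The frames are the pure tensors of generators. Homogeneity of \<open>F\<close> in both
  variables is the only algebraic condition: in rank one it determines \<open>F\<close> locally from
  its value at a pair of generators, and additivity follows.\<close>

lemma tensor_morphism:
  fixes F :: "'p set => 'm => 'n => 'k"
  assumes M: "line M" and N: "line N" and K: "msh K"
    and F: "\<And>U m n. opn U ==> m \<in>: sec M U ==> n \<in>: sec N U ==> F U m n \<in>: sec K U"
    and F_res: "\<And>U V m n. opn U ==> opn V ==> V \<subseteq> U ==> m \<in>: sec M U ==> n \<in>: sec N U ==>
       res K U V (F U m n) = F V (res M U V m) (res N U V n)"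
    and F_smult: "\<And>U m n a b. opn U ==> m \<in>: sec M U ==> n \<in>: sec N U ==>
       a \<in>: R U ==> b \<in>: R U ==>
       F U (a \<odot>[M,U] m) (b \<odot>[N,U] n) = (a \<otimes>[R U] b) \<odot>[K,U] F U m n"
  shows "\<exists>h. mmor (tensor X M N) K h \<and>
    (\<forall>U. opn U --> (\<forall>m\<in>carrier (sec M U). \<forall>n\<in>carrier (sec N U). h U (tens X M N U m n) = F U m n)) \<and>
    ((\<forall>U m n. gen M U m \<and> gen N U n --> gen K U (F U m n)) --> miso (tensor X M N) K h)"
proof -
  have Mp: "mpre M" and Np: "mpre N" and Kp: "mpre K"
    using M N K by simp_all
  note T = tensor_sheaf[OF Mp Np]
  define Fr where "Fr = (\<lambda>V g g'. \<exists>m n. gen M V m \<and> gen N V n \<and> g = tens X M N V m n \<and> g' = F V m n)"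
  have FrE: "\<exists>m n. gen M V m \<and> gen N V n \<and> g = tens X M N V m n \<and> g' = F V m n" if "Fr V g g'" for V g g'
    using that unfolding Fr_def .
  have fr: "frames (tensor X M N) K Fr"
  proof (rule framesI)
    fix V g g' assume "Fr V g g'"
    then obtain m n where m: "gen M V m" "gen N V n" "g = tens X M N V m n" "g' = F V m n" using FrE by blast
    then show "gen (tensor X M N) V g \<and> g' \<in>: sec K V"
      using gen_tens[OF Mp Np m(1,2)] F by auto
    fix W assume W: "opn W" "W \<subseteq> V"
    have "gen M W (res M V W m)" "gen N W (res N V W n)" using gen_res[OF Mp m(1) W] gen_res[OF Np m(2) W] .
    then show "Fr W (res (tensor X M N) V W g) (res K V W g')"
      unfolding Fr_def using m W tens_res[OF Mp Np gen_open[OF m(1)] W] F_res[OF gen_open[OF m(1)] W] by auto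
  next
    fix p assume p: "p \<in> whole X"
    obtain V m n where V: "opn V" "p \<in> V" "V \<subseteq> whole X" "gen M V m" "gen N V n" by (rule gens_within[OF M N openin_topspace p])
    then have "Fr V (tens X M N V m n) (F V m n)" unfolding Fr_def by blast
    then show "\<exists>V g g'. p \<in> V \<and> Fr V g g'" using V by blast
  next
    fix V g g' h h' a assume "Fr V g g'" "Fr V h h'" and a: "a \<in>: R V" "g = a \<odot>[tensor X M N,V] h"
    then obtain m n m2 n2 where m: "gen M V m" "gen N V n" "g = tens X M N V m n" "g' = F V m n"
      and m2: "gen M V m2" "gen N V n2" "h = tens X M N V m2 n2" "h' = F V m2 n2" using FrE by metis
    note V = gen_open[OF m(1)]
    interpret cring "R V" using V by (rule R_cring)
    obtain b c where b: "b \<in>: R V" "m = b \<odot>[M,V] m2" and c: "c \<in>: R V" "n = c \<odot>[N,V] n2"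
      using gen_coeff[OF Mp m2(1) gen_closed[OF m(1)]] gen_coeff[OF Np m2(2) gen_closed[OF m(2)]] by auto
    have "g = (b \<otimes>[R V] c) \<odot>[tensor X M N,V] h"
      unfolding m(3) m2(3) b(2) c(2) by (rule tens_smult[OF Mp Np V]) (use b c m2 in auto)
    then have "b \<otimes>[R V] c = a"
      using gen_cancel[OF ms_mp[OF T] gen_tens[OF Mp Np m2(1,2)]] a b(1) c(1) m2(3) by simp
    then show "g' = a \<odot>[K,V] h'"
      unfolding m(4) m2(4) b(2) c(2) using F_smult[OF V gen_closed[OF m2(1)] gen_closed[OF m2(2)] b(1) c(1)] by simp
  qed
  obtain h where h: "mmor (tensor X M N) K h" "\<And>V g g'. Fr V g g' ==> h V g = g'"
    using line_morphism[OF ms_mp[OF T] K fr] by auto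
  have "h U (tens X M N U m n) = F U m n" if U: "opn U" and m: "m \<in>: sec M U" and n: "n \<in>: sec N U" for U m n
  proof (rule sheaf_eqI[OF ms_sheaf[OF K] U])
    fix p assume p: "p \<in> U"
    obtain V g k where V: "opn V" "p \<in> V" "V \<subseteq> U" "gen M V g" "gen N V k" by (rule gens_within[OF M N U p])
    obtain b c where b: "b \<in>: R V" "res M U V m = b \<odot>[M,V] g"
      and c: "c \<in>: R V" "res N U V n = c \<odot>[N,V] k"
      using gen_coeff[OF Mp V(4) mres_closed[OF Mp U V(1,3) m]] gen_coeff[OF Np V(5) mres_closed[OF Np U V(1,3) n]] by auto
    interpret cring "R V" using V(1) by (rule R_cring)
    have hg: "h V (tens X M N V g k) = F V g k" by (rule h(2)) (use V in \<open>auto simp: Fr_def\<close>)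
    have "res K U V (h U (tens X M N U m n)) = h V (tens X M N V (res M U V m) (res N U V n))"
      using mm_res[OF h(1) U V(1,3) tens_closed[OF Mp Np U m n]] tens_res[OF Mp Np U V(1,3) m n] by simp
    also have "\<dots> = h V ((b \<otimes>[R V] c) \<odot>[tensor X M N,V] tens X M N V g k)"
      unfolding b(2) c(2) using tens_smult[OF Mp Np V(1) b(1) c(1) gen_closed[OF V(4)] gen_closed[OF V(5)]] by simp
    also have "\<dots> = (b \<otimes>[R V] c) \<odot>[K,V] F V g k"
      using mm_smult[OF h(1) V(1) _ tens_closed[OF Mp Np V(1) gen_closed[OF V(4)] gen_closed[OF V(5)]]] b c hg by simp
    also have "\<dots> = res K U V (F U m n)"
      unfolding F_res[OF U V(1,3) m n] b(2) c(2) using F_smult[OF V(1) gen_closed[OF V(4)] gen_closed[OF V(5)] b(1) c(1)] by simp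
    finally show "\<exists>W. opn W \<and> p \<in> W \<and> W \<subseteq> U \<and> res K U W (h U (tens X M N U m n)) = res K U W (F U m n)"
      using V by blast
  qed (use mm_closed[OF h(1) U tens_closed[OF Mp Np U m n]] F[OF U m n] in auto)
  moreover have "miso (tensor X M N) K h" if "\<forall>U m n. gen M U m \<and> gen N U n --> gen K U (F U m n)"
    by (rule line_isomorphism[OF T K fr _ h]) (use FrE that in blast)
  ultimately show ?thesis using h(1) by (intro exI[of _ h]) simp
qed

lemma tensor_morphism_unique:
  assumes M: "line M" and N: "line N" and K: "msh K"
    and h: "mmor (tensor X M N) K h" "mmor (tensor X M N) K h'"
    and e: "\<And>V m n. gen M V m ==> gen N V n ==> h V (tens X M N V m n) = h' V (tens X M N V m n)"
    and U: "opn U" and s: "s \<in>: sec (tensor X M N) U"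
  shows "h U s = h' U s"
proof (rule morphism_eq_on_gens[OF K _ h _ U s])
  have Mp: "mpre M" and Np: "mpre N" using M N by simp_all
  show "mpre (tensor X M N)" using tensor_sheaf[OF Mp Np] by simp
  fix p assume "p \<in> U"
  then obtain V m n where "opn V" "p \<in> V" "V \<subseteq> U" "gen M V m" "gen N V n" by (rule gens_within[OF M N U])
  then show "\<exists>V g. p \<in> V \<and> V \<subseteq> U \<and> gen (tensor X M N) V g \<and> h V g = h' V g" using gen_tens[OF Mp Np] e by metis
qed

text \<open>\<open>tensor_morphism\<close> produces a map with the conditions in the definition of
  \<open>tensor_map\<close>, so the map selected there has them too.\<close>

lemma tensor_map_props:
  assumes M: "line M" and N: "line N" and M': "line M'" and N': "line N'"
    and \<phi>: "mmor M M' \<phi>" and \<psi>: "mmor N N' \<psi>"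
  shows "mmor (tensor X M N) (tensor X M' N') (tensor_map X M M' N N' \<phi> \<psi>)"
    and "opn U ==> m \<in>: sec M U ==> n \<in>: sec N U ==>
      tensor_map X M M' N N' \<phi> \<psi> U (tens X M N U m n) = tens X M' N' U (\<phi> U m) (\<psi> U n)"
proof -
  have Mp: "mpre M'" and Np: "mpre N'" using M' N' by simp_all
  let ?F = "\<lambda>U m n. tens X M' N' U (\<phi> U m) (\<psi> U n)"
  have "\<exists>h. mmor (tensor X M N) (tensor X M' N') h \<and>
    (\<forall>U. opn U --> (\<forall>m\<in>carrier (sec M U). \<forall>n\<in>carrier (sec N U). h U (tens X M N U m n) = ?F U m n)) \<and>
    ((\<forall>U m n. gen M U m \<and> gen N U n --> gen (tensor X M' N') U (?F U m n)) -->
      miso (tensor X M N) (tensor X M' N') h)"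
    by (rule tensor_morphism[OF M N tensor_sheaf[OF Mp Np]])
      (use \<phi> \<psi> in \<open>simp_all add: tens_closed[OF Mp Np] tens_res[OF Mp Np] tens_smult[OF Mp Np] mm_res mm_smult\<close>)
  then have "\<exists>h. mmor (tensor X M N) (tensor X M' N') h \<and>
    (\<forall>U. opn U --> (\<forall>m\<in>carrier (sec M U). \<forall>n\<in>carrier (sec N U). h U (tens X M N U m n) = ?F U m n))" by auto
  note * = someI_ex[OF this, folded tensor_map_def]
  show "mmor (tensor X M N) (tensor X M' N') (tensor_map X M M' N N' \<phi> \<psi>)" using * by simp
  show "tensor_map X M M' N N' \<phi> \<psi> U (tens X M N U m n) = tens X M' N' U (\<phi> U m) (\<psi> U n)"
    if "opn U" "m \<in>: sec M U" "n \<in>: sec N U" using * that by simp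
qed

text \<open>The map selected by \<open>SOME\<close> is known on pure tensors only. The isomorphism
  \<open>h\<close> from \<open>tensor_morphism\<close> has the same values there, so both agree on
  all sections and bijectivity is inherited.\<close>

lemma tensor_map_iso:
  assumes M: "line M" and N: "line N" and M': "line M'" and N': "line N'"
    and \<phi>: "miso M M' \<phi>" and \<psi>: "miso N N' \<psi>"
  shows "miso (tensor X M N) (tensor X M' N') (tensor_map X M M' N N' \<phi> \<psi>)"
proof -
  have Mp: "mpre M'" and Np: "mpre N'" 
    and Mp0: "mpre M" and Np0: "mpre N" using M N M' N' by simp_all
  have \<phi>m: "mmor M M' \<phi>" and \<psi>m: "mmor N N' \<psi>" using \<phi> \<psi> by simp_all
  let ?F = "\<lambda>U m n. tens X M' N' U (\<phi> U m) (\<psi> U n)"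
  have "\<exists>h. mmor (tensor X M N) (tensor X M' N') h \<and>
    (\<forall>U. opn U --> (\<forall>m\<in>carrier (sec M U). \<forall>n\<in>carrier (sec N U). h U (tens X M N U m n) = ?F U m n)) \<and>
    ((\<forall>U m n. gen M U m \<and> gen N U n --> gen (tensor X M' N') U (?F U m n)) -->
      miso (tensor X M N) (tensor X M' N') h)"
    by (rule tensor_morphism[OF M N tensor_sheaf[OF Mp Np]])
      (use \<phi>m \<psi>m in \<open>simp_all add: tens_closed[OF Mp Np] tens_res[OF Mp Np] tens_smult[OF Mp Np] mm_res mm_smult\<close>)
  moreover have "gen (tensor X M' N') U (?F U m n)" if "gen M U m" "gen N U n" for U m n
    by (rule gen_tens[OF Mp Np gen_iso[OF Mp0 Mp \<phi> that(1)] gen_iso[OF Np0 Np \<psi> that(2)]])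
  ultimately obtain h where h: "miso (tensor X M N) (tensor X M' N') h"
    and hv: "\<forall>U. opn U --> (\<forall>m\<in>carrier (sec M U). \<forall>n\<in>carrier (sec N U). h U (tens X M N U m n) = ?F U m n)" by auto
  note tp = tensor_map_props[OF M N M' N' \<phi>m \<psi>m]
  have e: "tensor_map X M M' N N' \<phi> \<psi> U s = h U s" if "opn U" "s \<in>: sec (tensor X M N) U" for U s
    by (rule tensor_morphism_unique[OF M N tensor_sheaf[OF Mp Np] tp(1) mi_mm[OF h] _ that])
      (use tp(2) hv in simp)
  show ?thesis unfolding module_isomorphism_def
  proof (intro conjI allI impI tp(1))
    fix U assume U: "opn U"
    have "bij_betw (h U) (carrier (sec (tensor X M N) U)) (carrier (sec (tensor X M' N') U))"
      using h U by (simp add: module_isomorphism_def)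
    then show "bij_betw (tensor_map X M M' N N' \<phi> \<psi> U) (carrier (sec (tensor X M N) U)) (carrier (sec (tensor X M' N') U))"
      using bij_betw_cong[of "carrier (sec (tensor X M N) U)" "tensor_map X M M' N N' \<phi> \<psi> U" "h U"] e[OF U] by simp
  qed
qed

abbreviation "SO \<equiv> self_module (structure_sheaf X)"

lemma multiply_map_props:
  shows "miso (tensor X SO SO) SO (multiply_map X)"
    and "opn U ==> a \<in>: R U ==> b \<in>: R U ==> multiply_map X U (tens X SO SO U a b) = a \<otimes>[R U] b"
proof -
  have "\<exists>h. mmor (tensor X SO SO) SO h \<and>
    (\<forall>U. opn U --> (\<forall>m\<in>carrier (sec SO U). \<forall>n\<in>carrier (sec SO U). h U (tens X SO SO U m n) = m \<otimes>[R U] n)) \<and>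
    ((\<forall>U m n. gen SO U m \<and> gen SO U n --> gen SO U (m \<otimes>[R U] n)) --> miso (tensor X SO SO) SO h)"
  proof (rule tensor_morphism[OF self_invertible self_invertible self_sheaf])
    fix U m n a b assume U: "opn U"
    interpret cring "R U" using U by (rule R_cring)
    assume m: "m \<in>: sec SO U" "n \<in>: sec SO U"
    then show "m \<otimes>[R U] n \<in>: sec SO U" by simp
    fix V assume "opn V" "V \<subseteq> U"
    then show "res SO U V (m \<otimes>[R U] n) = res SO U V m \<otimes>[R V] res SO U V n" using U m by (simp add: rr_mult)
  next
    fix U m n a b assume U: "opn U" and m: "m \<in>: sec SO U" "n \<in>: sec SO U" and a: "a \<in>: R U" "b \<in>: R U"
    interpret cring "R U" using U by (rule R_cring)
    show "(a \<odot>[SO,U] m) \<otimes>[R U] (b \<odot>[SO,U] n) = (a \<otimes>[R U] b) \<odot>[SO,U] (m \<otimes>[R U] n)"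
      using m a by (simp add: m_ac)
  qed
  moreover have "gen SO U (m \<otimes>[R U] n)" if "gen SO U m" "gen SO U n" for U m n
    using gen_self_Units[OF that(1)] gen_self_Units[OF that(2)] gen_open[OF that(1)]
    by (intro gen_self) (auto intro: monoid.Units_m_closed simp: R_cring cring.axioms ring.is_monoid)
  ultimately have "\<exists>h. miso (tensor X SO SO) SO h \<and>
    (\<forall>U. opn U --> (\<forall>a\<in>carrier (R U). \<forall>b\<in>carrier (R U). h U (tens X SO SO U a b) = a \<otimes>[R U] b))" by auto
  note * = someI_ex[OF this]
  have d: "multiply_map X = (SOME h. miso (tensor X SO SO) SO h \<and>
    (\<forall>U. opn U --> (\<forall>a\<in>carrier (R U). \<forall>b\<in>carrier (R U). h U (tens X SO SO U a b) = a \<otimes>[R U] b)))"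
    by (simp add: multiply_map_def Let_def)
  show "miso (tensor X SO SO) SO (multiply_map X)" using * unfolding d by simp
  show "multiply_map X U (tens X SO SO U a b) = a \<otimes>[R U] b" if "opn U" "a \<in>: R U" "b \<in>: R U"
    using * that unfolding d by simp
qed

text \<open>The analogue of \<open>gen\<close> in rank 2: an isomorphism from the square of the
  structure sheaf to \<open>M\<close> over \<open>U\<close>.\<close>

definition basis2 :: "('p, 'r, 'm) module_presheaf => 'p set => 'm => 'm => bool" where
  "basis2 M U e f \<longleftrightarrow> opn U \<and> e \<in>: sec M U \<and> f \<in>: sec M U \<and> (\<forall>W. opn W \<and> W \<subseteq> U -->
     bij_betw (\<lambda>(a, b). a \<odot>[M,W] res M U W e \<oplus>[M,W] b \<odot>[M,W] res M U W f)
       (carrier (R W) \<times> carrier (R W)) (carrier (sec M W)))"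

lemma basis2_open [simp]: "basis2 M U e f ==> opn U" unfolding basis2_def by (elim conjE)
lemma basis2_closed [simp]: "basis2 M U e f ==> e \<in>: sec M U" "basis2 M U e f ==> f \<in>: sec M U"
  unfolding basis2_def by (elim conjE, assumption)+

context
  fixes M :: "('p, 'r, 'm) module_presheaf"
  assumes M: "mpre M"
begin

lemma basis2_res: "basis2 M U e f ==> opn W ==> W \<subseteq> U ==> basis2 M W (res M U W e) (res M U W f)"
  unfolding basis2_def using M by auto

lemma basis2_bij:
  assumes "basis2 M U e f"
  shows "bij_betw (\<lambda>(a, b). a \<odot>[M,U] e \<oplus>[M,U] b \<odot>[M,U] f)
       (carrier (R U) \<times> carrier (R U)) (carrier (sec M U))"
proof -
  have "bij_betw (\<lambda>(a, b). a \<odot>[M,U] res M U U e \<oplus>[M,U] b \<odot>[M,U] res M U U f)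
       (carrier (R U) \<times> carrier (R U)) (carrier (sec M U))" using assms unfolding basis2_def by blast
  then show ?thesis using mres_id[OF M basis2_open[OF assms]] basis2_closed[OF assms] by simp
qed

lemma basis2_coeff:
  assumes "basis2 M U e f" "m \<in>: sec M U"
  obtains a b where "a \<in>: R U" "b \<in>: R U" "m = a \<odot>[M,U] e \<oplus>[M,U] b \<odot>[M,U] f"
proof -
  have "m \<in> (\<lambda>(a, b). a \<odot>[M,U] e \<oplus>[M,U] b \<odot>[M,U] f) ` (carrier (R U) \<times> carrier (R U))"
    using basis2_bij[OF assms(1)] assms(2) by (simp add: bij_betw_def)
  then obtain ab where "ab \<in> carrier (R U) \<times> carrier (R U)"
    "m = (\<lambda>(a, b). a \<odot>[M,U] e \<oplus>[M,U] b \<odot>[M,U] f) ab" by blast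
  then show thesis using that[of "fst ab" "snd ab"] by (auto simp: case_prod_beta)
qed

lemma basis2_cancel:
  assumes b: "basis2 M U e f" and c: "a \<in>: R U" "b \<in>: R U" "a' \<in>: R U" "b' \<in>: R U"
    and e: "a \<odot>[M,U] e \<oplus>[M,U] b \<odot>[M,U] f = a' \<odot>[M,U] e \<oplus>[M,U] b' \<odot>[M,U] f"
  shows "a = a'" "b = b'"
  using inj_onD[OF bij_betw_imp_inj_on[OF basis2_bij[OF b]], of "(a, b)" "(a', b')"] c e by auto

lemma basis2I:
  assumes "opn U" "e \<in>: sec M U" "f \<in>: sec M U"
    and ex: "\<And>W m. opn W ==> W \<subseteq> U ==> m \<in>: sec M W ==> \<exists>a\<in>carrier (R W). \<exists>b\<in>carrier (R W).
       m = a \<odot>[M,W] res M U W e \<oplus>[M,W] b \<odot>[M,W] res M U W f"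
    and inj: "\<And>W a b a' b'. opn W ==> W \<subseteq> U ==> a \<in>: R W ==> b \<in>: R W ==> a' \<in>: R W ==> b' \<in>: R W ==>
       a \<odot>[M,W] res M U W e \<oplus>[M,W] b \<odot>[M,W] res M U W f =
       a' \<odot>[M,W] res M U W e \<oplus>[M,W] b' \<odot>[M,W] res M U W f ==> a = a' \<and> b = b'"
  shows "basis2 M U e f"
  unfolding basis2_def
proof (intro conjI allI impI assms(1-3); elim conjE)
  fix W assume W: "opn W" "W \<subseteq> U"
  let ?l = "\<lambda>(a, b). a \<odot>[M,W] res M U W e \<oplus>[M,W] b \<odot>[M,W] res M U W f"
  show "bij_betw ?l (carrier (R W) \<times> carrier (R W)) (carrier (sec M W))"
  proof (rule bij_betw_imageI)
    show "inj_on ?l (carrier (R W) \<times> carrier (R W))"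
      by (rule inj_onI) (use inj[OF W] in \<open>auto simp del: \<close>)
    show "?l ` (carrier (R W) \<times> carrier (R W)) = carrier (sec M W)"
    proof
      show "carrier (sec M W) \<subseteq> ?l ` (carrier (R W) \<times> carrier (R W))"
      proof
        fix m assume m: "m \<in>: sec M W"
        obtain a b where "a \<in>: R W" "b \<in>: R W" "m = ?l (a, b)" using ex[OF W m] by auto
        then show "m \<in> ?l ` (carrier (R W) \<times> carrier (R W))" by (intro image_eqI[of _ _ "(a, b)"]) auto
      qed
    qed (use M W assms(1-3) in auto)
  qed
qed

lemma sheaf_basis_2: "sheaf_basis X M 2 U e \<longleftrightarrow> basis2 M U (e 0) (e (Suc 0))"
proof -
  have "module_basis (R V) (sec M V) 2 (\<lambda>i. res M U V (e i)) \<longleftrightarrow>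
      bij_betw (\<lambda>(a, b). a \<odot>[M,V] res M U V (e 0) \<oplus>[M,V] b \<odot>[M,V] res M U V (e (Suc 0)))
       (carrier (R V) \<times> carrier (R V)) (carrier (sec M V))"
    if "opn U" "e 0 \<in>: sec M U" "e (Suc 0) \<in>: sec M U" "opn V" "V \<subseteq> U" for V
    by (rule module_basis_2[OF mp_module[OF M that(4)]]) (use that M in auto)
  then show ?thesis unfolding sheaf_basis_def basis2_def by (auto simp: less_2_cases_iff)
qed

lemma wedge2_sheaf: "msh (wedge2 X M)"
  unfolding wedge2_sheafify by (rule BS_sheaf[OF adm_wedge[OF M]])

lemma wedge_res: "opn U ==> opn V ==> V \<subseteq> U ==> m \<in>: sec M U ==> n \<in>: sec M U ==>
    res (wedge2 X M) U V (wedge X M U m n) = wedge X M V (res M U V m) (res M U V n)"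
  unfolding wedge_bt[OF M] wedge2_sheafify by (rule bt_res[OF adm_wedge[OF M]])

lemma wedge_alternating: "opn U ==> alternating (R U) (sec M U) (sec (wedge2 X M) U) (wedge X M U)"
proof -
  assume U: "opn U"
  let ?E = "\<lambda>U. alt_rel (R U) (sec M U)"
  note a = adm_wedge[OF M]
  interpret bilin_data "R U" "sec M U" "sec M U" "?E U" by (rule adm_bd[OF a U])
  have "bt M M ?E U x x = \<zero>[sec (sheafify X (bilin_presheaf X M M ?E)) U]" if "x \<in>: sec M U" for x
  proof -
    have "frag_of (x, x) \<in> ?E U"
      unfolding alt_rel_def using that U M R_cring[OF U] msmult_one[OF M U that]
      by (auto intro!: exI[of _ "\<one>[R U]"] exI[of _ x])
    then have "bilin_coset (R U) (sec M U) (sec M U) (?E U) (frag_of (x, x)) = \<zero>[sec (bilin_presheaf X M M ?E) U]"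
      using E_pt_zero[of x x] BP_sec[OF a] unfolding pt_def by simp
    then show ?thesis unfolding bt_def[OF a] S_zero_eq[OF BP_presheaf[OF a]] by simp
  qed
  then show ?thesis
    unfolding wedge_bt[OF M] wedge2_sheafify alternating_def alternating_axioms_def
    using mp_module[OF M U] mp_module[OF ms_mp[OF BS_sheaf[OF a]] U] U
      bt_closed[OF a U] bt_add_l[OF a U] bt_add_r[OF a U] bt_smult_l[OF a U] bt_smult_r[OF a U] by simp
qed

lemma wedge_closed: "opn U ==> m \<in>: sec M U ==> n \<in>: sec M U ==>
    wedge X M U m n \<in>: sec (wedge2 X M) U"
  using alternating.w_closed[OF wedge_alternating] by blast

lemma gen_wedge:
  assumes b: "basis2 M U e f" shows "gen (wedge2 X M) U (wedge X M U e f)"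
  unfolding wedge_bt[OF M] wedge2_sheafify
proof (rule gen_bt[OF adm_wedge[OF M] basis2_open[OF b] basis2_closed[OF b]])
  fix W assume W: "opn W" "W \<subseteq> U"
  show "bij_betw (\<lambda>a. a \<odot>[bilin_quot (R W) (sec M W) (sec M W) (alt_rel (R W) (sec M W))]
     bilin_data.pt (R W) (sec M W) (sec M W) (alt_rel (R W) (sec M W)) (res M U W e) (res M U W f))
     (carrier (R W)) (carrier (bilin_quot (R W) (sec M W) (sec M W) (alt_rel (R W) (sec M W))))"
    by (rule wedge_bij[OF adm_bd[OF adm_wedge[OF M] W(1)]])
      (use basis2_closed[OF basis2_res[OF b W]] basis2_bij[OF basis2_res[OF b W]] in auto)
qed

end

lemma locally_free_2_iff:
  "locally_free X 2 M \<longleftrightarrow> msh M \<and> (\<forall>p\<in>whole X. \<exists>U e f. p \<in> U \<and> basis2 M U e f)"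
proof (cases "msh M")
  case True
  have "(\<exists>e. sheaf_basis X M 2 U e) \<longleftrightarrow> (\<exists>e f. basis2 M U e f)" for U
  proof
    assume "\<exists>e f. basis2 M U e f"
    then obtain e f where "basis2 M U e f" by auto
    then have "sheaf_basis X M 2 U (\<lambda>i. if i = 0 then e else f)" using True by (simp add: sheaf_basis_2)
    then show "\<exists>e. sheaf_basis X M 2 U e" by blast
  qed (use True in \<open>auto simp: sheaf_basis_2\<close>)
  then show ?thesis unfolding locally_free_def using True by (simp only: ex_simps)
qed (simp add: locally_free_def)

lemma basis2_within:
  assumes M: "locally_free X 2 M" and U: "opn U" "p \<in> U"
  shows "\<exists>V e f. opn V \<and> p \<in> V \<and> V \<subseteq> U \<and> basis2 M V e f"
proof -
  have "p \<in> whole X" using U openin_subset by blast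
  then obtain V e f where V: "p \<in> V" "basis2 M V e f" using M by (auto simp: locally_free_2_iff)
  have "basis2 M (V \<inter> U) (res M V (V \<inter> U) e) (res M V (V \<inter> U) f)"
    by (rule basis2_res[OF _ V(2)]) (use V U M in \<open>auto simp: locally_free_2_iff\<close>)
  then show ?thesis using V U by (intro exI[of _ "V \<inter> U"]) auto
qed

lemma wedge2_invertible:
  assumes M: "locally_free X 2 M" shows "line (wedge2 X M)"
proof -
  have Mp: "mpre M" using M by (simp add: locally_free_2_iff)
  show ?thesis unfolding invertible_iff using wedge2_sheaf[OF Mp] gen_wedge[OF Mp] M
    unfolding locally_free_2_iff by metis
qed

lemma basis2_iso:
  assumes M: "mpre M" "mpre N" and i: "miso M N \<phi>" and b: "basis2 M U e f"
  shows "basis2 N U (\<phi> U e) (\<phi> U f)"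
proof (rule basis2I[OF M(2)])
  have mm: "mmor M N \<phi>" using i by simp
  note U = basis2_open[OF b] and ef = basis2_closed[OF b]
  show "opn U" "\<phi> U e \<in>: sec N U" "\<phi> U f \<in>: sec N U" using U ef mm by auto
  fix W assume W: "opn W" "W \<subseteq> U"
  note bW = basis2_res[OF M(1) b W]
  note eW = basis2_closed[OF bW]
  have r: "res N U W (\<phi> U e) = \<phi> W (res M U W e)" "res N U W (\<phi> U f) = \<phi> W (res M U W f)"
    using mm_res[OF mm U W] ef by auto
  have l: "a \<odot>[N,W] res N U W (\<phi> U e) \<oplus>[N,W] b \<odot>[N,W] res N U W (\<phi> U f) =
    \<phi> W (a \<odot>[M,W] res M U W e \<oplus>[M,W] b \<odot>[M,W] res M U W f)"
    if "a \<in>: R W" "b \<in>: R W" for a b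
    unfolding r using that eW W M by (simp add: mm_add[OF mm] mm_smult[OF mm])
  { fix m assume "m \<in>: sec N W"
    then obtain m' where m': "m' \<in>: sec M W" "m = \<phi> W m'" using mi_surj[OF i W(1)] by blast
    obtain a b where ab: "a \<in>: R W" "b \<in>: R W" "m' = a \<odot>[M,W] res M U W e \<oplus>[M,W] b \<odot>[M,W] res M U W f"
      by (rule basis2_coeff[OF M(1) bW m'(1)])
    then show "\<exists>a\<in>carrier (R W). \<exists>b\<in>carrier (R W).
       m = a \<odot>[N,W] res N U W (\<phi> U e) \<oplus>[N,W] b \<odot>[N,W] res N U W (\<phi> U f)" using l[OF ab(1,2)] ab m'(2) by (intro bexI[of _ a] bexI[of _ b]) auto }
  fix a b a' b' assume c: "a \<in>: R W" "b \<in>: R W" "a' \<in>: R W" "b' \<in>: R W"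
    and e: "a \<odot>[N,W] res N U W (\<phi> U e) \<oplus>[N,W] b \<odot>[N,W] res N U W (\<phi> U f) =
       a' \<odot>[N,W] res N U W (\<phi> U e) \<oplus>[N,W] b' \<odot>[N,W] res N U W (\<phi> U f)"
  have "a \<odot>[M,W] res M U W e \<oplus>[M,W] b \<odot>[M,W] res M U W f =
      a' \<odot>[M,W] res M U W e \<oplus>[M,W] b' \<odot>[M,W] res M U W f"
    by (rule mi_inj[OF i W(1)]) (use e l c eW M W in auto)
  from basis2_cancel[OF M(1) bW c this] show "a = a' \<and> b = b'" by simp
qed

text \<open>A change of basis multiplies e \<and> f and \<phi>(e) \<and> \<phi>(f) by the same
  determinant (\<open>det\<close>), so bases supply frames. The same determinant gives the formula
  for arbitrary x and y, which in turn shows that the selected map takes bases to bases and is an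
  isomorphism.\<close>

lemma wedge2_map_props:
  assumes M: "locally_free X 2 M" and N: "locally_free X 2 N" and i: "miso M N \<phi>"
  shows "miso (wedge2 X M) (wedge2 X N) (wedge2_map X M N \<phi>)"
    and "opn U ==> x \<in>: sec M U ==> y \<in>: sec M U ==>
      wedge2_map X M N \<phi> U (wedge X M U x y) = wedge X N U (\<phi> U x) (\<phi> U y)"
proof -
  have Mp: "mpre M" and Np: "mpre N" using M N by (simp_all add: locally_free_2_iff)
  have mm: "mmor M N \<phi>" using i by simp
  note T = wedge2_sheaf[OF Mp] and K = wedge2_sheaf[OF Np]
  define Fr where "Fr = (\<lambda>V g g'. \<exists>e f. basis2 M V e f \<and> g = wedge X M V e f \<and> g' = wedge X N V (\<phi> V e) (\<phi> V f))"
  have det: "wedge X M V (a \<odot>[M,V] e \<oplus>[M,V] b \<odot>[M,V] f) (c \<odot>[M,V] e \<oplus>[M,V] d \<odot>[M,V] f) =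
      (a \<otimes>[R V] d \<ominus>[R V] b \<otimes>[R V] c) \<odot>[wedge2 X M,V] wedge X M V e f"
    "wedge X N V (\<phi> V (a \<odot>[M,V] e \<oplus>[M,V] b \<odot>[M,V] f)) (\<phi> V (c \<odot>[M,V] e \<oplus>[M,V] d \<odot>[M,V] f)) =
      (a \<otimes>[R V] d \<ominus>[R V] b \<otimes>[R V] c) \<odot>[wedge2 X N,V] wedge X N V (\<phi> V e) (\<phi> V f)"
    if V: "opn V" and e: "e \<in>: sec M V" "f \<in>: sec M V"
      and a: "a \<in>: R V" "b \<in>: R V" "c \<in>: R V" "d \<in>: R V" for V e f a b c d
  proof -
    show "wedge X M V (a \<odot>[M,V] e \<oplus>[M,V] b \<odot>[M,V] f) (c \<odot>[M,V] e \<oplus>[M,V] d \<odot>[M,V] f) =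
      (a \<otimes>[R V] d \<ominus>[R V] b \<otimes>[R V] c) \<odot>[wedge2 X M,V] wedge X M V e f"
      by (rule alternating.w_det[OF wedge_alternating[OF Mp V] e a])
    have "\<phi> V (a \<odot>[M,V] e \<oplus>[M,V] b \<odot>[M,V] f) = a \<odot>[N,V] \<phi> V e \<oplus>[N,V] b \<odot>[N,V] \<phi> V f"
      if "a \<in>: R V" "b \<in>: R V" for a b using e that V Mp by (simp add: mm_add[OF mm] mm_smult[OF mm])
    then show "wedge X N V (\<phi> V (a \<odot>[M,V] e \<oplus>[M,V] b \<odot>[M,V] f)) (\<phi> V (c \<odot>[M,V] e \<oplus>[M,V] d \<odot>[M,V] f)) =
      (a \<otimes>[R V] d \<ominus>[R V] b \<otimes>[R V] c) \<odot>[wedge2 X N,V] wedge X N V (\<phi> V e) (\<phi> V f)"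
      using alternating.w_det[OF wedge_alternating[OF Np V] mm_closed[OF mm V e(1)] mm_closed[OF mm V e(2)] a] a by simp
  qed
  have cov: "\<exists>V e f. opn V \<and> p \<in> V \<and> V \<subseteq> U \<and> basis2 M V e f" if "opn U" "p \<in> U" for p U
    using basis2_within[OF M that] .
  have FrE: "\<exists>e f. basis2 M V e f \<and> g = wedge X M V e f \<and> g' = wedge X N V (\<phi> V e) (\<phi> V f)" if "Fr V g g'" for V g g'
    using that unfolding Fr_def .
  have fr: "frames (wedge2 X M) (wedge2 X N) Fr"
  proof (rule framesI)
    fix V g g' assume "Fr V g g'"
    then obtain e f where e: "basis2 M V e f" "g = wedge X M V e f" "g' = wedge X N V (\<phi> V e) (\<phi> V f)" using FrE by blast
    note V = basis2_open[OF e(1)] and ec = basis2_closed[OF e(1)]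
    show "gen (wedge2 X M) V g \<and> g' \<in>: sec (wedge2 X N) V"
      using gen_wedge[OF Mp e(1)] e wedge_closed[OF Np V] mm_closed[OF mm V] ec by simp
    fix W assume W: "opn W" "W \<subseteq> V"
    show "Fr W (res (wedge2 X M) V W g) (res (wedge2 X N) V W g')"
      unfolding Fr_def by (rule exI[of _ "res M V W e"], rule exI[of _ "res M V W f"]) (use basis2_res[OF Mp e(1) W] e(2,3) wedge_res[OF Mp V W ec]
        wedge_res[OF Np V W mm_closed[OF mm V ec(1)] mm_closed[OF mm V ec(2)]] mm_res[OF mm V W] ec in auto)
  next
    fix p assume p: "p \<in> whole X"
    obtain V e f where V: "p \<in> V" "basis2 M V e f" using cov[OF openin_topspace p] by auto
    then have "Fr V (wedge X M V e f) (wedge X N V (\<phi> V e) (\<phi> V f))" unfolding Fr_def by blast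
    then show "\<exists>V g g'. p \<in> V \<and> Fr V g g'" using V by blast
  next
    fix V g g' h h' k assume "Fr V g g'" "Fr V h h'" and k: "k \<in>: R V" "g = k \<odot>[wedge2 X M,V] h"
    then obtain e f e2 f2 where e: "basis2 M V e f" "g = wedge X M V e f" "g' = wedge X N V (\<phi> V e) (\<phi> V f)"
      and e2: "basis2 M V e2 f2" "h = wedge X M V e2 f2" "h' = wedge X N V (\<phi> V e2) (\<phi> V f2)" using FrE by metis
    note V = basis2_open[OF e(1)]
    interpret cring "R V" using V by (rule R_cring)
    obtain a b where a: "a \<in>: R V" "b \<in>: R V" "e = a \<odot>[M,V] e2 \<oplus>[M,V] b \<odot>[M,V] f2"
      by (rule basis2_coeff[OF Mp e2(1) basis2_closed(1)[OF e(1)]])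
    obtain c d where c: "c \<in>: R V" "d \<in>: R V" "f = c \<odot>[M,V] e2 \<oplus>[M,V] d \<odot>[M,V] f2"
      by (rule basis2_coeff[OF Mp e2(1) basis2_closed(2)[OF e(1)]])
    note dd = det[OF V basis2_closed[OF e2(1)] a(1,2) c(1,2)]
    have "a \<otimes>[R V] d \<ominus>[R V] b \<otimes>[R V] c = k"
      using gen_cancel[OF ms_mp[OF T] gen_wedge[OF Mp e2(1)]] dd(1) k a(1,2) c(1,2) e(2) e2(2)
      unfolding a(3)[symmetric] c(3)[symmetric] by simp
    then show "g' = k \<odot>[wedge2 X N,V] h'" using dd(2) e(3) e2(3) unfolding a(3)[symmetric] c(3)[symmetric] by simp
  qed
  obtain h where h: "mmor (wedge2 X M) (wedge2 X N) h" "\<And>V g g'. Fr V g g' ==> h V g = g'"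
    using line_morphism[OF ms_mp[OF T] K fr] by auto
  have hv: "h U (wedge X M U x y) = wedge X N U (\<phi> U x) (\<phi> U y)"
    if U: "opn U" and x: "x \<in>: sec M U" and y: "y \<in>: sec M U" for U x y
  proof (rule sheaf_eqI[OF ms_sheaf[OF K] U])
    have \<phi>xy: "\<phi> U x \<in>: sec N U" "\<phi> U y \<in>: sec N U" using mm_closed[OF mm U] x y by auto
    show "h U (wedge X M U x y) \<in>: sec (wedge2 X N) U" "wedge X N U (\<phi> U x) (\<phi> U y) \<in>: sec (wedge2 X N) U"
      using mm_closed[OF h(1) U wedge_closed[OF Mp U x y]] wedge_closed[OF Np U \<phi>xy] by auto
    fix p assume p: "p \<in> U"
    obtain V e f where V: "opn V" "p \<in> V" "V \<subseteq> U" "basis2 M V e f" using cov[OF U p] by auto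
    obtain a b where a: "a \<in>: R V" "b \<in>: R V" "res M U V x = a \<odot>[M,V] e \<oplus>[M,V] b \<odot>[M,V] f"
      by (rule basis2_coeff[OF Mp V(4) mres_closed[OF Mp U V(1,3) x]])
    obtain c d where c: "c \<in>: R V" "d \<in>: R V" "res M U V y = c \<odot>[M,V] e \<oplus>[M,V] d \<odot>[M,V] f"
      by (rule basis2_coeff[OF Mp V(4) mres_closed[OF Mp U V(1,3) y]])
    interpret cring "R V" using V(1) by (rule R_cring)
    note dd = det[OF V(1) basis2_closed[OF V(4)] a(1,2) c(1,2), folded a(3) c(3)]
    have hg: "h V (wedge X M V e f) = wedge X N V (\<phi> V e) (\<phi> V f)" by (rule h(2)) (use V in \<open>auto simp: Fr_def\<close>)
    have "res (wedge2 X N) U V (h U (wedge X M U x y)) = h V (wedge X M V (res M U V x) (res M U V y))"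
      using mm_res[OF h(1) U V(1,3) wedge_closed[OF Mp U x y]] wedge_res[OF Mp U V(1,3) x y] by simp
    also have "\<dots> = (a \<otimes>[R V] d \<ominus>[R V] b \<otimes>[R V] c) \<odot>[wedge2 X N,V] wedge X N V (\<phi> V e) (\<phi> V f)"
      using dd(1) mm_smult[OF h(1) V(1) _ wedge_closed[OF Mp V(1) basis2_closed[OF V(4)]]] a(1,2) c(1,2) hg by simp
    also have "\<dots> = res (wedge2 X N) U V (wedge X N U (\<phi> U x) (\<phi> U y))"
      using dd(2) wedge_res[OF Np U V(1,3) \<phi>xy] mm_res[OF mm U V(1,3)] x y by simp
    finally show "\<exists>W. opn W \<and> p \<in> W \<and> W \<subseteq> U \<and> res (wedge2 X N) U W (h U (wedge X M U x y)) =
        res (wedge2 X N) U W (wedge X N U (\<phi> U x) (\<phi> U y))" using V by blast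
  qed
  then have "\<exists>h. mmor (wedge2 X M) (wedge2 X N) h \<and>
    (\<forall>U. opn U --> (\<forall>x\<in>carrier (sec M U). \<forall>y\<in>carrier (sec M U).
       h U (wedge X M U x y) = wedge X N U (\<phi> U x) (\<phi> U y)))" using h(1) by auto
  note * = someI_ex[OF this, folded wedge2_map_def]
  show **: "wedge2_map X M N \<phi> U (wedge X M U x y) = wedge X N U (\<phi> U x) (\<phi> U y)"
    if "opn U" "x \<in>: sec M U" "y \<in>: sec M U" for U x y using * that by simp
  show "miso (wedge2 X M) (wedge2 X N) (wedge2_map X M N \<phi>)"
  proof (rule line_isomorphism[OF T K fr])
    fix V g g' assume "Fr V g g'"
    then obtain e f where e: "basis2 M V e f" "g = wedge X M V e f" "g' = wedge X N V (\<phi> V e) (\<phi> V f)" using FrE by blast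
    show "gen (wedge2 X N) V g'" unfolding e(3) by (rule gen_wedge[OF Np basis2_iso[OF Mp Np i e(1)]])
    show "wedge2_map X M N \<phi> V g = g'" unfolding e using ** basis2_open[OF e(1)] basis2_closed[OF e(1)] by simp
  qed (use * in simp)
qed

end

section \<open>Duals\<close>

context ringed
begin

lemma open_subspace_simps:
  "opn U ==> is_open (open_subspace X U) V \<longleftrightarrow> opn V \<and> V \<subseteq> U"
  "structure_sheaf (open_subspace X U) = structure_sheaf X"
  by (simp_all add: open_subspace_def openin_open_subtopology)

text \<open>These are the linear families that become sections of the dual after normalisation by
  \<open>cut\<close>. Linear algebra is done with them, and \<open>cut_closed\<close> transfers the
  result.\<close>

definition form :: "('p, 'r, 'm) module_presheaf => 'p set => ('p set => 'm => 'r) => bool" where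
  "form M U \<phi> \<longleftrightarrow> (\<forall>V. opn V \<and> V \<subseteq> U --> is_linear (R V) (sec M V) (sec SO V) (\<phi> V)) \<and>
    (\<forall>V W. opn V \<and> opn W \<and> V \<subseteq> U \<and> W \<subseteq> V --> (\<forall>m\<in>carrier (sec M V). \<phi> W (res M V W m) = rr V W (\<phi> V m)))"

lemma dual_carrier: "opn U ==> \<phi> \<in>: sec (dual X M) U \<longleftrightarrow> form M U \<phi> \<and> cut X M U \<phi> = \<phi>"
  unfolding dual_def form_def module_morphism_def by (auto simp: open_subspace_simps)

lemma form_closed: "form M U \<phi> ==> opn V ==> V \<subseteq> U ==> m \<in>: sec M V ==> \<phi> V m \<in>: R V"
  unfolding form_def is_linear_def by auto
lemma form_add: "form M U \<phi> ==> opn V ==> V \<subseteq> U ==> m \<in>: sec M V ==> n \<in>: sec M V ==>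
   \<phi> V (m \<oplus>[M,V] n) = \<phi> V m \<oplus>[R V] \<phi> V n"
  unfolding form_def is_linear_def by auto
lemma form_smult: "form M U \<phi> ==> opn V ==> V \<subseteq> U ==> a \<in>: R V ==> m \<in>: sec M V ==>
   \<phi> V (a \<odot>[M,V] m) = a \<otimes>[R V] \<phi> V m"
  unfolding form_def is_linear_def by auto
lemma form_res: "form M U \<phi> ==> opn V ==> opn W ==> V \<subseteq> U ==> W \<subseteq> V ==> m \<in>: sec M V ==>
   \<phi> W (res M V W m) = rr V W (\<phi> V m)"
  unfolding form_def by auto

lemma formI:
  assumes "\<And>V m. opn V ==> V \<subseteq> U ==> m \<in>: sec M V ==> \<phi> V m \<in>: R V"
    "\<And>V m n. opn V ==> V \<subseteq> U ==> m \<in>: sec M V ==> n \<in>: sec M V ==> \<phi> V (m \<oplus>[M,V] n) = \<phi> V m \<oplus>[R V] \<phi> V n"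
    "\<And>V a m. opn V ==> V \<subseteq> U ==> a \<in>: R V ==> m \<in>: sec M V ==> \<phi> V (a \<odot>[M,V] m) = a \<otimes>[R V] \<phi> V m"
    "\<And>V W m. opn V ==> opn W ==> V \<subseteq> U ==> W \<subseteq> V ==> m \<in>: sec M V ==> \<phi> W (res M V W m) = rr V W (\<phi> V m)"
  shows "form M U \<phi>"
  unfolding form_def is_linear_def using assms by auto

lemma cut_eval: "opn V ==> V \<subseteq> U ==> m \<in>: sec M V ==> cut X M U \<phi> V m = \<phi> V m"
  by (simp add: cut_def)

lemma cut_cong: "(\<And>V m. opn V ==> V \<subseteq> U ==> m \<in>: sec M V ==> \<phi> V m = \<psi> V m) ==> cut X M U \<phi> = cut X M U \<psi>"
  by (auto simp: cut_def fun_eq_iff)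

lemma cut_cut: "V \<subseteq> U ==> cut X M V (cut X M U \<phi>) = cut X M V \<phi>"
  by (rule cut_cong) (auto simp: cut_eval)

lemma form_subset: "form M U \<phi> ==> V \<subseteq> U ==> form M V \<phi>"
  unfolding form_def by (meson order_trans)

lemma dual_sec_simps:
  "\<phi> \<oplus>[dual X M,U] \<psi> = cut X M U (\<lambda>V m. \<phi> V m \<oplus>[R V] \<psi> V m)"
  "a \<odot>[dual X M,U] \<psi> = cut X M U (\<lambda>V m. rr U V a \<otimes>[R V] \<psi> V m)"
  "\<zero>[sec (dual X M) U] = cut X M U (\<lambda>V m. \<zero>[R V])"
  "res (dual X M) U V \<phi> = cut X M V \<phi>"
  by (simp_all add: dual_def)

lemma dual_ext:
  assumes "opn U" "\<phi> \<in>: sec (dual X M) U" "\<psi> \<in>: sec (dual X M) U"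
    "\<And>V m. opn V ==> V \<subseteq> U ==> m \<in>: sec M V ==> \<phi> V m = \<psi> V m"
  shows "\<phi> = \<psi>"
proof -
  have "cut X M U \<phi> = cut X M U \<psi>" by (rule cut_cong) (rule assms(4))
  then show ?thesis using assms(1-3) by (simp add: dual_carrier)
qed

lemma dual_form: "opn U ==> \<phi> \<in>: sec (dual X M) U ==> form M U \<phi>"
  by (simp add: dual_carrier)

context
  fixes M :: "('p, 'r, 'm) module_presheaf"
  assumes M: "mpre M"
begin

lemma cut_closed: "opn U ==> form M U \<phi> ==> cut X M U \<phi> \<in>: sec (dual X M) U"
proof -
  assume U: "opn U" and f: "form M U \<phi>"
  have "form M U (cut X M U \<phi>)"
  proof (rule formI)
    fix V W m assume V: "opn V" "opn W" "V \<subseteq> U" "W \<subseteq> V" and m: "m \<in>: sec M V"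
    have "W \<subseteq> U" using V by auto
    then show "cut X M U \<phi> W (res M V W m) = rr V W (cut X M U \<phi> V m)"
      using form_res[OF f V m] V m mres_closed[OF M V(1,2,4) m] by (simp add: cut_eval)
  qed (use f M in \<open>auto simp: cut_eval form_closed form_add form_smult\<close>)
  then show ?thesis using U by (simp add: dual_carrier cut_cut)
qed

lemma form_add_form: "opn U ==> form M U \<phi> ==> form M U \<psi> ==> form M U (\<lambda>V m. \<phi> V m \<oplus>[R V] \<psi> V m)"
proof -
  assume U: "opn U" and f: "form M U \<phi>" and g: "form M U \<psi>"
  show ?thesis
  proof (rule formI)
    fix V m assume V: "opn V" "V \<subseteq> U" and m: "m \<in>: sec M V"
    interpret cring "R V" using V(1) by (rule R_cring)
    note [simp] = form_closed[OF f V] form_closed[OF g V] form_add[OF f V] form_add[OF g V] form_smult[OF f V] form_smult[OF g V]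
    show "\<phi> V m \<oplus>[R V] \<psi> V m \<in>: R V" using m by simp
    { fix n assume n: "n \<in>: sec M V"
      show "\<phi> V (m \<oplus>[M,V] n) \<oplus>[R V] \<psi> V (m \<oplus>[M,V] n) = \<phi> V m \<oplus>[R V] \<psi> V m \<oplus>[R V] (\<phi> V n \<oplus>[R V] \<psi> V n)"
        using m n by (simp add: a_ac) }
    { fix a assume a: "a \<in>: R V"
      show "\<phi> V (a \<odot>[M,V] m) \<oplus>[R V] \<psi> V (a \<odot>[M,V] m) = a \<otimes>[R V] (\<phi> V m \<oplus>[R V] \<psi> V m)"
        using m a by (simp add: r_distr) }
    fix W assume W: "opn W" "W \<subseteq> V"
    show "\<phi> W (res M V W m) \<oplus>[R W] \<psi> W (res M V W m) = rr V W (\<phi> V m \<oplus>[R V] \<psi> V m)"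
      using m W V by (simp add: form_res[OF f] form_res[OF g] rr_add)
  qed
qed

lemma form_smult_form: "opn U ==> b \<in>: R U ==> form M U \<phi> ==> form M U (\<lambda>V m. rr U V b \<otimes>[R V] \<phi> V m)"
proof -
  assume U: "opn U" and f: "form M U \<phi>" and b: "b \<in>: R U"
  show ?thesis
  proof (rule formI)
    fix V m assume V: "opn V" "V \<subseteq> U" and m: "m \<in>: sec M V"
    interpret cring "R V" using V(1) by (rule R_cring)
    note [simp] = form_closed[OF f V] form_add[OF f V] form_smult[OF f V] rr_closed[OF U V b]
    show "rr U V b \<otimes>[R V] \<phi> V m \<in>: R V" using m by simp
    { fix n assume n: "n \<in>: sec M V"
      show "rr U V b \<otimes>[R V] \<phi> V (m \<oplus>[M,V] n) = rr U V b \<otimes>[R V] \<phi> V m \<oplus>[R V] rr U V b \<otimes>[R V] \<phi> V n"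
        using m n by (simp add: r_distr) }
    { fix a assume a: "a \<in>: R V"
      show "rr U V b \<otimes>[R V] \<phi> V (a \<odot>[M,V] m) = a \<otimes>[R V] (rr U V b \<otimes>[R V] \<phi> V m)"
        using m a by (simp add: m_lcomm) }
    fix W assume W: "opn W" "W \<subseteq> V"
    show "rr U W b \<otimes>[R W] \<phi> W (res M V W m) = rr V W (rr U V b \<otimes>[R V] \<phi> V m)"
      using m W V U b by (simp add: form_res[OF f] rr_mult)
  qed
qed

lemma form_zero_form: "form M U (\<lambda>V m. \<zero>[R V])"
proof (rule formI)
  fix V assume "opn V"
  then interpret cring "R V" by (rule R_cring)
  show "\<zero>[R V] \<in>: R V" "\<zero>[R V] = \<zero>[R V] \<oplus>[R V] \<zero>[R V]" by auto
  show "\<zero>[R V] = a \<otimes>[R V] \<zero>[R V]" if "a \<in>: R V" for a using that by auto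
qed auto

lemma dual_presheaf: "mpre (dual X M)"
  unfolding is_module_presheaf_def is_presheaf_def
proof (intro conjI allI impI ballI; (elim conjE)?)
  let ?D = "dual X M"
  { fix U V assume UV: "opn U" "opn V" "V \<subseteq> U"
    show "res ?D U V \<in> carrier (sec ?D U) \<rightarrow> carrier (sec ?D V)"
      unfolding dual_sec_simps by (rule funcsetI) (rule cut_closed[OF UV(2) form_subset[OF dual_form[OF UV(1)] UV(3)]]) }
  { fix U s assume "opn U" "s \<in>: sec ?D U"
    then show "res ?D U U s = s" unfolding dual_sec_simps by (simp add: dual_carrier) }
  { fix U V W :: "'p set" and s assume "W \<subseteq> V"
    then show "res ?D V W (res ?D U V s) = res ?D U W s" unfolding dual_sec_simps by (simp add: cut_cut) }
  { fix U V \<phi> \<psi> assume UV: "opn U" "opn V" "V \<subseteq> U"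
    show "res ?D U V (\<phi> \<oplus>[?D,U] \<psi>) = res ?D U V \<phi> \<oplus>[?D,V] res ?D U V \<psi>"
      unfolding dual_sec_simps cut_cut[OF UV(3)] by (rule cut_cong) (simp add: cut_eval) }
  { fix U V a \<phi> assume UV: "opn U" "opn V" "V \<subseteq> U" and a: "a \<in>: R U"
    show "res ?D U V (a \<odot>[?D,U] \<phi>) = rr U V a \<odot>[?D,V] res ?D U V \<phi>"
      unfolding dual_sec_simps cut_cut[OF UV(3)] by (rule cut_cong) (use UV a in \<open>simp add: cut_eval\<close>) }
  fix U assume U: "opn U"
  interpret RU: cring "R U" using U by (rule R_cring)
  note add_c = cut_closed[OF U form_add_form[OF U dual_form[OF U] dual_form[OF U]]]
  note sm_c = cut_closed[OF U form_smult_form[OF U _ dual_form[OF U]]]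
  have ext: "cut X M U \<phi> = cut X M U \<psi>" if "\<And>V m. opn V ==> V \<subseteq> U ==> m \<in>: sec M V ==> cring (R V) ==> \<phi> V m = \<psi> V m" for \<phi> \<psi>
    by (rule cut_cong) (use that R_cring in blast)
  have ext': "cut X M U \<phi> = \<psi>" if "\<psi> \<in>: sec ?D U" "\<And>V m. opn V ==> V \<subseteq> U ==> m \<in>: sec M V ==> cring (R V) ==> \<phi> V m = \<psi> V m" for \<phi> \<psi>
    using ext[OF that(2)] that(1) U by (simp add: dual_carrier)
  note fc = form_closed[OF dual_form[OF U]]
  have cr: "ring (R V) \<and> abelian_monoid (R V) \<and> monoid (R V)" if "cring (R V)" for V
    using that by (simp add: cring_def ring_def abelian_group_def)
  show "Module.module (R U) (sec ?D U)"
  proof (rule moduleI, rule RU.is_cring, rule abelian_groupI)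
    fix x assume x: "x \<in>: sec ?D U"
    show "\<zero>[sec ?D U] \<oplus>[?D,U] x = x" unfolding dual_sec_simps
      by (rule ext'[OF x]) (use fc[OF x] cr in \<open>simp add: cut_eval abelian_monoid.l_zero\<close>)
    show "\<one>[R U] \<odot>[?D,U] x = x" unfolding dual_sec_simps
      by (rule ext'[OF x]) (use fc[OF x] cr U in \<open>simp add: monoid.l_one\<close>)
    show "\<exists>y\<in>carrier (sec ?D U). y \<oplus>[?D,U] x = \<zero>[sec ?D U]"
    proof (rule bexI[of _ "(\<ominus>[R U] \<one>[R U]) \<odot>[?D,U] x"])
      show "(\<ominus>[R U] \<one>[R U]) \<odot>[?D,U] x \<oplus>[?D,U] x = \<zero>[sec ?D U]"
        unfolding dual_sec_simps
      proof (rule ext)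
        fix V m assume V: "opn V" "V \<subseteq> U" and m: "m \<in>: sec M V"
        interpret cring "R V" using V(1) by (rule R_cring)
        show "cut X M U (\<lambda>V m. rr U V (\<ominus>[R U] \<one>[R U]) \<otimes>[R V] x V m) V m \<oplus>[R V] x V m = \<zero>[R V]"
          using fc[OF x V m] V m U by (simp add: cut_eval rr_uminus l_minus l_neg)
      qed
      show "(\<ominus>[R U] \<one>[R U]) \<odot>[?D,U] x \<in>: sec ?D U" unfolding dual_sec_simps by (rule sm_c) (use x in auto)
    qed
    { fix a assume a: "a \<in>: R U"
      show "a \<odot>[?D,U] x \<in>: sec ?D U" unfolding dual_sec_simps by (rule sm_c[OF a x])
      fix b assume b: "b \<in>: R U"
      show "(a \<otimes>[R U] b) \<odot>[?D,U] x = a \<odot>[?D,U] (b \<odot>[?D,U] x)" unfolding dual_sec_simps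
      proof (rule ext)
        fix V m assume V: "opn V" "V \<subseteq> U" and m: "m \<in>: sec M V"
        interpret cring "R V" using V(1) by (rule R_cring)
        show "rr U V (a \<otimes>[R U] b) \<otimes>[R V] x V m = rr U V a \<otimes>[R V] cut X M U (\<lambda>V m. rr U V b \<otimes>[R V] x V m) V m"
          using fc[OF x V m] V m U a b by (simp add: cut_eval rr_mult m_assoc)
      qed
      show "(a \<oplus>[R U] b) \<odot>[?D,U] x = a \<odot>[?D,U] x \<oplus>[?D,U] b \<odot>[?D,U] x" unfolding dual_sec_simps
      proof (rule ext)
        fix V m assume V: "opn V" "V \<subseteq> U" and m: "m \<in>: sec M V"
        interpret cring "R V" using V(1) by (rule R_cring)
        show "rr U V (a \<oplus>[R U] b) \<otimes>[R V] x V m = cut X M U (\<lambda>V m. rr U V a \<otimes>[R V] x V m) V m \<oplus>[R V] cut X M U (\<lambda>V m. rr U V b \<otimes>[R V] x V m) V m"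
          using fc[OF x V m] V m U a b by (simp add: cut_eval rr_add l_distr)
      qed }
    fix y assume y: "y \<in>: sec ?D U"
    show "x \<oplus>[?D,U] y \<in>: sec ?D U" unfolding dual_sec_simps by (rule add_c[OF x y])
    show "x \<oplus>[?D,U] y = y \<oplus>[?D,U] x" unfolding dual_sec_simps
    proof (rule ext)
      fix V m assume V: "opn V" "V \<subseteq> U" and m: "m \<in>: sec M V"
      interpret cring "R V" using V(1) by (rule R_cring)
      show "x V m \<oplus>[R V] y V m = y V m \<oplus>[R V] x V m" using fc[OF x V m] fc[OF y V m] by (rule a_comm)
    qed
    { fix a assume a: "a \<in>: R U"
      show "a \<odot>[?D,U] (x \<oplus>[?D,U] y) = a \<odot>[?D,U] x \<oplus>[?D,U] a \<odot>[?D,U] y" unfolding dual_sec_simps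
      proof (rule ext)
        fix V m assume V: "opn V" "V \<subseteq> U" and m: "m \<in>: sec M V"
        interpret cring "R V" using V(1) by (rule R_cring)
        show "rr U V a \<otimes>[R V] cut X M U (\<lambda>V m. x V m \<oplus>[R V] y V m) V m =
            cut X M U (\<lambda>V m. rr U V a \<otimes>[R V] x V m) V m \<oplus>[R V] cut X M U (\<lambda>V m. rr U V a \<otimes>[R V] y V m) V m"
          using fc[OF x V m] fc[OF y V m] V m U a by (simp add: cut_eval r_distr)
      qed }
    fix z assume z: "z \<in>: sec ?D U"
    show "(x \<oplus>[?D,U] y) \<oplus>[?D,U] z = x \<oplus>[?D,U] (y \<oplus>[?D,U] z)" unfolding dual_sec_simps
    proof (rule ext)
      fix V m assume V: "opn V" "V \<subseteq> U" and m: "m \<in>: sec M V"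
      interpret cring "R V" using V(1) by (rule R_cring)
      show "cut X M U (\<lambda>V m. x V m \<oplus>[R V] y V m) V m \<oplus>[R V] z V m = x V m \<oplus>[R V] cut X M U (\<lambda>V m. y V m \<oplus>[R V] z V m) V m"
        using fc[OF x V m] fc[OF y V m] fc[OF z V m] V m by (simp add: cut_eval a_assoc)
    qed
  qed (unfold dual_sec_simps, rule cut_closed[OF U form_zero_form])
qed

text \<open>A linear form over the union is glued value by value: at a section \<open>m\<close> over
  \<open>V\<close> the values of the given forms on the sets \<open>V \<inter> K\<close> are
  compatible and glue in the structure sheaf.\<close>

lemma dual_sheaf: "msh (dual X M)"
  unfolding is_module_sheaf_def is_sheaf_def
proof (intro conjI allI impI dual_presheaf mp_presheaf[OF dual_presheaf]; elim conjE)
  let ?D = "dual X M"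
  fix C s assume s0: "\<forall>V\<in>C. opn V \<and> s V \<in>: sec ?D V"
    and c0: "\<forall>V\<in>C. \<forall>W\<in>C. res ?D V (V \<inter> W) (s V) = res ?D W (V \<inter> W) (s W)"
  let ?U = "\<Union>C"
  have U: "opn ?U" using s0 by blast
  have Co: "opn K" if "K \<in> C" for K using s0 that by blast
  have sf: "form M K (s K)" if "K \<in> C" for K using s0 that dual_form by blast
  have agree: "s K V m = s L V m" if "K \<in> C" "L \<in> C" "opn V" "V \<subseteq> K" "V \<subseteq> L" "m \<in>: sec M V" for K L V m
  proof -
    have "cut X M (K \<inter> L) (s K) = cut X M (K \<inter> L) (s L)" using c0 that(1,2) unfolding dual_sec_simps by blast
    then show ?thesis using cut_eval[of V "K \<inter> L" m M] that(3-6) by (metis le_inf_iff)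
  qed
  \<comment> \<open>Equality of functions over \<open>V\<close> may be tested on the sets
    \<open>V \<inter> K\<close>, where \<open>t\<close> is given by the form \<open>s K\<close>. All
    properties of \<open>t\<close> are derived in this way.\<close>
  have uniq: "a = b" if V: "opn V" "V \<subseteq> ?U" and ab: "a \<in>: R V" "b \<in>: R V"
    and eq: "\<And>K. K \<in> C ==> rr V (V \<inter> K) a = rr V (V \<inter> K) b" for V a b
  proof (rule sheaf_eqI[OF R_sheaf V(1) ab])
    fix p assume p: "p \<in> V"
    then obtain K where "K \<in> C" "p \<in> K" using V(2) by blast
    then show "\<exists>W. opn W \<and> p \<in> W \<and> W \<subseteq> V \<and> rr V W a = rr V W b"
      using V(1) eq p Co by (intro exI[of _ "V \<inter> K"]) auto
  qed
  \<comment> \<open>The condition that characterises the glued value at \<open>m\<close>: over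
    \<open>V \<inter> K\<close> it is the value of \<open>s K\<close>.\<close>
  define tP where "tP = (\<lambda>V m a. a \<in>: R V \<and> (\<forall>K\<in>C. rr V (V \<inter> K) a = s K (V \<inter> K) (res M V (V \<inter> K) m)))"
  define t where "t = (\<lambda>V m. SOME a. tP V m a)"
  have t: "tP V m (t V m)" if V: "opn V" "V \<subseteq> ?U" and m: "m \<in>: sec M V" for V m
    unfolding t_def
  proof (rule someI_ex)
    define P where "P = (\<lambda>W a. \<exists>K\<in>C. W = V \<inter> K \<and> a = s K W (res M V W m))"
    have "\<exists>a\<in>carrier (R V). \<forall>W b. P W b --> rr V W a = b"
    proof (rule sheaf_glue[OF R_sheaf V(1)])
      fix W b assume "P W b"
      then obtain K where K: "K \<in> C" "W = V \<inter> K" "b = s K W (res M V W m)" unfolding P_def by blast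
      then show "opn W \<and> W \<subseteq> V \<and> b \<in>: R W"
        using V m Co[OF K(1)] form_closed[OF sf[OF K(1)], of W] M by auto
    next
      fix p assume p: "p \<in> V"
      then obtain K where K: "K \<in> C" "p \<in> K" using V(2) by blast
      then have "P (V \<inter> K) (s K (V \<inter> K) (res M V (V \<inter> K) m))" unfolding P_def by (intro bexI[of _ K]) auto
      then show "\<exists>W b. p \<in> W \<and> P W b" using K p by (intro exI[of _ "V \<inter> K"] exI) auto
    next
      fix W b W' b' assume "P W b" "P W' b'"
      then obtain K K' where K: "K \<in> C" "W = V \<inter> K" "b = s K W (res M V W m)"
         and K': "K' \<in> C" "W' = V \<inter> K'" "b' = s K' W' (res M V W' m)" unfolding P_def by metis
      have o: "opn W" "opn W'" "opn (W \<inter> W')" using K K' V Co by auto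
      have i: "W \<subseteq> V" "W' \<subseteq> V" "W \<subseteq> K" "W' \<subseteq> K'" using K K' by auto
      have mW: "res M V W m \<in>: sec M W" "res M V W' m \<in>: sec M W'" using M V m o i by auto
      have "rr W (W \<inter> W') b = s K (W \<inter> W') (res M V (W \<inter> W') m)"
        unfolding K(3) using form_res[OF sf[OF K(1)] o(1,3) i(3) _ mW(1)] mres_trans[OF M V(1) o(1,3) _ i(1) m] by simp
      moreover have "rr W' (W \<inter> W') b' = s K' (W \<inter> W') (res M V (W \<inter> W') m)"
        unfolding K'(3) using form_res[OF sf[OF K'(1)] o(2,3) i(4) _ mW(2)] mres_trans[OF M V(1) o(2,3) _ i(2) m] by simp
      moreover have "res M V (W \<inter> W') m \<in>: sec M (W \<inter> W')" by (rule mres_closed[OF M V(1) o(3) _ m]) (use i in auto)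
      ultimately show "rr W (W \<inter> W') b = rr W' (W \<inter> W') b'" using agree[OF K(1) K'(1) o(3) le_infI1[OF i(3)] le_infI2[OF i(4)]] by simp
    qed
    then obtain a where "a \<in>: R V" "\<And>W b. P W b ==> rr V W a = b" by auto
    then show "\<exists>a. tP V m a" unfolding P_def tP_def by blast
  qed
  have tc: "t V m \<in>: R V" if "opn V" "V \<subseteq> ?U" "m \<in>: sec M V" for V m using t[OF that] by (simp add: tP_def)
  have tl: "rr V (V \<inter> K) (t V m) = s K (V \<inter> K) (res M V (V \<inter> K) m)" if "opn V" "V \<subseteq> ?U" "m \<in>: sec M V" "K \<in> C" for V m K
    using t[OF that(1-3)] that(4) by (simp add: tP_def)
  have tf: "form M ?U t"
  proof (rule formI)
    fix V m assume V: "opn V" "V \<subseteq> ?U" and m: "m \<in>: sec M V"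
    interpret RV: cring "R V" using V(1) by (rule R_cring)
    show "t V m \<in>: R V" using tc V m by blast
    { fix n assume n: "n \<in>: sec M V"
      show "t V (m \<oplus>[M,V] n) = t V m \<oplus>[R V] t V n"
      proof (rule uniq[OF V])
        fix K assume K: "K \<in> C"
        have o: "opn (V \<inter> K)" using V Co[OF K] by simp
        show "rr V (V \<inter> K) (t V (m \<oplus>[M,V] n)) = rr V (V \<inter> K) (t V m \<oplus>[R V] t V n)"
          using tl[OF V _ K] m n V o M tc[OF V] form_add[OF sf[OF K] o] by (simp add: rr_add mres_add)
      qed (use tc[OF V] m n M V in auto) }
    { fix a assume a: "a \<in>: R V"
      show "t V (a \<odot>[M,V] m) = a \<otimes>[R V] t V m"
      proof (rule uniq[OF V])
        fix K assume K: "K \<in> C"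
        have o: "opn (V \<inter> K)" using V Co[OF K] by simp
        show "rr V (V \<inter> K) (t V (a \<odot>[M,V] m)) = rr V (V \<inter> K) (a \<otimes>[R V] t V m)"
          using tl[OF V _ K] m a V o M tc[OF V] form_smult[OF sf[OF K] o] by (simp add: rr_mult mres_smult)
      qed (use tc[OF V] m a M V in auto) }
    fix W assume W: "opn W" "W \<subseteq> V"
    have WU: "W \<subseteq> ?U" using W V by auto
    show "t W (res M V W m) = rr V W (t V m)"
    proof (rule uniq[OF W(1) WU])
      fix K assume K: "K \<in> C"
      have o: "opn (W \<inter> K)" "opn (V \<inter> K)" using V W Co[OF K] by auto
      have i: "W \<inter> K \<subseteq> V \<inter> K" using W by auto
      have "rr W (W \<inter> K) (rr V W (t V m)) = rr (V \<inter> K) (W \<inter> K) (rr V (V \<inter> K) (t V m))"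
        using V W o i tc[OF V m] by simp
      also have "\<dots> = s K (W \<inter> K) (res M V (W \<inter> K) m)"
        unfolding tl[OF V m K] using form_res[OF sf[OF K] o(2,1) _ i mres_closed[OF M V(1) o(2) _ m]]
          mres_trans[OF M V(1) o(2,1) i _ m] by simp
      also have "res M V (W \<inter> K) m = res M W (W \<inter> K) (res M V W m)" using mres_trans[OF M V(1) W(1) o(1) _ W(2) m] by simp
      finally show "rr W (W \<inter> K) (t W (res M V W m)) = rr W (W \<inter> K) (rr V W (t V m))"
        using tl[OF W(1) WU mres_closed[OF M V(1) W m] K] by simp
    qed (use tc[OF W(1) WU mres_closed[OF M V(1) W m]] tc[OF V m] V W in auto)
  qed
  show "\<exists>!t. t \<in>: sec ?D ?U \<and> (\<forall>V\<in>C. res ?D ?U V t = s V)"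
  proof (rule ex1I[of _ "cut X M ?U t"])
    have "cut X M K (cut X M ?U t) = s K" if K: "K \<in> C" for K
    proof -
      have KU: "K \<subseteq> ?U" using K by blast
      have "cut X M K t = cut X M K (s K)"
      proof (rule cut_cong)
        fix V m assume V: "opn V" "V \<subseteq> K" and m: "m \<in>: sec M V"
        have VK: "V \<inter> K = V" and VU: "V \<subseteq> ?U" using V KU by auto
        show "t V m = s K V m" using tl[OF V(1) VU m K] tc[OF V(1) VU m] V m M unfolding VK by simp
      qed
      also have "\<dots> = s K" using s0 K dual_carrier[OF Co[OF K], of "s K"] by blast
      finally have "cut X M K t = s K" .
      moreover have "cut X M K (cut X M ?U t) = cut X M K t" by (rule cut_cut[OF KU])
      ultimately show ?thesis by (rule trans[rotated])
    qed
    then show "cut X M ?U t \<in>: sec ?D ?U \<and> (\<forall>V\<in>C. res ?D ?U V (cut X M ?U t) = s V)"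
      unfolding dual_sec_simps using cut_closed[OF U tf] by simp
    fix t' assume t': "t' \<in>: sec ?D ?U \<and> (\<forall>V\<in>C. res ?D ?U V t' = s V)"
    have t'f: "form M ?U t'" using t' dual_form[OF U] by blast
    show "t' = cut X M ?U t"
    proof (rule dual_ext[OF U _ cut_closed[OF U tf]])
      fix V m assume V: "opn V" "V \<subseteq> ?U" and m: "m \<in>: sec M V"
      have "t' V m = t V m"
      proof (rule uniq[OF V form_closed[OF t'f V m] tc[OF V m]])
        fix K assume K: "K \<in> C"
        have o: "opn (V \<inter> K)" "V \<inter> K \<subseteq> K" "V \<inter> K \<subseteq> ?U" using V Co[OF K] by auto
        have mK: "res M V (V \<inter> K) m \<in>: sec M (V \<inter> K)" using mres_closed[OF M V(1) o(1) _ m] by simp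
        have "cut X M K t' = s K" using t' K unfolding dual_sec_simps by blast
        then have "s K (V \<inter> K) (res M V (V \<inter> K) m) = t' (V \<inter> K) (res M V (V \<inter> K) m)"
          using cut_eval[OF o(1,2) mK, of t'] by simp
        then show "rr V (V \<inter> K) (t' V m) = rr V (V \<inter> K) (t V m)"
          using tl[OF V m K] form_res[OF t'f V(1) o(1) V(2) _ m] by simp
      qed
      then show "t' V m = cut X M ?U t V m" using V m by (simp add: cut_eval)
    qed (use t' in blast)
  qed
qed

text \<open>The coordinate with respect to \<open>g\<close>. It serves twice: for \<gamma>* on the
  quotient by the scalars and for x* on an invertible module over the algebra.\<close>

definition dual_gen :: "'p set => 'm => 'p set => 'm => 'r" where
  "dual_gen U g = cut X M U (\<lambda>V m. THE a. a \<in>: R V \<and> m = a \<odot>[M,V] res M U V g)"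

lemma dual_gen_eval:
  assumes g: "gen M U g" and V: "opn V" "V \<subseteq> U" and a: "a \<in>: R V"
  shows "dual_gen U g V (a \<odot>[M,V] res M U V g) = a"
proof -
  note gV = gen_res[OF M g V]
  have "(THE b. b \<in>: R V \<and> a \<odot>[M,V] res M U V g = b \<odot>[M,V] res M U V g) = a"
    by (rule the_equality) (use a gen_cancel[OF M gV] in auto)
  then show ?thesis unfolding dual_gen_def using V a gen_closed[OF gV] M by (simp add: cut_eval)
qed

lemma dual_gen_self: "gen M U g ==> dual_gen U g U g = \<one>[R U]"
  using dual_gen_eval[of U g U "\<one>[R U]"] M R_cring[of U] by (simp add: cring_def ring.is_monoid monoid.one_closed)

lemma dual_gen_closed:
  assumes g: "gen M U g" shows "dual_gen U g \<in>: sec (dual X M) U"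
proof -
  note U = gen_open[OF g]
  have "form M U (dual_gen U g)"
  proof (rule formI)
    fix V m assume V: "opn V" "V \<subseteq> U" and m: "m \<in>: sec M V"
    interpret cring "R V" using V(1) by (rule R_cring)
    note gV = gen_res[OF M g V] note gc = gen_closed[OF gV] note ev = dual_gen_eval[OF g V]
    obtain a where a: "a \<in>: R V" "m = a \<odot>[M,V] res M U V g" using gen_coeff[OF M gV m] by auto
    show "dual_gen U g V m \<in>: R V" unfolding a(2) ev[OF a(1)] by (rule a(1))
    { fix n assume n: "n \<in>: sec M V"
      obtain b where b: "b \<in>: R V" "n = b \<odot>[M,V] res M U V g" using gen_coeff[OF M gV n] by auto
      have "m \<oplus>[M,V] n = (a \<oplus>[R V] b) \<odot>[M,V] res M U V g"
        unfolding a b using msmult_l_distr[OF M V(1) a(1) b(1) gc] by simp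
      then show "dual_gen U g V (m \<oplus>[M,V] n) = dual_gen U g V m \<oplus>[R V] dual_gen U g V n"
        using ev a b by simp }
    { fix b assume b: "b \<in>: R V"
      have "b \<odot>[M,V] m = (b \<otimes>[R V] a) \<odot>[M,V] res M U V g"
        unfolding a using msmult_assoc[OF M V(1) b a(1) gc] by simp
      then show "dual_gen U g V (b \<odot>[M,V] m) = b \<otimes>[R V] dual_gen U g V m" using ev a b by simp }
    fix W assume W: "opn W" "W \<subseteq> V"
    have WU: "W \<subseteq> U" using W V by auto
    have "res M V W m = rr V W a \<odot>[M,W] res M U W g"
      unfolding a using mres_smult[OF M V(1) W a(1) gc] mres_trans[OF M U V(1) W(1,2) V(2) gen_closed[OF g]] by simp
    then show "dual_gen U g W (res M V W m) = rr V W (dual_gen U g V m)"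
      using dual_gen_eval[OF g W(1) WU] rr_closed[OF V(1) W a(1)] ev[OF a(1)] a(2) by simp
  qed
  then show ?thesis using U unfolding dual_carrier[OF U] unfolding dual_gen_def by (simp add: cut_cut)
qed

lemma form_gen_eq:
  assumes g: "gen M U g" and f: "form M U \<phi>" "form M U \<psi>" and e: "\<phi> U g = \<psi> U g"
    and V: "opn V" "V \<subseteq> U" and m: "m \<in>: sec M V"
  shows "\<phi> V m = \<psi> V m"
proof -
  note U = gen_open[OF g] note gV = gen_res[OF M g V]
  obtain a where a: "a \<in>: R V" "m = a \<odot>[M,V] res M U V g" using gen_coeff[OF M gV m] by auto
  show ?thesis unfolding a(2)
    using form_smult[OF f(1) V a(1) gen_closed[OF gV]] form_smult[OF f(2) V a(1) gen_closed[OF gV]]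
      form_res[OF f(1) U V(1) subset_refl V(2) gen_closed[OF g]] form_res[OF f(2) U V(1) subset_refl V(2) gen_closed[OF g]] e by simp
qed

lemma dual_gen_ext:
  assumes g: "gen M U g" and f: "\<phi> \<in>: sec (dual X M) U" "\<psi> \<in>: sec (dual X M) U" and e: "\<phi> U g = \<psi> U g"
  shows "\<phi> = \<psi>"
  by (rule dual_ext[OF gen_open[OF g] f])
    (rule form_gen_eq[OF g dual_form[OF gen_open[OF g] f(1)] dual_form[OF gen_open[OF g] f(2)] e])

lemma dual_smult_eval: "opn U ==> a \<in>: R U ==> m \<in>: sec M U ==>
    (a \<odot>[dual X M,U] \<phi>) U m = a \<otimes>[R U] \<phi> U m"
  unfolding dual_sec_simps by (simp add: cut_eval)

lemma dual_res_eval: "opn V ==> W \<subseteq> V ==> opn W ==> m \<in>: sec M W ==> res (dual X M) U V \<phi> W m = \<phi> W m"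
  unfolding dual_sec_simps by (simp add: cut_eval)

lemma dual_gen_res:
  assumes g: "gen M U g" and V: "opn V" "V \<subseteq> U"
  shows "res (dual X M) U V (dual_gen U g) = dual_gen V (res M U V g)"
proof (rule dual_gen_ext[OF gen_res[OF M g V]])
  note gV = gen_res[OF M g V] note U = gen_open[OF g]
  show "res (dual X M) U V (dual_gen U g) \<in>: sec (dual X M) V"
    by (rule mres_closed[OF dual_presheaf U V dual_gen_closed[OF g]])
  show "dual_gen V (res M U V g) \<in>: sec (dual X M) V" by (rule dual_gen_closed[OF gV])
  have 1: "\<one>[R V] \<in>: R V" using R_cring[OF V(1)] by (simp add: cring_def ring.is_monoid monoid.one_closed)
  show "res (dual X M) U V (dual_gen U g) V (res M U V g) = dual_gen V (res M U V g) V (res M U V g)"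
    using dual_gen_self[OF gV] dual_res_eval[OF V(1) subset_refl V(1) gen_closed[OF gV]]
      dual_gen_eval[OF g V 1] V gen_closed[OF gV] M by simp
qed

text \<open>The coefficient of a linear form with respect to the coordinate form is the value of the
  linear form at \<open>g\<close>.\<close>

lemma gen_dual_gen:
  assumes g: "gen M U g" shows "gen (dual X M) U (dual_gen U g)"
proof (rule genI[OF dual_presheaf gen_open[OF g] dual_gen_closed[OF g]])
  fix W assume W: "opn W" "W \<subseteq> U"
  note gW = gen_res[OF M g W]
  interpret cring "R W" using W(1) by (rule R_cring)
  note r = dual_gen_res[OF g W] note dc = dual_gen_closed[OF gW] note ds = dual_gen_self[OF gW]
  note sm = dual_smult_eval[OF W(1) _ gen_closed[OF gW]]
  { fix \<psi> assume p: "\<psi> \<in>: sec (dual X M) W"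
    have a: "\<psi> W (res M U W g) \<in>: R W" using form_closed[OF dual_form[OF W(1) p] W(1) subset_refl gen_closed[OF gW]] .
    have "\<psi> = \<psi> W (res M U W g) \<odot>[dual X M,W] dual_gen W (res M U W g)"
      by (rule dual_gen_ext[OF gW p]) (use msmult_closed[OF dual_presheaf W(1) a dc] sm[OF a] ds a in auto)
    then show "\<exists>a\<in>carrier (R W). \<psi> = a \<odot>[dual X M,W] res (dual X M) U W (dual_gen U g)"
      unfolding r using a by blast }
  fix a b assume ab: "a \<in>: R W" "b \<in>: R W"
    "a \<odot>[dual X M,W] res (dual X M) U W (dual_gen U g) = b \<odot>[dual X M,W] res (dual X M) U W (dual_gen U g)"
  then have "(a \<odot>[dual X M,W] dual_gen W (res M U W g)) W (res M U W g) =
     (b \<odot>[dual X M,W] dual_gen W (res M U W g)) W (res M U W g)" unfolding r by simp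
  then show "a = b" unfolding sm[OF ab(1)] sm[OF ab(2)] ds using ab by simp
qed

end

lemma dual_invertible: "line M ==> line (dual X M)"
  unfolding invertible_iff[of "dual X M"] using dual_sheaf gen_dual_gen unfolding invertible_iff by (metis ms_mp)

end

section \<open>The Picard group\<close>

text \<open>The structure of \<open>M\<close> carried to the images under \<open>\<iota>\<close>: if
  \<open>\<iota>\<close> is injective on sections over open sets, this is an isomorphic sheaf with
  another type of sections.\<close>

definition transport ::
  "('p set => 'm => 'n) => ('p, 'r, 'm) module_presheaf => ('p, 'r, 'n) module_presheaf" where
  "transport \<iota> M = \<lparr>sec = (\<lambda>U. mk_module (\<iota> U ` carrier (sec M U)) (\<iota> U \<zero>[sec M U])
      (\<lambda>x y. \<iota> U (inv_into (carrier (sec M U)) (\<iota> U) x \<oplus>[M,U] inv_into (carrier (sec M U)) (\<iota> U) y))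
      (\<lambda>a x. \<iota> U (a \<odot>[M,U] inv_into (carrier (sec M U)) (\<iota> U) x))),
    res = (\<lambda>U V x. \<iota> V (res M U V (inv_into (carrier (sec M U)) (\<iota> U) x)))\<rparr>"

context ringed
begin

context
  fixes \<iota> :: "'p set => 'm => 'n" and M :: "('p, 'r, 'm) module_presheaf"
  assumes M: "msh M" and inj: "\<And>U. opn U ==> inj_on (\<iota> U) (carrier (sec M U))"
begin

lemma Mp: "mpre M" using M by simp

abbreviation "TM \<equiv> transport \<iota> M"

lemma kappa: "opn U ==> s \<in>: sec M U ==> inv_into (carrier (sec M U)) (\<iota> U) (\<iota> U s) = s"
  using inj by (rule inv_into_f_f)

lemma TM_carrier: "carrier (sec TM U) = \<iota> U ` carrier (sec M U)" by (simp add: transport_def)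
lemma TM_zero: "\<zero>[sec TM U] = \<iota> U \<zero>[sec M U]" by (simp add: transport_def)
lemma TM_add: "opn U ==> s \<in>: sec M U ==> t \<in>: sec M U ==> \<iota> U s \<oplus>[TM,U] \<iota> U t = \<iota> U (s \<oplus>[M,U] t)"
  by (simp add: transport_def kappa)
lemma TM_smult: "opn U ==> s \<in>: sec M U ==> a \<odot>[TM,U] \<iota> U s = \<iota> U (a \<odot>[M,U] s)"
  by (simp add: transport_def kappa)
lemma TM_res: "opn U ==> s \<in>: sec M U ==> res TM U V (\<iota> U s) = \<iota> V (res M U V s)"
  by (simp add: transport_def kappa)

lemma TM_presheaf: "is_presheaf (underlying X) TM"
  unfolding is_presheaf_def TM_carrier
proof (intro conjI allI impI ballI; (elim conjE)?)
  { fix U V assume "opn U" "opn V" "V \<subseteq> U"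
    then show "res TM U V \<in> \<iota> U ` carrier (sec M U) \<rightarrow> \<iota> V ` carrier (sec M V)" using Mp by (auto simp: TM_res) }
  { fix U s assume "opn U" "s \<in> \<iota> U ` carrier (sec M U)"
    then show "res TM U U s = s" using Mp by (auto simp: TM_res) }
  { fix U V W :: "'p set" and s assume "opn U" "opn V" "opn W" "W \<subseteq> V" "V \<subseteq> U" "s \<in> \<iota> U ` carrier (sec M U)"
    then show "res TM V W (res TM U V s) = res TM U W s" using Mp by (auto simp: TM_res) }
qed

text \<open>Gluing takes place in \<open>M\<close> after passing to preimages, which are compatible
  because \<open>\<iota>\<close> is injective over the intersections.\<close>

lemma TM_module_sheaf: "msh TM"
  unfolding is_module_sheaf_def is_module_presheaf_def
proof (intro conjI allI impI TM_presheaf; (elim conjE)?)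
  fix U assume U: "opn U"
  interpret Module.module "R U" "sec M U" by (rule mp_module[OF Mp U])
  note [simp] = TM_add[OF U] TM_smult[OF U] TM_zero
  show "Module.module (R U) (sec TM U)"
  proof (rule moduleI, rule is_cring, rule abelian_groupI)
    fix x assume "x \<in>: sec TM U"
    then obtain s where s: "x = \<iota> U s" "s \<in>: sec M U" unfolding TM_carrier by auto
    show "\<exists>y\<in>carrier (sec TM U). y \<oplus>[TM,U] x = \<zero>[sec TM U]"
      using s by (intro bexI[of _ "\<iota> U (\<ominus>[sec M U] s)"]) (auto simp: TM_carrier M.l_neg)
  qed (auto simp: TM_carrier smult_l_distr smult_r_distr smult_assoc1 M.a_ac)
next
  fix U V assume UV: "opn U" "opn V" "V \<subseteq> U"
  show "\<forall>m\<in>carrier (sec TM U). \<forall>n\<in>carrier (sec TM U). res TM U V (m \<oplus>[TM,U] n) = res TM U V m \<oplus>[TM,V] res TM U V n"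
    using Mp UV by (auto simp: TM_carrier TM_add TM_res mres_add)
  show "\<forall>a\<in>carrier (R U). \<forall>m\<in>carrier (sec TM U). res TM U V (a \<odot>[TM,U] m) = rr U V a \<odot>[TM,V] res TM U V m"
    using Mp UV by (auto simp: TM_carrier TM_smult TM_res mres_smult)
next
  show "is_sheaf (underlying X) TM"
    unfolding is_sheaf_def
  proof (intro conjI allI impI TM_presheaf; (elim conjE)?)
    fix C s assume s: "\<forall>V\<in>C. opn V \<and> s V \<in>: sec TM V"
      and c: "\<forall>V\<in>C. \<forall>W\<in>C. res TM V (V \<inter> W) (s V) = res TM W (V \<inter> W) (s W)"
    have U: "opn (\<Union>C)" using s by blast
    define k where "k = (\<lambda>V. inv_into (carrier (sec M V)) (\<iota> V) (s V))"
    have k: "k V \<in>: sec M V" "s V = \<iota> V (k V)" if "V \<in> C" for V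
    proof -
      have "s V \<in> \<iota> V ` carrier (sec M V)" using s that unfolding TM_carrier by blast
      then show "k V \<in>: sec M V" "s V = \<iota> V (k V)" unfolding k_def by (auto intro: inv_into_into f_inv_into_f[symmetric])
    qed
    have ck: "res M V (V \<inter> W) (k V) = res M W (V \<inter> W) (k W)" if VW: "V \<in> C" "W \<in> C" for V W
    proof -
      have o: "opn V" "opn W" "opn (V \<inter> W)" using s VW by auto
      have "\<iota> (V \<inter> W) (res M V (V \<inter> W) (k V)) = \<iota> (V \<inter> W) (res M W (V \<inter> W) (k W))"
        using c[rule_format, OF VW] TM_res[OF o(1) k(1)[OF VW(1)], of "V \<inter> W"] TM_res[OF o(2) k(1)[OF VW(2)], of "V \<inter> W"]
          k(2)[OF VW(1)] k(2)[OF VW(2)] by simp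
      then show ?thesis by (rule inj_onD[OF inj[OF o(3)]])
        (use mres_closed[OF Mp o(1,3) _ k(1)[OF VW(1)]] mres_closed[OF Mp o(2,3) _ k(1)[OF VW(2)]] in auto)
    qed
    have "\<forall>V\<in>C. opn V \<and> k V \<in>: sec M V" using s k by simp
    moreover have "\<forall>V\<in>C. \<forall>W\<in>C. res M V (V \<inter> W) (k V) = res M W (V \<inter> W) (k W)" by (intro ballI) (rule ck)
    ultimately have ex1: "\<exists>!t. t \<in>: sec M (\<Union>C) \<and> (\<forall>V\<in>C. res M (\<Union>C) V t = k V)"
      by (rule ms_sheaf[OF M, unfolded is_sheaf_def, THEN conjunct2, THEN spec[of _ C], THEN spec[of _ k], THEN mp, OF conjI])
    from ex1 obtain t where t': "t \<in>: sec M (\<Union>C) \<and> (\<forall>V\<in>C. res M (\<Union>C) V t = k V)"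
      and u': "\<forall>t'. t' \<in>: sec M (\<Union>C) \<and> (\<forall>V\<in>C. res M (\<Union>C) V t' = k V) --> t' = t" by (rule ex1E)
    note t = conjunct1[OF t'] conjunct2[OF t'] note u = u'[rule_format]
    show "\<exists>!t. t \<in>: sec TM (\<Union>C) \<and> (\<forall>V\<in>C. res TM (\<Union>C) V t = s V)"
    proof (rule ex1I[of _ "\<iota> (\<Union>C) t"])
      show "\<iota> (\<Union>C) t \<in>: sec TM (\<Union>C) \<and> (\<forall>V\<in>C. res TM (\<Union>C) V (\<iota> (\<Union>C) t) = s V)"
        using t k by (simp add: TM_carrier TM_res[OF U])
      fix x assume x: "x \<in>: sec TM (\<Union>C) \<and> (\<forall>V\<in>C. res TM (\<Union>C) V x = s V)"
      then obtain t' where t': "t' \<in>: sec M (\<Union>C)" "x = \<iota> (\<Union>C) t'" unfolding TM_carrier by auto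
      have "res M (\<Union>C) V t' = k V" if V: "V \<in> C" for V
      proof -
        have o: "opn V" "V \<subseteq> \<Union>C" using s V by auto
        have "\<iota> V (res M (\<Union>C) V t') = \<iota> V (k V)" using x V k(2)[OF V] t' TM_res[OF U t'(1), of V] by auto
        then show ?thesis by (rule inj_onD[OF inj[OF o(1)]]) (use mres_closed[OF Mp U o t'(1)] k(1)[OF V] in auto)
      qed
      then have "t' = t" using u t'(1) by simp
      then show "x = \<iota> (\<Union>C) t" using t' by simp
    qed
  qed
qed

lemma TM_iso: "miso M TM \<iota>"
  unfolding module_isomorphism_def module_morphism_def is_linear_def
  using inj by (auto simp: TM_carrier TM_add TM_smult TM_res bij_betw_def)

end

lemma iso_invertible:
  assumes M: "line M" and N: "msh N" and i: "miso M N \<phi>"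
  shows "line N"
  using gen_iso[OF _ _ i] M N unfolding invertible_iff by (metis ms_mp)

definition isom :: "('p, 'r, 'm) module_presheaf => ('p, 'r, 'n) module_presheaf => bool" where
  "isom M N \<longleftrightarrow> (\<exists>\<phi>. miso M N \<phi>)"
lemma isom_sym: "line M ==> isom M N ==> isom N M" unfolding isom_def using mi_inv[of M N] by auto
lemma isom_trans: "isom M N ==> isom N K ==> isom M K" unfolding isom_def using mi_comp by blast

text \<open>A section is determined by its coordinates with respect to generators chosen around every point.\<close>

lemma ex_isom_over_functions:
  fixes M :: "('p, 'r, 'm) module_presheaf"
  assumes M: "line M"
  shows "\<exists>N :: ('p, 'r, 'p => 'r) module_presheaf. \<exists>\<phi>. line N \<and> miso N M \<phi>"
proof -
  have Mp: "mpre M" using M by simp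
  have "\<forall>p. \<exists>Ug. p \<in> whole X --> p \<in> fst Ug \<and> gen M (fst Ug) (snd Ug)"
    using M unfolding invertible_iff by (metis fst_conv snd_conv)
  then obtain h where h: "\<And>p. p \<in> whole X ==> p \<in> fst (h p) \<and> gen M (fst (h p)) (snd (h p))" by metis
  define A where "A = (\<lambda>U p. U \<inter> fst (h p))"
  define g where "g = (\<lambda>U p. res M (fst (h p)) (A U p) (snd (h p)))"
  define \<iota> where "\<iota> = (\<lambda>U s p. if p \<in> U then SOME a. a \<in>: R (A U p) \<and> res M U (A U p) s = a \<odot>[sec M (A U p)] g U p else undefined)"
  have A: "opn (A U p)" "p \<in> A U p" "A U p \<subseteq> U" "gen M (A U p) (g U p)" if U: "opn U" "p \<in> U" for U p
  proof -
    have "p \<in> whole X" using U openin_subset by blast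
    then have hp: "p \<in> fst (h p)" "gen M (fst (h p)) (snd (h p))" using h by auto
    then show "opn (A U p)" "p \<in> A U p" "A U p \<subseteq> U" using U gen_open[OF hp(2)] unfolding A_def by auto
    then show "gen M (A U p) (g U p)" unfolding g_def by (intro gen_res[OF Mp hp(2)]) (auto simp: A_def)
  qed
  have \<iota>: "\<iota> U s p \<in>: R (A U p) \<and> res M U (A U p) s = \<iota> U s p \<odot>[sec M (A U p)] g U p"
    if U: "opn U" "p \<in> U" and s: "s \<in>: sec M U" for U s p
  proof -
    note a = A[OF U]
    have "\<exists>b. b \<in>: R (A U p) \<and> res M U (A U p) s = b \<odot>[sec M (A U p)] g U p"
      using gen_coeff[OF Mp a(4) mres_closed[OF Mp U(1) a(1,3) s]] by blast
    from someI_ex[OF this] show ?thesis unfolding \<iota>_def using U by simp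
  qed
  have inj: "inj_on (\<iota> U) (carrier (sec M U))" if U: "opn U" for U
  proof (rule inj_onI)
    fix s t assume s: "s \<in>: sec M U" and t: "t \<in>: sec M U" and e: "\<iota> U s = \<iota> U t"
    show "s = t"
    proof (rule sheaf_eqI[OF ms_sheaf[OF inv_ms[OF M]] U s t])
      fix p assume p: "p \<in> U"
      have "res M U (A U p) s = res M U (A U p) t" using \<iota>[OF U p s] \<iota>[OF U p t] e by simp
      then show "\<exists>W. opn W \<and> p \<in> W \<and> W \<subseteq> U \<and> res M U W s = res M U W t" using A[OF U p] by blast
    qed
  qed
  have i: "miso M (transport \<iota> M) \<iota>" by (rule TM_iso[OF inv_ms[OF M] inj])
  have "line (transport \<iota> M)" by (rule iso_invertible[OF M TM_module_sheaf[OF inv_ms[OF M] inj] i])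
  then show ?thesis using mi_inv[OF i Mp] by blast
qed

text \<open>The frames are triples of generators: if x, y, z acquire factors b1, b2, b3, then both
  triple products acquire the product of the three. The value at pure tensors of generators is
  recorded, since rigidifications are compared there.\<close>

lemma tensor_assoc:
  assumes I: "line I" and J: "line J" and K: "line K"
  shows "\<exists>\<phi>. miso (tensor X (tensor X I J) K) (tensor X I (tensor X J K)) \<phi> \<and>
    (\<forall>V x y z. gen I V x \<and> gen J V y \<and> gen K V z -->
      \<phi> V (tens X (tensor X I J) K V (tens X I J V x y) z) = tens X I (tensor X J K) V x (tens X J K V y z))"
proof -
  note p = ms_mp[OF inv_ms[OF I]] ms_mp[OF inv_ms[OF J]] ms_mp[OF inv_ms[OF K]]
  let ?IJ = "tensor X I J" and ?JK = "tensor X J K"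
  have q: "mpre ?IJ" "mpre ?JK" using tensor_sheaf[OF p(1,2)] tensor_sheaf[OF p(2,3)] by auto
  let ?l = "\<lambda>V x y z. tens X ?IJ K V (tens X I J V x y) z" and ?r = "\<lambda>V x y z. tens X I ?JK V x (tens X J K V y z)"
  define Fr where "Fr = (\<lambda>V g g'. \<exists>x y z. gen I V x \<and> gen J V y \<and> gen K V z \<and> g = ?l V x y z \<and> g' = ?r V x y z)"
  have gl: "gen (tensor X ?IJ K) V (?l V x y z)" and gr: "gen (tensor X I ?JK) V (?r V x y z)"
    if "gen I V x" "gen J V y" "gen K V z" for V x y z
    using that gen_tens[OF q(1) p(3) gen_tens[OF p(1,2)]] gen_tens[OF p(1) q(2) _ gen_tens[OF p(2,3)]] by auto
  have fr: "frames (tensor X ?IJ K) (tensor X I ?JK) Fr"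
  proof (rule framesI)
    fix V g g' assume "Fr V g g'"
    then obtain x y z where x: "gen I V x" "gen J V y" "gen K V z" "g = ?l V x y z" "g' = ?r V x y z" unfolding Fr_def by blast
    show "gen (tensor X ?IJ K) V g \<and> g' \<in>: sec (tensor X I ?JK) V"
      unfolding x using gl[OF x(1-3)] gen_closed[OF gr[OF x(1-3)]] by simp
    note V = gen_open[OF x(1)] note c = gen_closed[OF x(1)] gen_closed[OF x(2)] gen_closed[OF x(3)]
    fix W assume W: "opn W" "W \<subseteq> V"
    show "Fr W (res (tensor X ?IJ K) V W g) (res (tensor X I ?JK) V W g')" unfolding Fr_def x
      by (rule exI[of _ "res I V W x"], rule exI[of _ "res J V W y"], rule exI[of _ "res K V W z"])
        (use gen_res[OF p(1) x(1) W] gen_res[OF p(2) x(2) W] gen_res[OF p(3) x(3) W] c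
          tens_res[OF q(1) p(3) V W tens_closed[OF p(1,2) V c(1,2)] c(3)] tens_res[OF p(1,2) V W c(1,2)]
          tens_res[OF p(1) q(2) V W c(1) tens_closed[OF p(2,3) V c(2,3)]] tens_res[OF p(2,3) V W c(2,3)] in auto)
  next
    fix pt assume pt: "pt \<in> whole X"
    obtain V1 x y where V1: "opn V1" "pt \<in> V1" "V1 \<subseteq> whole X" "gen I V1 x" "gen J V1 y"
      by (rule gens_within[OF I J openin_topspace pt])
    obtain V z where V: "opn V" "pt \<in> V" "V \<subseteq> V1" "gen K V z" using inv_gen_within[OF K V1(1,2)] by auto
    have "Fr V (?l V (res I V1 V x) (res J V1 V y) z) (?r V (res I V1 V x) (res J V1 V y) z)"
      unfolding Fr_def using gen_res[OF p(1) V1(4) V(1,3)] gen_res[OF p(2) V1(5) V(1,3)] V(4) by blast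
    then show "\<exists>V g g'. pt \<in> V \<and> Fr V g g'" using V by blast
  next
    fix V g g' h h' a assume "Fr V g g'" "Fr V h h'" and a: "a \<in>: R V" "g = a \<odot>[tensor X ?IJ K,V] h"
    then obtain x y z x2 y2 z2 where x: "gen I V x" "gen J V y" "gen K V z" "g = ?l V x y z" "g' = ?r V x y z"
      and x2: "gen I V x2" "gen J V y2" "gen K V z2" "h = ?l V x2 y2 z2" "h' = ?r V x2 y2 z2" unfolding Fr_def by blast
    note V = gen_open[OF x(1)]
    interpret cring "R V" using V by (rule R_cring)
    note c = gen_closed[OF x2(1)] gen_closed[OF x2(2)] gen_closed[OF x2(3)]
    obtain b1 where b1: "b1 \<in>: R V" "x = b1 \<odot>[I,V] x2" using gen_coeff[OF p(1) x2(1) gen_closed[OF x(1)]] by auto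
    obtain b2 where b2: "b2 \<in>: R V" "y = b2 \<odot>[J,V] y2" using gen_coeff[OF p(2) x2(2) gen_closed[OF x(2)]] by auto
    obtain b3 where b3: "b3 \<in>: R V" "z = b3 \<odot>[K,V] z2" using gen_coeff[OF p(3) x2(3) gen_closed[OF x(3)]] by auto
    have "g = (b1 \<otimes>[R V] b2 \<otimes>[R V] b3) \<odot>[tensor X ?IJ K,V] h"
      unfolding x(4) x2(4) b1 b2 b3
      using tens_smult[OF p(1,2) V b1(1) b2(1) c(1,2)] tens_smult[OF q(1) p(3) V _ b3(1) tens_closed[OF p(1,2) V c(1,2)] c(3)] b1 b2 by simp
    then have ab: "a = b1 \<otimes>[R V] b2 \<otimes>[R V] b3"
      using gen_cancel[OF ms_mp[OF tensor_sheaf[OF q(1) p(3)]] gl[OF x2(1-3)]] a b1(1) b2(1) b3(1) x2(4) by simp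
    show "g' = a \<odot>[tensor X I ?JK,V] h'"
      unfolding x(5) x2(5) ab b1 b2 b3
      using tens_smult[OF p(2,3) V b2(1) b3(1) c(2,3)] tens_smult[OF p(1) q(2) V b1(1) _ c(1) tens_closed[OF p(2,3) V c(2,3)]] b1 b2 b3
      by (simp add: m_assoc)
  qed
  have "\<exists>\<phi>. miso (tensor X ?IJ K) (tensor X I ?JK) \<phi> \<and> (\<forall>V g g'. Fr V g g' --> \<phi> V g = g')"
    by (rule ex_line_isomorphism[OF tensor_sheaf[OF q(1) p(3)] tensor_sheaf[OF p(1) q(2)] fr]) (use gr in \<open>auto simp: Fr_def\<close>)
  then show ?thesis unfolding Fr_def by blast
qed

lemma tensor_unit:
  assumes I: "line I"
  shows "\<exists>\<phi>. miso (tensor X SO I) I \<phi> \<and>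
    (\<forall>U. opn U --> (\<forall>a\<in>carrier (R U). \<forall>m\<in>carrier (sec I U). \<phi> U (tens X SO I U a m) = a \<odot>[I,U] m))"
proof -
  have Ip: "mpre I" using I by simp
  have "\<exists>h. mmor (tensor X SO I) I h \<and>
    (\<forall>U. opn U --> (\<forall>m\<in>carrier (sec SO U). \<forall>n\<in>carrier (sec I U). h U (tens X SO I U m n) = m \<odot>[I,U] n)) \<and>
    ((\<forall>U m n. gen SO U m \<and> gen I U n --> gen I U (m \<odot>[I,U] n)) --> miso (tensor X SO I) I h)"
  proof (rule tensor_morphism[OF self_invertible I inv_ms[OF I]])
    fix U m n a b assume U: "opn U" and m: "m \<in>: sec SO U" "n \<in>: sec I U" and a: "a \<in>: R U" "b \<in>: R U"
    interpret cring "R U" using U by (rule R_cring)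
    show "(a \<odot>[SO,U] m) \<odot>[I,U] (b \<odot>[I,U] n) = (a \<otimes>[R U] b) \<odot>[I,U] (m \<odot>[I,U] n)"
      using m a U Ip by (simp add: msmult_assoc[symmetric] m_ac)
  qed (use Ip in \<open>auto simp: mres_smult\<close>)
  moreover have "gen I U (m \<odot>[I,U] n)" if "gen SO U m" "gen I U n" for U m n
    by (rule gen_smult[OF Ip that(2) gen_self_Units[OF that(1)]])
  ultimately show ?thesis by auto
qed

text \<open>Evaluation is an isomorphism because it sends a pair of generators to a unit: a
  generator of the dual is a unit multiple u of the coordinate form of x, with value u at x.\<close>

lemma tensor_dual:
  assumes I: "line I"
  shows "\<exists>\<phi>. miso (tensor X (dual X I) I) SO \<phi> \<and>
    (\<forall>U. opn U --> (\<forall>\<delta>\<in>carrier (sec (dual X I) U). \<forall>m\<in>carrier (sec I U). \<phi> U (tens X (dual X I) I U \<delta> m) = \<delta> U m))"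
proof -
  have Ip: "mpre I" using I by simp
  note Dp = dual_presheaf[OF Ip]
  have "\<exists>h. mmor (tensor X (dual X I) I) SO h \<and>
    (\<forall>U. opn U --> (\<forall>m\<in>carrier (sec (dual X I) U). \<forall>n\<in>carrier (sec I U). h U (tens X (dual X I) I U m n) = m U n)) \<and>
    ((\<forall>U m n. gen (dual X I) U m \<and> gen I U n --> gen SO U (m U n)) --> miso (tensor X (dual X I) I) SO h)"
  proof (rule tensor_morphism[OF dual_invertible[OF I] I self_sheaf])
    fix U \<delta> n assume U: "opn U" and \<delta>: "\<delta> \<in>: sec (dual X I) U" and n: "n \<in>: sec I U"
    interpret cring "R U" using U by (rule R_cring)
    note f = dual_form[OF U \<delta>]
    show "\<delta> U n \<in>: sec SO U" using form_closed[OF f U subset_refl n] by simp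
    { fix V assume V: "opn V" "V \<subseteq> U"
      show "res SO U V (\<delta> U n) = (res (dual X I) U V \<delta>) V (res I U V n)"
        using form_res[OF f U V(1) subset_refl V(2) n] dual_res_eval[OF Ip V(1) subset_refl V(1) mres_closed[OF Ip U V n]] by simp }
    fix a b assume a: "a \<in>: R U" "b \<in>: R U"
    show "(a \<odot>[dual X I,U] \<delta>) U (b \<odot>[I,U] n) = (a \<otimes>[R U] b) \<odot>[SO,U] \<delta> U n"
      using dual_smult_eval[OF Ip U a(1) msmult_closed[OF Ip U a(2) n]] form_smult[OF f U subset_refl a(2) n]
        form_closed[OF f U subset_refl n] a by (simp add: m_assoc)
  qed
  moreover have "gen SO U (\<delta> U n)" if \<delta>: "gen (dual X I) U \<delta>" and n: "gen I U n" for U \<delta> n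
  proof -
    note U = gen_open[OF n]
    interpret cring "R U" using U by (rule R_cring)
    obtain u where u: "u \<in> Units (R U)" "\<delta> = u \<odot>[dual X I,U] dual_gen I U n"
      using gen_ratio[OF Dp \<delta> gen_dual_gen[OF Ip n]] by auto
    have uc: "u \<in>: R U" using u(1) by (rule Units_closed)
    have "\<delta> U n = u" unfolding u(2) using dual_smult_eval[OF Ip U uc gen_closed[OF n]] dual_gen_self[OF Ip n] uc by simp
    then show ?thesis using gen_self[OF U u(1)] by simp
  qed
  ultimately show ?thesis by auto
qed

section \<open>Isomorphism classes of invertible sheaves and their group law\<close>

lemma mem_pic_class: "J \<in> pic_class X I \<longleftrightarrow> line J \<and> isom J I"
  by (simp add: pic_class_def isom_def)

lemma ex_mem_pic_class: "line I ==> \<exists>J. J \<in> pic_class X I"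
  using ex_isom_over_functions[of I] unfolding pic_class_def by blast

lemma pic_class_cong:
  assumes "line I" "isom I J" shows "pic_class X I = pic_class X J"
  using isom_trans[OF _ assms(2)] isom_trans[OF _ isom_sym[OF assms]] by (auto simp: mem_pic_class)

text \<open>A common member \<open>K\<close> links the two sheaves. That the class is inhabited is
  the content of \<open>ex_isom_over_functions\<close>, as members have a fixed type of sections and
  \<open>I\<close> need not.\<close>

lemma pic_class_eqD:
  assumes "line I" "pic_class X I = pic_class X J" shows "isom I J"
proof -
  obtain K where "K \<in> pic_class X I" using ex_mem_pic_class[OF assms(1)] by auto
  then have "line K" "isom K I" "isom K J" using assms(2) by (auto simp: mem_pic_class)
  then show ?thesis using isom_sym isom_trans by blast
qed

lemma pic_class_mem_eq: "J \<in> pic_class X I ==> pic_class X J = pic_class X I"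
  using pic_class_cong by (auto simp: mem_pic_class)

lemma Pic_carrier: "line I ==> pic_class X I \<in>: Pic X"
proof -
  assume I: "line I"
  then obtain J where J: "J \<in> pic_class X I" using ex_mem_pic_class by auto
  have "pic_class X I = pic_class X J" using pic_class_mem_eq[OF J] by simp
  then show ?thesis using J unfolding Pic_def by (auto simp: mem_pic_class)
qed

lemma Pic_carrierE:
  assumes "a \<in>: Pic X"
  obtains I :: "('p, 'r, 'p => 'r) module_presheaf" where "line I" "a = pic_class X I"
  using assms unfolding Pic_def by auto

lemma isom_tensor:
  assumes "line I" "line J" "line I'" "line J'" "isom I I'" "isom J J'"
  shows "isom (tensor X I J) (tensor X I' J')"
  using assms tensor_map_iso[OF assms(1-4)] unfolding isom_def by blast

text \<open>By \<open>isom_tensor\<close> the union in the definition of the product is over equal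
  classes. Here \<open>I\<close> and \<open>J\<close> may have any type of sections, so that
  iterated tensor products and duals can be inserted.\<close>

lemma Pic_mult:
  assumes I: "line I" and J: "line J"
  shows "pic_class X I \<otimes>[Pic X] pic_class X J = pic_class X (tensor X I J)"
proof -
  obtain I0 where "I0 \<in> pic_class X I" using ex_mem_pic_class[OF I] by blast
  obtain J0 where "J0 \<in> pic_class X J" using ex_mem_pic_class[OF J] by blast
  have "(\<Union>I'\<in>pic_class X I. \<Union>J'\<in>pic_class X J. pic_class X (tensor X I' J')) = pic_class X (tensor X I J)"
  proof (rule UN_const[OF \<open>I0 \<in> _\<close>], rule UN_const[OF \<open>J0 \<in> _\<close>])
    fix I' J' assume "I' \<in> pic_class X I" "J' \<in> pic_class X J"
    then show "pic_class X (tensor X I' J') = pic_class X (tensor X I J)"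
      using I J isom_tensor[of I' J' I J] pic_class_cong[OF tensor_invertible[of I' J']] by (auto simp: mem_pic_class)
  qed
  then show ?thesis by (simp add: Pic_def)
qed

lemma Pic_one: "\<one>[Pic X] = pic_class X SO" by (simp add: Pic_def)

lemma Pic_group: "group (Pic X)"
proof (rule groupI)
  show "\<one>[Pic X] \<in>: Pic X" unfolding Pic_one by (rule Pic_carrier[OF self_invertible])
  fix x assume "x \<in>: Pic X"
  then obtain I :: "('p, 'r, 'p => 'r) module_presheaf" where I: "line I" "x = pic_class X I" by (rule Pic_carrierE)
  have "isom (tensor X SO I) I" using tensor_unit[OF I(1)] unfolding isom_def by blast
  then show "\<one>[Pic X] \<otimes>[Pic X] x = x"
    unfolding I(2) Pic_one Pic_mult[OF self_invertible I(1)] by (intro pic_class_cong tensor_invertible self_invertible I)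
  have "isom (tensor X (dual X I) I) SO" using tensor_dual[OF I(1)] unfolding isom_def by blast
  then have "pic_class X (dual X I) \<otimes>[Pic X] x = \<one>[Pic X]"
    unfolding I(2) Pic_one Pic_mult[OF dual_invertible[OF I(1)] I(1)] by (intro pic_class_cong tensor_invertible dual_invertible I)
  then show "\<exists>y\<in>carrier (Pic X). y \<otimes>[Pic X] x = \<one>[Pic X]" using Pic_carrier[OF dual_invertible[OF I(1)]] by blast
  fix y assume "y \<in>: Pic X"
  then obtain J :: "('p, 'r, 'p => 'r) module_presheaf" where J: "line J" "y = pic_class X J" by (rule Pic_carrierE)
  note IJ = tensor_invertible[OF I(1) J(1)]
  show "x \<otimes>[Pic X] y \<in>: Pic X" unfolding I J Pic_mult[OF I(1) J(1)] by (rule Pic_carrier[OF IJ])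
  fix z assume "z \<in>: Pic X"
  then obtain K :: "('p, 'r, 'p => 'r) module_presheaf" where K: "line K" "z = pic_class X K" by (rule Pic_carrierE)
  note JK = tensor_invertible[OF J(1) K(1)]
  have "isom (tensor X (tensor X I J) K) (tensor X I (tensor X J K))" using tensor_assoc[OF I(1) J(1) K(1)] unfolding isom_def by blast
  then show "x \<otimes>[Pic X] y \<otimes>[Pic X] z = x \<otimes>[Pic X] (y \<otimes>[Pic X] z)"
    unfolding I(2) J(2) K(2) Pic_mult[OF I(1) J(1)] Pic_mult[OF J(1) K(1)] Pic_mult[OF IJ K(1)] Pic_mult[OF I(1) JK]
    by (intro pic_class_cong tensor_invertible I J K)
qed

end

section \<open>Quadratic algebras\<close>

lemma over_simps [simp]:
  "underlying (over X Y) = underlying X" "structure_sheaf (over X Y) = algebra_sheaf Y"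
  by (simp_all add: over_def)

lemma rs_simps [simp]:
  "carrier (sec (restrict_scalars Y I) U) = carrier (sec I U)"
  "\<zero>[sec (restrict_scalars Y I) U] = \<zero>[sec I U]"
  "x \<oplus>[restrict_scalars Y I,U] y = x \<oplus>[I,U] y"
  "a \<odot>[restrict_scalars Y I,U] x = algebra_map Y U a \<odot>[I,U] x"
  "res (restrict_scalars Y I) = res I"
  by (simp_all add: restrict_scalars_def)

text \<open>The determinant is 1, so the adjugate matrix inverts the change of coordinates.\<close>

lemma (in Module.module) basis_change:
  assumes e: "e \<in>: M" "f \<in>: M"
    and b: "bij_betw (\<lambda>(s, t). s \<odot>[M] e \<oplus>[M] t \<odot>[M] f) (carrier R \<times> carrier R) (carrier M)"
    and c: "a \<in>: R" "b \<in>: R" "c \<in>: R" "d \<in>: R"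
    and det: "a \<otimes>[R] d \<ominus>[R] b \<otimes>[R] c = \<one>[R]"
  shows "bij_betw (\<lambda>(s, t). s \<odot>[M] (a \<odot>[M] e \<oplus>[M] b \<odot>[M] f) \<oplus>[M] t \<odot>[M] (c \<odot>[M] e \<oplus>[M] d \<odot>[M] f))
    (carrier R \<times> carrier R) (carrier M)"
proof -
  let ?k = "\<lambda>(s, t). (s \<otimes>[R] a \<oplus>[R] t \<otimes>[R] c, s \<otimes>[R] b \<oplus>[R] t \<otimes>[R] d)"
  let ?k' = "\<lambda>(s, t). (s \<otimes>[R] d \<ominus>[R] t \<otimes>[R] c, t \<otimes>[R] a \<ominus>[R] s \<otimes>[R] b)"
  let ?l = "\<lambda>(s, t). s \<odot>[M] e \<oplus>[M] t \<odot>[M] f"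
  have d: "x \<otimes>[R] (a \<otimes>[R] d \<ominus>[R] b \<otimes>[R] c) = x" if "x \<in>: R" for x using that det by simp
  have 1: "(s \<otimes>[R] a \<oplus>[R] t \<otimes>[R] c) \<otimes>[R] d \<ominus>[R] (s \<otimes>[R] b \<oplus>[R] t \<otimes>[R] d) \<otimes>[R] c = s \<otimes>[R] (a \<otimes>[R] d \<ominus>[R] b \<otimes>[R] c)"
    "(s \<otimes>[R] b \<oplus>[R] t \<otimes>[R] d) \<otimes>[R] a \<ominus>[R] (s \<otimes>[R] a \<oplus>[R] t \<otimes>[R] c) \<otimes>[R] b = t \<otimes>[R] (a \<otimes>[R] d \<ominus>[R] b \<otimes>[R] c)"
    "(s \<otimes>[R] d \<ominus>[R] t \<otimes>[R] c) \<otimes>[R] a \<oplus>[R] (t \<otimes>[R] a \<ominus>[R] s \<otimes>[R] b) \<otimes>[R] c = s \<otimes>[R] (a \<otimes>[R] d \<ominus>[R] b \<otimes>[R] c)"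
    "(s \<otimes>[R] d \<ominus>[R] t \<otimes>[R] c) \<otimes>[R] b \<oplus>[R] (t \<otimes>[R] a \<ominus>[R] s \<otimes>[R] b) \<otimes>[R] d = t \<otimes>[R] (a \<otimes>[R] d \<ominus>[R] b \<otimes>[R] c)"
    if "s \<in>: R" "t \<in>: R" for s t using that c by algebra+
  have k: "bij_betw ?k (carrier R \<times> carrier R) (carrier R \<times> carrier R)"
    by (rule bij_betw_byWitness[where f' = ?k']) (use c in \<open>auto simp: 1 d\<close>)
  have "?l (?k (s, t)) = s \<odot>[M] (a \<odot>[M] e \<oplus>[M] b \<odot>[M] f) \<oplus>[M] t \<odot>[M] (c \<odot>[M] e \<oplus>[M] d \<odot>[M] f)"
    if "s \<in>: R" "t \<in>: R" for s t
    using that c e by (simp add: smult_r_distr smult_l_distr smult_assoc1 M.a_ac)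
  then have "bij_betw (\<lambda>(s, t). s \<odot>[M] (a \<odot>[M] e \<oplus>[M] b \<odot>[M] f) \<oplus>[M] t \<odot>[M] (c \<odot>[M] e \<oplus>[M] d \<odot>[M] f))
    (carrier R \<times> carrier R) (carrier M) \<longleftrightarrow> bij_betw (?l \<circ> ?k) (carrier R \<times> carrier R) (carrier M)"
    by (intro bij_betw_cong) auto
  then show ?thesis using bij_betw_trans[OF k b] by simp
qed

section \<open>The ringed space of a quadratic algebra and its local bases\<close>

locale quadratic = ringed X for X :: "('p, 'r) ringed_space" +
  fixes Y :: "('p, 'r, 's) sheaf_algebra"
  assumes quadratic_algebra: "is_quadratic_algebra X Y"
begin

lemma alg: "is_algebra X Y" and alg_free: "locally_free X 2 (alg_module Y)"
  using quadratic_algebra by (auto simp: is_quadratic_algebra_def)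

end

text \<open>The rewriting identifies the open sets of \<open>over X Y\<close> with those of
  \<open>X\<close>, so the results on ringed spaces apply to modules over the algebra and to modules
  over \<open>X\<close> on the same open sets.\<close>

sublocale quadratic \<subseteq> XY: ringed "over X Y"
  rewrites "underlying (over X Y) = underlying X" and "structure_sheaf (over X Y) = algebra_sheaf Y"
proof -
  show "ringed (over X Y)"
    by unfold_locales (use alg in \<open>simp add: is_ringed_space_def is_algebra_def\<close>)
qed simp_all

context quadratic
begin

abbreviation "B U \<equiv> alg_of Y U"
abbreviation "al U \<equiv> algebra_map Y U"
abbreviation "br U V \<equiv> res (algebra_sheaf Y) U V"
abbreviation "rs I \<equiv> restrict_scalars Y I"
abbreviation "AM \<equiv> alg_module Y"
abbreviation "BA \<equiv> alg_self Y"

lemma al_hom: "opn U ==> algebra_map Y U \<in> ring_hom (R U) (B U)"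
  using alg by (simp add: is_algebra_def)

context
  fixes U assumes U: "opn U"
begin
interpretation h: ring_hom_cring "R U" "B U" "algebra_map Y U"
  using R_cring[OF U] XY.R_cring[OF U] al_hom[OF U] by (simp add: ring_hom_cring_def ring_hom_cring_axioms_def)
lemma al_closed [simp]: "a \<in>: R U ==> al U a \<in>: B U" by simp
lemma al_add: "a \<in>: R U ==> b \<in>: R U ==> al U (a \<oplus>[R U] b) = al U a \<oplus>[B U] al U b" by simp
lemma al_mult: "a \<in>: R U ==> b \<in>: R U ==> al U (a \<otimes>[R U] b) = al U a \<otimes>[B U] al U b" by simp
lemma al_uminus: "a \<in>: R U ==> al U (\<ominus>[R U] a) = \<ominus>[B U] al U a" by simp
lemma al_zero [simp]: "al U \<zero>[R U] = \<zero>[B U]" by (rule h.hom_zero)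
lemma al_one [simp]: "al U \<one>[R U] = \<one>[B U]" by (rule h.hom_one)
end

lemma al_res: "opn U ==> opn V ==> V \<subseteq> U ==> a \<in>: R U ==> al V (rr U V a) = br U V (al U a)"
  using alg by (simp add: is_algebra_def)

lemma rs_presheaf:
  assumes I: "XY.mpre I" shows "mpre (rs I)"
  unfolding is_module_presheaf_def
proof (intro conjI allI impI)
  have "is_presheaf (underlying X) I" using XY.mp_presheaf[OF I] by simp
  then show "is_presheaf (underlying X) (rs I)" unfolding is_presheaf_def by simp
  fix U assume U: "opn U"
  interpret m: Module.module "B U" "sec I U" by (rule XY.mp_module[OF I U])
  show "Module.module (R U) (sec (rs I) U)"
  proof (rule moduleI, rule R_cring[OF U], rule abelian_groupI)
    fix x assume "x \<in>: sec (rs I) U"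
    then show "\<exists>y\<in>carrier (sec (rs I) U). y \<oplus>[rs I,U] x = \<zero>[sec (rs I) U]"
      by (intro bexI[of _ "\<ominus>[sec I U] x"]) (auto simp: m.M.l_neg)
  qed (use U in \<open>auto simp: m.M.a_ac al_add al_mult m.smult_l_distr m.smult_r_distr m.smult_assoc1\<close>)
next
  fix U V assume UV: "opn U \<and> opn V \<and> V \<subseteq> U"
  then show "\<forall>m\<in>carrier (sec (rs I) U). \<forall>n\<in>carrier (sec (rs I) U).
     res (rs I) U V (m \<oplus>[rs I,U] n) = res (rs I) U V m \<oplus>[rs I,V] res (rs I) U V n"
    using XY.mres_add[OF I] by simp
  show "\<forall>a\<in>carrier (R U). \<forall>m\<in>carrier (sec (rs I) U).
     res (rs I) U V (a \<odot>[rs I,U] m) = rr U V a \<odot>[rs I,V] res (rs I) U V m"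
    using UV XY.mres_smult[OF I] by (simp add: al_res)
qed

lemma rs_sheaf: "XY.msh I ==> msh (rs I)"
proof -
  assume I: "XY.msh I"
  have "is_sheaf (underlying X) (rs I)" using XY.ms_sheaf[OF I] unfolding is_sheaf_def is_presheaf_def rs_simps .
  then show ?thesis unfolding is_module_sheaf_def using rs_presheaf[OF XY.ms_mp[OF I]] by blast
qed

lemma alg_self_sheaf: "XY.msh BA" using XY.self_sheaf by simp

lemma AM_sheaf: "msh AM" by (rule rs_sheaf[OF alg_self_sheaf])
lemma AM_presheaf: "mpre AM" using AM_sheaf by simp

text \<open>With 1 as first basis vector, another choice of \<gamma> is a substitution p + t
  \<gamma>, and the exterior square of the algebra and its quotient by the scalars both see only
  t.\<close>

definition qfr :: "'p set => 's => bool" where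
  "qfr U \<gamma> \<longleftrightarrow> basis2 AM U \<one>[B U] \<gamma>"

lemma qfr_open [simp]: "qfr U \<gamma> ==> opn U" unfolding qfr_def by (rule basis2_open)
lemma qfr_closed [simp]: "qfr U \<gamma> ==> \<gamma> \<in>: B U" unfolding qfr_def using basis2_closed(2) by fastforce

lemma B_one_closed [simp]: "opn U ==> \<one>[B U] \<in>: B U"
  using XY.R_cring[of U] by (simp add: cring_def ring.is_monoid monoid.one_closed)

lemma R_one_closed [simp]: "opn U ==> \<one>[R U] \<in>: R U"
  using R_cring[of U] by (simp add: cring_def ring.is_monoid monoid.one_closed)

lemma qfr_res: "qfr U \<gamma> ==> opn V ==> V \<subseteq> U ==> qfr V (br U V \<gamma>)"
proof -
  assume q: "qfr U \<gamma>" and V: "opn V" "V \<subseteq> U"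
  show ?thesis using basis2_res[OF AM_presheaf q[unfolded qfr_def] V] XY.rr_one[OF qfr_open[OF q] V] unfolding qfr_def by simp
qed

lemma qfr_coord:
  assumes q: "qfr U \<gamma>" and b: "b \<in>: B U"
  obtains r s where "r \<in>: R U" "s \<in>: R U" "b = al U r \<oplus>[B U] al U s \<otimes>[B U] \<gamma>"
proof -
  interpret cring "B U" using q by (simp add: XY.R_cring)
  have b': "b \<in>: sec AM U" using b by simp
  obtain r s where rs: "r \<in>: R U" "s \<in>: R U" "b = r \<odot>[AM,U] \<one>[B U] \<oplus>[AM,U] s \<odot>[AM,U] \<gamma>"
    by (rule basis2_coeff[OF AM_presheaf q[unfolded qfr_def] b'])
  show thesis by (rule that[OF rs(1,2)]) (use rs q in simp)
qed

lemma qfr_cancel: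
  assumes q: "qfr U \<gamma>" and c: "a \<in>: R U" "b \<in>: R U" "a' \<in>: R U" "b' \<in>: R U"
    and e: "al U a \<oplus>[B U] al U b \<otimes>[B U] \<gamma> = al U a' \<oplus>[B U] al U b' \<otimes>[B U] \<gamma>"
  shows "a = a'" "b = b'"
proof -
  interpret cring "B U" using q by (simp add: XY.R_cring)
  have "a \<odot>[AM,U] \<one>[B U] \<oplus>[AM,U] b \<odot>[AM,U] \<gamma> = a' \<odot>[AM,U] \<one>[B U] \<oplus>[AM,U] b' \<odot>[AM,U] \<gamma>"
    using e c q by simp
  from basis2_cancel[OF AM_presheaf q[unfolded qfr_def] c this] show "a = a'" "b = b'" .
qed

text \<open>If \<open>1 = a e + b f\<close>, then the \<open>e\<close>-coordinate of \<open>1 e = a e e + b f e\<close> shows that \<open>a\<close> and \<open>b\<close>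
  generate the unit ideal, so that \<open>1\<close> is a member of a basis.\<close>

lemma ex_qfr:
  assumes b: "basis2 AM U e f"
  shows "\<exists>\<gamma>. qfr U \<gamma>"
proof -
  note U = basis2_open[OF b]
  have e: "e \<in>: B U" "f \<in>: B U" using basis2_closed[OF b] by auto
  interpret BU: cring "B U" using U by (rule XY.R_cring)
  interpret RU: cring "R U" using U by (rule R_cring)
  have cf: "\<exists>a c. a \<in>: R U \<and> c \<in>: R U \<and> m = al U a \<otimes>[B U] e \<oplus>[B U] al U c \<otimes>[B U] f" if "m \<in>: B U" for m
    by (rule basis2_coeff[OF AM_presheaf b, of m]) (use that in auto)
  obtain a c where a: "a \<in>: R U" "c \<in>: R U" "\<one>[B U] = al U a \<otimes>[B U] e \<oplus>[B U] al U c \<otimes>[B U] f"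
    using cf[of "\<one>[B U]"] by auto
  obtain x x' where x: "x \<in>: R U" "x' \<in>: R U" "e \<otimes>[B U] e = al U x \<otimes>[B U] e \<oplus>[B U] al U x' \<otimes>[B U] f"
    using cf[of "e \<otimes>[B U] e"] e by auto
  obtain y y' where y: "y \<in>: R U" "y' \<in>: R U" "f \<otimes>[B U] e = al U y \<otimes>[B U] e \<oplus>[B U] al U y' \<otimes>[B U] f"
    using cf[of "f \<otimes>[B U] e"] e by auto
  note alc = al_closed[OF U a(1)] al_closed[OF U a(2)] al_closed[OF U x(1)] al_closed[OF U x(2)] al_closed[OF U y(1)] al_closed[OF U y(2)]
  have "\<one>[B U] \<otimes>[B U] e = al U a \<otimes>[B U] (e \<otimes>[B U] e) \<oplus>[B U] al U c \<otimes>[B U] (f \<otimes>[B U] e)"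
    unfolding a(3) using alc e by (simp add: BU.l_distr BU.m_assoc)
  also have "\<dots> = al U (a \<otimes>[R U] x \<oplus>[R U] c \<otimes>[R U] y) \<otimes>[B U] e \<oplus>[B U] al U (a \<otimes>[R U] x' \<oplus>[R U] c \<otimes>[R U] y') \<otimes>[B U] f"
    unfolding x(3) y(3) using alc e a x y U by (simp add: al_add al_mult BU.r_distr BU.l_distr BU.m_assoc BU.a_ac)
  finally have 1: "(a \<otimes>[R U] x \<oplus>[R U] c \<otimes>[R U] y) \<odot>[AM,U] e \<oplus>[AM,U] (a \<otimes>[R U] x' \<oplus>[R U] c \<otimes>[R U] y') \<odot>[AM,U] f
     = \<one>[R U] \<odot>[AM,U] e \<oplus>[AM,U] \<zero>[R U] \<odot>[AM,U] f"
    using e U by simp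
  have axcy: "a \<otimes>[R U] x \<oplus>[R U] c \<otimes>[R U] y = \<one>[R U]"
    by (rule basis2_cancel(1)[OF AM_presheaf b _ _ _ _ 1]) (use a x y in auto)
  \<comment> \<open>The coordinates of 1 are a, c, and those of \<gamma> are -y, x: together they
    form a matrix of determinant a x + c y, which is 1 by \<open>axcy\<close>.\<close>
  define \<gamma> where "\<gamma> = (\<ominus>[R U] y) \<odot>[AM,U] e \<oplus>[AM,U] x \<odot>[AM,U] f"
  have one: "\<one>[B U] = a \<odot>[AM,U] e \<oplus>[AM,U] c \<odot>[AM,U] f" using a(3) by simp
  have \<gamma>c: "\<gamma> \<in>: sec AM U" unfolding \<gamma>_def using e U x y by simp
  have ec: "e \<in>: sec AM U" "f \<in>: sec AM U" using e by auto
  have det: "a \<otimes>[R U] x \<ominus>[R U] c \<otimes>[R U] (\<ominus>[R U] y) = \<one>[R U]"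
    using axcy a x y by (simp add: RU.minus_eq RU.r_minus)
  have "basis2 AM U \<one>[B U] \<gamma>"
    unfolding basis2_def
  proof (intro conjI allI impI U \<gamma>c; (elim conjE)?)
    show "\<one>[B U] \<in>: sec AM U" by simp
    fix W assume W: "opn W" "W \<subseteq> U"
    interpret RW: cring "R W" using W(1) by (rule R_cring)
    interpret m: Module.module "R W" "sec AM W" by (rule mp_module[OF AM_presheaf W(1)])
    note bW = basis2_res[OF AM_presheaf b W]
    have r1: "res AM U W \<one>[B U] = rr U W a \<odot>[AM,W] res AM U W e \<oplus>[AM,W] rr U W c \<odot>[AM,W] res AM U W f"
      unfolding one mres_add[OF AM_presheaf U W msmult_closed[OF AM_presheaf U a(1) ec(1)] msmult_closed[OF AM_presheaf U a(2) ec(2)]]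
        mres_smult[OF AM_presheaf U W a(1) ec(1)] mres_smult[OF AM_presheaf U W a(2) ec(2)] ..
    have my: "\<ominus>[R U] y \<in>: R U" using y by simp
    have r2: "res AM U W \<gamma> = rr U W (\<ominus>[R U] y) \<odot>[AM,W] res AM U W e \<oplus>[AM,W] rr U W x \<odot>[AM,W] res AM U W f"
      unfolding \<gamma>_def mres_add[OF AM_presheaf U W msmult_closed[OF AM_presheaf U my ec(1)] msmult_closed[OF AM_presheaf U x(1) ec(2)]]
        mres_smult[OF AM_presheaf U W my ec(1)] mres_smult[OF AM_presheaf U W x(1) ec(2)] ..
    have "rr U W (a \<otimes>[R U] x \<ominus>[R U] c \<otimes>[R U] (\<ominus>[R U] y)) = \<one>[R W]" unfolding det using U W by simp
    then have "rr U W a \<otimes>[R W] rr U W x \<ominus>[R W] rr U W c \<otimes>[R W] rr U W (\<ominus>[R U] y) = \<one>[R W]"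
      using a x my by (simp add: rr_minus[OF U W] rr_mult[OF U W])
    then show "bij_betw (\<lambda>(s, t). s \<odot>[AM,W] res AM U W \<one>[B U] \<oplus>[AM,W] t \<odot>[AM,W] res AM U W \<gamma>)
       (carrier (R W) \<times> carrier (R W)) (carrier (sec AM W))"
      unfolding r1 r2 by (intro m.basis_change basis2_closed[OF bW] basis2_bij[OF AM_presheaf bW] rr_closed[OF U W] a x my)
  qed
  then show ?thesis unfolding qfr_def by blast
qed

text \<open>On these sets \<open>nrm\<close> and n(x) have a meaning. They are stable under
  shrinking and, by \<open>good_within\<close>, occur inside every neighbourhood.\<close>

definition good :: "'p set => bool" where "good U \<longleftrightarrow> (\<exists>\<gamma>. qfr U \<gamma>)"

lemma good_open [simp]: "good U ==> opn U" unfolding good_def by auto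
lemma good_subset: "good U ==> opn V ==> V \<subseteq> U ==> good V" unfolding good_def using qfr_res by blast

lemma good_within: "opn U ==> p \<in> U ==> \<exists>V. good V \<and> p \<in> V \<and> V \<subseteq> U"
  using basis2_within[OF alg_free, of U p] ex_qfr unfolding good_def by blast

section \<open>Exterior squares of modules over the algebra\<close>

context
  fixes I :: "('p, 's, 'm) module_presheaf"
  assumes I: "XY.mpre I"
begin

lemma rsI: "mpre (rs I)" by (rule rs_presheaf[OF I])

abbreviation "wdg U x y \<equiv> alg_wedge X Y I U x y"
abbreviation "W2 \<equiv> alg_wedge2 X Y I"

lemma wdg_alternating: "opn U ==> alternating (R U) (sec (rs I) U) (sec W2 U) (wdg U)"
  by (rule wedge_alternating[OF rsI])

lemma wdg_closed: "opn U ==> x \<in>: sec I U ==> y \<in>: sec I U ==> wdg U x y \<in>: sec W2 U"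
  using wedge_closed[OF rsI] by simp

lemma wdg_res: "opn U ==> opn V ==> V \<subseteq> U ==> x \<in>: sec I U ==> y \<in>: sec I U ==>
    res W2 U V (wdg U x y) = wdg V (res I U V x) (res I U V y)"
  using wedge_res[OF rsI] by simp

lemma W2_presheaf: "mpre W2" using wedge2_sheaf[OF rsI] by simp

text \<open>The first basis vector is \<gamma> x and the second is x, whereas coordinates are listed
  with the coefficient of 1 first; hence the determinant reads b c - a d.\<close>

lemma wdg_coord:
  assumes U: "opn U" and x: "x \<in>: sec I U" and g: "\<gamma> \<in>: B U"
    and c: "a \<in>: R U" "b \<in>: R U" "c \<in>: R U" "d \<in>: R U"
  shows "wdg U ((al U a \<oplus>[B U] al U b \<otimes>[B U] \<gamma>) \<odot>[I,U] x) ((al U c \<oplus>[B U] al U d \<otimes>[B U] \<gamma>) \<odot>[I,U] x) =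
    (b \<otimes>[R U] c \<ominus>[R U] a \<otimes>[R U] d) \<odot>[W2,U] wdg U (\<gamma> \<odot>[I,U] x) x"
proof -
  interpret m: Module.module "B U" "sec I U" by (rule XY.mp_module[OF I U])
  interpret w: alternating "R U" "sec (rs I) U" "sec W2 U" "wdg U" by (rule wdg_alternating[OF U])
  have s: "(al U a \<oplus>[B U] al U b \<otimes>[B U] \<gamma>) \<odot>[I,U] x = b \<odot>[rs I,U] (\<gamma> \<odot>[I,U] x) \<oplus>[rs I,U] a \<odot>[rs I,U] x"
    if "a \<in>: R U" "b \<in>: R U" for a b
    using that x g U by (simp add: m.smult_l_distr m.smult_assoc1 m.M.a_comm)
  show ?thesis unfolding s[OF c(1,2)] s[OF c(3,4)]
    by (rule w.w_det) (use x g c in auto)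
qed

text \<open>The case c = 1, d = 0 of \<open>wdg_coord\<close>: the summand a x vanishes against x,
  so the substitution a + b \<gamma> contributes only the factor b.\<close>

lemma wdg_affine:
  assumes U: "opn U" and x: "x \<in>: sec I U" and g: "\<gamma> \<in>: B U"
    and c: "a \<in>: R U" "b \<in>: R U"
  shows "wdg U ((al U a \<oplus>[B U] al U b \<otimes>[B U] \<gamma>) \<odot>[I,U] x) x = b \<odot>[W2,U] wdg U (\<gamma> \<odot>[I,U] x) x"
proof -
  interpret m: Module.module "B U" "sec I U" by (rule XY.mp_module[OF I U])
  interpret RU: cring "R U" by (rule R_cring[OF U])
  have "wdg U ((al U a \<oplus>[B U] al U b \<otimes>[B U] \<gamma>) \<odot>[I,U] x) ((al U \<one>[R U] \<oplus>[B U] al U \<zero>[R U] \<otimes>[B U] \<gamma>) \<odot>[I,U] x) =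
    (b \<otimes>[R U] \<one>[R U] \<ominus>[R U] a \<otimes>[R U] \<zero>[R U]) \<odot>[W2,U] wdg U (\<gamma> \<odot>[I,U] x) x"
    by (rule wdg_coord[OF U x g c]) auto
  then show ?thesis using c g x U by (simp add: RU.minus_eq)
qed

text \<open>Multiplying the basis of the algebra into a generator of the module gives a basis over
  \<open>X\<close>; the order of the two vectors is that in \<gamma> x \<and> x.\<close>

lemma basis2_gen:
  assumes q: "qfr U \<gamma>" and x: "XY.gen I U x"
  shows "basis2 (rs I) U (\<gamma> \<odot>[I,U] x) x"
proof (rule basis2I[OF rsI])
  note U = qfr_open[OF q] and g = qfr_closed[OF q] and xc = XY.gen_closed[OF x]
  show "opn U" by (rule U)
  show "\<gamma> \<odot>[I,U] x \<in>: sec (rs I) U" "x \<in>: sec (rs I) U" using XY.msmult_closed[OF I U g xc] xc by auto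
  fix W assume W: "opn W" "W \<subseteq> U"
  interpret m: Module.module "B W" "sec I W" by (rule XY.mp_module[OF I W(1)])
  note qW = qfr_res[OF q W] note gW = qfr_closed[OF qW] note xW = XY.gen_res[OF I x W] note xWc = XY.gen_closed[OF xW]
  have l: "a \<odot>[rs I,W] res (rs I) U W (\<gamma> \<odot>[I,U] x) \<oplus>[rs I,W] b \<odot>[rs I,W] res (rs I) U W x =
     (al W b \<oplus>[B W] al W a \<otimes>[B W] br U W \<gamma>) \<odot>[I,W] res I U W x" if "a \<in>: R W" "b \<in>: R W" for a b
    using that gW xWc W by (simp add: XY.mres_smult[OF I U W g xc] m.smult_l_distr m.smult_assoc1 m.M.a_comm)
  { fix k assume "k \<in>: sec (rs I) W"
    then have "k \<in>: sec I W" by simp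
    then obtain b where b: "b \<in>: B W" "k = b \<odot>[I,W] res I U W x" using XY.gen_coeff[OF I xW] by auto
    obtain r s where rs: "r \<in>: R W" "s \<in>: R W" "b = al W r \<oplus>[B W] al W s \<otimes>[B W] br U W \<gamma>"
      by (rule qfr_coord[OF qW b(1)])
    show "\<exists>a\<in>carrier (R W). \<exists>b\<in>carrier (R W).
       k = a \<odot>[rs I,W] res (rs I) U W (\<gamma> \<odot>[I,U] x) \<oplus>[rs I,W] b \<odot>[rs I,W] res (rs I) U W x"
      by (rule bexI[of _ s], rule bexI[of _ r]) (use l[OF rs(2,1)] b(2) rs in auto) }
  fix a b a' b' assume c: "a \<in>: R W" "b \<in>: R W" "a' \<in>: R W" "b' \<in>: R W"
    and e: "a \<odot>[rs I,W] res (rs I) U W (\<gamma> \<odot>[I,U] x) \<oplus>[rs I,W] b \<odot>[rs I,W] res (rs I) U W x =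
       a' \<odot>[rs I,W] res (rs I) U W (\<gamma> \<odot>[I,U] x) \<oplus>[rs I,W] b' \<odot>[rs I,W] res (rs I) U W x"
  have "al W b \<oplus>[B W] al W a \<otimes>[B W] br U W \<gamma> = al W b' \<oplus>[B W] al W a' \<otimes>[B W] br U W \<gamma>"
    by (rule XY.gen_cancel[OF I xW]) (use e[unfolded l[OF c(1,2)] l[OF c(3,4)]] c gW W in auto)
  from qfr_cancel[OF qW c(2,1,4,3) this] show "a = a' \<and> b = b'" by simp
qed

lemma gen_wdg: "qfr U \<gamma> ==> XY.gen I U x ==> gen W2 U (wdg U (\<gamma> \<odot>[I,U] x) x)"
  by (rule gen_wedge[OF rsI basis2_gen])

end

lemma rs_locally_free: "XY.line I ==> locally_free X 2 (rs I)"
proof -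
  assume I: "XY.line I"
  have Ip: "XY.mpre I" using I by simp
  have "\<exists>U e f. p \<in> U \<and> basis2 (rs I) U e f" if p: "p \<in> whole X" for p
  proof -
    obtain V where V: "good V" "p \<in> V" using good_within[OF openin_topspace p] by blast
    obtain W g where W: "opn W" "p \<in> W" "W \<subseteq> V" "XY.gen I W g" using XY.inv_gen_within[OF I good_open[OF V(1)] V(2)] by auto
    obtain \<gamma> where "qfr W \<gamma>" using good_subset[OF V(1) W(1,3)] unfolding good_def by auto
    then show ?thesis using basis2_gen[OF Ip _ W(4)] W(2) by blast
  qed
  then show ?thesis unfolding locally_free_2_iff using rs_sheaf[OF XY.inv_ms[OF I]] by blast
qed

lemma alg_self_gen: "opn U ==> XY.gen BA U \<one>[B U]"
proof -
  assume U: "opn U"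
  interpret cring "B U" by (rule XY.R_cring[OF U])
  show ?thesis using XY.gen_self[OF U Units_one_closed] by simp
qed

text \<open>Multiplication by \<open>b\<close> sends \<open>\<gamma> \<and> 1\<close> to \<open>b \<gamma> \<and> b\<close>, so \<open>\<nu>\<close> is its determinant.  Only meaningful if the
  algebra has a basis \<open>1, \<gamma>\<close> over \<open>U\<close>.\<close>

definition nrm :: "'p set => 's => 'r" where
  "nrm U b = (THE \<nu>. \<nu> \<in>: R U \<and> (\<exists>\<gamma>. qfr U \<gamma> \<and>
     wdg BA U (b \<otimes>[B U] \<gamma>) b = \<nu> \<odot>[W2 BA,U] wdg BA U \<gamma> \<one>[B U]))"

lemma AS: "XY.mpre BA" using alg_self_sheaf by simp

text \<open>The description in \<open>nrm\<close> allows any basis vector. Uniqueness holds because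
  passing from \<gamma> to c + d \<gamma> multiplies both \<gamma> \<and> 1 and b \<gamma> \<and> b
  by the same d.\<close>

lemma nrm_coord:
  assumes q: "qfr U \<gamma>" and p: "p \<in>: R U" "t \<in>: R U" "r \<in>: R U" "s \<in>: R U"
    and b: "b = al U p \<oplus>[B U] al U t \<otimes>[B U] \<gamma>" and bg: "b \<otimes>[B U] \<gamma> = al U r \<oplus>[B U] al U s \<otimes>[B U] \<gamma>"
  shows "nrm U b = s \<otimes>[R U] p \<ominus>[R U] r \<otimes>[R U] t"
proof -
  note U = qfr_open[OF q] and g = qfr_closed[OF q]
  interpret BU: cring "B U" by (rule XY.R_cring[OF U])
  interpret RU: cring "R U" by (rule R_cring[OF U])
  let ?w = "wdg BA U" and ?W = "W2 BA"
  have bc: "b \<in>: B U" unfolding b using p g U by simp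
  have w: "?w (b \<otimes>[B U] \<gamma>) b = (s \<otimes>[R U] p \<ominus>[R U] r \<otimes>[R U] t) \<odot>[?W,U] ?w \<gamma> \<one>[B U]"
    using wdg_coord[OF AS U _ g p(3,4,1,2), of "\<one>[B U]"] g bc U BU.m_closed[OF bc g]
    unfolding bg[symmetric] b[symmetric] by simp
  show ?thesis unfolding nrm_def
  proof (rule the_equality)
    show "s \<otimes>[R U] p \<ominus>[R U] r \<otimes>[R U] t \<in>: R U \<and> (\<exists>\<gamma>. qfr U \<gamma> \<and> ?w (b \<otimes>[B U] \<gamma>) b =
       (s \<otimes>[R U] p \<ominus>[R U] r \<otimes>[R U] t) \<odot>[?W,U] ?w \<gamma> \<one>[B U])" using w q p by auto
    fix \<nu> assume "\<nu> \<in>: R U \<and> (\<exists>\<gamma>. qfr U \<gamma> \<and> ?w (b \<otimes>[B U] \<gamma>) b = \<nu> \<odot>[?W,U] ?w \<gamma> \<one>[B U])"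
    then obtain \<gamma>' where \<nu>: "\<nu> \<in>: R U" and q': "qfr U \<gamma>'"
      and w': "?w (b \<otimes>[B U] \<gamma>') b = \<nu> \<odot>[?W,U] ?w \<gamma>' \<one>[B U]" by auto
    note g' = qfr_closed[OF q']
    obtain c d where cd: "c \<in>: R U" "d \<in>: R U" "\<gamma>' = al U c \<oplus>[B U] al U d \<otimes>[B U] \<gamma>" by (rule qfr_coord[OF q g'])
    have g1: "\<gamma>' \<otimes>[B U] x = (al U c \<oplus>[B U] al U d \<otimes>[B U] \<gamma>) \<otimes>[B U] x" for x by (simp add: cd(3))
    have e1: "?w \<gamma>' \<one>[B U] = d \<odot>[?W,U] ?w \<gamma> \<one>[B U]"
      using wdg_affine[OF AS U _ g cd(1,2), of "\<one>[B U]"] g g' unfolding cd(3)[symmetric] by simp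
    have e2: "?w (\<gamma>' \<otimes>[B U] b) b = d \<odot>[?W,U] ?w (\<gamma> \<otimes>[B U] b) b"
      using wdg_affine[OF AS U _ g cd(1,2), of b] bc unfolding cd(3)[symmetric] by simp
    have gn: "gen ?W U (?w \<gamma>' \<one>[B U])"
      using gen_wdg[OF AS q' alg_self_gen[OF U]] g' by simp
    note Wp = W2_presheaf[OF AS]
    have wc: "?w \<gamma> \<one>[B U] \<in>: sec ?W U" using wdg_closed[OF AS U, of \<gamma> "\<one>[B U]"] g by simp
    let ?n = "s \<otimes>[R U] p \<ominus>[R U] r \<otimes>[R U] t"
    have nc: "?n \<in>: R U" using p by simp
    have "\<nu> \<odot>[?W,U] ?w \<gamma>' \<one>[B U] = d \<odot>[?W,U] (?n \<odot>[?W,U] ?w \<gamma> \<one>[B U])"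
      unfolding w'[symmetric] w[symmetric] using e2 bc g g' by (simp add: BU.m_comm)
    also have "\<dots> = ?n \<odot>[?W,U] ?w \<gamma>' \<one>[B U]"
      unfolding e1 using msmult_assoc[OF Wp U cd(2) nc wc] msmult_assoc[OF Wp U nc cd(2) wc] RU.m_comm[OF cd(2) nc] by simp
    finally show "\<nu> = ?n" by (rule gen_cancel[OF Wp gn \<nu> nc])
  qed
qed

lemma nrm_closed: assumes "good U" "b \<in>: B U" shows "nrm U b \<in>: R U"
proof -
  obtain \<gamma> where q: "qfr U \<gamma>" using assms(1) unfolding good_def by auto
  interpret BU: cring "B U" by (rule XY.R_cring[OF qfr_open[OF q]])
  interpret RU: cring "R U" by (rule R_cring[OF qfr_open[OF q]])
  obtain p t where p: "p \<in>: R U" "t \<in>: R U" "b = al U p \<oplus>[B U] al U t \<otimes>[B U] \<gamma>" by (rule qfr_coord[OF q assms(2)])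
  obtain r s where r: "r \<in>: R U" "s \<in>: R U" "b \<otimes>[B U] \<gamma> = al U r \<oplus>[B U] al U s \<otimes>[B U] \<gamma>"
    by (rule qfr_coord[OF q BU.m_closed[OF assms(2) qfr_closed[OF q]]])
  show ?thesis unfolding nrm_coord[OF q p(1,2) r(1,2) p(3) r(3)] using p r by simp
qed

text \<open>The coordinates of b and b \<gamma> in 1, \<gamma> also express b x and \<gamma> b x in
  x and \<gamma> x, for every section x, so the determinant is that of multiplication on the
  algebra. Writing g0 as c + d \<gamma> puts the same factor d on both sides.\<close>

lemma det_wdg:
  assumes I: "XY.mpre I" and U: "good U" and b: "b \<in>: B U" and g0: "g0 \<in>: B U"
    and x: "x \<in>: sec I U"
  shows "wdg I U (g0 \<odot>[I,U] (b \<odot>[I,U] x)) (b \<odot>[I,U] x) =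
    nrm U b \<odot>[W2 I,U] wdg I U (g0 \<odot>[I,U] x) x"
proof -
  obtain \<gamma> where q: "qfr U \<gamma>" using U unfolding good_def by auto
  note Uo = qfr_open[OF q] and g = qfr_closed[OF q]
  interpret BU: cring "B U" by (rule XY.R_cring[OF Uo])
  interpret RU: cring "R U" by (rule R_cring[OF Uo])
  interpret m: Module.module "B U" "sec I U" by (rule XY.mp_module[OF I Uo])
  obtain p t where p: "p \<in>: R U" "t \<in>: R U" "b = al U p \<oplus>[B U] al U t \<otimes>[B U] \<gamma>" by (rule qfr_coord[OF q b])
  obtain r s where r: "r \<in>: R U" "s \<in>: R U" "b \<otimes>[B U] \<gamma> = al U r \<oplus>[B U] al U s \<otimes>[B U] \<gamma>"
    by (rule qfr_coord[OF q BU.m_closed[OF b g]])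
  obtain c d where cd: "c \<in>: R U" "d \<in>: R U" "g0 = al U c \<oplus>[B U] al U d \<otimes>[B U] \<gamma>" by (rule qfr_coord[OF q g0])
  let ?w = "wdg I U" and ?W = "sec (W2 I) U"
  have n: "nrm U b = s \<otimes>[R U] p \<ominus>[R U] r \<otimes>[R U] t" by (rule nrm_coord[OF q p(1,2) r(1,2) p(3) r(3)])
  have nc: "nrm U b \<in>: R U" by (rule nrm_closed[OF U b])
  have bx: "b \<odot>[I,U] x \<in>: sec I U" using b x by simp
  have w0: "?w (\<gamma> \<odot>[I,U] (b \<odot>[I,U] x)) (b \<odot>[I,U] x) = nrm U b \<odot>[?W] ?w (\<gamma> \<odot>[I,U] x) x"
    using wdg_coord[OF I Uo x g r(1,2) p(1,2)] b g x unfolding p(3)[symmetric] r(3)[symmetric] n[symmetric]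
    by (simp add: m.smult_assoc1[symmetric] BU.m_comm)
  have wc: "?w (\<gamma> \<odot>[I,U] x) x \<in>: ?W" using wdg_closed[OF I Uo] g x by simp
  have 1: "?w (g0 \<odot>[I,U] (b \<odot>[I,U] x)) (b \<odot>[I,U] x) = d \<odot>[?W] ?w (\<gamma> \<odot>[I,U] (b \<odot>[I,U] x)) (b \<odot>[I,U] x)"
    unfolding cd(3) by (rule wdg_affine[OF I Uo bx g cd(1,2)])
  have 2: "?w (g0 \<odot>[I,U] x) x = d \<odot>[?W] ?w (\<gamma> \<odot>[I,U] x) x"
    unfolding cd(3) by (rule wdg_affine[OF I Uo x g cd(1,2)])
  show ?thesis unfolding 1 2 w0
    using msmult_assoc[OF W2_presheaf[OF I] Uo cd(2) nc wc] msmult_assoc[OF W2_presheaf[OF I] Uo nc cd(2) wc] RU.m_comm[OF cd(2) nc] by simp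
qed

text \<open>The generator \<gamma> \<and> 1 of the exterior square is acted on by b c at once, and
  by c and then b; cancelling it leaves the equality of the factors.\<close>

lemma nrm_mult:
  assumes U: "good U" and b: "b \<in>: B U" and c: "c \<in>: B U"
  shows "nrm U (b \<otimes>[B U] c) = nrm U b \<otimes>[R U] nrm U c"
proof -
  obtain \<gamma> where q: "qfr U \<gamma>" using U unfolding good_def by auto
  note Uo = qfr_open[OF q] and g = qfr_closed[OF q]
  interpret BU: cring "B U" by (rule XY.R_cring[OF Uo])
  interpret RU: cring "R U" by (rule R_cring[OF Uo])
  let ?w = "wdg BA U" and ?W = "W2 BA"
  note n = nrm_closed[OF U]
  have gn: "gen ?W U (?w (\<gamma> \<otimes>[B U] \<one>[B U]) \<one>[B U])" using gen_wdg[OF AS q alg_self_gen[OF Uo]] by simp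
  note wc = gen_closed[OF gn]
  have d: "?w (\<gamma> \<otimes>[B U] (b \<otimes>[B U] x)) (b \<otimes>[B U] x) = nrm U b \<odot>[?W,U] ?w (\<gamma> \<otimes>[B U] x) x"
    if "b \<in>: B U" "x \<in>: B U" for b x
    using det_wdg[OF AS U that(1) g, of x] that by simp
  have "nrm U (b \<otimes>[B U] c) \<odot>[?W,U] ?w (\<gamma> \<otimes>[B U] \<one>[B U]) \<one>[B U] =
     nrm U b \<odot>[?W,U] (nrm U c \<odot>[?W,U] ?w (\<gamma> \<otimes>[B U] \<one>[B U]) \<one>[B U])"
    using d[of "b \<otimes>[B U] c" "\<one>[B U]"] d[of b c] d[of c "\<one>[B U]"] b c by simp
  also have "\<dots> = (nrm U b \<otimes>[R U] nrm U c) \<odot>[?W,U] ?w (\<gamma> \<otimes>[B U] \<one>[B U]) \<one>[B U]"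
    using msmult_assoc[OF W2_presheaf[OF AS] Uo n[OF b] n[OF c] wc] by simp
  finally show ?thesis
    by (rule gen_cancel[OF W2_presheaf[OF AS] gn n[OF BU.m_closed[OF b c]] RU.m_closed[OF n[OF b] n[OF c]]])
qed

lemma nrm_res:
  assumes U: "good U" and V: "opn V" "V \<subseteq> U" and b: "b \<in>: B U"
  shows "nrm V (br U V b) = rr U V (nrm U b)"
proof -
  obtain \<gamma> where q: "qfr U \<gamma>" using U unfolding good_def by auto
  note Uo = qfr_open[OF q] and g = qfr_closed[OF q]
  interpret BU: cring "B U" by (rule XY.R_cring[OF Uo])
  interpret RU: cring "R U" by (rule R_cring[OF Uo])
  obtain p t where p: "p \<in>: R U" "t \<in>: R U" "b = al U p \<oplus>[B U] al U t \<otimes>[B U] \<gamma>" by (rule qfr_coord[OF q b])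
  obtain r s where r: "r \<in>: R U" "s \<in>: R U" "b \<otimes>[B U] \<gamma> = al U r \<oplus>[B U] al U s \<otimes>[B U] \<gamma>"
    by (rule qfr_coord[OF q BU.m_closed[OF b g]])
  have rw: "br U V (al U p \<oplus>[B U] al U t \<otimes>[B U] \<gamma>) = al V (rr U V p) \<oplus>[B V] al V (rr U V t) \<otimes>[B V] br U V \<gamma>"
    if "p \<in>: R U" "t \<in>: R U" for p t
    using that Uo V g by (simp add: XY.rr_add XY.rr_mult al_res)
  have 1: "br U V b = al V (rr U V p) \<oplus>[B V] al V (rr U V t) \<otimes>[B V] br U V \<gamma>" unfolding p(3) by (rule rw[OF p(1,2)])
  have "br U V (b \<otimes>[B U] \<gamma>) = al V (rr U V r) \<oplus>[B V] al V (rr U V s) \<otimes>[B V] br U V \<gamma>" unfolding r(3) by (rule rw[OF r(1,2)])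
  then have 2: "br U V b \<otimes>[B V] br U V \<gamma> = al V (rr U V r) \<oplus>[B V] al V (rr U V s) \<otimes>[B V] br U V \<gamma>"
    using XY.rr_mult[OF Uo V b g] by simp
  show ?thesis
    unfolding nrm_coord[OF q p(1,2) r(1,2) p(3) r(3)]
      nrm_coord[OF qfr_res[OF q V] rr_closed[OF Uo V p(1)] rr_closed[OF Uo V p(2)] rr_closed[OF Uo V r(1)] rr_closed[OF Uo V r(2)] 1 2]
    using p r by (simp add: rr_minus[OF Uo V] rr_mult[OF Uo V])
qed

lemma nrm_one: assumes U: "good U" shows "nrm U \<one>[B U] = \<one>[R U]"
proof -
  obtain \<gamma> where q: "qfr U \<gamma>" using U unfolding good_def by auto
  note Uo = qfr_open[OF q] and g = qfr_closed[OF q]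
  interpret BU: cring "B U" by (rule XY.R_cring[OF Uo])
  interpret RU: cring "R U" by (rule R_cring[OF Uo])
  have "nrm U \<one>[B U] = \<one>[R U] \<otimes>[R U] \<one>[R U] \<ominus>[R U] \<zero>[R U] \<otimes>[R U] \<zero>[R U]"
    by (rule nrm_coord[OF q]) (use Uo g in auto)
  then show ?thesis by (simp add: RU.minus_eq)
qed

end

section \<open>The norm of an invertible module\<close>

context quadratic
begin

section \<open>The quotient of the algebra by the scalars and its dual\<close>

abbreviation "QP \<equiv> quotient_presheaf X Y"
abbreviation "QM \<equiv> quotient_module X Y"
abbreviation "qcl \<equiv> quotient_class X Y"

definition qco :: "'p set => 's => 's set" where
  "qco U b = scalars X Y U +>\<^bsub>B U\<^esub> b"

lemma mem_qco: "d \<in> qco U b \<longleftrightarrow> (\<exists>a\<in>carrier (R U). d = al U a \<oplus>[B U] b)"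
  unfolding qco_def a_r_coset_def' by auto

lemma scalars_subgroup: assumes U: "opn U" shows "abelian_subgroup (scalars X Y U) (B U)"
proof -
  interpret BU: cring "B U" by (rule XY.R_cring[OF U])
  interpret RU: cring "R U" by (rule R_cring[OF U])
  have "subgroup (scalars X Y U) (add_monoid (B U))"
  proof (rule group.subgroupI[OF BU.a_group])
    fix x y assume "x \<in> scalars X Y U" "y \<in> scalars X Y U"
    then obtain a b where ab: "a \<in>: R U" "b \<in>: R U" "x = al U a" "y = al U b" by auto
    show "x \<otimes>[add_monoid (B U)] y \<in> scalars X Y U" using ab U by (auto simp: al_add[symmetric])
    have "inv\<^bsub>add_monoid (B U)\<^esub> x = al U (\<ominus>[R U] a)" using ab al_uminus[OF U ab(1)] by (simp add: a_inv_def)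
    then show "inv\<^bsub>add_monoid (B U)\<^esub> x \<in> scalars X Y U" using ab by auto
  qed (use U in auto)
  then show ?thesis by (intro abelian_subgroupI3 additive_subgroup.intro BU.is_abelian_group)
qed

context
  fixes U assumes U: "opn U"
begin

interpretation BU: cring "B U" by (rule XY.R_cring[OF U])
interpretation RU: cring "R U" by (rule R_cring[OF U])

lemma qco_eqI:
  assumes "a \<in>: R U" "b \<in>: B U"
  shows "qco U (al U a \<oplus>[B U] b) = qco U b"
proof (intro Set.set_eqI iffI)
  fix d assume "d \<in> qco U (al U a \<oplus>[B U] b)"
  then obtain c where "c \<in>: R U" "d = al U c \<oplus>[B U] (al U a \<oplus>[B U] b)" unfolding mem_qco by auto
  then have "c \<oplus>[R U] a \<in>: R U" "d = al U (c \<oplus>[R U] a) \<oplus>[B U] b"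
    using assms U by (auto simp: al_add BU.a_assoc)
  then show "d \<in> qco U b" unfolding mem_qco by blast
next
  fix d assume "d \<in> qco U b"
  then obtain c where "c \<in>: R U" "d = al U c \<oplus>[B U] b" unfolding mem_qco by auto
  then have "c \<ominus>[R U] a \<in>: R U" "d = al U (c \<ominus>[R U] a) \<oplus>[B U] (al U a \<oplus>[B U] b)"
    using assms U by (auto simp: al_add al_uminus RU.minus_eq BU.a_assoc BU.r_neg1 BU.r_neg2)
  then show "d \<in> qco U (al U a \<oplus>[B U] b)" unfolding mem_qco by blast
qed

lemma qco_self: "b \<in>: B U ==> b \<in> qco U b"
  unfolding mem_qco using U by (intro bexI[of _ "\<zero>[R U]"]) auto

lemma QP_carrier: "carrier (sec QP U) = qco U ` carrier (B U)"
  by (auto simp: quotient_presheaf_def A_RCOSETS_def' qco_def)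

lemma QP_zero: "\<zero>[sec QP U] = qco U \<zero>[B U]"
proof -
  have "qco U \<zero>[B U] = scalars X Y U" using U by (auto simp: mem_qco set_eq_iff image_iff)
  then show ?thesis by (simp add: quotient_presheaf_def)
qed

lemma QP_add: "b \<in>: B U ==> c \<in>: B U ==> qco U b \<oplus>[QP,U] qco U c = qco U (b \<oplus>[B U] c)"
  using abelian_subgroup.a_rcos_sum[OF scalars_subgroup[OF U]] by (simp add: quotient_presheaf_def qco_def)

lemma QP_smult:
  assumes a: "a \<in>: R U" and b: "b \<in>: B U"
  shows "a \<odot>[QP,U] qco U b = qco U (al U a \<otimes>[B U] b)"
proof -
  have "(\<Union>d\<in>qco U b. qco U (al U a \<otimes>[B U] d)) = qco U (al U a \<otimes>[B U] b)"
  proof (rule UN_const[OF qco_self[OF b]])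
    fix d assume "d \<in> qco U b"
    then obtain c where c: "c \<in>: R U" "d = al U c \<oplus>[B U] b" unfolding mem_qco by auto
    then have "al U a \<otimes>[B U] d = al U (a \<otimes>[R U] c) \<oplus>[B U] al U a \<otimes>[B U] b" using a b U by (simp add: al_mult BU.r_distr)
    then show "qco U (al U a \<otimes>[B U] d) = qco U (al U a \<otimes>[B U] b)"
      using qco_eqI[of "a \<otimes>[R U] c" "al U a \<otimes>[B U] b"] a b c U by simp
  qed
  then show ?thesis by (simp add: quotient_presheaf_def qco_def)
qed

lemma QP_res:
  assumes V: "opn V" "V \<subseteq> U" and b: "b \<in>: B U"
  shows "res QP U V (qco U b) = qco V (br U V b)"
proof -
  have "(\<Union>d\<in>qco U b. qco V (br U V d)) = qco V (br U V b)"
  proof (rule UN_const[OF qco_self[OF b]])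
    fix d assume "d \<in> qco U b"
    then obtain c where c: "c \<in>: R U" "d = al U c \<oplus>[B U] b" unfolding mem_qco by auto
    then show "qco V (br U V d) = qco V (br U V b)"
      using b U V by (simp add: XY.rr_add al_res[symmetric] quadratic.qco_eqI[OF quadratic_axioms])
  qed
  then show ?thesis by (simp add: quotient_presheaf_def qco_def)
qed

lemma QP_module: "Module.module (R U) (sec QP U)"
proof (rule moduleI, rule RU.is_cring, rule abelian_groupI)
  fix x assume "x \<in>: sec QP U"
  then obtain b where b: "x = qco U b" "b \<in>: B U" unfolding QP_carrier by auto
  show "\<exists>y\<in>carrier (sec QP U). y \<oplus>[QP,U] x = \<zero>[sec QP U]"
    using b by (intro bexI[of _ "qco U (\<ominus>[B U] b)"]) (auto simp: QP_carrier QP_add QP_zero BU.l_neg)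
qed (use U in \<open>auto simp: QP_carrier QP_add QP_zero QP_smult al_add al_mult BU.a_ac BU.m_assoc BU.l_distr BU.r_distr\<close>)

end

lemma QP_presheaf: "mpre QP"
  unfolding is_module_presheaf_def is_presheaf_def
proof (intro conjI allI impI ballI; (elim conjE)?)
  fix U V assume UV: "opn U" "opn V" "V \<subseteq> U"
  show "res QP U V \<in> carrier (sec QP U) \<rightarrow> carrier (sec QP V)"
    using UV by (auto simp: QP_carrier QP_res)
  { fix s t assume "s \<in>: sec QP U" "t \<in>: sec QP U"
    then show "res QP U V (s \<oplus>[QP,U] t) = res QP U V s \<oplus>[QP,V] res QP U V t"
      using UV XY.R_cring[OF UV(1)] by (auto simp: QP_carrier QP_res QP_add XY.rr_add cring_def ring.ring_simprules(1)) }
  fix a s assume "a \<in>: R U" "s \<in>: sec QP U"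
  then show "res QP U V (a \<odot>[QP,U] s) = rr U V a \<odot>[QP,V] res QP U V s"
    using UV XY.R_cring[OF UV(1)] by (auto simp: QP_carrier QP_res QP_smult XY.rr_mult al_res cring_def ring.ring_simprules(5))
next
  fix U s assume "opn U" "s \<in>: sec QP U"
  then show "res QP U U s = s" by (auto simp: QP_carrier QP_res)
next
  fix U V W s assume "opn U" "opn V" "opn W" "W \<subseteq> V" "V \<subseteq> U" "s \<in>: sec QP U"
  then show "res QP V W (res QP U V s) = res QP U W s" by (auto simp: QP_carrier QP_res)
next
  fix U assume "opn U" then show "Module.module (R U) (sec QP U)" by (rule QP_module)
qed

lemma QM_sheaf: "msh QM"
  unfolding quotient_module_def by (rule sheafify_sheaf[OF QP_presheaf])

lemma QM_presheaf: "mpre QM" using QM_sheaf by simp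

lemma qcl_to_sh: "qcl U b = to_sheafification X QP U (qco U b)"
  by (simp add: quotient_class_def qco_def)

lemma qcl_closed: "opn U ==> b \<in>: B U ==> qcl U b \<in>: sec QM U"
  unfolding qcl_to_sh quotient_module_def by (rule to_sh_closed[OF QP_presheaf]) (auto simp: QP_carrier)

lemma qcl_res: "opn U ==> opn V ==> V \<subseteq> U ==> b \<in>: B U ==> res QM U V (qcl U b) = qcl V (br U V b)"
  unfolding qcl_to_sh quotient_module_def
  using mm_res[OF to_sh_morphism[OF QP_presheaf], of U V "qco U b"] by (simp add: QP_carrier QP_res)

lemma qcl_affine:
  assumes U: "opn U" and c: "p \<in>: R U" "t \<in>: R U" and g: "g \<in>: B U"
  shows "qcl U (al U p \<oplus>[B U] al U t \<otimes>[B U] g) = t \<odot>[QM,U] qcl U g"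
proof -
  interpret BU: cring "B U" by (rule XY.R_cring[OF U])
  have "qco U (al U p \<oplus>[B U] al U t \<otimes>[B U] g) = t \<odot>[QP,U] qco U g"
    using qco_eqI[OF U c(1), of "al U t \<otimes>[B U] g"] QP_smult[OF U c(2) g] c g U by simp
  then show ?thesis unfolding qcl_to_sh quotient_module_def
    using mm_smult[OF to_sh_morphism[OF QP_presheaf] U c(2), of "qco U g"] g by (simp add: QP_carrier[OF U])
qed

text \<open>Already for the presheaf of quotients the class of \<gamma> is a free generator: the
  summand p of p + t \<gamma> dies in the quotient, and t is determined because 1, \<gamma> are
  independent.\<close>

lemma gen_qcl: assumes q: "qfr U \<gamma>" shows "gen QM U (qcl U \<gamma>)"
  unfolding qcl_to_sh quotient_module_def
proof (rule gen_sheafify[OF QP_presheaf], rule genI[OF QP_presheaf])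
  note U = qfr_open[OF q] and g = qfr_closed[OF q]
  show "opn U" "qco U \<gamma> \<in>: sec QP U" using U g by (auto simp: QP_carrier)
  fix W assume W: "opn W" "W \<subseteq> U"
  interpret BW: cring "B W" by (rule XY.R_cring[OF W(1)])
  interpret RW: cring "R W" by (rule R_cring[OF W(1)])
  note qW = qfr_res[OF q W] note gW = qfr_closed[OF qW]
  have r: "a \<odot>[QP,W] res QP U W (qco U \<gamma>) = qco W (al W a \<otimes>[B W] br U W \<gamma>)" if "a \<in>: R W" for a
    using that QP_smult[OF W(1) that gW] QP_res[OF U W g] by simp
  { fix m assume "m \<in>: sec QP W"
    then obtain b where b: "m = qco W b" "b \<in>: B W" using QP_carrier[OF W(1)] by auto
    obtain p t where p: "p \<in>: R W" "t \<in>: R W" "b = al W p \<oplus>[B W] al W t \<otimes>[B W] br U W \<gamma>" by (rule qfr_coord[OF qW b(2)])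
    have "m = t \<odot>[QP,W] res QP U W (qco U \<gamma>)" unfolding r[OF p(2)] b(1) p(3) using qco_eqI[OF W(1) p(1)] p W gW by simp
    then show "\<exists>a\<in>carrier (R W). m = a \<odot>[QP,W] res QP U W (qco U \<gamma>)" using p by blast }
  fix a b assume a: "a \<in>: R W" and b: "b \<in>: R W"
    and e: "a \<odot>[QP,W] res QP U W (qco U \<gamma>) = b \<odot>[QP,W] res QP U W (qco U \<gamma>)"
  have "al W a \<otimes>[B W] br U W \<gamma> \<in> qco W (al W b \<otimes>[B W] br U W \<gamma>)"
    using e qco_self[OF W(1), of "al W a \<otimes>[B W] br U W \<gamma>"] a gW W unfolding r[OF a] r[OF b] by simp
  then obtain c where c: "c \<in>: R W" "al W a \<otimes>[B W] br U W \<gamma> = al W c \<oplus>[B W] al W b \<otimes>[B W] br U W \<gamma>" unfolding mem_qco by auto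
  then have "al W \<zero>[R W] \<oplus>[B W] al W a \<otimes>[B W] br U W \<gamma> = al W c \<oplus>[B W] al W b \<otimes>[B W] br U W \<gamma>" using W a b gW by simp
  from qfr_cancel(2)[OF qW _ a c(1) b this] show "a = b" by simp
qed

lemma QM_invertible: "line QM"
  unfolding invertible_iff using QM_sheaf gen_qcl good_within[OF openin_topspace] unfolding good_def by metis

abbreviation "QD \<equiv> qdual X Y"

lemma QD_invertible: "line QD" by (rule dual_invertible[OF QM_invertible])
lemma QD_presheaf: "mpre QD" using QD_invertible by simp

text \<open>The linear form \<gamma>* of the overview.\<close>

definition del :: "'p set => 's => ('p, 'r, 's) quotient_dual" where
  "del U \<gamma> = dual_gen QM U (qcl U \<gamma>)"

lemma gen_del: "qfr U \<gamma> ==> gen QD U (del U \<gamma>)"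
  unfolding del_def by (rule gen_dual_gen[OF QM_presheaf gen_qcl])

lemma del_self: "qfr U \<gamma> ==> del U \<gamma> U (qcl U \<gamma>) = \<one>[R U]"
  unfolding del_def by (rule dual_gen_self[OF QM_presheaf gen_qcl])

lemma del_res: "qfr U \<gamma> ==> opn V ==> V \<subseteq> U ==> res QD U V (del U \<gamma>) = del V (br U V \<gamma>)"
  unfolding del_def using dual_gen_res[OF QM_presheaf gen_qcl] qcl_res[of U V \<gamma>] by simp

lemma QD_eval:
  assumes U: "opn U" and d: "\<delta> \<in>: sec QD U" and c: "p \<in>: R U" "t \<in>: R U" and g: "g \<in>: B U"
  shows "\<delta> U (qcl U (al U p \<oplus>[B U] al U t \<otimes>[B U] g)) = t \<otimes>[R U] \<delta> U (qcl U g)"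
  unfolding qcl_affine[OF U c g] by (rule form_smult[OF dual_form[OF U d] U subset_refl c(2) qcl_closed[OF U g]])

text \<open>Both sides take the value t at the class of \<gamma>'. In this direction the formula
  contains t itself and no inverse of it.\<close>

lemma del_affine:
  assumes q: "qfr U \<gamma>" and q': "qfr U \<gamma>'" and c: "p \<in>: R U" "t \<in>: R U" "\<gamma>' = al U p \<oplus>[B U] al U t \<otimes>[B U] \<gamma>"
  shows "del U \<gamma> = t \<odot>[QD,U] del U \<gamma>'"
proof (rule dual_gen_ext[OF QM_presheaf gen_qcl[OF q']])
  note U = qfr_open[OF q] and g = qfr_closed[OF q] and dc = gen_closed[OF gen_del[OF q]] gen_closed[OF gen_del[OF q']]
  interpret RU: cring "R U" by (rule R_cring[OF U])
  show "del U \<gamma> \<in>: sec QD U" "t \<odot>[QD,U] del U \<gamma>' \<in>: sec QD U"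
    using dc msmult_closed[OF QD_presheaf U c(2)] by auto
  have "del U \<gamma> U (qcl U \<gamma>') = t" unfolding c(3) using QD_eval[OF U dc(1) c(1,2) g] del_self[OF q] c(2) by simp
  then show "del U \<gamma> U (qcl U \<gamma>') = (t \<odot>[QD,U] del U \<gamma>') U (qcl U \<gamma>')"
    using dual_smult_eval[OF QM_presheaf U c(2) qcl_closed[OF U qfr_closed[OF q']]] del_self[OF q'] c(2) by simp
qed

text \<open>The generator \<open>n(x)\<close>; by \<open>nn_eq\<close> below, the choice of \<open>\<gamma>\<close> does not matter.\<close>

definition nn :: "('p, 's, 'm) module_presheaf => 'p set => 'm => ('p, 'r, 's, 'm) normed" where
  "nn I U x = (let \<gamma> = SOME \<gamma>. qfr U \<gamma> in norm_tens X Y I U (wdg I U (\<gamma> \<odot>[I,U] x) x) (del U \<gamma>))"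

abbreviation "NM \<equiv> norm_module X Y"

lemma W2_invertible: "XY.line I ==> line (W2 I)"
  by (rule wedge2_invertible[OF rs_locally_free])

lemma NM_invertible: "XY.line I ==> line (NM I)"
  unfolding norm_module_def by (rule tensor_invertible[OF W2_invertible QD_invertible])

lemma NM_sheaf: "XY.line I ==> msh (NM I)" using NM_invertible by (rule inv_ms)

context
  fixes I :: "('p, 's, 'm) module_presheaf"
  assumes I: "XY.line I"
begin

lemma Ip: "XY.mpre I" using I by simp

lemma W2p: "mpre (W2 I)" by (rule W2_presheaf[OF Ip])

text \<open>The factor t by which \<gamma>' x \<and> x differs from \<gamma> x \<and> x moves across
  the tensor sign, where \<open>del_affine\<close> absorbs it into the linear form.\<close>

lemma nn_eq:
  assumes q: "qfr U \<gamma>" and x: "x \<in>: sec I U"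
  shows "nn I U x = norm_tens X Y I U (wdg I U (\<gamma> \<odot>[I,U] x) x) (del U \<gamma>)"
proof -
  define \<gamma>' where "\<gamma>' = (SOME \<gamma>. qfr U \<gamma>)"
  have q': "qfr U \<gamma>'" unfolding \<gamma>'_def using q by (rule someI)
  note U = qfr_open[OF q] and g = qfr_closed[OF q]
  obtain p t where c: "p \<in>: R U" "t \<in>: R U" "\<gamma>' = al U p \<oplus>[B U] al U t \<otimes>[B U] \<gamma>"
    by (rule qfr_coord[OF q qfr_closed[OF q']])
  let ?w = "wdg I U (\<gamma> \<odot>[I,U] x) x"
  have wc: "?w \<in>: sec (W2 I) U" by (rule wdg_closed[OF Ip U XY.msmult_closed[OF Ip U g x] x])
  have w: "wdg I U (\<gamma>' \<odot>[I,U] x) x = t \<odot>[W2 I,U] ?w"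
    unfolding c(3) by (rule wdg_affine[OF Ip U x g c(1,2)])
  have dc: "del U \<gamma>' \<in>: sec QD U" by (rule gen_closed[OF gen_del[OF q']])
  have "nn I U x = norm_tens X Y I U (wdg I U (\<gamma>' \<odot>[I,U] x) x) (del U \<gamma>')"
    unfolding nn_def Let_def \<gamma>'_def ..
  also have "\<dots> = norm_tens X Y I U ?w (t \<odot>[QD,U] del U \<gamma>')"
    unfolding w using tens_smult_l[OF W2p QD_presheaf U c(2) wc dc] tens_smult_r[OF W2p QD_presheaf U c(2) wc dc] by simp
  also have "t \<odot>[QD,U] del U \<gamma>' = del U \<gamma>" by (rule del_affine[OF q q' c, symmetric])
  finally show ?thesis .
qed

lemma nn_closed: assumes U: "good U" and x: "x \<in>: sec I U" shows "nn I U x \<in>: sec (NM I) U"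
proof -
  obtain \<gamma> where q: "qfr U \<gamma>" using U unfolding good_def by auto
  note Uo = qfr_open[OF q]
  show ?thesis unfolding nn_eq[OF q x] norm_module_def
    by (rule tens_closed[OF W2p QD_presheaf Uo wdg_closed[OF Ip Uo XY.msmult_closed[OF Ip Uo qfr_closed[OF q] x] x] gen_closed[OF gen_del[OF q]]])
qed

lemma gen_nn: assumes U: "good U" and x: "XY.gen I U x" shows "gen (NM I) U (nn I U x)"
proof -
  obtain \<gamma> where q: "qfr U \<gamma>" using U unfolding good_def by auto
  show ?thesis unfolding nn_eq[OF q XY.gen_closed[OF x]] norm_module_def
    by (rule gen_tens[OF W2p QD_presheaf gen_wdg[OF Ip q x] gen_del[OF q]])
qed

lemma nn_res:
  assumes U: "good U" and V: "opn V" "V \<subseteq> U" and x: "x \<in>: sec I U"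
  shows "res (NM I) U V (nn I U x) = nn I V (res I U V x)"
proof -
  obtain \<gamma> where q: "qfr U \<gamma>" using U unfolding good_def by auto
  note Uo = qfr_open[OF q] and g = qfr_closed[OF q]
  note gx = XY.msmult_closed[OF Ip Uo g x] and xV = XY.mres_closed[OF Ip Uo V x]
  show ?thesis unfolding nn_eq[OF q x] nn_eq[OF qfr_res[OF q V] xV] norm_module_def
    using tens_res[OF W2p QD_presheaf Uo V wdg_closed[OF Ip Uo gx x] gen_closed[OF gen_del[OF q]]]
      wdg_res[OF Ip Uo V gx x] XY.mres_smult[OF Ip Uo V g x] del_res[OF q V] by simp
qed

lemma nn_smult:
  assumes U: "good U" and b: "b \<in>: B U" and x: "x \<in>: sec I U"
  shows "nn I U (b \<odot>[I,U] x) = nrm U b \<odot>[NM I,U] nn I U x"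
proof -
  obtain \<gamma> where q: "qfr U \<gamma>" using U unfolding good_def by auto
  note Uo = qfr_open[OF q] and g = qfr_closed[OF q]
  show ?thesis unfolding nn_eq[OF q x] nn_eq[OF q XY.msmult_closed[OF Ip Uo b x]] norm_module_def det_wdg[OF Ip U b g x]
    by (rule tens_smult_l[OF W2p QD_presheaf Uo nrm_closed[OF U b] wdg_closed[OF Ip Uo XY.msmult_closed[OF Ip Uo g x] x] gen_closed[OF gen_del[OF q]]])
qed

lemma good_gen_within:
  assumes "opn U" "p \<in> U"
  obtains V x where "good V" "p \<in> V" "V \<subseteq> U" "XY.gen I V x"
proof -
  obtain V where V: "good V" "p \<in> V" "V \<subseteq> U" using good_within[OF assms] by blast
  obtain W x where W: "opn W" "p \<in> W" "W \<subseteq> V" "XY.gen I W x" using XY.inv_gen_within[OF I good_open[OF V(1)] V(2)] by auto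
  show thesis by (rule that[OF good_subset[OF V(1) W(1,3)] W(2) _ W(4)]) (use V W in auto)
qed

end

text \<open>As frames restrict, compatibility is needed only for two frames over the same open set.\<close>

lemma norm_morphism:
  assumes I: "XY.line I" and K: "msh K"
    and Fr: "\<And>V x k. Fr V x k ==> good V \<and> XY.gen I V x \<and> k \<in>: sec K V"
    and res: "\<And>V W x k. Fr V x k ==> opn W ==> W \<subseteq> V ==> Fr W (res I V W x) (res K V W k)"
    and cov: "\<And>p. p \<in> whole X ==> \<exists>V x k. p \<in> V \<and> Fr V x k"
    and compat: "\<And>V x k y l b. Fr V x k ==> Fr V y l ==> b \<in>: B V ==> x = b \<odot>[I,V] y ==>
       k = nrm V b \<odot>[K,V] l"
  shows "\<exists>h. mmor (NM I) K h \<and> (\<forall>V x k. Fr V x k --> h V (nn I V x) = k) \<and>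
    ((\<forall>V x k. Fr V x k --> gen K V k) --> miso (NM I) K h)"
proof -
  note Ip = Ip[OF I] and NI = NM_sheaf[OF I]
  define F where "F = (\<lambda>V g g'. \<exists>x. Fr V x g' \<and> g = nn I V x)"
  have fr: "frames (NM I) K F"
  proof (rule framesI)
    fix V g g' assume "F V g g'"
    then obtain x where x: "Fr V x g'" "g = nn I V x" unfolding F_def by auto
    note f = Fr[OF x(1)]
    show "gen (NM I) V g \<and> g' \<in>: sec K V" unfolding x(2) using f gen_nn[OF I] by blast
    fix W assume W: "opn W" "W \<subseteq> V"
    have "res (NM I) V W g = nn I W (res I V W x)" unfolding x(2) using f by (intro nn_res[OF I _ W]) auto
    then show "F W (res (NM I) V W g) (res K V W g')" unfolding F_def using res[OF x(1) W] by blast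
  next
    fix p assume "p \<in> whole X"
    then obtain V x k where V: "p \<in> V" "Fr V x k" using cov by metis
    then have "F V (nn I V x) k" unfolding F_def by blast
    then show "\<exists>V g g'. p \<in> V \<and> F V g g'" using V(1) by blast
  next
    fix V g g' h h' a assume "F V g g'" "F V h h'" and a: "a \<in>: R V" "g = a \<odot>[NM I,V] h"
    then obtain x y where x: "Fr V x g'" "g = nn I V x" and y: "Fr V y h'" "h = nn I V y" unfolding F_def by auto
    have f: "good V" "XY.gen I V x" "XY.gen I V y" using Fr[OF x(1)] Fr[OF y(1)] by auto
    obtain b where b: "b \<in>: B V" "x = b \<odot>[I,V] y" using XY.gen_coeff[OF Ip f(3) XY.gen_closed[OF f(2)]] by auto
    have "a = nrm V b"
      by (rule gen_cancel[OF ms_mp[OF NI] gen_nn[OF I f(1,3)] a(1) nrm_closed[OF f(1) b(1)]])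
        (use a(2) nn_smult[OF I f(1) b(1) XY.gen_closed[OF f(3)]] x y b in simp)
    then show "g' = a \<odot>[K,V] h'" using compat[OF x(1) y(1) b] by simp
  qed
  obtain h where h: "mmor (NM I) K h" "\<And>V g g'. F V g g' ==> h V g = g'"
    using line_morphism[OF ms_mp[OF NI] K fr] by auto
  have "miso (NM I) K h" if "\<forall>V x k. Fr V x k --> gen K V k"
    by (rule line_isomorphism[OF NI K fr _ h]) (use that in \<open>auto simp: F_def\<close>)
  then show ?thesis using h unfolding F_def by blast
qed

text \<open>One generator around each point is enough: n(x) restricts to a generator of the norm on
  every smaller open set, and agreement restricts with it.\<close>

lemma norm_morphism_eq:
  assumes I: "XY.line I" and K: "msh K"
    and h: "mmor (NM I) K h" "mmor (NM I) K h'"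
    and cov: "\<And>p. p \<in> whole X ==> \<exists>V x. p \<in> V \<and> good V \<and> XY.gen I V x \<and> h V (nn I V x) = h' V (nn I V x)"
    and U: "opn U" "n \<in>: sec (NM I) U"
  shows "h U n = h' U n"
proof (rule morphism_eq_on_gens[OF K _ h _ U])
  show Np: "mpre (NM I)" using NM_sheaf[OF I] by simp
  fix p assume p: "p \<in> U"
  have "p \<in> whole X" using p openin_subset[OF U(1)] by blast
  then obtain V x where V: "p \<in> V" "good V" "XY.gen I V x" and e: "h V (nn I V x) = h' V (nn I V x)" using cov by blast
  note Vo = good_open[OF V(2)] and gn = gen_nn[OF I V(2,3)]
  have o: "opn (V \<inter> U)" "V \<inter> U \<subseteq> V" using Vo U by auto
  have "gen (NM I) (V \<inter> U) (res (NM I) V (V \<inter> U) (nn I V x))" by (rule gen_res[OF Np gn o])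
  moreover have "h (V \<inter> U) (res (NM I) V (V \<inter> U) (nn I V x)) = h' (V \<inter> U) (res (NM I) V (V \<inter> U) (nn I V x))"
    using mm_res[OF h(1) Vo o gen_closed[OF gn]] mm_res[OF h(2) Vo o gen_closed[OF gn]] e by simp
  ultimately show "\<exists>V g. p \<in> V \<and> V \<subseteq> U \<and> gen (NM I) V g \<and> h V g = h' V g" using V p by blast
qed

section \<open>Functoriality of the norm and the canonical rigidification\<close>

lemma rs_iso: "XY.miso I J \<phi> ==> miso (rs I) (rs J) \<phi>"
  unfolding module_isomorphism_def module_morphism_def is_linear_def by auto

text \<open>As \<open>\<phi>\<close> is linear over the algebra, it carries \<gamma> x \<and> x to
  \<gamma> \<phi>(x) \<and> \<phi>(x), and the factor \<gamma>* is left alone.\<close>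

lemma norm_map_props:
  assumes I: "XY.line I" and J: "XY.line J" and i: "XY.miso I J \<phi>"
  shows "miso (NM I) (NM J) (norm_map X Y I J \<phi>)"
    and "good U ==> x \<in>: sec I U ==> norm_map X Y I J \<phi> U (nn I U x) = nn J U (\<phi> U x)"
proof -
  note w = wedge2_map_props[OF rs_locally_free[OF I] rs_locally_free[OF J] rs_iso[OF i]]
  have d: "miso QD QD (\<lambda>U \<delta>. \<delta>)" by (rule mi_id[OF QD_presheaf])
  show "miso (NM I) (NM J) (norm_map X Y I J \<phi>)"
    unfolding norm_map_def norm_module_def
    by (rule tensor_map_iso[OF W2_invertible[OF I] QD_invertible W2_invertible[OF J] QD_invertible w(1) d])
  assume U: "good U" and x: "x \<in>: sec I U"
  obtain \<gamma> where q: "qfr U \<gamma>" using U unfolding good_def by auto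
  note Uo = qfr_open[OF q] and g = qfr_closed[OF q]
  have gx: "\<gamma> \<odot>[I,U] x \<in>: sec I U" by (rule XY.msmult_closed[OF Ip[OF I] Uo g x])
  have \<phi>m: "XY.mmor I J \<phi>" using XY.mi_mm[OF i] .
  have \<phi>x: "\<phi> U x \<in>: sec J U" by (rule XY.mm_closed[OF \<phi>m Uo x])
  show "norm_map X Y I J \<phi> U (nn I U x) = nn J U (\<phi> U x)"
    unfolding nn_eq[OF I q x] nn_eq[OF J q \<phi>x] norm_map_def
    using tensor_map_props(2)[OF W2_invertible[OF I] QD_invertible W2_invertible[OF J] QD_invertible mi_mm[OF w(1)] mi_mm[OF d] Uo
        wdg_closed[OF Ip[OF I] Uo gx x] gen_closed[OF gen_del[OF q]]]
      w(2)[OF Uo, of "\<gamma> \<odot>[I,U] x" x] gx x XY.mm_smult[OF \<phi>m Uo g x] by simp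
qed

text \<open>The map is built from its value 1 at n(1) and only then shown to satisfy the evaluation
  formula for all \<gamma> and \<delta>, which is what \<open>canonical_rig\<close> asks
  for.\<close>

lemma canonical_rig_props:
  shows "rigidification X Y BA (canonical_rig X Y)"
    and "good U ==> canonical_rig X Y U (nn BA U \<one>[B U]) = \<one>[R U]"
proof -
  have A: "XY.line BA" using XY.self_invertible by simp
  let ?I = "BA"
  \<comment> \<open>The only generator used is 1, so the compatibility of frames reduces to the fact
    that the norm of 1 is 1.\<close>
  define Fr where "Fr = (\<lambda>V x k. good V \<and> x = \<one>[B V] \<and> k = \<one>[R V])"
  have "\<exists>h. mmor (NM ?I) SO h \<and> (\<forall>V x k. Fr V x k --> h V (nn ?I V x) = k) \<and>
    ((\<forall>V x k. Fr V x k --> gen SO V k) --> miso (NM ?I) SO h)"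
  proof (rule norm_morphism[OF A self_sheaf])
    fix V x k assume f: "Fr V x k"
    then show "good V \<and> XY.gen ?I V x \<and> k \<in>: sec SO V" using alg_self_gen unfolding Fr_def by auto
    { fix W assume "opn W" "W \<subseteq> V"
      then show "Fr W (res ?I V W x) (res SO V W k)" using f good_subset unfolding Fr_def by auto }
    fix y l b assume f2: "Fr V y l" and b: "b \<in>: B V" "x = b \<odot>[?I,V] y"
    interpret BV: cring "B V" using f by (simp add: Fr_def XY.R_cring)
    interpret RV: cring "R V" using f by (simp add: Fr_def R_cring)
    have "b = \<one>[B V]" using b f f2 unfolding Fr_def by simp
    then show "k = nrm V b \<odot>[SO,V] l" using f f2 nrm_one unfolding Fr_def by simp
  next
    fix p assume "p \<in> whole X"
    then show "\<exists>V x k. p \<in> V \<and> Fr V x k" using good_within[OF openin_topspace] unfolding Fr_def by blast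
  qed
  moreover have "gen SO V k" if "Fr V x k" for V x k
    using that gen_self[of V "\<one>[R V]"] R_cring[of V] unfolding Fr_def
    by (auto simp: cring_def ring.is_monoid monoid.Units_one_closed)
  ultimately obtain h where h: "miso (NM ?I) SO h" "\<And>V. good V ==> h V (nn ?I V \<one>[B V]) = \<one>[R V]"
    unfolding Fr_def by blast
  have hm: "mmor (NM ?I) SO h" using h by simp
  note p = W2p[OF A] QD_presheaf
  \<comment> \<open>Over a small set \<gamma> is a + t g0 and \<delta> is e times
    \<open>del V g0\<close>; both sides then restrict to t e.\<close>
  have hv: "h U (norm_tens X Y ?I U (wdg ?I U \<gamma> \<one>[B U]) \<delta>) = \<delta> U (qcl U \<gamma>)"
    if U: "opn U" and g: "\<gamma> \<in>: B U" and d: "\<delta> \<in>: sec QD U" for U \<gamma> \<delta>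
  proof (rule sheaf_eqI[OF R_sheaf U])
    have wc: "wdg ?I U \<gamma> \<one>[B U] \<in>: sec (W2 ?I) U" using wdg_closed[OF AS U] g U by simp
    have tc: "norm_tens X Y ?I U (wdg ?I U \<gamma> \<one>[B U]) \<delta> \<in>: sec (NM ?I) U"
      unfolding norm_module_def by (rule tens_closed[OF p U wc d])
    show "h U (norm_tens X Y ?I U (wdg ?I U \<gamma> \<one>[B U]) \<delta>) \<in>: R U" using mm_closed[OF hm U tc] by simp
    show "\<delta> U (qcl U \<gamma>) \<in>: R U" by (rule form_closed[OF dual_form[OF U d] U subset_refl qcl_closed[OF U g]])
    fix pt assume pt: "pt \<in> U"
    obtain V where V: "good V" "pt \<in> V" "V \<subseteq> U" using good_within[OF U pt] by auto
    obtain g0 where q: "qfr V g0" using V unfolding good_def by auto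
    note Vo = qfr_open[OF q] and g0 = qfr_closed[OF q]
    interpret BV: cring "B V" by (rule XY.R_cring[OF Vo])
    interpret RV: cring "R V" by (rule R_cring[OF Vo])
    obtain a t where c: "a \<in>: R V" "t \<in>: R V" "br U V \<gamma> = al V a \<oplus>[B V] al V t \<otimes>[B V] g0"
      by (rule qfr_coord[OF q XY.rr_closed[OF U Vo V(3) g]])
    obtain e where e: "e \<in>: R V" "res QD U V \<delta> = e \<odot>[QD,V] del V g0"
      using gen_coeff[OF QD_presheaf gen_del[OF q] mres_closed[OF QD_presheaf U Vo V(3) d]] by auto
    note dc = gen_closed[OF gen_del[OF q]]
    have w0: "wdg ?I V g0 \<one>[B V] \<in>: sec (W2 ?I) V" using wdg_closed[OF AS Vo] g0 Vo by simp
    have n0: "nn ?I V \<one>[B V] = norm_tens X Y ?I V (wdg ?I V g0 \<one>[B V]) (del V g0)"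
      using nn_eq[OF A q, of "\<one>[B V]"] g0 by simp
    have n0c: "nn ?I V \<one>[B V] \<in>: sec (NM ?I) V" using nn_closed[OF A V(1)] by simp
    have w: "wdg ?I V (br U V \<gamma>) \<one>[B V] = t \<odot>[W2 ?I,V] wdg ?I V g0 \<one>[B V]"
      unfolding c(3) using wdg_affine[OF AS Vo _ g0 c(1,2), of "\<one>[B V]"] g0 c Vo by simp
    have wr: "res (W2 ?I) U V (wdg ?I U \<gamma> \<one>[B U]) = wdg ?I V (br U V \<gamma>) \<one>[B V]"
      using wdg_res[OF AS U Vo V(3), of \<gamma> "\<one>[B U]"] g U Vo V(3) by simp
    have "rr U V (h U (norm_tens X Y ?I U (wdg ?I U \<gamma> \<one>[B U]) \<delta>)) =
       h V (res (NM ?I) U V (norm_tens X Y ?I U (wdg ?I U \<gamma> \<one>[B U]) \<delta>))"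
      using mm_res[OF hm U Vo V(3) tc] by simp
    also have "res (NM ?I) U V (norm_tens X Y ?I U (wdg ?I U \<gamma> \<one>[B U]) \<delta>) = (t \<otimes>[R V] e) \<odot>[NM ?I,V] nn ?I V \<one>[B V]"
      unfolding n0 norm_module_def tens_res[OF p U Vo V(3) wc d] wr w e(2) by (rule tens_smult[OF p Vo c(2) e(1) w0 dc])
    also have "h V \<dots> = t \<otimes>[R V] e" using mm_smult[OF hm Vo _ n0c] h(2)[OF V(1)] c e by simp
    also have "\<dots> = (res QD U V \<delta>) V (qcl V (br U V \<gamma>))"
      unfolding e(2) dual_smult_eval[OF QM_presheaf Vo e(1) qcl_closed[OF Vo XY.rr_closed[OF U Vo V(3) g]]]
      unfolding c(3) QD_eval[OF Vo dc c(1,2) g0] del_self[OF q] using c e by (simp add: RV.m_comm)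
    also have "\<dots> = rr U V (\<delta> U (qcl U \<gamma>))"
      using dual_res_eval[OF QM_presheaf Vo subset_refl Vo qcl_closed[OF Vo XY.rr_closed[OF U Vo V(3) g]], of U \<delta>]
        form_res[OF dual_form[OF U d] U Vo subset_refl V(3) qcl_closed[OF U g]] qcl_res[OF U Vo V(3) g] by simp
    finally show "\<exists>W. opn W \<and> pt \<in> W \<and> W \<subseteq> U \<and> rr U W (h U (norm_tens X Y ?I U (wdg ?I U \<gamma> \<one>[B U]) \<delta>)) = rr U W (\<delta> U (qcl U \<gamma>))"
      using Vo V by blast
  qed
  have "\<exists>r. rigidification X Y ?I r \<and> (\<forall>U. opn U --> (\<forall>\<gamma>\<in>carrier (B U). \<forall>\<delta>\<in>carrier (sec QD U).
       r U (norm_tens X Y ?I U (wdg ?I U \<gamma> \<one>[B U]) \<delta>) = \<delta> U (qcl U \<gamma>)))"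
    using h(1) hv unfolding rigidification_def by blast
  note * = someI_ex[OF this, folded canonical_rig_def]
  show "rigidification X Y ?I (canonical_rig X Y)" using * by blast
  assume U: "good U"
  obtain \<gamma> where q: "qfr U \<gamma>" using U unfolding good_def by auto
  interpret BU: cring "B U" by (rule XY.R_cring[OF qfr_open[OF q]])
  have "nn ?I U \<one>[B U] = norm_tens X Y ?I U (wdg ?I U \<gamma> \<one>[B U]) (del U \<gamma>)"
    using nn_eq[OF A q, of "\<one>[B U]"] qfr_closed[OF q] by simp
  then show "canonical_rig X Y U (nn ?I U \<one>[B U]) = \<one>[R U]"
    using * qfr_open[OF q] qfr_closed[OF q] gen_closed[OF gen_del[OF q]] del_self[OF q] by simp
qed

end

section \<open>Multiplicativity of the norm\<close>

context quadratic
begin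

lemma BA_invertible: "XY.line BA" using XY.self_invertible by simp

abbreviation "w1 U \<gamma> \<equiv> wdg BA U \<one>[B U] \<gamma>"

lemma w1_closed: "opn U ==> \<gamma> \<in>: B U ==> w1 U \<gamma> \<in>: sec (W2 BA) U"
  using wdg_closed[OF AS, of U "\<one>[B U]" \<gamma>] by simp

lemma w1_res: "opn U ==> opn V ==> V \<subseteq> U ==> \<gamma> \<in>: B U ==>
   res (W2 BA) U V (w1 U \<gamma>) = w1 V (br U V \<gamma>)"
  using wdg_res[OF AS, of U V "\<one>[B U]" \<gamma>] by simp

lemma gen_w1: "qfr U \<gamma> ==> gen (W2 BA) U (w1 U \<gamma>)"
  unfolding qfr_def by (rule gen_wedge[OF AM_presheaf])

lemma w1_affine:
  assumes U: "opn U" and c: "p \<in>: R U" "t \<in>: R U" and g: "g \<in>: B U"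
  shows "w1 U (al U p \<oplus>[B U] al U t \<otimes>[B U] g) = t \<odot>[W2 BA,U] w1 U g"
proof -
  interpret BU: cring "B U" by (rule XY.R_cring[OF U])
  interpret w: alternating "R U" "sec AM U" "sec (W2 BA) U" "wdg BA U" by (rule wdg_alternating[OF AS U])
  have "w1 U (p \<odot>[AM,U] \<one>[B U] \<oplus>[AM,U] t \<odot>[AM,U] g) =
     p \<odot>[W2 BA,U] w1 U \<one>[B U] \<oplus>[W2 BA,U] t \<odot>[W2 BA,U] w1 U g"
    using w.w_add_r[of "\<one>[B U]" "p \<odot>[AM,U] \<one>[B U]" "t \<odot>[AM,U] g"] w.w_smult_r[of p "\<one>[B U]" "\<one>[B U]"]
      w.w_smult_r[of t "\<one>[B U]" g] c g U by simp
  then show ?thesis using w.w_self[of "\<one>[B U]"] w1_closed[OF U g] c g U w.P.smult_r_null by simp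
qed

text \<open>The wedge 1 \<and> \<gamma> and the class of \<gamma> are generators that both acquire
  the factor t when \<gamma> becomes p + t \<gamma>, so they form frames; the same rule extends the
  formula to every \<gamma>.\<close>

lemma wedge2_alg_iso_props:
  shows "miso (W2 BA) QM (wedge2_alg_iso X Y)"
    and "opn U ==> \<gamma> \<in>: B U ==> wedge2_alg_iso X Y U (w1 U \<gamma>) = qcl U \<gamma>"
proof -
  let ?W = "W2 BA"
  have W: "msh ?W" using W2_invertible[OF BA_invertible] by simp
  have Wp: "mpre ?W" using W by simp
  define Fr where "Fr = (\<lambda>V g g'. \<exists>\<gamma>. qfr V \<gamma> \<and> g = w1 V \<gamma> \<and> g' = qcl V \<gamma>)"
  have fr: "frames ?W QM Fr"
  proof (rule framesI)
    fix V g g' assume "Fr V g g'"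
    then obtain \<gamma> where q: "qfr V \<gamma>" "g = w1 V \<gamma>" "g' = qcl V \<gamma>" unfolding Fr_def by auto
    note V = qfr_open[OF q(1)] and gc = qfr_closed[OF q(1)]
    show "gen ?W V g \<and> g' \<in>: sec QM V" unfolding q using gen_w1[OF q(1)] qcl_closed[OF V gc] by simp
    fix U assume U: "opn U" "U \<subseteq> V"
    show "Fr U (res ?W V U g) (res QM V U g')" unfolding Fr_def q
      using qfr_res[OF q(1) U] w1_res[OF V U gc] qcl_res[OF V U gc] by blast
  next
    fix p assume "p \<in> whole X"
    then obtain V \<gamma> where "p \<in> V" "qfr V \<gamma>" using good_within[OF openin_topspace] unfolding good_def by metis
    then show "\<exists>V g g'. p \<in> V \<and> Fr V g g'" unfolding Fr_def by blast
  next
    fix V g g' h h' a assume "Fr V g g'" "Fr V h h'" and a: "a \<in>: R V" "g = a \<odot>[?W,V] h"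
    then obtain \<gamma> \<gamma>' where q: "qfr V \<gamma>" "g = w1 V \<gamma>" "g' = qcl V \<gamma>" and q': "qfr V \<gamma>'" "h = w1 V \<gamma>'" "h' = qcl V \<gamma>'"
      unfolding Fr_def by auto
    note V = qfr_open[OF q(1)]
    obtain p t where c: "p \<in>: R V" "t \<in>: R V" "\<gamma> = al V p \<oplus>[B V] al V t \<otimes>[B V] \<gamma>'"
      by (rule qfr_coord[OF q'(1) qfr_closed[OF q(1)]])
    have "t = a" by (rule gen_cancel[OF Wp gen_w1[OF q'(1)] c(2) a(1)])
      (use a(2) w1_affine[OF V c(1,2) qfr_closed[OF q'(1)]] q(2) q'(2) c(3) in simp)
    then show "g' = a \<odot>[QM,V] h'" using qcl_affine[OF V c(1,2) qfr_closed[OF q'(1)]] q(3) q'(3) c(3) by simp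
  qed
  have "\<exists>\<kappa>. miso ?W QM \<kappa> \<and> (\<forall>V g g'. Fr V g g' --> \<kappa> V g = g')"
    by (rule ex_line_isomorphism[OF W QM_sheaf fr]) (use gen_qcl in \<open>auto simp: Fr_def\<close>)
  then obtain \<kappa> where \<kappa>: "miso ?W QM \<kappa>" "\<And>V \<gamma>. qfr V \<gamma> ==> \<kappa> V (w1 V \<gamma>) = qcl V \<gamma>"
    unfolding Fr_def by blast
  have km: "mmor ?W QM \<kappa>" using \<kappa> by simp
  have "\<kappa> U (w1 U \<gamma>) = qcl U \<gamma>" if U: "opn U" and g: "\<gamma> \<in>: B U" for U \<gamma>
  proof (rule sheaf_eqI[OF ms_sheaf[OF QM_sheaf] U mm_closed[OF km U w1_closed[OF U g]] qcl_closed[OF U g]])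
    fix pt assume pt: "pt \<in> U"
    obtain V \<gamma>' where V: "pt \<in> V" "V \<subseteq> U" and q: "qfr V \<gamma>'" using good_within[OF U pt] unfolding good_def by auto
    note Vo = qfr_open[OF q] and g' = qfr_closed[OF q]
    obtain p t where c: "p \<in>: R V" "t \<in>: R V" "br U V \<gamma> = al V p \<oplus>[B V] al V t \<otimes>[B V] \<gamma>'"
      by (rule qfr_coord[OF q XY.rr_closed[OF U Vo V(2) g]])
    have "res QM U V (\<kappa> U (w1 U \<gamma>)) = \<kappa> V (w1 V (br U V \<gamma>))"
      using mm_res[OF km U Vo V(2) w1_closed[OF U g]] w1_res[OF U Vo V(2) g] by simp
    also have "\<dots> = res QM U V (qcl U \<gamma>)"
      unfolding qcl_res[OF U Vo V(2) g] c(3) w1_affine[OF Vo c(1,2) g'] qcl_affine[OF Vo c(1,2) g']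
        mm_smult[OF km Vo c(2) w1_closed[OF Vo g']] \<kappa>(2)[OF q] ..
    finally show "\<exists>W. opn W \<and> pt \<in> W \<and> W \<subseteq> U \<and> res QM U W (\<kappa> U (w1 U \<gamma>)) = res QM U W (qcl U \<gamma>)"
      using Vo V by blast
  qed
  then have "\<exists>\<kappa>. miso ?W QM \<kappa> \<and> (\<forall>U. opn U --> (\<forall>\<gamma>\<in>carrier (B U). \<kappa> U (w1 U \<gamma>) = qcl U \<gamma>))"
    using \<kappa>(1) by blast
  note * = someI_ex[OF this, folded wedge2_alg_iso_def]
  show "miso ?W QM (wedge2_alg_iso X Y)" using * by blast
  show "wedge2_alg_iso X Y U (w1 U \<gamma>) = qcl U \<gamma>" if "opn U" "\<gamma> \<in>: B U" using * that by blast
qed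

text \<open>The two changes of \<gamma> x \<and> x at once: t comes from the substitution for
  \<gamma> and the norm of b from that for x.\<close>

lemma wdg_scale:
  assumes I: "XY.mpre I" and U: "good U" and b: "b \<in>: B U" and g: "g \<in>: B U"
    and c: "p \<in>: R U" "t \<in>: R U" and x: "x \<in>: sec I U"
  shows "wdg I U ((al U p \<oplus>[B U] al U t \<otimes>[B U] g) \<odot>[I,U] (b \<odot>[I,U] x)) (b \<odot>[I,U] x) =
    (t \<otimes>[R U] nrm U b) \<odot>[W2 I,U] wdg I U (g \<odot>[I,U] x) x"
  using wdg_affine[OF I good_open[OF U] XY.msmult_closed[OF I good_open[OF U] b x] g c] det_wdg[OF I U b g x]
    msmult_assoc[OF W2_presheaf[OF I] good_open[OF U] c(2) nrm_closed[OF U b]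
      wdg_closed[OF I good_open[OF U] XY.msmult_closed[OF I good_open[OF U] g x] x]] by simp

section \<open>The isomorphism for exterior squares of a tensor product\<close>

context
  fixes I :: "('p, 's, 'm) module_presheaf" and J :: "('p, 's, 'n) module_presheaf"
  assumes I: "XY.line I" and J: "XY.line J"
begin

abbreviation "TI \<equiv> alg_tensor X Y I J"
abbreviation "tz \<equiv> alg_tens X Y I J"

lemma TI_invertible: "XY.line TI" by (rule XY.tensor_invertible[OF I J])

text \<open>With \<open>rpt\<close>, the two sides of the formula that characterises
  \<open>wedge2_tensor_iso\<close>.\<close>

definition "lpt U x y g = tens X (W2 I) (W2 J) U
   (wdg I U (g \<odot>[I,U] x) x) (wdg J U (g \<odot>[J,U] y) y)"
definition "rpt U x y g = tens X (W2 TI) (W2 BA) U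
   (wdg TI U (g \<odot>[TI,U] tz U x y) (tz U x y)) (w1 U g)"

abbreviation "LT \<equiv> tensor X (W2 I) (W2 J)"
abbreviation "RT \<equiv> tensor X (W2 TI) (W2 BA)"

lemma Ips: "XY.mpre I" "XY.mpre J" "XY.mpre TI"
  using I J TI_invertible by auto

lemma Wps: "mpre (W2 I)" "mpre (W2 J)"
  "mpre (W2 TI)" "mpre (W2 BA)"
  using W2_presheaf[OF Ips(1)] W2_presheaf[OF Ips(2)] W2_presheaf[OF Ips(3)] W2_presheaf[OF AS] by auto

lemma tz_closed: "opn U ==> x \<in>: sec I U ==> y \<in>: sec J U ==> tz U x y \<in>: sec TI U"
  by (rule XY.tens_closed[OF Ips(1,2)])

lemma tz_smult: "opn U ==> b \<in>: B U ==> c \<in>: B U ==> x \<in>: sec I U ==> y \<in>: sec J U ==>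
   tz U (b \<odot>[I,U] x) (c \<odot>[J,U] y) = (b \<otimes>[B U] c) \<odot>[TI,U] tz U x y"
  by (rule XY.tens_smult[OF Ips(1,2)])

lemma tz_res: "opn U ==> opn V ==> V \<subseteq> U ==> x \<in>: sec I U ==> y \<in>: sec J U ==>
   res TI U V (tz U x y) = tz V (res I U V x) (res J U V y)"
  by (rule XY.tens_res[OF Ips(1,2)])

lemma gen_tz: "XY.gen I U x ==> XY.gen J U y ==> XY.gen TI U (tz U x y)"
  by (rule XY.gen_tens[OF Ips(1,2)])

text \<open>On the left each exterior square contributes t and a norm. On the right the exterior
  square of the tensor product contributes only one t, together with the norm of b c; the second t
  comes from 1 \<and> \<gamma>, which explains that factor. Multiplicativity of the norm makes both
  equal.\<close>

lemma pt_scale: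
  assumes U: "good U" and x: "x \<in>: sec I U" and y: "y \<in>: sec J U" and g: "g \<in>: B U"
    and b: "b \<in>: B U" "c \<in>: B U" and pt: "p \<in>: R U" "t \<in>: R U"
  defines "k \<equiv> (t \<otimes>[R U] nrm U b) \<otimes>[R U] (t \<otimes>[R U] nrm U c)"
  shows "lpt U (b \<odot>[I,U] x) (c \<odot>[J,U] y) (al U p \<oplus>[B U] al U t \<otimes>[B U] g) = k \<odot>[LT,U] lpt U x y g"
    and "rpt U (b \<odot>[I,U] x) (c \<odot>[J,U] y) (al U p \<oplus>[B U] al U t \<otimes>[B U] g) = k \<odot>[RT,U] rpt U x y g"
    and "k \<in>: R U"
proof -
  note Uo = good_open[OF U]
  interpret BU: cring "B U" by (rule XY.R_cring[OF Uo])
  interpret RU: cring "R U" by (rule R_cring[OF Uo])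
  note n = nrm_closed[OF U b(1)] nrm_closed[OF U b(2)]
  have tn: "t \<otimes>[R U] nrm U b \<in>: R U" "t \<otimes>[R U] nrm U c \<in>: R U" using pt n by auto
  show "k \<in>: R U" unfolding k_def using tn by simp
  note wI = wdg_closed[OF Ips(1) Uo XY.msmult_closed[OF Ips(1) Uo g x] x]
  note wJ = wdg_closed[OF Ips(2) Uo XY.msmult_closed[OF Ips(2) Uo g y] y]
  note zc = tz_closed[OF Uo x y]
  note wT = wdg_closed[OF Ips(3) Uo XY.msmult_closed[OF Ips(3) Uo g zc] zc]
  show "lpt U (b \<odot>[I,U] x) (c \<odot>[J,U] y) (al U p \<oplus>[B U] al U t \<otimes>[B U] g) = k \<odot>[LT,U] lpt U x y g"
    unfolding lpt_def k_def wdg_scale[OF Ips(1) U b(1) g pt x] wdg_scale[OF Ips(2) U b(2) g pt y]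
    by (rule tens_smult[OF Wps(1,2) Uo tn wI wJ])
  have "rpt U (b \<odot>[I,U] x) (c \<odot>[J,U] y) (al U p \<oplus>[B U] al U t \<otimes>[B U] g) =
     ((t \<otimes>[R U] nrm U (b \<otimes>[B U] c)) \<otimes>[R U] t) \<odot>[RT,U] rpt U x y g"
    unfolding rpt_def tz_smult[OF Uo b x y] wdg_scale[OF Ips(3) U BU.m_closed[OF b] g pt zc] w1_affine[OF Uo pt g]
    by (rule tens_smult[OF Wps(3,4) Uo _ pt(2) wT w1_closed[OF Uo g]]) (use pt nrm_closed[OF U BU.m_closed[OF b]] in simp)
  moreover have "(t \<otimes>[R U] nrm U (b \<otimes>[B U] c)) \<otimes>[R U] t = k"
    unfolding k_def nrm_mult[OF U b] using pt n by (simp add: RU.m_ac)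
  ultimately show "rpt U (b \<odot>[I,U] x) (c \<odot>[J,U] y) (al U p \<oplus>[B U] al U t \<otimes>[B U] g) = k \<odot>[RT,U] rpt U x y g"
    by simp
qed

lemma gen_pt:
  assumes "qfr U g" "XY.gen I U x" "XY.gen J U y"
  shows "gen LT U (lpt U x y g)" "gen RT U (rpt U x y g)"
  unfolding lpt_def rpt_def
  using gen_tens[OF Wps(1,2) gen_wdg[OF Ips(1) assms(1,2)] gen_wdg[OF Ips(2) assms(1,3)]]
    gen_tens[OF Wps(3,4) gen_wdg[OF Ips(3) assms(1) gen_tz[OF assms(2,3)]] gen_w1[OF assms(1)]] by auto

lemma pt_res:
  assumes U: "opn U" and V: "opn V" "V \<subseteq> U" and x: "x \<in>: sec I U" and y: "y \<in>: sec J U" and g: "g \<in>: B U"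
  shows "res LT U V (lpt U x y g) = lpt V (res I U V x) (res J U V y) (br U V g)"
    and "res RT U V (rpt U x y g) = rpt V (res I U V x) (res J U V y) (br U V g)"
    and "lpt U x y g \<in>: sec LT U" and "rpt U x y g \<in>: sec RT U"
proof -
  note gx = XY.msmult_closed[OF Ips(1) U g x] and gy = XY.msmult_closed[OF Ips(2) U g y]
  note wI = wdg_closed[OF Ips(1) U gx x] and wJ = wdg_closed[OF Ips(2) U gy y]
  note zc = tz_closed[OF U x y] note gz = XY.msmult_closed[OF Ips(3) U g zc] note wT = wdg_closed[OF Ips(3) U gz zc]
  note w1c = w1_closed[OF U g]
  show "lpt U x y g \<in>: sec LT U" "rpt U x y g \<in>: sec RT U"
    unfolding lpt_def rpt_def using tens_closed[OF Wps(1,2) U wI wJ] tens_closed[OF Wps(3,4) U wT w1c] by auto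
  show "res LT U V (lpt U x y g) = lpt V (res I U V x) (res J U V y) (br U V g)"
    unfolding lpt_def tens_res[OF Wps(1,2) U V wI wJ] wdg_res[OF Ips(1) U V gx x] wdg_res[OF Ips(2) U V gy y]
      XY.mres_smult[OF Ips(1) U V g x] XY.mres_smult[OF Ips(2) U V g y] ..
  show "res RT U V (rpt U x y g) = rpt V (res I U V x) (res J U V y) (br U V g)"
    unfolding rpt_def tens_res[OF Wps(3,4) U V wT w1c] wdg_res[OF Ips(3) U V gz zc] w1_res[OF U V g]
      XY.mres_smult[OF Ips(3) U V g zc] tz_res[OF U V x y] ..
qed

lemma frame_within:
  assumes "opn U" "p \<in> U"
  obtains V g x y where "qfr V g" "p \<in> V" "V \<subseteq> U" "XY.gen I V x" "XY.gen J V y"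
proof -
  obtain V where V: "good V" "p \<in> V" "V \<subseteq> U" using good_within[OF assms] by blast
  obtain W x y where W: "opn W" "p \<in> W" "W \<subseteq> V" "XY.gen I W x" "XY.gen J W y"
    by (rule XY.gens_within[OF I J good_open[OF V(1)] V(2)])
  obtain g where "qfr W g" using good_subset[OF V(1) W(1,3)] unfolding good_def by auto
  then show thesis by (rule that[OF _ W(2) _ W(4,5)]) (use V W in auto)
qed

lemma gen_coords:
  assumes q: "qfr V g'" and x: "XY.gen I V x'" and y: "XY.gen J V y'"
    and c: "x \<in>: sec I V" "y \<in>: sec J V" "g \<in>: B V"
  obtains b c p t where "b \<in>: B V" "c \<in>: B V" "p \<in>: R V" "t \<in>: R V"
    "x = b \<odot>[I,V] x'" "y = c \<odot>[J,V] y'" "g = al V p \<oplus>[B V] al V t \<otimes>[B V] g'"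
proof -
  obtain b where b: "b \<in>: B V" "x = b \<odot>[I,V] x'" using XY.gen_coeff[OF Ips(1) x c(1)] by auto
  obtain d where d: "d \<in>: B V" "y = d \<odot>[J,V] y'" using XY.gen_coeff[OF Ips(2) y c(2)] by auto
  obtain p t where p: "p \<in>: R V" "t \<in>: R V" "g = al V p \<oplus>[B V] al V t \<otimes>[B V] g'" by (rule qfr_coord[OF q c(3)])
  show thesis by (rule that[OF b(1) d(1) p(1,2) b(2) d(2) p(3)])
qed

text \<open>\<open>pt_scale\<close> is used twice: for generators it is the compatibility of the
  frames, and for arbitrary x, y, \<gamma>, written locally in terms of generators and a basis, it
  extends the formula to them.\<close>

lemma wedge2_tensor_iso_props:
  shows "miso LT RT (wedge2_tensor_iso X Y I J)"
    and "opn U ==> x \<in>: sec I U ==> y \<in>: sec J U ==> g \<in>: B U ==>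
      wedge2_tensor_iso X Y I J U (lpt U x y g) = rpt U x y g"
proof -
  note L = tensor_sheaf[OF Wps(1,2)] and Rs = tensor_sheaf[OF Wps(3,4)]
  define Fr where "Fr = (\<lambda>V l r. \<exists>x y g. qfr V g \<and> XY.gen I V x \<and> XY.gen J V y \<and> l = lpt V x y g \<and> r = rpt V x y g)"
  have FrE: "\<exists>x y g. qfr V g \<and> XY.gen I V x \<and> XY.gen J V y \<and> l = lpt V x y g \<and> r = rpt V x y g" if "Fr V l r" for V l r
    using that unfolding Fr_def .
  have fr: "frames LT RT Fr"
  proof (rule framesI)
    fix V l r assume "Fr V l r"
    then obtain x y g where f: "qfr V g" "XY.gen I V x" "XY.gen J V y" "l = lpt V x y g" "r = rpt V x y g" using FrE by blast
    note c = qfr_open[OF f(1)] XY.gen_closed[OF f(2)] XY.gen_closed[OF f(3)] qfr_closed[OF f(1)]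
    show "gen LT V l \<and> r \<in>: sec RT V" unfolding f using gen_pt[OF f(1-3)] by simp
    fix W assume W: "opn W" "W \<subseteq> V"
    have "qfr W (br V W g)" "XY.gen I W (res I V W x)" "XY.gen J W (res J V W y)"
      using qfr_res[OF f(1) W] XY.gen_res[OF Ips(1) f(2) W] XY.gen_res[OF Ips(2) f(3) W] by auto
    then show "Fr W (res LT V W l) (res RT V W r)" unfolding Fr_def f pt_res(1,2)[OF c(1) W c(2-4)] by blast
  next
    fix p assume p: "p \<in> whole X"
    obtain V g x y where "qfr V g" "p \<in> V" "V \<subseteq> whole X" "XY.gen I V x" "XY.gen J V y" by (rule frame_within[OF openin_topspace p])
    then show "\<exists>V l r. p \<in> V \<and> Fr V l r" unfolding Fr_def by blast
  next
    fix V l r l' r' a assume "Fr V l r" "Fr V l' r'" and a: "a \<in>: R V" "l = a \<odot>[LT,V] l'"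
    then obtain x y g x' y' g' where f: "qfr V g" "XY.gen I V x" "XY.gen J V y" "l = lpt V x y g" "r = rpt V x y g"
      and f': "qfr V g'" "XY.gen I V x'" "XY.gen J V y'" "l' = lpt V x' y' g'" "r' = rpt V x' y' g'" using FrE by metis
    obtain b c p t where b: "b \<in>: B V" "c \<in>: B V" "p \<in>: R V" "t \<in>: R V"
      "x = b \<odot>[I,V] x'" "y = c \<odot>[J,V] y'" "g = al V p \<oplus>[B V] al V t \<otimes>[B V] g'"
      by (rule gen_coords[OF f'(1-3) XY.gen_closed[OF f(2)] XY.gen_closed[OF f(3)] qfr_closed[OF f(1)]])
    have V: "good V" using f(1) unfolding good_def by auto
    note s = pt_scale[OF V XY.gen_closed[OF f'(2)] XY.gen_closed[OF f'(3)] qfr_closed[OF f'(1)] b(1-4), folded b(5-7)]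
    have "(t \<otimes>[R V] nrm V b) \<otimes>[R V] (t \<otimes>[R V] nrm V c) = a"
      by (rule gen_cancel[OF ms_mp[OF L] gen_pt(1)[OF f'(1-3)] s(3) a(1)]) (use s(1) a(2) f(4) f'(4) in simp)
    then show "r = a \<odot>[RT,V] r'" using s(2) f(5) f'(5) by simp
  qed
  have "\<exists>\<Psi>. miso LT RT \<Psi> \<and> (\<forall>V l r. Fr V l r --> \<Psi> V l = r)"
    by (rule ex_line_isomorphism[OF L Rs fr]) (use FrE gen_pt(2) in metis)
  then obtain \<Psi> where \<Psi>: "miso LT RT \<Psi>"
    "\<And>V x y g. qfr V g ==> XY.gen I V x ==> XY.gen J V y ==> \<Psi> V (lpt V x y g) = rpt V x y g" unfolding Fr_def by blast
  have m: "mmor LT RT \<Psi>" using \<Psi> by simp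
  have "\<Psi> U (lpt U x y g) = rpt U x y g"
    if U: "opn U" and x: "x \<in>: sec I U" and y: "y \<in>: sec J U" and g: "g \<in>: B U" for U x y g
  proof (rule sheaf_eqI[OF ms_sheaf[OF Rs] U])
    note pr = pt_res[OF U _ _ x y g]
    note pc = pt_res(3,4)[OF U U subset_refl x y g]
    show "\<Psi> U (lpt U x y g) \<in>: sec RT U" "rpt U x y g \<in>: sec RT U" using mm_closed[OF m U pc(1)] pc(2) by auto
    fix pt assume pt: "pt \<in> U"
    obtain V g' x' y' where f: "qfr V g'" "pt \<in> V" "V \<subseteq> U" "XY.gen I V x'" "XY.gen J V y'" by (rule frame_within[OF U pt])
    note Vo = qfr_open[OF f(1)]
    obtain b c p t where b: "b \<in>: B V" "c \<in>: B V" "p \<in>: R V" "t \<in>: R V"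
      "res I U V x = b \<odot>[I,V] x'" "res J U V y = c \<odot>[J,V] y'" "br U V g = al V p \<oplus>[B V] al V t \<otimes>[B V] g'"
      by (rule gen_coords[OF f(1,4,5) XY.mres_closed[OF Ips(1) U Vo f(3) x] XY.mres_closed[OF Ips(2) U Vo f(3) y] XY.rr_closed[OF U Vo f(3) g]])
    have V: "good V" using f(1) unfolding good_def by auto
    note s = pt_scale[OF V XY.gen_closed[OF f(4)] XY.gen_closed[OF f(5)] qfr_closed[OF f(1)] b(1-4), folded b(5-7)]
    note pV = gen_closed[OF gen_pt(1)[OF f(1,4,5)]]
    have "res RT U V (\<Psi> U (lpt U x y g)) = \<Psi> V (lpt V (res I U V x) (res J U V y) (br U V g))"
      using mm_res[OF m U Vo f(3) pc(1)] pr(1)[OF Vo f(3)] by simp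
    also have "\<dots> = res RT U V (rpt U x y g)"
      unfolding pr(2)[OF Vo f(3)] s(1,2) mm_smult[OF m Vo s(3) pV] \<Psi>(2)[OF f(1,4,5)] ..
    finally show "\<exists>W. opn W \<and> pt \<in> W \<and> W \<subseteq> U \<and> res RT U W (\<Psi> U (lpt U x y g)) = res RT U W (rpt U x y g)"
      using Vo f by blast
  qed
  then have "\<exists>\<Psi>. miso LT RT \<Psi> \<and> (\<forall>U. opn U --> (\<forall>x\<in>carrier (sec I U). \<forall>y\<in>carrier (sec J U).
      \<forall>g\<in>carrier (B U). \<Psi> U (lpt U x y g) = rpt U x y g))" using \<Psi>(1) by blast
  note * = someI_ex[OF this, unfolded lpt_def rpt_def, folded wedge2_tensor_iso_def]
  show "miso LT RT (wedge2_tensor_iso X Y I J)" using * by blast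
  show "wedge2_tensor_iso X Y I J U (lpt U x y g) = rpt U x y g"
    if "opn U" "x \<in>: sec I U" "y \<in>: sec J U" "g \<in>: B U"
    unfolding lpt_def rpt_def using * that by blast
qed

section \<open>Multiplicativity of the norm and products of rigidifications\<close>

abbreviation "NN \<equiv> tensor X (NM I) (NM J)"

lemma NMp: "mpre (NM I)" "mpre (NM J)" "mpre (NM TI)"
  using NM_invertible[OF I] NM_invertible[OF J] NM_invertible[OF TI_invertible] by auto

definition "npt U x y = tens X (NM I) (NM J) U (nn I U x) (nn J U y)"

lemma gen_npt: "good U ==> XY.gen I U x ==> XY.gen J U y ==> gen NN U (npt U x y)"
  unfolding npt_def by (rule gen_tens[OF NMp(1,2) gen_nn[OF I] gen_nn[OF J]])

lemma npt_smult:
  assumes U: "good U" and x: "x \<in>: sec I U" and y: "y \<in>: sec J U" and b: "b \<in>: B U" "c \<in>: B U"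
  shows "npt U (b \<odot>[I,U] x) (c \<odot>[J,U] y) = (nrm U b \<otimes>[R U] nrm U c) \<odot>[NN,U] npt U x y"
  unfolding npt_def nn_smult[OF I U b(1) x] nn_smult[OF J U b(2) y]
  by (rule tens_smult[OF NMp(1,2) good_open[OF U] nrm_closed[OF U b(1)] nrm_closed[OF U b(2)] nn_closed[OF I U x] nn_closed[OF J U y]])

text \<open>The isomorphism is constructed from n(x) \<otimes> n(y) \<mapsto> n(x \<otimes> y),
  whose frames are compatible because the norm of the algebra is multiplicative. That it satisfies
  the condition in the definition of \<open>norm_tensor_iso\<close> is checked afterwards;
  conversely, that condition fixes the value of the selected map on generators.\<close>

lemma norm_tensor_iso_props:
  shows "miso NN (NM TI) (norm_tensor_iso X Y I J)"
    and "good U ==> XY.gen I U x ==> XY.gen J U y ==> norm_tensor_iso X Y I J U (npt U x y) = nn TI U (tz U x y)"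
proof -
  note NNs = tensor_sheaf[OF NMp(1,2)] and NTs = NM_sheaf[OF TI_invertible]
  define Fr where "Fr = (\<lambda>V l r. \<exists>x y. good V \<and> XY.gen I V x \<and> XY.gen J V y \<and> l = npt V x y \<and> r = nn TI V (tz V x y))"
  have FrE: "\<exists>x y. good V \<and> XY.gen I V x \<and> XY.gen J V y \<and> l = npt V x y \<and> r = nn TI V (tz V x y)" if "Fr V l r" for V l r
    using that unfolding Fr_def .
  have gr: "gen (NM TI) V (nn TI V (tz V x y))" if "good V" "XY.gen I V x" "XY.gen J V y" for V x y
    by (rule gen_nn[OF TI_invertible that(1) gen_tz[OF that(2,3)]])
  have fr: "frames NN (NM TI) Fr"
  proof (rule framesI)
    fix V l r assume "Fr V l r"
    then obtain x y where f: "good V" "XY.gen I V x" "XY.gen J V y" "l = npt V x y" "r = nn TI V (tz V x y)" using FrE by blast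
    note c = good_open[OF f(1)] XY.gen_closed[OF f(2)] XY.gen_closed[OF f(3)]
    show "gen NN V l \<and> r \<in>: sec (NM TI) V" unfolding f using gen_npt[OF f(1-3)] gr[OF f(1-3)] by simp
    fix W assume W: "opn W" "W \<subseteq> V"
    have "good W" "XY.gen I W (res I V W x)" "XY.gen J W (res J V W y)"
      using good_subset[OF f(1) W] XY.gen_res[OF Ips(1) f(2) W] XY.gen_res[OF Ips(2) f(3) W] by auto
    moreover have "res NN V W l = npt W (res I V W x) (res J V W y)"
      unfolding f npt_def tens_res[OF NMp(1,2) c(1) W nn_closed[OF I f(1) c(2)] nn_closed[OF J f(1) c(3)]]
        nn_res[OF I f(1) W c(2)] nn_res[OF J f(1) W c(3)] ..
    moreover have "res (NM TI) V W r = nn TI W (tz W (res I V W x) (res J V W y))"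
      unfolding f nn_res[OF TI_invertible f(1) W tz_closed[OF c]] tz_res[OF c(1) W c(2,3)] ..
    ultimately show "Fr W (res NN V W l) (res (NM TI) V W r)" unfolding Fr_def by blast
  next
    fix p assume p: "p \<in> whole X"
    obtain V g x y where "qfr V g" "p \<in> V" "V \<subseteq> whole X" "XY.gen I V x" "XY.gen J V y" by (rule frame_within[OF openin_topspace p])
    then show "\<exists>V l r. p \<in> V \<and> Fr V l r" unfolding Fr_def good_def by blast
  next
    fix V l r l' r' a assume "Fr V l r" "Fr V l' r'" and a: "a \<in>: R V" "l = a \<odot>[NN,V] l'"
    then obtain x y x' y' where f: "good V" "XY.gen I V x" "XY.gen J V y" "l = npt V x y" "r = nn TI V (tz V x y)"
      and f': "XY.gen I V x'" "XY.gen J V y'" "l' = npt V x' y'" "r' = nn TI V (tz V x' y')" using FrE by metis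
    note Vo = good_open[OF f(1)]
    interpret BV: cring "B V" by (rule XY.R_cring[OF Vo])
    interpret RV: cring "R V" by (rule R_cring[OF Vo])
    obtain b where b: "b \<in>: B V" "x = b \<odot>[I,V] x'" using XY.gen_coeff[OF Ips(1) f'(1) XY.gen_closed[OF f(2)]] by auto
    obtain d where d: "d \<in>: B V" "y = d \<odot>[J,V] y'" using XY.gen_coeff[OF Ips(2) f'(2) XY.gen_closed[OF f(3)]] by auto
    note xy = XY.gen_closed[OF f'(1)] XY.gen_closed[OF f'(2)]
    have "nrm V b \<otimes>[R V] nrm V d = a"
      by (rule gen_cancel[OF ms_mp[OF NNs] gen_npt[OF f(1) f'(1,2)] RV.m_closed[OF nrm_closed[OF f(1) b(1)] nrm_closed[OF f(1) d(1)]] a(1)])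
        (use npt_smult[OF f(1) xy b(1) d(1)] a(2) f(4) f'(3) b(2) d(2) in simp)
    then show "r = a \<odot>[NM TI,V] r'"
      unfolding f(5) f'(4) b(2) d(2) tz_smult[OF Vo b(1) d(1) xy]
        nn_smult[OF TI_invertible f(1) BV.m_closed[OF b(1) d(1)] tz_closed[OF Vo xy]] nrm_mult[OF f(1) b(1) d(1)] by simp
  qed
  have "\<exists>h. miso NN (NM TI) h \<and> (\<forall>V l r. Fr V l r --> h V l = r)"
    by (rule ex_line_isomorphism[OF NNs NTs fr]) (use FrE gr in metis)
  then obtain h where h: "miso NN (NM TI) h"
    "\<And>V x y. good V ==> XY.gen I V x ==> XY.gen J V y ==> h V (npt V x y) = nn TI V (tz V x y)" unfolding Fr_def by blast
  have m: "mmor NN (NM TI) h" using h by simp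
  let ?\<Psi> = "wedge2_tensor_iso X Y I J" and ?\<kappa> = "wedge2_alg_iso X Y"
  let ?WI = "W2 I" and ?WJ = "W2 J" and ?WT = "W2 TI" and ?WA = "W2 BA"
  note \<Psi> = wedge2_tensor_iso_props and \<kappa> = wedge2_alg_iso_props
  have \<Psi>m: "mmor LT RT ?\<Psi>" and \<kappa>m: "mmor ?WA QM ?\<kappa>" using \<Psi>(1) \<kappa>(1) by auto
  note D = QD_presheaf
  \<comment> \<open>Over a small set, w, w', \<mu>, \<nu>, \<delta>, \<delta>' have coordinates a,
    a', c, n, d, d'. The claim becomes (a d) (a' d') = c ((d' n) d), and the hypothesis
    \<open>e\<close> supplies exactly a a' = c n.\<close>
  have hv: "h U (tens X (NM I) (NM J) U (norm_tens X Y I U w \<delta>) (norm_tens X Y J U w' \<delta>')) =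
       norm_tens X Y TI U \<mu> (\<delta>' U (?\<kappa> U \<nu>) \<odot>[QD,U] \<delta>)"
    if U: "opn U" and w: "w \<in>: sec ?WI U" and w': "w' \<in>: sec ?WJ U" and \<mu>: "\<mu> \<in>: sec ?WT U"
      and \<nu>: "\<nu> \<in>: sec ?WA U" and \<delta>: "\<delta> \<in>: sec QD U" and \<delta>': "\<delta>' \<in>: sec QD U"
      and e: "?\<Psi> U (tens X ?WI ?WJ U w w') = tens X ?WT ?WA U \<mu> \<nu>" for U w w' \<mu> \<nu> \<delta> \<delta>'
  proof (rule sheaf_eqI[OF ms_sheaf[OF NTs] U])
    have t1: "norm_tens X Y I U w \<delta> \<in>: sec (NM I) U" "norm_tens X Y J U w' \<delta>' \<in>: sec (NM J) U"
      unfolding norm_module_def by (rule tens_closed[OF Wps(1) D U w \<delta>], rule tens_closed[OF Wps(2) D U w' \<delta>'])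
    note t2 = tens_closed[OF NMp(1,2) U t1]
    have kc: "?\<kappa> U \<nu> \<in>: sec QM U" by (rule mm_closed[OF \<kappa>m U \<nu>])
    have dk: "\<delta>' U (?\<kappa> U \<nu>) \<in>: R U" by (rule form_closed[OF dual_form[OF U \<delta>'] U subset_refl kc])
    note dd = msmult_closed[OF D U dk \<delta>]
    show "h U (tens X (NM I) (NM J) U (norm_tens X Y I U w \<delta>) (norm_tens X Y J U w' \<delta>')) \<in>: sec (NM TI) U"
      by (rule mm_closed[OF m U t2])
    show "norm_tens X Y TI U \<mu> (\<delta>' U (?\<kappa> U \<nu>) \<odot>[QD,U] \<delta>) \<in>: sec (NM TI) U"
      unfolding norm_module_def by (rule tens_closed[OF Wps(3) D U \<mu> dd])
    fix pt assume pt: "pt \<in> U"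
    obtain V g x y where f: "qfr V g" "pt \<in> V" "V \<subseteq> U" "XY.gen I V x" "XY.gen J V y" by (rule frame_within[OF U pt])
    note Vo = qfr_open[OF f(1)] and gc = qfr_closed[OF f(1)] and xc = XY.gen_closed[OF f(4)] and yc = XY.gen_closed[OF f(5)]
    note UV = U Vo f(3)
    interpret RV: cring "R V" by (rule R_cring[OF Vo])
    have V: "good V" using f(1) unfolding good_def by auto
    note gI = gen_wdg[OF Ips(1) f(1,4)] and gJ = gen_wdg[OF Ips(2) f(1,5)]
      and gT = gen_wdg[OF Ips(3) f(1) gen_tz[OF f(4,5)]] and gA = gen_w1[OF f(1)] and gD = gen_del[OF f(1)]
    let ?z = "tz V x y"
    have zc: "?z \<in>: sec TI V" by (rule tz_closed[OF Vo xc yc])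
    let ?wI = "wdg I V (g \<odot>[I,V] x) x" and ?wJ = "wdg J V (g \<odot>[J,V] y) y"
      and ?wT = "wdg TI V (g \<odot>[TI,V] ?z) ?z" and ?d = "del V g"
    obtain a where a: "a \<in>: R V" "res ?WI U V w = a \<odot>[?WI,V] ?wI"
      using gen_coeff[OF Wps(1) gI mres_closed[OF Wps(1) UV w]] by auto
    obtain a' where a': "a' \<in>: R V" "res ?WJ U V w' = a' \<odot>[?WJ,V] ?wJ"
      using gen_coeff[OF Wps(2) gJ mres_closed[OF Wps(2) UV w']] by auto
    obtain c where c: "c \<in>: R V" "res ?WT U V \<mu> = c \<odot>[?WT,V] ?wT"
      using gen_coeff[OF Wps(3) gT mres_closed[OF Wps(3) UV \<mu>]] by auto
    obtain n where n: "n \<in>: R V" "res ?WA U V \<nu> = n \<odot>[?WA,V] w1 V g"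
      using gen_coeff[OF Wps(4) gA mres_closed[OF Wps(4) UV \<nu>]] by auto
    obtain d where d: "d \<in>: R V" "res QD U V \<delta> = d \<odot>[QD,V] ?d" using gen_coeff[OF D gD mres_closed[OF D UV \<delta>]] by auto
    obtain d' where d': "d' \<in>: R V" "res QD U V \<delta>' = d' \<odot>[QD,V] ?d" using gen_coeff[OF D gD mres_closed[OF D UV \<delta>']] by auto
    note cl = gen_closed[OF gI] gen_closed[OF gJ] gen_closed[OF gT] gen_closed[OF gA] gen_closed[OF gD]
    have "(a \<otimes>[R V] a') \<odot>[RT,V] rpt V x y g = ?\<Psi> V (res LT U V (tens X ?WI ?WJ U w w'))"
      unfolding tens_res[OF Wps(1,2) UV w w'] a(2) a'(2) tens_smult[OF Wps(1,2) Vo a(1) a'(1) cl(1,2)]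
        mm_smult[OF \<Psi>m Vo RV.m_closed[OF a(1) a'(1)] tens_closed[OF Wps(1,2) Vo cl(1,2)]]
        \<Psi>(2)[OF Vo xc yc gc, unfolded lpt_def] ..
    also have "\<dots> = res RT U V (tens X ?WT ?WA U \<mu> \<nu>)" using mm_res[OF \<Psi>m UV tens_closed[OF Wps(1,2) U w w']] e by simp
    also have "\<dots> = (c \<otimes>[R V] n) \<odot>[RT,V] rpt V x y g"
      unfolding tens_res[OF Wps(3,4) UV \<mu> \<nu>] c(2) n(2) rpt_def by (rule tens_smult[OF Wps(3,4) Vo c(1) n(1) cl(3,4)])
    finally have aa: "a \<otimes>[R V] a' = c \<otimes>[R V] n"
      by (rule gen_cancel[OF ms_mp[OF tensor_sheaf[OF Wps(3,4)]] gen_pt(2)[OF f(1,4,5)] RV.m_closed[OF a(1) a'(1)] RV.m_closed[OF c(1) n(1)]])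
    have nI: "res (NM I) U V (norm_tens X Y I U w \<delta>) = (a \<otimes>[R V] d) \<odot>[NM I,V] nn I V x"
      unfolding norm_module_def tens_res[OF Wps(1) D UV w \<delta>] a(2) d(2) nn_eq[OF I f(1) xc] by (rule tens_smult[OF Wps(1) D Vo a(1) d(1) cl(1,5)])
    have nJ: "res (NM J) U V (norm_tens X Y J U w' \<delta>') = (a' \<otimes>[R V] d') \<odot>[NM J,V] nn J V y"
      unfolding norm_module_def tens_res[OF Wps(2) D UV w' \<delta>'] a'(2) d'(2) nn_eq[OF J f(1) yc] by (rule tens_smult[OF Wps(2) D Vo a'(1) d'(1) cl(2,5)])
    have ad: "a \<otimes>[R V] d \<in>: R V" "a' \<otimes>[R V] d' \<in>: R V" using a a' d d' by auto
    have "res (NM TI) U V (h U (tens X (NM I) (NM J) U (norm_tens X Y I U w \<delta>) (norm_tens X Y J U w' \<delta>'))) =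
        h V (((a \<otimes>[R V] d) \<otimes>[R V] (a' \<otimes>[R V] d')) \<odot>[NN,V] npt V x y)"
      unfolding mm_res[OF m UV t2, symmetric] tens_res[OF NMp(1,2) UV t1] nI nJ npt_def
        tens_smult[OF NMp(1,2) Vo ad nn_closed[OF I V xc] nn_closed[OF J V yc]] ..
    also have "\<dots> = ((a \<otimes>[R V] d) \<otimes>[R V] (a' \<otimes>[R V] d')) \<odot>[NM TI,V] nn TI V ?z"
      using mm_smult[OF m Vo RV.m_closed[OF ad] gen_closed[OF gen_npt[OF V f(4,5)]]] h(2)[OF V f(4,5)] by simp
    also have "(a \<otimes>[R V] d) \<otimes>[R V] (a' \<otimes>[R V] d') = (a \<otimes>[R V] a') \<otimes>[R V] (d' \<otimes>[R V] d)" using a(1) a'(1) d(1) d'(1) by (simp add: RV.m_ac)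
    also have "\<dots> = c \<otimes>[R V] ((d' \<otimes>[R V] n) \<otimes>[R V] d)" unfolding aa using c(1) n(1) d(1) d'(1) by (simp add: RV.m_ac)
    finally have l: "res (NM TI) U V (h U (tens X (NM I) (NM J) U (norm_tens X Y I U w \<delta>) (norm_tens X Y J U w' \<delta>'))) =
       (c \<otimes>[R V] ((d' \<otimes>[R V] n) \<otimes>[R V] d)) \<odot>[NM TI,V] nn TI V ?z" .
    have qc: "qcl V g \<in>: sec QM V" by (rule qcl_closed[OF Vo gc])
    have kV: "?\<kappa> V (res ?WA U V \<nu>) = n \<odot>[QM,V] qcl V g"
      unfolding n(2) mm_smult[OF \<kappa>m Vo n(1) cl(4)] \<kappa>(2)[OF Vo gc] ..
    have nq: "n \<odot>[QM,V] qcl V g \<in>: sec QM V" by (rule msmult_closed[OF QM_presheaf Vo n(1) qc])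
    have "rr U V (\<delta>' U (?\<kappa> U \<nu>)) = res QD U V \<delta>' V (n \<odot>[QM,V] qcl V g)"
      using form_res[OF dual_form[OF U \<delta>'] U Vo subset_refl f(3) kc] mm_res[OF \<kappa>m UV \<nu>] kV
        dual_res_eval[OF QM_presheaf Vo subset_refl Vo nq, of U \<delta>'] by simp
    also have "\<dots> = d' \<otimes>[R V] n"
      unfolding d'(2) dual_smult_eval[OF QM_presheaf Vo d'(1) nq]
      using form_smult[OF dual_form[OF Vo cl(5)] Vo subset_refl n(1) qc] del_self[OF f(1)] n(1) by simp
    finally have ev: "rr U V (\<delta>' U (?\<kappa> U \<nu>)) = d' \<otimes>[R V] n" .
    have dn: "d' \<otimes>[R V] n \<in>: R V" using d' n by simp
    have rd: "res QD U V (\<delta>' U (?\<kappa> U \<nu>) \<odot>[QD,U] \<delta>) = ((d' \<otimes>[R V] n) \<otimes>[R V] d) \<odot>[QD,V] ?d"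
      unfolding mres_smult[OF D UV dk \<delta>] ev d(2) by (rule msmult_assoc[OF D Vo dn d(1) cl(5), symmetric])
    have "res (NM TI) U V (norm_tens X Y TI U \<mu> (\<delta>' U (?\<kappa> U \<nu>) \<odot>[QD,U] \<delta>)) =
        (c \<otimes>[R V] ((d' \<otimes>[R V] n) \<otimes>[R V] d)) \<odot>[NM TI,V] nn TI V ?z"
      unfolding norm_module_def tens_res[OF Wps(3) D UV \<mu> dd] c(2) rd nn_eq[OF TI_invertible f(1) zc]
      by (rule tens_smult[OF Wps(3) D Vo c(1) RV.m_closed[OF dn d(1)] cl(3,5)])
    then show "\<exists>W. opn W \<and> pt \<in> W \<and> W \<subseteq> U \<and>
        res (NM TI) U W (h U (tens X (NM I) (NM J) U (norm_tens X Y I U w \<delta>) (norm_tens X Y J U w' \<delta>'))) =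
        res (NM TI) U W (norm_tens X Y TI U \<mu> (\<delta>' U (?\<kappa> U \<nu>) \<odot>[QD,U] \<delta>))"
      using l Vo f by (intro exI[of _ V]) simp
  qed
  have "\<exists>h. miso NN (NM TI) h \<and> (\<forall>U. opn U -->
      (\<forall>w\<in>carrier (sec ?WI U). \<forall>w'\<in>carrier (sec ?WJ U). \<forall>\<mu>\<in>carrier (sec ?WT U). \<forall>\<nu>\<in>carrier (sec ?WA U).
       \<forall>\<delta>\<in>carrier (sec QD U). \<forall>\<delta>'\<in>carrier (sec QD U).
       ?\<Psi> U (tens X ?WI ?WJ U w w') = tens X ?WT ?WA U \<mu> \<nu> -->
       h U (tens X (NM I) (NM J) U (norm_tens X Y I U w \<delta>) (norm_tens X Y J U w' \<delta>')) =
       norm_tens X Y TI U \<mu> (\<delta>' U (?\<kappa> U \<nu>) \<odot>[QD,U] \<delta>)))"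
    by (rule exI[of _ h]) (use h(1) hv in simp)
  note * = someI_ex[OF this, folded norm_tensor_iso_def]
  show "miso NN (NM TI) (norm_tensor_iso X Y I J)" using * by blast
  assume U: "good U" and x: "XY.gen I U x" and y: "XY.gen J U y"
  obtain g where q: "qfr U g" using U unfolding good_def by auto
  note Uo = qfr_open[OF q] and gc = qfr_closed[OF q] and xc = XY.gen_closed[OF x] and yc = XY.gen_closed[OF y]
  interpret RU: cring "R U" by (rule R_cring[OF Uo])
  note cl = gen_closed[OF gen_wdg[OF Ips(1) q x]] gen_closed[OF gen_wdg[OF Ips(2) q y]]
    gen_closed[OF gen_wdg[OF Ips(3) q gen_tz[OF x y]]] gen_closed[OF gen_w1[OF q]] gen_closed[OF gen_del[OF q]]
  \<comment> \<open>The condition is applied with the \<mu> and \<nu> of \<open>rpt\<close>, so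
    \<nu> is 1 \<and> g; its class pairs to 1 with \<open>del U g\<close>, and the scalar
    disappears.\<close>
  have "del U g U (?\<kappa> U (w1 U g)) \<odot>[QD,U] del U g = del U g"
    unfolding \<kappa>(2)[OF Uo gc] del_self[OF q] using cl(5) Uo D by simp
  moreover have "norm_tensor_iso X Y I J U (npt U x y) =
      norm_tens X Y TI U (wdg TI U (g \<odot>[TI,U] tz U x y) (tz U x y)) (del U g U (?\<kappa> U (w1 U g)) \<odot>[QD,U] del U g)"
    unfolding npt_def nn_eq[OF I q xc] nn_eq[OF J q yc]
    by (rule conjunct2[OF *, rule_format]) (use Uo cl \<Psi>(2)[OF Uo xc yc gc, unfolded lpt_def rpt_def] in auto)
  ultimately show "norm_tensor_iso X Y I J U (npt U x y) = nn TI U (tz U x y)"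
    unfolding nn_eq[OF TI_invertible q tz_closed[OF Uo xc yc]] by simp
qed

text \<open>The product begins with the inverse of \<open>norm_tensor_iso\<close>, which is known
  explicitly at n(x \<otimes> y); therefore the value is given at tensors of generators.\<close>

lemma rig_product_props:
  assumes r: "rigidification X Y I r" and r': "rigidification X Y J r'"
  shows "rigidification X Y TI (rig_product X Y I r J r')"
    and "good U ==> XY.gen I U x ==> XY.gen J U y ==>
      rig_product X Y I r J r' U (nn TI U (tz U x y)) = r U (nn I U x) \<otimes>[R U] r' U (nn J U y)"
proof -
  note ri = r[unfolded rigidification_def] r'[unfolded rigidification_def]
  note Ni = NM_invertible[OF I] NM_invertible[OF J]
  note NNp = ms_mp[OF tensor_sheaf[OF NMp(1,2)]]
  note h = norm_tensor_iso_props
  note tm = tensor_map_iso[OF Ni self_invertible self_invertible ri]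
  show "rigidification X Y TI (rig_product X Y I r J r')"
    unfolding rigidification_def rig_product_def
    by (rule mi_comp[OF mi_comp[OF mi_inv[OF h(1) NNp] tm] multiply_map_props(1)])
  assume U: "good U" and x: "XY.gen I U x" and y: "XY.gen J U y"
  note Uo = good_open[OF U]
  note c = nn_closed[OF I U XY.gen_closed[OF x]] nn_closed[OF J U XY.gen_closed[OF y]]
  have rc: "r U (nn I U x) \<in>: R U" "r' U (nn J U y) \<in>: R U"
    using mm_closed[OF mi_mm[OF ri(1)] Uo c(1)] mm_closed[OF mi_mm[OF ri(2)] Uo c(2)] by auto
  have "inv_into (carrier (sec NN U)) (norm_tensor_iso X Y I J U) (nn TI U (tz U x y)) = npt U x y"
  proof (rule inv_into_f_eq)
    show "inj_on (norm_tensor_iso X Y I J U) (carrier (sec NN U))"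
      using h(1) Uo unfolding module_isomorphism_def bij_betw_def by blast
  qed (use h(2)[OF U x y] gen_closed[OF gen_npt[OF U x y]] in auto)
  then show "rig_product X Y I r J r' U (nn TI U (tz U x y)) = r U (nn I U x) \<otimes>[R U] r' U (nn J U y)"
    unfolding rig_product_def npt_def
    using tensor_map_props(2)[OF Ni self_invertible self_invertible mi_mm[OF ri(1)] mi_mm[OF ri(2)] Uo c] multiply_map_props(2)[OF Uo rc] by simp
qed

end

end

section \<open>The norm of a global section\<close>

context quadratic
begin

abbreviation "T \<equiv> whole X"

text \<open>Any e \<and> f is a multiple of \<gamma> \<and> 1, with a coefficient that comes from
  coordinates and persists after multiplication by b; so the determinant acts as it does on \<gamma>
  \<and> 1.\<close>

lemma wdg_mult:
  assumes U: "good U" and c: "b \<in>: B U" "e \<in>: B U" "f \<in>: B U"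
  shows "wdg BA U (b \<otimes>[B U] e) (b \<otimes>[B U] f) = nrm U b \<odot>[W2 BA,U] wdg BA U e f"
proof -
  obtain \<gamma> where q: "qfr U \<gamma>" using U unfolding good_def by auto
  note Uo = qfr_open[OF q] and g = qfr_closed[OF q]
  interpret BU: cring "B U" by (rule XY.R_cring[OF Uo])
  interpret RU: cring "R U" by (rule R_cring[OF Uo])
  obtain p t where p: "p \<in>: R U" "t \<in>: R U" "e = al U p \<oplus>[B U] al U t \<otimes>[B U] \<gamma>" by (rule qfr_coord[OF q c(2)])
  obtain r s where r: "r \<in>: R U" "s \<in>: R U" "f = al U r \<oplus>[B U] al U s \<otimes>[B U] \<gamma>" by (rule qfr_coord[OF q c(3)])
  let ?W = "sec (W2 BA) U" and ?w = "wdg BA U"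
  let ?d = "t \<otimes>[R U] r \<ominus>[R U] p \<otimes>[R U] s"
  have d: "?d \<in>: R U" using p r by simp
  have w: "?w (e \<otimes>[B U] x) (f \<otimes>[B U] x) = ?d \<odot>[?W] ?w (\<gamma> \<otimes>[B U] x) x" if "x \<in>: B U" for x
    unfolding p(3) r(3) using wdg_coord[OF AS Uo _ g p(1,2) r(1,2), of x] that by simp
  have wc: "?w \<gamma> \<one>[B U] \<in>: ?W" using wdg_closed[OF AS Uo] g by simp
  have "?w (\<gamma> \<otimes>[B U] b) b = nrm U b \<odot>[?W] ?w \<gamma> \<one>[B U]" using det_wdg[OF AS U c(1) g, of "\<one>[B U]"] g c by simp
  then show ?thesis using w[OF c(1)] w[of "\<one>[B U]"] c g d wc nrm_closed[OF U c(1)]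
      msmult_assoc[OF W2_presheaf[OF AS] Uo d nrm_closed[OF U c(1)] wc] msmult_assoc[OF W2_presheaf[OF AS] Uo nrm_closed[OF U c(1)] d wc]
    by (simp add: BU.m_comm[of b] RU.m_comm[OF d])
qed

text \<open>The definition of \<open>Nm\<close> uses arbitrary local bases, \<open>nrm\<close> only
  bases 1, \<gamma>. This lemma connects the two: both determinants describe the action on the
  generator e \<and> f.\<close>

lemma nrm_det:
  assumes U: "good U" and bs: "basis2 AM U e f" and b: "b \<in>: B U"
    and c: "c0 \<in>: R U" "c1 \<in>: R U" "d0 \<in>: R U" "d1 \<in>: R U"
    and be: "b \<otimes>[B U] e = al U c0 \<otimes>[B U] e \<oplus>[B U] al U c1 \<otimes>[B U] f"
    and bf: "b \<otimes>[B U] f = al U d0 \<otimes>[B U] e \<oplus>[B U] al U d1 \<otimes>[B U] f"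
  shows "nrm U b = c0 \<otimes>[R U] d1 \<ominus>[R U] d0 \<otimes>[R U] c1"
proof (rule gen_cancel[OF W2_presheaf[OF AS] gen_wedge[OF AM_presheaf bs] nrm_closed[OF U b]])
  note Uo = good_open[OF U]
  interpret RU: cring "R U" by (rule R_cring[OF Uo])
  interpret w: alternating "R U" "sec AM U" "sec (W2 BA) U" "wdg BA U" by (rule wdg_alternating[OF AS Uo])
  have ef: "e \<in>: B U" "f \<in>: B U" using basis2_closed[OF bs] by auto
  show "c0 \<otimes>[R U] d1 \<ominus>[R U] d0 \<otimes>[R U] c1 \<in>: R U" using c by simp
  show "nrm U b \<odot>[W2 BA,U] wdg BA U e f =
      (c0 \<otimes>[R U] d1 \<ominus>[R U] d0 \<otimes>[R U] c1) \<odot>[W2 BA,U] wdg BA U e f"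
    using wdg_mult[OF U b ef] w.w_det[of e f c0 c1 d0 d1] ef c unfolding be bf by (simp add: RU.m_comm)
qed

text \<open>The local norms glue because they are compatible with restriction.
  \<open>nrm_det\<close> shows that the glued function is the determinant in every local basis, and
  the bases 1, \<gamma> alone determine it.\<close>

lemma Nm_props:
  assumes b: "b \<in>: B T"
  shows "Nm X Y b \<in>: R T" and "good U ==> rr T U (Nm X Y b) = nrm U (br T U b)"
proof -
  have T: "opn T" "\<And>U. opn U ==> U \<subseteq> T" using openin_subset by auto
  let ?P = "\<lambda>a. a \<in>: R T \<and> (\<forall>U e c. sheaf_basis X AM 2 U e \<and> (\<forall>i<2. \<forall>j<2. c i j \<in>: R U) \<and>
       (\<forall>j<2. br T U b \<otimes>[B U] e j = (\<Oplus>\<^bsub>B U\<^esub>i\<in>{..<2::nat}. al U (c i j) \<otimes>[B U] e i)) -->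
       rr T U a = (c 0 0 \<otimes>[R U] c 1 1) \<ominus>[R U] (c 0 1 \<otimes>[R U] c 1 0))"
  have two: "{..<2::nat} = {0, Suc 0}" by auto
  have "\<exists>a\<in>carrier (R T). \<forall>V n. good V \<and> n = nrm V (br T V b) --> rr T V a = n"
  proof (rule sheaf_glue[OF R_sheaf T(1)])
    fix V n assume "good V \<and> n = nrm V (br T V b)"
    then show "opn V \<and> V \<subseteq> T \<and> n \<in>: R V" using nrm_closed[OF _ XY.rr_closed[OF T(1) _ _ b]] T good_open by blast
  next
    fix p assume "p \<in> T" then show "\<exists>V n. p \<in> V \<and> good V \<and> n = nrm V (br T V b)" using good_within[OF T(1)] by blast
  next
    fix V n W n' assume V: "good V \<and> n = nrm V (br T V b)" and W: "good W \<and> n' = nrm W (br T W b)"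
    then have o: "opn V" "opn W" "opn (V \<inter> W)" using good_open by auto
    show "rr V (V \<inter> W) n = rr W (V \<inter> W) n'"
      using V W o T b nrm_res[of V "V \<inter> W" "br T V b"] nrm_res[of W "V \<inter> W" "br T W b"] by simp
  qed
  then obtain a where a: "a \<in>: R T" "\<And>V. good V ==> rr T V a = nrm V (br T V b)" by blast
  have "?P a"
  proof (intro conjI allI impI a(1), elim conjE)
    fix U e and c :: "nat => nat => 'r" assume bs: "sheaf_basis X AM 2 U e" and c: "\<forall>i<2. \<forall>j<2. c i j \<in>: R U"
      and m: "\<forall>j<2. br T U b \<otimes>[B U] e j = (\<Oplus>\<^bsub>B U\<^esub>i\<in>{..<2::nat}. al U (c i j) \<otimes>[B U] e i)"
    note b2 = bs[unfolded sheaf_basis_2[OF AM_presheaf]]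
    note U = basis2_open[OF b2]
    interpret BU: cring "B U" by (rule XY.R_cring[OF U])
    interpret RU: cring "R U" by (rule R_cring[OF U])
    have ee: "e 0 \<in>: B U" "e (Suc 0) \<in>: B U" using basis2_closed[OF b2] by auto
    have cc: "c 0 0 \<in>: R U" "c 0 1 \<in>: R U" "c 1 0 \<in>: R U" "c 1 1 \<in>: R U" using c by auto
    have m2: "br T U b \<otimes>[B U] e j = al U (c 0 j) \<otimes>[B U] e 0 \<oplus>[B U] al U (c 1 j) \<otimes>[B U] e (Suc 0)" if "j < 2" for j
      using m that c ee U by (simp add: two)
    show "rr T U a = (c 0 0 \<otimes>[R U] c 1 1) \<ominus>[R U] (c 0 1 \<otimes>[R U] c 1 0)"
    proof (rule sheaf_eqI[OF R_sheaf U])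
      fix p assume "p \<in> U"
      then obtain V where V: "good V" "p \<in> V" "V \<subseteq> U" using good_within[OF U] by blast
      note Vo = good_open[OF V(1)]
      have b2V: "basis2 AM V (br U V (e 0)) (br U V (e (Suc 0)))" using basis2_res[OF AM_presheaf b2 Vo V(3)] by simp
      have bV: "br U V (br T U b) = br T V b" using T U Vo V b by simp
      have r: "br T V b \<otimes>[B V] br U V (e j) = al V (rr U V (c 0 j)) \<otimes>[B V] br U V (e 0) \<oplus>[B V] al V (rr U V (c 1 j)) \<otimes>[B V] br U V (e (Suc 0))"
        if "j = 0 \<or> j = 1" for j
      proof -
        have "c 0 j \<in>: R U" "c 1 j \<in>: R U" "e j \<in>: B U" "br T U b \<in>: B U" using that cc ee b T U by auto
        then show ?thesis using arg_cong[OF m2, of j "br U V"] that ee U Vo V(3)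
          by (auto simp: XY.rr_mult XY.rr_add al_res bV)
      qed
      have "nrm V (br T V b) = rr U V (c 0 0) \<otimes>[R V] rr U V (c 1 1) \<ominus>[R V] rr U V (c 0 1) \<otimes>[R V] rr U V (c 1 0)"
        by (rule nrm_det[OF V(1) b2V]) (use r[of 0] r[of 1] T b cc U Vo V(3) in auto)
      then have "rr U V (rr T U a) = rr U V ((c 0 0 \<otimes>[R U] c 1 1) \<ominus>[R U] (c 0 1 \<otimes>[R U] c 1 0))"
        using a T U Vo V(1,3) cc by (simp add: rr_minus rr_mult)
      then show "\<exists>W. opn W \<and> p \<in> W \<and> W \<subseteq> U \<and> rr U W (rr T U a) = rr U W ((c 0 0 \<otimes>[R U] c 1 1) \<ominus>[R U] (c 0 1 \<otimes>[R U] c 1 0))"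
        using V Vo by blast
    qed (use a T U cc in auto)
  qed
  \<comment> \<open>Uniqueness: around each point the condition on \<open>a'\<close> is applied to a
    basis 1, \<gamma>.\<close>
  moreover have "a' = a" if P: "?P a'" for a'
  proof (rule sheaf_eqI[OF R_sheaf T(1)])
    show "a' \<in>: R T" using P by blast
    fix p assume "p \<in> T"
    then obtain V where V: "good V" "p \<in> V" using good_within[OF T(1)] by blast
    obtain \<gamma> where q: "qfr V \<gamma>" using V unfolding good_def by auto
    note Vo = qfr_open[OF q] and g = qfr_closed[OF q]
    interpret BV: cring "B V" by (rule XY.R_cring[OF Vo])
    define x where "x = br T V b"
    have x: "x \<in>: B V" unfolding x_def using T Vo b by simp
    obtain p0 p1 where p: "p0 \<in>: R V" "p1 \<in>: R V" "x = al V p0 \<oplus>[B V] al V p1 \<otimes>[B V] \<gamma>" by (rule qfr_coord[OF q x])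
    obtain q0 q1 where q': "q0 \<in>: R V" "q1 \<in>: R V" "x \<otimes>[B V] \<gamma> = al V q0 \<oplus>[B V] al V q1 \<otimes>[B V] \<gamma>"
      by (rule qfr_coord[OF q BV.m_closed[OF x g]])
    define e where "e = (\<lambda>i::nat. if i = 0 then \<one>[B V] else \<gamma>)"
    \<comment> \<open>Column \<open>j\<close> holds the coordinates of \<open>x\<close> times the
      basis vector \<open>e j\<close>.\<close>
    define c where "c = (\<lambda>(i::nat) (j::nat). if j = 0 then (if i = 0 then p0 else p1) else (if i = 0 then q0 else q1))"
    have "sheaf_basis X AM 2 V e" unfolding sheaf_basis_2[OF AM_presheaf] using q by (simp add: e_def qfr_def)
    moreover have "\<forall>j<2. x \<otimes>[B V] e j = (\<Oplus>\<^bsub>B V\<^esub>i\<in>{..<2::nat}. al V (c i j) \<otimes>[B V] e i)"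
      using p q' g x Vo by (auto simp: two c_def e_def less_2_cases_iff)
    moreover have "\<forall>i<2. \<forall>j<2. c i j \<in>: R V" using p q' by (simp add: c_def)
    ultimately have "rr T V a' = c 0 0 \<otimes>[R V] c 1 1 \<ominus>[R V] c 0 1 \<otimes>[R V] c 1 0" using P unfolding x_def by blast
    also have "\<dots> = nrm V x"
      by (rule nrm_det[OF V(1) q[unfolded qfr_def] x, symmetric]) (use p q' g x Vo in \<open>auto simp: c_def\<close>)
    finally have "rr T V a' = rr T V a" using a(2)[OF V(1)] by (simp add: x_def)
    then show "\<exists>W. opn W \<and> p \<in> W \<and> W \<subseteq> T \<and> rr T W a' = rr T W a" using V Vo T by blast
  qed (rule a(1))
  ultimately have "Nm X Y b = a" unfolding Nm_def by (intro the_equality)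
  then show "Nm X Y b \<in>: R T" "good U ==> rr T U (Nm X Y b) = nrm U (br T U b)" using a by auto
qed

end

section \<open>Rigidified modules\<close>

context quadratic
begin

section \<open>Norms of global units and the quotient by them\<close>

lemma Nm_eqI:
  assumes b: "b \<in>: B T" and a: "a \<in>: R T" "\<And>U. good U ==> rr T U a = nrm U (br T U b)"
  shows "Nm X Y b = a"
proof (rule sheaf_eqI[OF R_sheaf _ Nm_props(1)[OF b] a(1)])
  fix p assume p: "p \<in> T"
  obtain V where V: "good V" "p \<in> V" using good_within[OF openin_topspace p] by blast
  then have "V \<subseteq> T" using good_open openin_subset by blast
  then show "\<exists>W. opn W \<and> p \<in> W \<and> W \<subseteq> T \<and> rr T W (Nm X Y b) = rr T W a"
    using V good_open[OF V(1)] a(2)[OF V(1)] Nm_props(2)[OF b V(1)] by metis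
qed simp

lemma good_T: "good U ==> opn U \<and> U \<subseteq> T" using good_open openin_subset by blast

lemma Nm_mult: assumes b: "b \<in>: B T" "c \<in>: B T"
  shows "Nm X Y (b \<otimes>[B T] c) = Nm X Y b \<otimes>[R T] Nm X Y c"
proof -
  interpret BT: cring "B T" by (rule XY.R_cring[OF openin_topspace])
  interpret RT: cring "R T" by (rule R_cring[OF openin_topspace])
  show ?thesis
    by (rule Nm_eqI) (use b good_T in \<open>auto simp: Nm_props rr_mult XY.rr_mult nrm_mult\<close>)
qed

lemma Nm_one: "Nm X Y \<one>[B T] = \<one>[R T]"
  by (rule Nm_eqI) (use good_T in \<open>auto simp: nrm_one\<close>)

lemma Nm_Units: assumes b: "b \<in> Units (B T)" shows "Nm X Y b \<in> Units (R T)"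
proof -
  interpret BT: cring "B T" by (rule XY.R_cring[OF openin_topspace])
  interpret RT: cring "R T" by (rule R_cring[OF openin_topspace])
  show ?thesis
    using b BT.Units_closed[OF b] Nm_mult[of b "inv\<^bsub>B T\<^esub> b"] Nm_mult[of "inv\<^bsub>B T\<^esub> b" b] Nm_one
      Nm_props(1)[of b] Nm_props(1)[of "inv\<^bsub>B T\<^esub> b"] unfolding Units_def[of "R T"] by auto
qed

abbreviation "UG \<equiv> units_of (R T)"
abbreviation "NG \<equiv> Nm X Y ` Units (B T)"

lemma units_comm_group: "comm_group UG"
proof -
  interpret RT: cring "R T" by (rule R_cring[OF openin_topspace])
  show ?thesis by (rule RT.units_comm_group)
qed

lemma NG_normal: "NG \<lhd> UG"
proof (rule comm_group.subgroup_imp_normal[OF units_comm_group])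
  interpret BT: cring "B T" by (rule XY.R_cring[OF openin_topspace])
  interpret BG: group "units_of (B T)" by (rule BT.units_group)
  have "group_hom (units_of (B T)) UG (Nm X Y)"
    unfolding group_hom_def group_hom_axioms_def
    using comm_group.axioms(2)[OF units_comm_group] BG.is_group Nm_Units Nm_mult BT.Units_closed by (simp add: units_of_def hom_def Pi_iff)
  then show "subgroup NG UG" using group_hom.img_is_subgroup[of "units_of (B T)" UG] by (simp add: units_of_def)
qed

lemma units_mod_norms_group: "group (units_mod_norms X Y)"
  unfolding units_mod_norms_def by (rule normal.factorgroup_is_group[OF NG_normal])

lemma mem_norm_coset: "v \<in> NG #>\<^bsub>UG\<^esub> u \<longleftrightarrow> (\<exists>b\<in>Units (B T). v = Nm X Y b \<otimes>[R T] u)"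
  by (auto simp: r_coset_def units_of_def)

lemma units_mod_normsE:
  assumes "c \<in>: units_mod_norms X Y" obtains u where "u \<in> Units (R T)" "c = NG #>\<^bsub>UG\<^esub> u"
  using assms by (auto simp: units_mod_norms_def FactGroup_def RCOSETS_def units_of_def)

lemma norm_coset_closed: "u \<in> Units (R T) ==> NG #>\<^bsub>UG\<^esub> u \<in>: units_mod_norms X Y"
  by (auto simp: units_mod_norms_def FactGroup_def RCOSETS_def units_of_def)

lemma norm_coset_mult:
  "u \<in> Units (R T) ==> v \<in> Units (R T) ==>
    (NG #>\<^bsub>UG\<^esub> u) \<otimes>[units_mod_norms X Y] (NG #>\<^bsub>UG\<^esub> v) = NG #>\<^bsub>UG\<^esub> (u \<otimes>[R T] v)"
  using normal.rcos_sum[OF NG_normal, of u v] by (simp add: units_mod_norms_def FactGroup_def units_of_def)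

lemma norm_coset_eqI:
  assumes u: "u \<in> Units (R T)" and b: "b \<in> Units (B T)" shows "NG #>\<^bsub>UG\<^esub> (Nm X Y b \<otimes>[R T] u) = NG #>\<^bsub>UG\<^esub> u"
proof -
  interpret U: comm_group UG by (rule units_comm_group)
  show ?thesis
    using U.repr_independence[of "Nm X Y b \<otimes>[R T] u" NG u] mem_norm_coset[of "Nm X Y b \<otimes>[R T] u" u] u b
      normal_imp_subgroup[OF NG_normal] by (auto simp: units_of_def)
qed

section \<open>Rigidified isomorphisms and their classes\<close>

lemma rig_mm: "rigidification X Y I r ==> mmor (NM I) SO r" by (simp add: rigidification_def)

lemma rig_unit:
  assumes I: "XY.line I" "rigidification X Y I r" and V: "good V" "XY.gen I V x"
  shows "r V (nn I V x) \<in> Units (R V)"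
  by (rule gen_self_Units[OF gen_iso[OF ms_mp[OF NM_sheaf[OF I(1)]] ms_mp[OF self_sheaf] I(2)[unfolded rigidification_def] gen_nn[OF I(1) V]]])

definition rpair :: "('p, 's, 'm) module_presheaf => ('p set => ('p, 'r, 's, 'm) normed => 'r) => bool" where
  "rpair I r \<longleftrightarrow> XY.line I \<and> rigidification X Y I r"

definition "risom I r J s \<longleftrightarrow> (\<exists>\<phi>. rigidified_isomorphism X Y I r J s \<phi>)"

text \<open>Both composites are morphisms out of N(I), so compatibility with the rigidifications is
  tested on one generator n(x) around each point, where the induced map sends n(x) to
  n(\<phi>(x)).\<close>

lemma rigidified_isomorphismI:
  assumes p: "rpair I r" "rpair J s" and i: "XY.miso I J \<phi>"
    and cov: "\<And>p. p \<in> T ==> \<exists>V x. p \<in> V \<and> good V \<and> XY.gen I V x \<and> s V (nn J V (\<phi> V x)) = r V (nn I V x)"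
  shows "rigidified_isomorphism X Y I r J s \<phi>"
proof -
  note I = p(1)[unfolded rpair_def, THEN conjunct1] and J = p(2)[unfolded rpair_def, THEN conjunct1]
    and r = p(1)[unfolded rpair_def, THEN conjunct2, THEN rig_mm] and s = p(2)[unfolded rpair_def, THEN conjunct2, THEN rig_mm]
  note nm = norm_map_props[OF I J i]
  have "s U (norm_map X Y I J \<phi> U n) = r U n" if U: "opn U" "n \<in>: sec (NM I) U" for U n
  proof (rule norm_morphism_eq[OF I self_sheaf mm_comp[OF mi_mm[OF nm(1)] s] r _ U])
    fix p assume "p \<in> T"
    then obtain V x where V: "p \<in> V" "good V" "XY.gen I V x" "s V (nn J V (\<phi> V x)) = r V (nn I V x)" using cov by blast
    then show "\<exists>V x. p \<in> V \<and> good V \<and> XY.gen I V x \<and> s V (norm_map X Y I J \<phi> V (nn I V x)) = r V (nn I V x)"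
      using nm(2)[OF V(2) XY.gen_closed[OF V(3)]] by (intro exI[of _ V] exI[of _ x]) simp
  qed
  then show ?thesis using i unfolding rigidified_isomorphism_def by blast
qed

lemma rigidified_isomorphismD:
  assumes p: "rpair I r" "rpair J s" and i: "rigidified_isomorphism X Y I r J s \<phi>" and V: "good V" "x \<in>: sec I V"
  shows "s V (nn J V (\<phi> V x)) = r V (nn I V x)"
proof -
  note I = p(1)[unfolded rpair_def, THEN conjunct1] and J = p(2)[unfolded rpair_def, THEN conjunct1]
  show ?thesis using i norm_map_props(2)[OF I J _ V] nn_closed[OF I V] good_open[OF V(1)]
    unfolding rigidified_isomorphism_def by metis
qed

lemma rpairD: "rpair I r ==> XY.line I" "rpair I r ==> rigidification X Y I r" by (simp_all add: rpair_def)

lemma rigidified_isoD: "rigidified_isomorphism X Y I r J s \<phi> ==> XY.miso I J \<phi>"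
  by (simp add: rigidified_isomorphism_def)

lemma risomI:
  assumes p: "rpair I r" "rpair J s" and i: "XY.miso I J \<phi>"
    and e: "\<And>V x. good V ==> XY.gen I V x ==> s V (nn J V (\<phi> V x)) = r V (nn I V x)"
  shows "risom I r J s"
proof -
  have "rigidified_isomorphism X Y I r J s \<phi>"
  proof (rule rigidified_isomorphismI[OF p i])
    fix q assume "q \<in> T"
    then obtain V x where "good V" "q \<in> V" "XY.gen I V x" using good_gen_within[OF rpairD(1)[OF p(1)] openin_topspace] by metis
    then show "\<exists>V x. q \<in> V \<and> good V \<and> XY.gen I V x \<and> s V (nn J V (\<phi> V x)) = r V (nn I V x)" using e by blast
  qed
  then show ?thesis unfolding risom_def by blast
qed

lemma risom_trans:
  assumes p: "rpair I r" "rpair J s" "rpair K t" and i: "risom I r J s" "risom J s K t" shows "risom I r K t"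
proof -
  obtain \<phi> \<psi> where f: "rigidified_isomorphism X Y I r J s \<phi>" "rigidified_isomorphism X Y J s K t \<psi>" using i unfolding risom_def by auto
  note m = rigidified_isoD[OF f(1)] rigidified_isoD[OF f(2)]
  show ?thesis
  proof (rule risomI[OF p(1,3) XY.mi_comp[OF m]])
    fix V x assume V: "good V" "XY.gen I V x"
    note x = XY.gen_closed[OF V(2)]
    show "t V (nn K V (\<psi> V (\<phi> V x))) = r V (nn I V x)"
      using rigidified_isomorphismD[OF p(1,2) f(1) V(1) x] rigidified_isomorphismD[OF p(2,3) f(2) V(1), of "\<phi> V x"]
        XY.mm_closed[OF XY.mi_mm[OF m(1)] _ x] good_open[OF V(1)] by simp
  qed
qed

lemma risom_sym:
  assumes p: "rpair I r" "rpair J s" and i: "risom I r J s" shows "risom J s I r"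
proof -
  obtain \<phi> where f: "rigidified_isomorphism X Y I r J s \<phi>" using i unfolding risom_def by auto
  note m = rigidified_isoD[OF f]
  note Ip = Ip[OF rpairD(1)[OF p(1)]]
  show ?thesis
  proof (rule risomI[OF p(2,1) XY.mi_inv[OF m Ip]])
    fix V y assume V: "good V" "XY.gen J V y"
    obtain x where x: "x \<in>: sec I V" "\<phi> V x = y" using XY.mi_surj[OF m _ XY.gen_closed[OF V(2)]] good_open[OF V(1)] by auto
    have "inv_into (carrier (sec I V)) (\<phi> V) y = x"
      by (rule inv_into_f_eq) (use m x V(1) in \<open>auto simp: module_isomorphism_def bij_betw_def\<close>)
    then show "r V (nn I V (inv_into (carrier (sec I V)) (\<phi> V) y)) = s V (nn J V y)"
      using rigidified_isomorphismD[OF p f V(1) x(1)] x(2) by simp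
  qed
qed

text \<open>Pulling the rigidification back along an isomorphism of modules makes that isomorphism
  rigidified; thus every rigidified module has a representative over the fixed type of
  sections.\<close>

lemma ex_rig_over_functions:
  fixes I :: "('p, 's, 'm) module_presheaf"
  assumes p: "rpair I r"
  shows "\<exists>(J :: ('p, 's, 'p => 's) module_presheaf) s. rpair J s \<and> risom J s I r"
proof -
  note I = rpairD[OF p]
  obtain J :: "('p, 's, 'p => 's) module_presheaf" and \<phi> where J: "XY.line J" "XY.miso J I \<phi>"
    using XY.ex_isom_over_functions[OF I(1)] by auto
  let ?s = "\<lambda>U n. r U (norm_map X Y J I \<phi> U n)"
  have "rigidification X Y J ?s" unfolding rigidification_def
    by (rule mi_comp[OF norm_map_props(1)[OF J(1) I(1) J(2)] I(2)[unfolded rigidification_def]])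
  moreover have "rigidified_isomorphism X Y J ?s I r \<phi>" using J(2) by (simp add: rigidified_isomorphism_def)
  ultimately show ?thesis using J(1) unfolding rpair_def risom_def by blast
qed

lemma mem_rig_class: "(J, s) \<in> rig_class X Y I r \<longleftrightarrow> rpair J s \<and> risom J s I r"
  by (auto simp: rig_class_def rpair_def risom_def)

lemma ex_mem_rig_class: "rpair I r ==> \<exists>J s. (J, s) \<in> rig_class X Y I r"
  using ex_rig_over_functions by (simp add: mem_rig_class)

lemma rig_class_cong:
  assumes p: "rpair I r" "rpair J s" and i: "risom I r J s" shows "rig_class X Y I r = rig_class X Y J s"
proof -
  have "(K, t) \<in> rig_class X Y I r \<longleftrightarrow> (K, t) \<in> rig_class X Y J s" for K t
    using risom_trans[OF _ p(1,2) _ i, of K t] risom_trans[OF _ p(2,1) _ risom_sym[OF p i], of K t] by (auto simp: mem_rig_class)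
  then show ?thesis by auto
qed

lemma rig_class_eqD:
  assumes p: "rpair I r" "rpair J s" and e: "rig_class X Y I r = rig_class X Y J s" shows "risom I r J s"
proof -
  obtain K t where k: "(K, t) \<in> rig_class X Y I r" using ex_mem_rig_class[OF p(1)] by blast
  note K = k[unfolded mem_rig_class] k[unfolded e mem_rig_class]
  show ?thesis by (rule risom_trans[OF p(1) K(1)[THEN conjunct1] p(2) risom_sym[OF K(1)[THEN conjunct1] p(1) K(1)[THEN conjunct2]] K(2)[THEN conjunct2]])
qed

section \<open>The group of rigidified classes\<close>

lemma RigPic_carrier:
  assumes p: "rpair I r" shows "rig_class X Y I r \<in>: RigPic X Y"
proof -
  obtain J s where "(J, s) \<in> rig_class X Y I r" using ex_mem_rig_class[OF p] by blast
  then have J: "rpair J s" "risom J s I r" by (auto simp: mem_rig_class)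
  have "rig_class X Y J s \<in>: RigPic X Y" using rpairD[OF J(1)] unfolding RigPic_def by auto
  then show ?thesis using rig_class_cong[OF J(1) p J(2)] by simp
qed

lemma RigPic_carrierE:
  assumes "a \<in>: RigPic X Y"
  obtains I :: "('p, 's, 'p => 's) module_presheaf" and r where "rpair I r" "a = rig_class X Y I r"
  using assms unfolding RigPic_def rpair_def by auto

lemma rpair_tensor: "rpair I r ==> rpair J s ==> rpair (TI I J) (rig_product X Y I r J s)"
  using rig_product_props(1) TI_invertible unfolding rpair_def by blast

lemma rpair_one: "rpair BA (canonical_rig X Y)"
  using canonical_rig_props(1) BA_invertible unfolding rpair_def by blast

text \<open>The criterion behind all group laws: a map out of a tensor product is tested at x
  \<otimes> y, because the product rigidification has a known value there, and one such pair around
  each point suffices.\<close>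

lemma risom_tensorI:
  assumes p: "rpair I r" "rpair J s" "rpair K t" and i: "XY.miso (TI I J) K \<phi>"
    and fr: "\<And>q. q \<in> T ==> \<exists>V x y. q \<in> V \<and> good V \<and> XY.gen I V x \<and> XY.gen J V y \<and>
       t V (nn K V (\<phi> V (tz I J V x y))) = r V (nn I V x) \<otimes>[R V] s V (nn J V y)"
  shows "risom (TI I J) (rig_product X Y I r J s) K t"
proof -
  note I = rpairD[OF p(1)] and J = rpairD[OF p(2)]
  have "rigidified_isomorphism X Y (TI I J) (rig_product X Y I r J s) K t \<phi>"
  proof (rule rigidified_isomorphismI[OF rpair_tensor[OF p(1,2)] p(3) i])
    fix q assume "q \<in> T"
    then obtain V x y where V: "q \<in> V" "good V" "XY.gen I V x" "XY.gen J V y"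
      "t V (nn K V (\<phi> V (tz I J V x y))) = r V (nn I V x) \<otimes>[R V] s V (nn J V y)" using fr by blast
    then show "\<exists>V z. q \<in> V \<and> good V \<and> XY.gen (TI I J) V z \<and>
       t V (nn K V (\<phi> V z)) = rig_product X Y I r J s V (nn (TI I J) V z)"
      using gen_tz[OF I(1) J(1) V(3,4)] rig_product_props(2)[OF I(1) J(1) I(2) J(2) V(2-4)] V by (intro exI[of _ V] exI[of _ "tz I J V x y"]) simp
  qed
  then show ?thesis unfolding risom_def by blast
qed

lemma good_gens_within:
  assumes "XY.line I" "XY.line J" "opn U" "q \<in> U"
  obtains V x y where "q \<in> V" "V \<subseteq> U" "good V" "XY.gen I V x" "XY.gen J V y"
  using frame_within[OF assms] unfolding good_def by metis

lemma risom_tensor: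
  assumes p: "rpair I r" "rpair J s" "rpair I' r'" "rpair J' s'" and i: "risom I r I' r'" "risom J s J' s'"
  shows "risom (TI I J) (rig_product X Y I r J s) (TI I' J') (rig_product X Y I' r' J' s')"
proof -
  obtain \<phi> \<psi> where f: "rigidified_isomorphism X Y I r I' r' \<phi>" "rigidified_isomorphism X Y J s J' s' \<psi>" using i unfolding risom_def by auto
  note m = rigidified_isoD[OF f(1)] rigidified_isoD[OF f(2)]
  note I = rpairD[OF p(1)] and J = rpairD[OF p(2)] and I' = rpairD[OF p(3)] and J' = rpairD[OF p(4)]
  show ?thesis
  proof (rule risom_tensorI[OF p(1,2) rpair_tensor[OF p(3,4)] XY.tensor_map_iso[OF I(1) J(1) I'(1) J'(1) m]])
    fix q assume q: "q \<in> T"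
    obtain V x y where V: "q \<in> V" "V \<subseteq> T" "good V" "XY.gen I V x" "XY.gen J V y" by (rule good_gens_within[OF I(1) J(1) openin_topspace q])
    note Vo = good_open[OF V(3)]
    have g: "XY.gen I' V (\<phi> V x)" "XY.gen J' V (\<psi> V y)"
      using XY.gen_iso[OF Ip[OF I(1)] Ip[OF I'(1)] m(1) V(4)] XY.gen_iso[OF Ip[OF J(1)] Ip[OF J'(1)] m(2) V(5)] by auto
    show "\<exists>V x y. q \<in> V \<and> good V \<and> XY.gen I V x \<and> XY.gen J V y \<and>
       rig_product X Y I' r' J' s' V (nn (TI I' J') V (tensor_map (over X Y) I I' J J' \<phi> \<psi> V (tz I J V x y))) =
         r V (nn I V x) \<otimes>[R V] s V (nn J V y)"
      using V XY.tensor_map_props(2)[OF I(1) J(1) I'(1) J'(1) XY.mi_mm[OF m(1)] XY.mi_mm[OF m(2)] Vo XY.gen_closed[OF V(4)] XY.gen_closed[OF V(5)]]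
        rig_product_props(2)[OF I'(1) J'(1) I'(2) J'(2) V(3) g] rigidified_isomorphismD[OF p(1,3) f(1) V(3) XY.gen_closed[OF V(4)]]
        rigidified_isomorphismD[OF p(2,4) f(2) V(3) XY.gen_closed[OF V(5)]]
      by (intro exI[of _ V] exI[of _ x] exI[of _ y]) simp
  qed
qed

lemma RigPic_mult:
  assumes p: "rpair I r" "rpair J s"
  shows "rig_class X Y I r \<otimes>[RigPic X Y] rig_class X Y J s = rig_class X Y (TI I J) (rig_product X Y I r J s)"
proof -
  obtain I0 where 1: "I0 \<in> rig_class X Y I r" using ex_mem_rig_class[OF p(1)] by blast
  obtain J0 where 2: "J0 \<in> rig_class X Y J s" using ex_mem_rig_class[OF p(2)] by blast
  have "(\<Union>(I', r')\<in>rig_class X Y I r. \<Union>(J', s')\<in>rig_class X Y J s. rig_class X Y (TI I' J') (rig_product X Y I' r' J' s')) =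
     rig_class X Y (TI I J) (rig_product X Y I r J s)"
  proof (rule UN_pair_pair_const[OF 1 2])
    fix I' r' J' s' assume "(I', r') \<in> rig_class X Y I r" "(J', s') \<in> rig_class X Y J s"
    then have i: "rpair I' r'" "risom I' r' I r" "rpair J' s'" "risom J' s' J s" by (auto simp: mem_rig_class)
    show "rig_class X Y (TI I' J') (rig_product X Y I' r' J' s') = rig_class X Y (TI I J) (rig_product X Y I r J s)"
      by (rule rig_class_cong[OF rpair_tensor[OF i(1,3)] rpair_tensor[OF p] risom_tensor[OF i(1,3) p i(2,4)]])
  qed
  then show ?thesis by (simp add: RigPic_def)
qed

lemma RigPic_one: "\<one>[RigPic X Y] = rig_class X Y BA (canonical_rig X Y)" by (simp add: RigPic_def)

lemma rig_unit_closed: "rpair I r ==> good V ==> XY.gen I V x ==> r V (nn I V x) \<in>: R V"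
  using rig_unit[of I r V x] rpairD[of I r] R_cring[of V] by (auto simp: cring_def ring.is_monoid monoid.Units_closed)

text \<open>At a triple of generators both rigidifications take the product of the three values,
  bracketed differently; associativity in the ring of sections concludes.\<close>

lemma risom_assoc:
  assumes p: "rpair I r" "rpair J s" "rpair K t"
  defines "L \<equiv> TI I J" and "M \<equiv> TI J K"
    and "lr \<equiv> rig_product X Y I r J s" and "mr \<equiv> rig_product X Y J s K t"
  shows "risom (TI L K) (rig_product X Y L lr K t) (TI I M) (rig_product X Y I r M mr)"
proof -
  note I = rpairD[OF p(1)] and J = rpairD[OF p(2)] and K = rpairD[OF p(3)]
  have L: "rpair L lr" and M: "rpair M mr" using p rpair_tensor unfolding L_def M_def lr_def mr_def by auto
  obtain \<phi> where \<phi>: "XY.miso (TI L K) (TI I M) \<phi>"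
    "\<And>V x y z. XY.gen I V x ==> XY.gen J V y ==> XY.gen K V z ==>
       \<phi> V (tz L K V (tz I J V x y) z) = tz I M V x (tz J K V y z)"
    using XY.tensor_assoc[OF I(1) J(1) K(1)] unfolding L_def M_def by auto
  show ?thesis
  proof (rule risom_tensorI[OF L p(3) rpair_tensor[OF p(1) M] \<phi>(1)])
    fix q assume q: "q \<in> T"
    obtain V1 x1 y1 where V1: "q \<in> V1" "V1 \<subseteq> T" "good V1" "XY.gen I V1 x1" "XY.gen J V1 y1"
      by (rule good_gens_within[OF I(1) J(1) openin_topspace q])
    obtain V z where V: "good V" "q \<in> V" "V \<subseteq> V1" "XY.gen K V z" by (rule good_gen_within[OF K(1) good_open[OF V1(3)] V1(1)])
    note Vo = good_open[OF V(1)]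
    interpret RV: cring "R V" by (rule R_cring[OF Vo])
    define x where "x = res I V1 V x1"
    define y where "y = res J V1 V y1"
    have g: "XY.gen I V x" "XY.gen J V y" unfolding x_def y_def
      by (rule XY.gen_res[OF Ip[OF I(1)] V1(4) Vo V(3)], rule XY.gen_res[OF Ip[OF J(1)] V1(5) Vo V(3)])
    have gl: "XY.gen L V (tz I J V x y)" and gm: "XY.gen M V (tz J K V y z)"
      unfolding L_def M_def using gen_tz[OF I(1) J(1) g] gen_tz[OF J(1) K(1) g(2) V(4)] by auto
    note c = rig_unit_closed[OF p(1) V(1) g(1)] rig_unit_closed[OF p(2) V(1) g(2)] rig_unit_closed[OF p(3) V(1,4)]
    have "rig_product X Y I r M mr V (nn (TI I M) V (\<phi> V (tz L K V (tz I J V x y) z))) =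
       lr V (nn L V (tz I J V x y)) \<otimes>[R V] t V (nn K V z)"
      unfolding \<phi>(2)[OF g V(4)] rig_product_props(2)[OF I(1) rpairD(1)[OF M] I(2) rpairD(2)[OF M] V(1) g(1) gm]
      unfolding L_def M_def lr_def mr_def rig_product_props(2)[OF I(1) J(1) I(2) J(2) V(1) g]
        rig_product_props(2)[OF J(1) K(1) J(2) K(2) V(1) g(2) V(4)] using c by (simp add: RV.m_assoc)
    then show "\<exists>V x y. q \<in> V \<and> good V \<and> XY.gen L V x \<and> XY.gen K V y \<and>
       rig_product X Y I r M mr V (nn (TI I M) V (\<phi> V (tz L K V x y))) = lr V (nn L V x) \<otimes>[R V] t V (nn K V y)"
      using V gl by blast
  qed
qed

lemma risom_unit:
  assumes p: "rpair I r"
  shows "risom (TI BA I) (rig_product X Y BA (canonical_rig X Y) I r) I r"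
proof -
  note I = rpairD[OF p]
  obtain \<phi> where \<phi>: "XY.miso (TI BA I) I \<phi>"
    "\<And>U a m. opn U ==> a \<in>: B U ==> m \<in>: sec I U ==> \<phi> U (tz BA I U a m) = a \<odot>[I,U] m"
    using XY.tensor_unit[OF I(1)] by auto
  show ?thesis
  proof (rule risom_tensorI[OF rpair_one p p \<phi>(1)])
    fix q assume q: "q \<in> T"
    obtain V x where V: "good V" "q \<in> V" "V \<subseteq> T" "XY.gen I V x" by (rule good_gen_within[OF I(1) openin_topspace q])
    note Vo = good_open[OF V(1)]
    interpret RV: cring "R V" by (rule R_cring[OF Vo])
    have "\<phi> V (tz BA I V \<one>[B V] x) = x" using \<phi>(2)[OF Vo, of "\<one>[B V]" x] XY.gen_closed[OF V(4)] Vo XY.msmult_one[OF Ip[OF I(1)] Vo] by simp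
    then show "\<exists>V x y. q \<in> V \<and> good V \<and> XY.gen BA V x \<and> XY.gen I V y \<and>
       r V (nn I V (\<phi> V (tz BA I V x y))) = canonical_rig X Y V (nn BA V x) \<otimes>[R V] r V (nn I V y)"
      using V alg_self_gen[OF Vo] canonical_rig_props(2)[OF V(1)] rig_unit_closed[OF p V(1,4)]
      by (intro exI[of _ V] exI[of _ "\<one>[B V]"] exI[of _ x]) simp
  qed
qed

lemma risom_dual:
  assumes p: "rpair I r"
  shows "\<exists>s. rpair (dual (over X Y) I) s \<and> risom (TI (dual (over X Y) I) I) (rig_product X Y (dual (over X Y) I) s I r) BA (canonical_rig X Y)"
proof -
  note I = rpairD[OF p]
  let ?D = "dual (over X Y) I"
  have D: "XY.line ?D" by (rule XY.dual_invertible[OF I(1)])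
  note Ipp = Ip[OF I(1)]
  let ?d = "XY.dual_gen I"
  define Fr where "Fr = (\<lambda>V d k. \<exists>x. good V \<and> XY.gen I V x \<and> d = ?d V x \<and> k = inv\<^bsub>R V\<^esub> (r V (nn I V x)))"
  have Uc: "r V (nn I V x) \<in> Units (R V)" if "good V" "XY.gen I V x" for V x by (rule rig_unit[OF I that])
  have "\<exists>h. mmor (NM ?D) SO h \<and> (\<forall>V x k. Fr V x k --> h V (nn ?D V x) = k) \<and>
    ((\<forall>V x k. Fr V x k --> gen SO V k) --> miso (NM ?D) SO h)"
  proof (rule norm_morphism[OF D self_sheaf])
    fix V d k assume f: "Fr V d k"
    then obtain x where x: "good V" "XY.gen I V x" "d = ?d V x" "k = inv\<^bsub>R V\<^esub> (r V (nn I V x))" unfolding Fr_def by auto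
    note Vo = good_open[OF x(1)]
    interpret BV: cring "B V" by (rule XY.R_cring[OF Vo])
    interpret RV: cring "R V" by (rule R_cring[OF Vo])
    note u = Uc[OF x(1,2)]
    show "good V \<and> XY.gen ?D V d \<and> k \<in>: sec SO V"
      unfolding x(3,4) using x(1) XY.gen_dual_gen[OF Ipp x(2)] RV.Units_inv_closed[OF u] by simp
    { fix W assume W: "opn W" "W \<subseteq> V"
      interpret RW: cring "R W" by (rule R_cring[OF W(1)])
      note gW = good_subset[OF x(1) W] and xW = XY.gen_res[OF Ipp x(2) W]
      note nc = nn_closed[OF I(1) x(1) XY.gen_closed[OF x(2)]]
      have e: "rr V W (r V (nn I V x)) = r W (nn I W (res I V W x))"
        using mm_res[OF rig_mm[OF I(2)] Vo W nc] nn_res[OF I(1) x(1) W XY.gen_closed[OF x(2)]] by simp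
      have "rr V W (inv\<^bsub>R V\<^esub> (r V (nn I V x))) \<otimes>[R W] r W (nn I W (res I V W x)) = \<one>[R W]"
        unfolding e[symmetric] using rr_mult[OF Vo W, of "inv\<^bsub>R V\<^esub> (r V (nn I V x))" "r V (nn I V x)"] u RV.Units_closed[OF u] Vo W by simp
      \<comment> \<open>The restriction of an inverse is an inverse of the restriction, so the
        frames are stable under restriction.\<close>
      then have "rr V W (inv\<^bsub>R V\<^esub> (r V (nn I V x))) = inv\<^bsub>R W\<^esub> (r W (nn I W (res I V W x)))"
        using u Uc[OF gW xW] rr_closed[OF Vo W, of "inv\<^bsub>R V\<^esub> (r V (nn I V x))"] RV.Units_inv_closed[OF u]
        by (intro sym[OF RW.inv_char]) (auto simp: RW.m_comm)
      then show "Fr W (res ?D V W d) (res SO V W k)"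
        unfolding Fr_def x(3,4) using gW xW XY.dual_gen_res[OF Ipp x(2) W] by (intro exI[of _ "res I V W x"]) simp }
    fix d' k' b assume "Fr V d' k'" and b: "b \<in>: B V" "d = b \<odot>[?D,V] d'"
    then obtain y where y: "XY.gen I V y" "d' = ?d V y" "k' = inv\<^bsub>R V\<^esub> (r V (nn I V y))" unfolding Fr_def by auto
    obtain c where c: "c \<in>: B V" "x = c \<odot>[I,V] y" using XY.gen_coeff[OF Ipp y(1) XY.gen_closed[OF x(2)]] by auto
    have dy: "?d V y \<in>: sec ?D V" by (rule XY.dual_gen_closed[OF Ipp y(1)])
    \<comment> \<open>With x = c y and x* = b y*, evaluating at x gives 1 = b c. Hence the norms of
      b and c are inverse to each other, as compatibility of the prescribed values requires.\<close>
    have "?d V y V x = c" unfolding c(2)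
      using XY.form_smult[OF XY.dual_form[OF Vo dy] Vo subset_refl c(1) XY.gen_closed[OF y(1)]] XY.dual_gen_self[OF Ipp y(1)] c(1) by simp
    then have "b \<otimes>[B V] c = \<one>[B V]"
      using XY.dual_smult_eval[OF Ipp Vo b(1) XY.gen_closed[OF x(2)], of "?d V y"] XY.dual_gen_self[OF Ipp x(2)] b(2) x(3) y(2) by simp
    then have n: "nrm V b \<otimes>[R V] nrm V c = \<one>[R V]" using nrm_mult[OF x(1) b(1) c(1)] nrm_one[OF x(1)] by simp
    note nc = nrm_closed[OF x(1) b(1)] nrm_closed[OF x(1) c(1)]
    note uy = Uc[OF x(1) y(1)]
    have rx: "r V (nn I V x) = nrm V c \<otimes>[R V] r V (nn I V y)"
      unfolding c(2) nn_smult[OF I(1) x(1) c(1) XY.gen_closed[OF y(1)]]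
      using mm_smult[OF rig_mm[OF I(2)] Vo nc(2) nn_closed[OF I(1) x(1) XY.gen_closed[OF y(1)]]] by simp
    have "(nrm V b \<otimes>[R V] inv\<^bsub>R V\<^esub> (r V (nn I V y))) \<otimes>[R V] r V (nn I V x) = \<one>[R V]"
    proof -
      have "(nrm V b \<otimes>[R V] inv\<^bsub>R V\<^esub> (r V (nn I V y))) \<otimes>[R V] (nrm V c \<otimes>[R V] r V (nn I V y)) =
         (nrm V b \<otimes>[R V] nrm V c) \<otimes>[R V] (inv\<^bsub>R V\<^esub> (r V (nn I V y)) \<otimes>[R V] r V (nn I V y))"
        using nc RV.Units_inv_closed[OF uy] RV.Units_closed[OF uy] by (simp only: RV.m_ac RV.m_closed)
      then show ?thesis unfolding rx n using RV.Units_l_inv[OF uy] by simp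
    qed
    then have "k = nrm V b \<otimes>[R V] inv\<^bsub>R V\<^esub> (r V (nn I V y))"
      unfolding x(4) using nc RV.Units_inv_closed[OF uy] u by (intro RV.inv_char) (auto simp: RV.m_comm)
    then show "k = nrm V b \<odot>[SO,V] k'" unfolding y(3) by simp
  next
    fix q assume q: "q \<in> T"
    obtain V x where V: "good V" "q \<in> V" "V \<subseteq> T" "XY.gen I V x" by (rule good_gen_within[OF I(1) openin_topspace q])
    then show "\<exists>V d k. q \<in> V \<and> Fr V d k" unfolding Fr_def by blast
  qed
  moreover have "gen SO V k" if f: "Fr V d k" for V d k
  proof -
    obtain x where x: "good V" "XY.gen I V x" "k = inv\<^bsub>R V\<^esub> (r V (nn I V x))" using f unfolding Fr_def by auto
    interpret RV: cring "R V" by (rule R_cring[OF good_open[OF x(1)]])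
    show ?thesis unfolding x(3) by (rule gen_self[OF good_open[OF x(1)] RV.Units_inv_Units[OF Uc[OF x(1,2)]]])
  qed
  ultimately obtain s where s: "miso (NM ?D) SO s" "\<And>V d k. Fr V d k ==> s V (nn ?D V d) = k" by blast
  have ps: "rpair ?D s" using s(1) D unfolding rpair_def rigidification_def by blast
  obtain \<phi> where \<phi>: "XY.miso (TI ?D I) BA \<phi>"
    "\<And>U \<delta> m. opn U ==> \<delta> \<in>: sec ?D U ==> m \<in>: sec I U ==> \<phi> U (tz ?D I U \<delta> m) = \<delta> U m"
    using XY.tensor_dual[OF I(1)] by auto
  have "risom (TI ?D I) (rig_product X Y ?D s I r) BA (canonical_rig X Y)"
  proof (rule risom_tensorI[OF ps p rpair_one \<phi>(1)])
    fix q assume q: "q \<in> T"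
    obtain V x where V: "good V" "q \<in> V" "V \<subseteq> T" "XY.gen I V x" by (rule good_gen_within[OF I(1) openin_topspace q])
    interpret RV: cring "R V" by (rule R_cring[OF good_open[OF V(1)]])
    have "\<phi> V (tz ?D I V (?d V x) x) = \<one>[B V]"
      using \<phi>(2)[OF good_open[OF V(1)] XY.dual_gen_closed[OF Ipp V(4)] XY.gen_closed[OF V(4)]] XY.dual_gen_self[OF Ipp V(4)] by simp
    moreover have "s V (nn ?D V (?d V x)) = inv\<^bsub>R V\<^esub> (r V (nn I V x))" by (rule s(2)) (use V in \<open>auto simp: Fr_def\<close>)
    ultimately show "\<exists>V x y. q \<in> V \<and> good V \<and> XY.gen ?D V x \<and> XY.gen I V y \<and>
       canonical_rig X Y V (nn BA V (\<phi> V (tz ?D I V x y))) = s V (nn ?D V x) \<otimes>[R V] r V (nn I V y)"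
      using V XY.gen_dual_gen[OF Ipp V(4)] canonical_rig_props(2)[OF V(1)] RV.Units_l_inv[OF Uc[OF V(1,4)]]
      by (intro exI[of _ V] exI[of _ "?d V x"] exI[of _ x]) simp
  qed
  then show ?thesis using ps by blast
qed

lemma RigPic_group: "group (RigPic X Y)"
proof (rule groupI)
  show "\<one>[RigPic X Y] \<in>: RigPic X Y" unfolding RigPic_one by (rule RigPic_carrier[OF rpair_one])
  fix x assume "x \<in>: RigPic X Y"
  then obtain I :: "('p, 's, 'p => 's) module_presheaf" and r where I: "rpair I r" "x = rig_class X Y I r" by (rule RigPic_carrierE)
  show "\<one>[RigPic X Y] \<otimes>[RigPic X Y] x = x"
    unfolding I(2) RigPic_one RigPic_mult[OF rpair_one I(1)] by (rule rig_class_cong[OF rpair_tensor[OF rpair_one I(1)] I(1) risom_unit[OF I(1)]])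
  obtain s where s: "rpair (dual (over X Y) I) s"
    "risom (TI (dual (over X Y) I) I) (rig_product X Y (dual (over X Y) I) s I r) BA (canonical_rig X Y)"
    using risom_dual[OF I(1)] by blast
  have "rig_class X Y (dual (over X Y) I) s \<otimes>[RigPic X Y] x = \<one>[RigPic X Y]"
    unfolding I(2) RigPic_one RigPic_mult[OF s(1) I(1)] by (rule rig_class_cong[OF rpair_tensor[OF s(1) I(1)] rpair_one s(2)])
  then show "\<exists>y\<in>carrier (RigPic X Y). y \<otimes>[RigPic X Y] x = \<one>[RigPic X Y]" using RigPic_carrier[OF s(1)] by blast
  fix y assume "y \<in>: RigPic X Y"
  then obtain J :: "('p, 's, 'p => 's) module_presheaf" and s where J: "rpair J s" "y = rig_class X Y J s" by (rule RigPic_carrierE)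
  note IJ = rpair_tensor[OF I(1) J(1)]
  show "x \<otimes>[RigPic X Y] y \<in>: RigPic X Y" unfolding I J RigPic_mult[OF I(1) J(1)] by (rule RigPic_carrier[OF IJ])
  fix z assume "z \<in>: RigPic X Y"
  then obtain K :: "('p, 's, 'p => 's) module_presheaf" and t where K: "rpair K t" "z = rig_class X Y K t" by (rule RigPic_carrierE)
  note JK = rpair_tensor[OF J(1) K(1)]
  show "x \<otimes>[RigPic X Y] y \<otimes>[RigPic X Y] z = x \<otimes>[RigPic X Y] (y \<otimes>[RigPic X Y] z)"
    unfolding I(2) J(2) K(2) RigPic_mult[OF I(1) J(1)] RigPic_mult[OF J(1) K(1)] RigPic_mult[OF IJ K(1)] RigPic_mult[OF I(1) JK]
    by (rule rig_class_cong[OF rpair_tensor[OF IJ K(1)] rpair_tensor[OF I(1) JK] risom_assoc[OF I(1) J(1) K(1)]])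
qed

end

section \<open>The exact sequence\<close>

context ringed
begin

text \<open>Used over \<open>X\<close> to rescale a rigidification, and over \<open>over X Y\<close>
  for the automorphism of the algebra given by a global unit. Scaling by the inverse unit is the
  inverse map.\<close>

lemma scale_iso:
  assumes u: "u \<in> Units (R (whole X))"
  shows "miso SO SO (\<lambda>U a. rr (whole X) U u \<otimes>[R U] a)"
proof -
  let ?s = "\<lambda>u U a. rr (whole X) U u \<otimes>[R U] a"
  interpret RT: cring "R (whole X)" by (rule R_cring[OF openin_topspace])
  have sub: "U \<subseteq> whole X" if "opn U" for U using that openin_subset by blast
  have c: "rr (whole X) U v \<in>: R U" if "opn U" "v \<in> Units (R (whole X))" for U v
    using rr_closed[OF openin_topspace that(1) sub[OF that(1)]] RT.Units_closed[OF that(2)] by blast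
  have m: "mmor SO SO (?s v)" if v: "v \<in> Units (R (whole X))" for v
    unfolding module_morphism_def is_linear_def
  proof (intro conjI allI impI ballI funcsetI; (elim conjE)?)
    fix U m assume U: "opn U" and m: "m \<in>: sec SO U"
    interpret cring "R U" by (rule R_cring[OF U])
    show "?s v U m \<in>: sec SO U" using c[OF U v] m by simp
    fix n assume n: "n \<in>: sec SO U"
    show "?s v U (m \<oplus>[SO,U] n) = ?s v U m \<oplus>[SO,U] ?s v U n" using c[OF U v] m n by (simp add: r_distr)
  next
    fix U a m assume U: "opn U" and m: "a \<in>: R U" "m \<in>: sec SO U"
    interpret cring "R U" by (rule R_cring[OF U])
    show "?s v U (a \<odot>[SO,U] m) = a \<odot>[SO,U] ?s v U m" using c[OF U v] m by (simp add: m_lcomm)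
  next
    fix U V m assume U: "opn U" "opn V" "V \<subseteq> U" and m: "m \<in>: sec SO U"
    show "?s v V (res SO U V m) = res SO U V (?s v U m)"
      using rr_mult[OF U c[OF U(1) v], of m] rr_trans[OF openin_topspace U(1,2) U(3) sub[OF U(1)] RT.Units_closed[OF v]] m by simp
  qed
  have i: "?s v U (?s w U a) = a" if "opn U" "v \<in> Units (R (whole X))" "w \<in> Units (R (whole X))" "v \<otimes>[R (whole X)] w = \<one>[R (whole X)]" "a \<in>: R U" for U v w a
  proof -
    interpret cring "R U" by (rule R_cring[OF that(1)])
    have "rr (whole X) U v \<otimes>[R U] rr (whole X) U w = \<one>[R U]"
      using rr_mult[OF openin_topspace that(1) sub[OF that(1)], of v w] rr_one[OF openin_topspace that(1) sub[OF that(1)]] that RT.Units_closed by simp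
    then show ?thesis using m_assoc[OF c[OF that(1,2)] c[OF that(1,3)] that(5)] that(5) by simp
  qed
  have "bij_betw (?s u U) (carrier (sec SO U)) (carrier (sec SO U))" if U: "opn U" for U
    by (rule bij_betw_byWitness[where f' = "?s (inv\<^bsub>R (whole X)\<^esub> u) U"])
      (use i[OF U] u mm_closed[OF m U] in auto)
  then show ?thesis using m[OF u] unfolding module_isomorphism_def by blast
qed

end

context quadratic
begin

section \<open>The norm homomorphism, its kernel and the forgetful map\<close>

lemma isom_NM: "XY.line I ==> XY.line J ==> XY.isom I J ==> isom (NM I) (NM J)"
  unfolding XY.isom_def isom_def using norm_map_props(1) by fastforce

lemma norm_hom_class:
  assumes I: "XY.line I" shows "norm_hom X Y (pic_class (over X Y) I) = pic_class X (NM I)"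
proof -
  obtain I0 where I0: "I0 \<in> pic_class (over X Y) I" using XY.ex_mem_pic_class[OF I] by blast
  show ?thesis unfolding norm_hom_def
  proof (rule UN_const[OF I0])
    fix J assume "J \<in> pic_class (over X Y) I"
    then have J: "XY.line J" "XY.isom J I" by (auto simp: XY.mem_pic_class)
    show "pic_class X (NM J) = pic_class X (NM I)" by (rule pic_class_cong[OF NM_invertible[OF J(1)] isom_NM[OF J(1) I J(2)]])
  qed
qed

abbreviation "PY \<equiv> Pic (over X Y)"

lemma norm_group_hom: "group_hom PY (Pic X) (norm_hom X Y)"
proof -
  have "norm_hom X Y \<in> hom PY (Pic X)"
  proof (rule homI)
    fix x assume "x \<in>: PY"
    then obtain I :: "('p, 's, 'p => 's) module_presheaf" where I: "XY.line I" "x = pic_class (over X Y) I" by (rule XY.Pic_carrierE)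
    show "norm_hom X Y x \<in>: Pic X" unfolding I(2) norm_hom_class[OF I(1)] by (rule Pic_carrier[OF NM_invertible[OF I(1)]])
    fix y assume "y \<in>: PY"
    then obtain J :: "('p, 's, 'p => 's) module_presheaf" where J: "XY.line J" "y = pic_class (over X Y) J" by (rule XY.Pic_carrierE)
    note IJ = TI_invertible[OF I(1) J(1)]
    have "isom (tensor X (NM I) (NM J)) (NM (TI I J))" unfolding isom_def using norm_tensor_iso_props(1)[OF I(1) J(1)] by blast
    then have "pic_class X (tensor X (NM I) (NM J)) = pic_class X (NM (TI I J))"
      by (rule pic_class_cong[OF tensor_invertible[OF NM_invertible[OF I(1)] NM_invertible[OF J(1)]]])
    then show "norm_hom X Y (x \<otimes>[PY] y) = norm_hom X Y x \<otimes>[Pic X] norm_hom X Y y"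
      unfolding I(2) J(2) XY.Pic_mult[OF I(1) J(1)] norm_hom_class[OF I(1)] norm_hom_class[OF J(1)] norm_hom_class[OF IJ]
        Pic_mult[OF NM_invertible[OF I(1)] NM_invertible[OF J(1)]] by simp
  qed
  then show ?thesis unfolding group_hom_def group_hom_axioms_def using XY.Pic_group Pic_group by blast
qed

abbreviation "KY \<equiv> Pic_kernel X Y"

lemma Pic_kernel_group: "group KY"
  unfolding Pic_kernel_def by (rule subgroup.subgroup_is_group[OF group_hom.subgroup_kernel[OF norm_group_hom] XY.Pic_group])

lemma Pic_kernel_carrier: "carrier KY = {a \<in> carrier PY. norm_hom X Y a = \<one>[Pic X]}"
  by (simp add: Pic_kernel_def kernel_def)

lemma forget_class:
  assumes p: "rpair I r" shows "forget_map X Y (rig_class X Y I r) = pic_class (over X Y) I"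
proof -
  obtain I0 where I0: "I0 \<in> rig_class X Y I r" using ex_mem_rig_class[OF p] by blast
  show ?thesis unfolding forget_map_def
  proof (rule UN_pair_const[OF I0])
    fix J s assume "(J, s) \<in> rig_class X Y I r"
    then have J: "rpair J s" "XY.isom J I" unfolding mem_rig_class risom_def XY.isom_def using rigidified_isoD by blast+
    show "pic_class (over X Y) J = pic_class (over X Y) I" by (rule XY.pic_class_cong[OF rpairD(1)[OF J(1)] J(2)])
  qed
qed

lemma Pic_kernel_one: "\<one>[KY] = pic_class (over X Y) BA" using XY.Pic_one by (simp add: Pic_kernel_def)

lemma forget_group_hom: "group_hom (RigPic X Y) KY (forget_map X Y)"
proof -
  have "forget_map X Y \<in> hom (RigPic X Y) KY"
  proof (rule homI)
    fix x assume "x \<in>: RigPic X Y"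
    then obtain I :: "('p, 's, 'p => 's) module_presheaf" and r where I: "rpair I r" "x = rig_class X Y I r" by (rule RigPic_carrierE)
    have "isom (NM I) SO" using rpairD(2)[OF I(1)] unfolding isom_def rigidification_def by blast
    then have "pic_class X (NM I) = \<one>[Pic X]" unfolding Pic_one by (rule pic_class_cong[OF NM_invertible[OF rpairD(1)[OF I(1)]]])
    then show "forget_map X Y x \<in>: KY"
      unfolding Pic_kernel_carrier I(2) forget_class[OF I(1)] using norm_hom_class[OF rpairD(1)[OF I(1)]] XY.Pic_carrier[OF rpairD(1)[OF I(1)]] by simp
    fix y assume "y \<in>: RigPic X Y"
    then obtain J :: "('p, 's, 'p => 's) module_presheaf" and s where J: "rpair J s" "y = rig_class X Y J s" by (rule RigPic_carrierE)
    show "forget_map X Y (x \<otimes>[RigPic X Y] y) = forget_map X Y x \<otimes>[KY] forget_map X Y y"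
      unfolding I(2) J(2) RigPic_mult[OF I(1) J(1)] forget_class[OF I(1)] forget_class[OF J(1)] forget_class[OF rpair_tensor[OF I(1) J(1)]]
      using XY.Pic_mult[OF rpairD(1)[OF I(1)] rpairD(1)[OF J(1)]] by (simp add: Pic_kernel_def)
  qed
  then show ?thesis unfolding group_hom_def group_hom_axioms_def using RigPic_group Pic_kernel_group by blast
qed

lemma forget_surj: "forget_map X Y ` carrier (RigPic X Y) = carrier KY"
proof
  show "forget_map X Y ` carrier (RigPic X Y) \<subseteq> carrier KY" using group_hom.hom_closed[OF forget_group_hom] by blast
  show "carrier KY \<subseteq> forget_map X Y ` carrier (RigPic X Y)"
  proof
    fix a assume "a \<in>: KY"
    then have a: "a \<in>: PY" "norm_hom X Y a = \<one>[Pic X]" unfolding Pic_kernel_carrier by auto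
    obtain I :: "('p, 's, 'p => 's) module_presheaf" where I: "XY.line I" "a = pic_class (over X Y) I" by (rule XY.Pic_carrierE[OF a(1)])
    have "isom (NM I) SO" by (rule pic_class_eqD[OF NM_invertible[OF I(1)]]) (use a(2) I norm_hom_class[OF I(1)] Pic_one in simp)
    then obtain r where "rpair I r" using I(1) unfolding isom_def rpair_def rigidification_def by blast
    then show "a \<in> forget_map X Y ` carrier (RigPic X Y)" using forget_class RigPic_carrier I(2) by blast
  qed
qed

section \<open>The rescaling map and exactness\<close>

lemma T_Units_closed: "u \<in> Units (R T) ==> u \<in>: R T" unfolding Units_def by blast

lemma T_rr_closed: "u \<in> Units (R T) ==> good V ==> rr T V u \<in>: R V"
  using rr_closed[OF openin_topspace] good_T T_Units_closed by blast

lemma rpair_rescaled: assumes u: "u \<in> Units (R T)" shows "rpair BA (rescaled_rig X Y u)"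
  using rpair_one mi_comp[OF _ scale_iso[OF u]] unfolding rpair_def rigidification_def rescaled_rig_def by blast

text \<open>Follows from n(b) = Nm(b) n(1) and the value 1 of the canonical rigidification at
  n(1).\<close>

lemma rescaled_value:
  assumes u: "u \<in> Units (R T)" and V: "good V" and b: "b \<in>: B V"
  shows "rescaled_rig X Y u V (nn BA V b) = nrm V b \<otimes>[R V] rr T V u"
proof -
  note Vo = good_open[OF V]
  interpret BV: cring "B V" by (rule XY.R_cring[OF Vo])
  interpret RV: cring "R V" by (rule R_cring[OF Vo])
  have "nn BA V b = nrm V b \<odot>[NM BA,V] nn BA V \<one>[B V]" using nn_smult[OF BA_invertible V b, of "\<one>[B V]"] b by simp
  then have "canonical_rig X Y V (nn BA V b) = nrm V b"
    using mm_smult[OF rig_mm[OF canonical_rig_props(1)] Vo nrm_closed[OF V b] nn_closed[OF BA_invertible V, of "\<one>[B V]"]]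
      canonical_rig_props(2)[OF V] nrm_closed[OF V b] by simp
  then show ?thesis unfolding rescaled_rig_def using RV.m_comm[OF nrm_closed[OF V b] T_rr_closed[OF u V]] by simp
qed

lemma one_frame:
  assumes "q \<in> T" obtains V where "q \<in> V" "good V" "XY.gen BA V \<one>[B V]"
  using good_within[OF openin_topspace assms] alg_self_gen good_open by blast

lemma risom_rescaled_iff:
  assumes u: "u \<in> Units (R T)" and v: "v \<in> Units (R T)"
  shows "risom BA (rescaled_rig X Y u) BA (rescaled_rig X Y v) \<longleftrightarrow> (\<exists>b\<in>Units (B T). u = Nm X Y b \<otimes>[R T] v)"
proof
  interpret BT: cring "B T" by (rule XY.R_cring[OF openin_topspace])
  interpret RT: cring "R T" by (rule R_cring[OF openin_topspace])
  note p = rpair_rescaled[OF u] rpair_rescaled[OF v]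
  have e: "rr T V (Nm X Y b \<otimes>[R T] v) = nrm V (br T V b) \<otimes>[R V] rr T V v" if "b \<in>: B T" "good V" for b V
    using Nm_props[OF that(1)] that(2) good_T[OF that(2)] T_Units_closed[OF v] by (simp add: rr_mult)
  { assume "risom BA (rescaled_rig X Y u) BA (rescaled_rig X Y v)"
    then obtain \<phi> where \<phi>: "rigidified_isomorphism X Y BA (rescaled_rig X Y u) BA (rescaled_rig X Y v) \<phi>" unfolding risom_def by blast
    note i = rigidified_isoD[OF \<phi>]
    \<comment> \<open>An automorphism of the algebra as a module over itself is multiplication by
      the image of 1, which is a unit because isomorphisms preserve generators.\<close>
    define b where "b = \<phi> T \<one>[B T]"
    have b: "b \<in> Units (B T)" unfolding b_def
      using XY.gen_self_Units[of T "\<phi> T \<one>[B T]"] XY.gen_iso[OF AS AS i alg_self_gen[OF openin_topspace]] by simp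
    have "u = Nm X Y b \<otimes>[R T] v"
    \<comment> \<open>The equation is compared locally, since n(1) is available only where the
      algebra has a basis 1, \<gamma>.\<close>
    proof (rule sheaf_eqI[OF R_sheaf openin_topspace T_Units_closed[OF u]])
      show "Nm X Y b \<otimes>[R T] v \<in>: R T" using Nm_props(1)[OF BT.Units_closed[OF b]] T_Units_closed[OF v] by simp
      fix q assume "q \<in> T"
      then obtain V where V: "q \<in> V" "good V" "XY.gen BA V \<one>[B V]" by (rule one_frame)
      note Vo = good_open[OF V(2)] good_T[OF V(2), THEN conjunct2]
      interpret BV: cring "B V" by (rule XY.R_cring[OF Vo(1)])
      interpret RV: cring "R V" by (rule R_cring[OF Vo(1)])
      have bV: "\<phi> V \<one>[B V] = br T V b"
        unfolding b_def using XY.mm_res[OF XY.mi_mm[OF i] openin_topspace Vo, of "\<one>[B T]"] Vo by simp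
      have c: "br T V b \<in>: B V" using XY.rr_closed[OF openin_topspace Vo BT.Units_closed[OF b]] .
      have "rr T V u = nrm V (br T V b) \<otimes>[R V] rr T V v"
        using rigidified_isomorphismD[OF p \<phi> V(2), of "\<one>[B V]"] rescaled_value[OF u V(2), of "\<one>[B V]"] rescaled_value[OF v V(2) c]
          nrm_one[OF V(2)] T_rr_closed[OF u V(2)] unfolding bV by simp
      then show "\<exists>W. opn W \<and> q \<in> W \<and> W \<subseteq> T \<and> rr T W u = rr T W (Nm X Y b \<otimes>[R T] v)"
        using e[OF BT.Units_closed[OF b] V(2)] V(1) Vo by auto
    qed
    then show "\<exists>b\<in>Units (B T). u = Nm X Y b \<otimes>[R T] v" using b by blast }
  assume "\<exists>b\<in>Units (B T). u = Nm X Y b \<otimes>[R T] v"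
  then obtain b where b: "b \<in> Units (B T)" "u = Nm X Y b \<otimes>[R T] v" by blast
  have i: "XY.miso BA BA (\<lambda>U a. br T U b \<otimes>[B U] a)" using XY.scale_iso[of b] b(1) by simp
  have "rigidified_isomorphism X Y BA (rescaled_rig X Y u) BA (rescaled_rig X Y v) (\<lambda>U a. br T U b \<otimes>[B U] a)"
  proof (rule rigidified_isomorphismI[OF p i])
    fix q assume "q \<in> T"
    then obtain V where V: "q \<in> V" "good V" "XY.gen BA V \<one>[B V]" by (rule one_frame)
    note Vo = good_open[OF V(2)] good_T[OF V(2), THEN conjunct2]
    interpret BV: cring "B V" by (rule XY.R_cring[OF Vo(1)])
    interpret RV: cring "R V" by (rule R_cring[OF Vo(1)])
    have c: "br T V b \<in>: B V" using XY.rr_closed[OF openin_topspace Vo BT.Units_closed[OF b(1)]] .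
    have "rescaled_rig X Y v V (nn BA V (br T V b \<otimes>[B V] \<one>[B V])) = rescaled_rig X Y u V (nn BA V \<one>[B V])"
      using rescaled_value[OF u V(2), of "\<one>[B V]"] rescaled_value[OF v V(2) c] c nrm_one[OF V(2)] e[OF BT.Units_closed[OF b(1)] V(2)] b(2)
        T_rr_closed[OF u V(2)] by simp
    then show "\<exists>V x. q \<in> V \<and> good V \<and> XY.gen BA V x \<and>
       rescaled_rig X Y v V (nn BA V (br T V b \<otimes>[B V] x)) = rescaled_rig X Y u V (nn BA V x)" using V by blast
  qed
  then show "risom BA (rescaled_rig X Y u) BA (rescaled_rig X Y v)" unfolding risom_def by blast
qed

lemma Nm_smult_Units: "b \<in> Units (B T) ==> u \<in> Units (R T) ==> Nm X Y b \<otimes>[R T] u \<in> Units (R T)"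
  using Nm_Units monoid.Units_m_closed[OF ring.is_monoid[OF cring.axioms(1)[OF R_cring[OF openin_topspace]]]] by blast

text \<open>The members of a norm coset differ by norms of units, so by
  \<open>risom_rescaled_iff\<close> the union in \<open>rescale_map\<close> is over one and the same
  class.\<close>

lemma rescale_class:
  assumes u: "u \<in> Units (R T)"
  shows "rescale_map X Y (NG #>\<^bsub>UG\<^esub> u) = rig_class X Y BA (rescaled_rig X Y u)"
  unfolding rescale_map_def
proof (rule UN_const)
  interpret BT: cring "B T" by (rule XY.R_cring[OF openin_topspace])
  interpret RT: cring "R T" by (rule R_cring[OF openin_topspace])
  show "u \<in> NG #>\<^bsub>UG\<^esub> u" unfolding mem_norm_coset using Nm_one u by (intro bexI[of _ "\<one>[B T]"]) auto
  fix v assume "v \<in> NG #>\<^bsub>UG\<^esub> u"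
  then obtain b where b: "b \<in> Units (B T)" "v = Nm X Y b \<otimes>[R T] u" unfolding mem_norm_coset by blast
  have v: "v \<in> Units (R T)" unfolding b(2) by (rule Nm_smult_Units[OF b(1) u])
  show "rig_class X Y BA (rescaled_rig X Y v) = rig_class X Y BA (rescaled_rig X Y u)"
    by (rule rig_class_cong[OF rpair_rescaled[OF v] rpair_rescaled[OF u]]) (use risom_rescaled_iff[OF v u] b in blast)
qed

text \<open>Multiplication of the algebra sends 1 \<otimes> 1 to 1, and the rigidifications
  concerned have the values u, v and u v at n(1).\<close>

lemma risom_rescaled_mult:
  assumes u: "u \<in> Units (R T)" and v: "v \<in> Units (R T)"
  shows "risom (TI BA BA) (rig_product X Y BA (rescaled_rig X Y u) BA (rescaled_rig X Y v)) BA (rescaled_rig X Y (u \<otimes>[R T] v))"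
proof -
  interpret RT: cring "R T" by (rule R_cring[OF openin_topspace])
  have uv: "u \<otimes>[R T] v \<in> Units (R T)" using u v by simp
  obtain \<phi> where \<phi>: "XY.miso (TI BA BA) BA \<phi>"
    "\<And>U a m. opn U ==> a \<in>: B U ==> m \<in>: B U ==> \<phi> U (tz BA BA U a m) = a \<otimes>[B U] m"
    using XY.tensor_unit[OF BA_invertible] by auto
  show ?thesis
  proof (rule risom_tensorI[OF rpair_rescaled[OF u] rpair_rescaled[OF v] rpair_rescaled[OF uv] \<phi>(1)])
    fix q assume "q \<in> T"
    then obtain V where V: "q \<in> V" "good V" "XY.gen BA V \<one>[B V]" by (rule one_frame)
    note Vo = good_open[OF V(2)] good_T[OF V(2), THEN conjunct2]
    interpret BV: cring "B V" by (rule XY.R_cring[OF Vo(1)])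
    interpret RV: cring "R V" by (rule R_cring[OF Vo(1)])
    have r: "rescaled_rig X Y w V (nn BA V \<one>[B V]) = rr T V w" if "w \<in> Units (R T)" for w
      using rescaled_value[OF that V(2), of "\<one>[B V]"] nrm_one[OF V(2)] T_rr_closed[OF that V(2)] by simp
    have "\<phi> V (tz BA BA V \<one>[B V] \<one>[B V]) = \<one>[B V]" using \<phi>(2)[OF Vo(1), of "\<one>[B V]" "\<one>[B V]"] by simp
    then show "\<exists>V x y. q \<in> V \<and> good V \<and> XY.gen BA V x \<and> XY.gen BA V y \<and>
       rescaled_rig X Y (u \<otimes>[R T] v) V (nn BA V (\<phi> V (tz BA BA V x y))) =
         rescaled_rig X Y u V (nn BA V x) \<otimes>[R V] rescaled_rig X Y v V (nn BA V y)"
      using V r[OF u] r[OF v] r[OF uv] rr_mult[OF openin_topspace Vo T_Units_closed[OF u] T_Units_closed[OF v]]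
      by (intro exI[of _ V] exI[of _ "\<one>[B V]"]) simp
  qed
qed

lemma rescale_group_hom: "group_hom (units_mod_norms X Y) (RigPic X Y) (rescale_map X Y)"
proof -
  interpret RT: cring "R T" by (rule R_cring[OF openin_topspace])
  have "rescale_map X Y \<in> hom (units_mod_norms X Y) (RigPic X Y)"
  proof (rule homI)
    fix x assume "x \<in>: units_mod_norms X Y"
    then obtain u where u: "u \<in> Units (R T)" "x = NG #>\<^bsub>UG\<^esub> u" by (rule units_mod_normsE)
    show "rescale_map X Y x \<in>: RigPic X Y" unfolding u(2) rescale_class[OF u(1)] by (rule RigPic_carrier[OF rpair_rescaled[OF u(1)]])
    fix y assume "y \<in>: units_mod_norms X Y"
    then obtain v where v: "v \<in> Units (R T)" "y = NG #>\<^bsub>UG\<^esub> v" by (rule units_mod_normsE)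
    have uv: "u \<otimes>[R T] v \<in> Units (R T)" using u v by simp
    note p = rpair_rescaled[OF u(1)] rpair_rescaled[OF v(1)]
    show "rescale_map X Y (x \<otimes>[units_mod_norms X Y] y) = rescale_map X Y x \<otimes>[RigPic X Y] rescale_map X Y y"
      unfolding u(2) v(2) norm_coset_mult[OF u(1) v(1)] rescale_class[OF u(1)] rescale_class[OF v(1)] rescale_class[OF uv] RigPic_mult[OF p]
      by (rule rig_class_cong[OF rpair_tensor[OF p] rpair_rescaled[OF uv] risom_rescaled_mult[OF u(1) v(1)], symmetric])
  qed
  then show ?thesis unfolding group_hom_def group_hom_axioms_def using units_mod_norms_group RigPic_group by blast
qed

lemma rescale_inj: "inj_on (rescale_map X Y) (carrier (units_mod_norms X Y))"
proof (rule inj_onI)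
  fix x y assume "x \<in>: units_mod_norms X Y" "y \<in>: units_mod_norms X Y" and e: "rescale_map X Y x = rescale_map X Y y"
  then obtain u v where u: "u \<in> Units (R T)" "x = NG #>\<^bsub>UG\<^esub> u" and v: "v \<in> Units (R T)" "y = NG #>\<^bsub>UG\<^esub> v" using units_mod_normsE by metis
  have "risom BA (rescaled_rig X Y u) BA (rescaled_rig X Y v)"
    by (rule rig_class_eqD[OF rpair_rescaled[OF u(1)] rpair_rescaled[OF v(1)]])
      (use e in \<open>simp add: u(2) v(2) rescale_class[OF u(1)] rescale_class[OF v(1)]\<close>)
  then obtain b where "b \<in> Units (B T)" "u = Nm X Y b \<otimes>[R T] v" using risom_rescaled_iff[OF u(1) v(1)] by blast
  then show "x = y" unfolding u(2) v(2) using norm_coset_eqI[OF v(1)] by simp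
qed

text \<open>The unit should be the value of \<open>r\<close> at n(1), but n(1) is available only
  locally. Composing \<open>r\<close> with the inverse of the canonical rigidification gives an
  automorphism of the structure sheaf, whose value at the global section 1 is the unit
  sought.\<close>

lemma rig_of_alg:
  assumes r: "rpair BA r"
  shows "\<exists>u\<in>Units (R T). risom BA (rescaled_rig X Y u) BA r"
proof -
  note c = canonical_rig_props(1)[unfolded rigidification_def] and Np = ms_mp[OF NM_sheaf[OF BA_invertible]]
  define \<psi> where "\<psi> = (\<lambda>U a. r U (inv_into (carrier (sec (NM BA) U)) (canonical_rig X Y U) a))"
  have i: "miso SO SO \<psi>" unfolding \<psi>_def
    by (rule mi_comp[OF mi_inv[OF c Np] rpairD(2)[OF r, unfolded rigidification_def]])
  define u where "u = \<psi> T \<one>[R T]"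
  interpret RT: cring "R T" by (rule R_cring[OF openin_topspace])
  have u: "u \<in> Units (R T)" unfolding u_def
    by (rule gen_self_Units[OF gen_iso[OF ms_mp[OF self_sheaf] ms_mp[OF self_sheaf] i gen_self[OF openin_topspace RT.Units_one_closed]]])
  have "rigidified_isomorphism X Y BA (rescaled_rig X Y u) BA r (\<lambda>U m. m)"
  proof (rule rigidified_isomorphismI[OF rpair_rescaled[OF u] r XY.mi_id[OF AS]])
    fix q assume "q \<in> T"
    then obtain V where V: "q \<in> V" "good V" "XY.gen BA V \<one>[B V]" by (rule one_frame)
    note Vo = good_open[OF V(2)] good_T[OF V(2), THEN conjunct2]
    interpret RV: cring "R V" by (rule R_cring[OF Vo(1)])
    \<comment> \<open>Locally the canonical rigidification sends n(1) to 1, so its inverse returns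
      n(1).\<close>
    have "inv_into (carrier (sec (NM BA) V)) (canonical_rig X Y V) \<one>[R V] = nn BA V \<one>[B V]"
      by (rule inv_into_f_eq) (use c Vo(1) canonical_rig_props(2)[OF V(2)] nn_closed[OF BA_invertible V(2) XY.gen_closed[OF V(3)]]
        in \<open>auto simp: module_isomorphism_def bij_betw_def\<close>)
    then have "r V (nn BA V \<one>[B V]) = \<psi> V \<one>[R V]" by (simp add: \<psi>_def)
    also have "\<dots> = rr T V u" unfolding u_def using mm_res[OF mi_mm[OF i] openin_topspace Vo, of "\<one>[R T]"] Vo by simp
    also have "\<dots> = rescaled_rig X Y u V (nn BA V \<one>[B V])"
      using rescaled_value[OF u V(2), of "\<one>[B V]"] nrm_one[OF V(2)] T_rr_closed[OF u V(2)] Vo by simp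
    finally show "\<exists>V x. q \<in> V \<and> good V \<and> XY.gen BA V x \<and> r V (nn BA V x) = rescaled_rig X Y u V (nn BA V x)" using V by blast
  qed
  then show ?thesis using u unfolding risom_def by blast
qed

text \<open>If the underlying module is trivial, the rigidification is pulled back to the algebra
  along a trivialisation, and by \<open>rig_of_alg\<close> it is there a rescaling of the canonical
  one.\<close>

lemma rescale_image: "rescale_map X Y ` carrier (units_mod_norms X Y) = kernel (RigPic X Y) KY (forget_map X Y)"
proof (intro equalityI subsetI)
  fix x assume "x \<in> rescale_map X Y ` carrier (units_mod_norms X Y)"
  then obtain u where u: "u \<in> Units (R T)" "x = rig_class X Y BA (rescaled_rig X Y u)" using rescale_class units_mod_normsE by (smt (verit) imageE)
  show "x \<in> kernel (RigPic X Y) KY (forget_map X Y)"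
    unfolding kernel_def u(2) using forget_class[OF rpair_rescaled[OF u(1)]] RigPic_carrier[OF rpair_rescaled[OF u(1)]] Pic_kernel_one by simp
next
  fix x assume "x \<in> kernel (RigPic X Y) KY (forget_map X Y)"
  then have x: "x \<in>: RigPic X Y" "forget_map X Y x = \<one>[KY]" unfolding kernel_def by auto
  obtain I :: "('p, 's, 'p => 's) module_presheaf" and r where I: "rpair I r" "x = rig_class X Y I r" by (rule RigPic_carrierE[OF x(1)])
  note Ii = rpairD[OF I(1)]
  have "pic_class (over X Y) BA = pic_class (over X Y) I" using x(2) forget_class[OF I(1)] Pic_kernel_one unfolding I(2) by simp
  then obtain \<phi> where \<phi>: "XY.miso BA I \<phi>" using XY.pic_class_eqD[OF BA_invertible] unfolding XY.isom_def by blast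
  \<comment> \<open>With this pullback of \<open>r\<close> to the algebra, \<open>\<phi>\<close> is
    rigidified by construction.\<close>
  let ?s = "\<lambda>U n. r U (norm_map X Y BA I \<phi> U n)"
  have s: "rpair BA ?s" using mi_comp[OF norm_map_props(1)[OF BA_invertible Ii(1) \<phi>] Ii(2)[unfolded rigidification_def]] BA_invertible
    unfolding rpair_def rigidification_def by blast
  have "rigidified_isomorphism X Y BA ?s I r \<phi>" using \<phi> by (simp add: rigidified_isomorphism_def)
  then have i: "risom BA ?s I r" unfolding risom_def by blast
  obtain u where u: "u \<in> Units (R T)" "risom BA (rescaled_rig X Y u) BA ?s" using rig_of_alg[OF s] by blast
  have "rig_class X Y BA (rescaled_rig X Y u) = x"
    unfolding I(2) by (rule rig_class_cong[OF rpair_rescaled[OF u(1)] I(1) risom_trans[OF rpair_rescaled[OF u(1)] s I(1) u(2) i]])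
  then have "x = rescale_map X Y (NG #>\<^bsub>UG\<^esub> u)" using rescale_class[OF u(1)] by simp
  then show "x \<in> rescale_map X Y ` carrier (units_mod_norms X Y)" using norm_coset_closed[OF u(1)] by blast
qed

end

theorem proposition1p5p4:
  fixes X :: "('p, 'r) ringed_space" and Y :: "('p, 'r, 's) sheaf_algebra"
  assumes "is_scheme X" and "is_quadratic_algebra X Y"
  shows "short_exact (units_mod_norms X Y) (RigPic X Y) (Pic_kernel X Y)
    (rescale_map X Y) (forget_map X Y)"
proof -
  interpret quadratic X Y using assms by unfold_locales (auto simp: is_scheme_def)
  show ?thesis
    unfolding short_exact_def using rescale_group_hom forget_group_hom rescale_inj rescale_image forget_surj by blast
qed

end
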